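(* Let $G$ be a smooth linear group scheme over $R$ with commutator map $[\ ,\ ]:G\times G\to G$, $[a,b]=aba^{-1}b^{-1}$, and let $r,s\ge 1$. 1) There exists a unique $\delta$-map $[\ ,\ ]_\delta:L_\delta^r(G)\times L_\delta^s(G)\to L_\delta^{r+s}(G)$ of order $\max\{r,s\}$ such that on sets of $R$-points $ex^{r+s}([\alpha,\beta]_\delta)=[ex^r(\alpha),ex^s(\beta)]$ for all $\alpha\in L_\delta^r(G)$, $\beta\in L_\delta^s(G)$. 2) The $\delta$-map $[\ ,\ ]_\delta$ is functorial in $G$ with respect to homomorphisms $f:G\to G'$ of (smooth linear) group schemes, i.e., for the induced maps $L_\delta^i(f):L_\delta^i(G)\to L_\delta^i(G')$, $i=r,s,r+s$, we have $[L_\delta^r(f)(\alpha),L_\delta^s(f)(\beta)]_\delta=L_\delta^{r+s}(f)([\alpha,\beta]_\delta)$. 3) If $\alpha_1,\alpha_2\in L_\delta^r(G)$ and $\beta_1,\beta_2\in L_\delta^s(G)$ are such that $\alpha_1\equiv\alpha_2$ mod $p^m$ and $\beta_1\equiv\beta_2$ mod $p^m$, then $[\alpha_1,\beta_1]_\delta\equiv[\alpha_2,\beta_2]_\delta$ mod $p^m$. 4) If $\alpha_1,\alpha_2\in L_\delta^r(G)$, $\beta\in L_\delta^s(G)$ then $[\alpha_1+_{\delta,*}\alpha_2,\beta]_\delta\equiv[\alpha_1,\beta]_\delta+_{\delta,*}[\alpha_2,\beta]_\delta$ mod $p$. 5) If $\alpha\in L_\delta^r(G)$, $\beta\in L_\delta^s(G)$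 then $[\alpha,\beta]_\delta+_{\delta,*}[\beta,\alpha]_\delta\equiv 0$ mod $p$. 6) If $\alpha\in L_\delta^r(G)$, $\beta\in L_\delta^s(G)$, $\gamma\in L_\delta^t(G)$ ($t\ge1$) then $[[\alpha,\beta]_\delta,\gamma]_\delta+_{\delta,*}[[\beta,\gamma]_\delta,\alpha]_\delta+_{\delta,*}[[\gamma,\alpha]_\delta,\beta]_\delta\equiv 0$ mod $p$. 7) Let $G=GL_n$ and let $[\ ,\ ]:\mathfrak{gl}_n\times\mathfrak{gl}_n\to\mathfrak{gl}_n$, $[a,b]=ab-ba$. Then for any $\alpha\in L_\delta^r(GL_n)$ and $\beta\in L_\delta^s(GL_n)$ we have in $\mathfrak{gl}_n$: $[\alpha,\beta]_\delta\equiv[\alpha^{(p^s)},\beta^{(p^r)}]$ mod $p$.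
   Context: Fix an odd prime $p$. $R$ is the unique complete discrete valuation ring with maximal ideal $pR$ and residue field an algebraic closure of $\mathbb F_p$; $\phi:R\to R$ is the unique lift of Frobenius, $\delta a=(\phi(a)-a^p)/p$. A hat denotes $p$-adic completion. A group scheme is linear if isomorphic to a closed subgroup scheme of some $GL_n$. $p$-jets. For tuples of indeterminates $x,x',x'',\dots$, let $\phi$ be the lift of Frobenius on $R[x,x',x'',\dots]$ extending $\phi$ on $R$ with $\phi(x)=x^p+px'$, $\phi(x')=(x')^p+px''$, etc. (componentwise), and $\delta f=(\phi(f)-f^p)/p$. For $X=\mathrm{Spec}\,R[x]/(f)$ of finite type, $J^n(X)=\mathrm{Spf}\,R[x,x',\dots,x^{(n)}]^\wedge/(f,\delta f,\dots,\delta^nf)$; for general $X$ glue over affine covers. The same construction applies to $p$-formal schemes (formal schemes locally isomorphic to $p$-adic completions of finite type schemes). $J^0(X)=\widehat X$; there are $R$-morphisms $\pi:J^n(X)\to J^{n-1}(X)$ (induced by inclusion of variables) and $\phi$-semilinear morphisms $\pi_\phi:J^n(X)\to J^{n-1}(X)$ induced by $\phi:R[x,\dots,x^{(n-1)}]^\wedge\to R[x,\dots,x^{(n)}]^\wedge$; there are maps $\nabla^n:X(R)\to J^n(X)(R)$, $a\mapsto(a,\delta a,\dots,\delta^na)$. A $\delta$-map $X\to Y$ of order $n$ is a morphism of $p$-formal schemes $J^n(X)\to\widehat Y$ (with $\widehat Y=Y$ for $Y$ $p$-formal); composing with $\nabla^n$ gives a map $X(R)\to Y(R)$, which for smooth $X,Y$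 determines the $\delta$-map and is identified with it. $J^n$ takes groups to groups. $L_\delta^r(G)=\mathrm{Ker}(\pi:J^r(G)\to J^{r-1}(G))$, a group $p$-formal scheme (the order $r$ $\delta$-Lie algebra), functorial in $G$; its set of $R$-points is also denoted $L_\delta^r(G)$; its group law is denoted $+_{\delta,r}$, or $+_{\delta,*}$ when $r$ is clear, and its identity element $0$. $ex^r:L_\delta^r(G)\to\widehat G$ is the composition of $L_\delta^r(G)\subset J^r(G)$ with $J^r(G)\xrightarrow{\pi_\phi}J^{r-1}(G)\xrightarrow{\pi_\phi}\cdots\xrightarrow{\pi_\phi}\widehat G$; it is $\phi^r$-semilinear, and a $\phi^r$-semilinear morphism $f:X\to Y$ acts on $R$-points by $P\mapsto f\circ P\circ\phi^{-r}$. The bracket on $L_\delta^i(G)\times L_\delta^j(G)$ for any $i,j\geq 1$ is the one from 1). For $GL_n$ with coordinate matrix $x$, the points of $L_\delta^r(GL_n)=\mathrm{Spf}\,R[x^{(r)}]^\wedge$ are identified with the set $\mathfrak{gl}_n$ of $n\times n$ matrices over $R$, via the value of $x^{(r)}$. Then $a+_{\delta,r}b=a+b+p^rab$ and $ex^r(a)=1+p^r\phi^{-r}(a)$ ($\phi^{-r}$ applied to entries). $a^{(p^s)}$ is the matrix with entries $a_{ij}^{p^s}$. For $R$-points $a,b$ of an $R$-scheme, $a\equiv b$ mod $p^m$ means that the induced $R/p^mR$-points coincide. *)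

theory Defs
  imports
    "HOL-Library.Poly_Mapping"
    "HOL-Library.FuncSet"
    "HOL-Algebra.Ideal"
    "HOL-Algebra.QuotRing"
    "HOL-Algebra.Algebraic_Closure"
    "HOL-Algebra.Algebraic_Closure_Type"
    "Jordan_Normal_Form.Determinant"
begin

section \<open>The base ring\<close>

text \<open>
  The ring \<open>R\<close> is a type \<open>'r\<close>. In \<open>complete_dvr\<close> a discrete valuation ring is a local
  principal ideal domain that is not a field, and \<open>F\<^sub>p\<close> is the image of the integers
  in the residue field.
\<close>

definition complete_dvr :: "nat \<Rightarrow> 'r::idom itself \<Rightarrow> bool" where
  "complete_dvr p _ \<longleftrightarrow>
     (let R = (ring_of_type_algebra :: 'r ring); pR = PIdl\<^bsub>R\<^esub> (of_nat p) in
        principal_domain R \<and> (of_nat p :: 'r) \<noteq> 0 \<and>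
        (\<forall>M. maximalideal M R \<longleftrightarrow> M = pR) \<and>
        (\<forall>a :: nat \<Rightarrow> 'r. (\<forall>n. of_nat p ^ n dvd a (Suc n) - a n) \<longrightarrow>
           (\<exists>l. \<forall>n. of_nat p ^ n dvd l - a n)) \<and>
        algebraic_closure (R Quot pR) ((\<lambda>z::int. pR +>\<^bsub>R\<^esub> of_int z) ` UNIV))"

definition frobenius_lift :: "nat \<Rightarrow> ('r::idom \<Rightarrow> 'r) \<Rightarrow> bool" where
  "frobenius_lift p \<phi> \<longleftrightarrow>
     \<phi> 1 = 1 \<and> (\<forall>a b. \<phi> (a + b) = \<phi> a + \<phi> b) \<and> (\<forall>a b. \<phi> (a * b) = \<phi> a * \<phi> b) \<and>
     (\<forall>a. of_nat p dvd \<phi> a - a ^ p)"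

definition base_ring :: "nat \<Rightarrow> ('r::idom \<Rightarrow> 'r) \<Rightarrow> bool" where
  "base_ring p \<phi> \<longleftrightarrow>
     Factorial_Ring.prime p \<and> odd p \<and> complete_dvr p TYPE('r) \<and> frobenius_lift p \<phi>"

text \<open>
  \<open>(\<Phi> a - a^p) / p\<close>, for \<open>\<Phi>\<close> the lift of Frobenius on \<open>R\<close> or on a ring of power series.
\<close>

definition pderivation :: "nat \<Rightarrow> ('a::comm_ring_1 \<Rightarrow> 'a) \<Rightarrow> 'a \<Rightarrow> 'a" where
  "pderivation p \<Phi> a = (THE b. of_nat p * b = \<Phi> a - a ^ p)"


section \<open>Affine schemes of finite type\<close>

type_synonym ('v, 'r) mpoly = "('v \<Rightarrow>\<^sub>0 nat) \<Rightarrow>\<^sub>0 'r"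

definition mvar :: "'v \<Rightarrow> ('v, 'r::comm_ring_1) mpoly" where
  "mvar v = Poly_Mapping.single (Poly_Mapping.single v 1) 1"

definition mconst :: "'r::comm_ring_1 \<Rightarrow> ('v, 'r) mpoly" where
  "mconst c = Poly_Mapping.single 0 c"

text \<open>Evaluation at \<open>F\<close> in an algebra with structure map \<open>\<iota>\<close>.\<close>

definition meval :: "('r \<Rightarrow> 'a) \<Rightarrow> ('v \<Rightarrow> 'a) \<Rightarrow> ('v, 'r::comm_ring_1) mpoly \<Rightarrow> 'a::comm_ring_1" where
  "meval \<iota> F f = (\<Sum>k\<in>Poly_Mapping.keys f. \<iota> (Poly_Mapping.lookup f k) *
                    (\<Prod>v\<in>Poly_Mapping.keys k. F v ^ Poly_Mapping.lookup k v))"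

abbreviation msubst :: "('v \<Rightarrow> ('w, 'r) mpoly) \<Rightarrow> ('v, 'r::comm_ring_1) mpoly \<Rightarrow> ('w, 'r) mpoly" where
  "msubst \<equiv> meval mconst"

definition mpderiv :: "'v \<Rightarrow> ('v, 'r::comm_ring_1) mpoly \<Rightarrow> ('v, 'r) mpoly" where
  "mpderiv v f = (\<Sum>k\<in>Poly_Mapping.keys f.
     Poly_Mapping.single (k - Poly_Mapping.single v 1) (of_nat (Poly_Mapping.lookup k v) * Poly_Mapping.lookup f k))"

definition pol_ring :: "'v set \<Rightarrow> ('v, 'r::comm_ring_1) mpoly ring" where
  "pol_ring V = \<lparr>carrier = {f. \<forall>k\<in>Poly_Mapping.keys f. Poly_Mapping.keys k \<subseteq> V},
     monoid.mult = (*), one = 1, ring.zero = 0, add = (+)\<rparr>"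

lemma cring_pol_ring: "cring (pol_ring V)"
proof -
  have mult: "f * g \<in> carrier (pol_ring V)"
    if f: "f \<in> carrier (pol_ring V)" and g: "g \<in> carrier (pol_ring V)" for f g :: "('a, 'b) mpoly"
  proof -
    have "Poly_Mapping.keys k \<subseteq> V" if k: "k \<in> Poly_Mapping.keys (f * g)" for k
    proof -
      obtain a b where "k = a + b" "a \<in> Poly_Mapping.keys f" "b \<in> Poly_Mapping.keys g"
        using k keys_mult[of f g] by blast
      then show ?thesis
        using f g keys_add[of a b] unfolding pol_ring_def by simp blast
    qed
    then show ?thesis
      by (simp add: pol_ring_def)
  qed
  have add: "f + g \<in> carrier (pol_ring V)"
    if "f \<in> carrier (pol_ring V)" "g \<in> carrier (pol_ring V)" for f g :: "('a, 'b) mpoly"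
    using that keys_add[of f g] unfolding pol_ring_def by simp blast
  have neg: "\<exists>g\<in>carrier (pol_ring V). g + f = 0"
    if "f \<in> carrier (pol_ring V)" for f :: "('a, 'b) mpoly"
    using that by (intro bexI[of _ "- f"]) (auto simp: pol_ring_def in_keys_iff)
  have one: "1 \<in> carrier (pol_ring V :: ('a, 'b) mpoly ring)"
    and zero: "0 \<in> carrier (pol_ring V :: ('a, 'b) mpoly ring)"
    by (simp_all add: pol_ring_def)
  let ?A = "pol_ring V :: ('a, 'b) mpoly ring"
  have sel: "monoid.mult ?A = (*)" "add ?A = (+)" "\<one>\<^bsub>?A\<^esub> = 1" "\<zero>\<^bsub>?A\<^esub> = 0"
    by (simp_all add: pol_ring_def)
  show ?thesis
    by (intro cringI abelian_groupI comm_monoidI; unfold sel)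
      (use mult add neg one zero in \<open>simp_all add: algebra_simps\<close>)
qed

text \<open>
  \<open>Spec R[vars]/eqs\<close>. A morphism \<open>S \<rightarrow> T\<close> is given by a tuple of polynomials, a point of
  \<open>T\<close> with values in the coordinate ring of \<open>S\<close>; tuples congruent modulo the ideal of \<open>S\<close>
  give the same morphism.
\<close>

record (overloaded) ('v, 'r::zero) affine =
  vars :: "'v set"
  eqs :: "('v, 'r) mpoly set"

definition is_affine_scheme :: "('v, 'r::comm_ring_1, 'z) affine_scheme \<Rightarrow> bool" where
  "is_affine_scheme S \<longleftrightarrow> finite (vars S) \<and> ideal (eqs S) (pol_ring (vars S))"

definition aprod :: "('v, 'r::comm_ring_1, 'y) affine_scheme \<Rightarrow> ('w, 'r, 'z) affine_scheme \<Rightarrow>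
    ('v + 'w, 'r) affine" where
  "aprod S T = \<lparr>vars = Sum_Type.Plus (vars S) (vars T),
     eqs = Idl\<^bsub>pol_ring (Sum_Type.Plus (vars S) (vars T))\<^esub>
       (msubst (\<lambda>v. mvar (Inl v)) ` eqs S \<union> msubst (\<lambda>w. mvar (Inr w)) ` eqs T)\<rparr>"

definition amor :: "('v, 'r::comm_ring_1, 'y) affine_scheme \<Rightarrow> ('w, 'r, 'z) affine_scheme \<Rightarrow>
    ('w \<Rightarrow> ('v, 'r) mpoly) \<Rightarrow> bool" where
  "amor S T F \<longleftrightarrow> (\<forall>w\<in>vars T. F w \<in> carrier (pol_ring (vars S))) \<and>
                 (\<forall>g\<in>eqs T. msubst F g \<in> eqs S)"

definition amor_eq :: "('v, 'r::comm_ring_1, 'y) affine_scheme \<Rightarrow> ('w, 'r, 'z) affine_scheme \<Rightarrow>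
    ('w \<Rightarrow> ('v, 'r) mpoly) \<Rightarrow> ('w \<Rightarrow> ('v, 'r) mpoly) \<Rightarrow> bool" where
  "amor_eq S T F F' \<longleftrightarrow> (\<forall>w\<in>vars T. F w - F' w \<in> eqs S)"

text \<open>
  Smoothness is the definition of Bosch, Luetkebohmert and Raynaud (Neron Models, 2.2/3) for
  the given embedding in affine space: near each point \<open>P\<close> the ideal is generated by
  finitely many \<open>g\<^sub>i\<close> whose differentials are linearly independent over the residue field
  of \<open>P\<close>. A linear relation over this field is written after clearing denominators.
\<close>

definition smooth :: "('v, 'r::comm_ring_1, 'z) affine_scheme \<Rightarrow> bool" where
  "smooth S \<longleftrightarrow> (let A = pol_ring (vars S) in
     \<forall>P. primeideal P A \<and> eqs S \<subseteq> P \<longrightarrow>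
       (\<exists>gs. set gs \<subseteq> eqs S \<and>
          (\<exists>h \<in> carrier A - P. \<forall>f\<in>eqs S. \<exists>N. h ^ N * f \<in> Idl\<^bsub>A\<^esub> (set gs)) \<and>
          (\<forall>c. (\<forall>i<length gs. c i \<in> carrier A) \<and>
               (\<forall>v\<in>vars S. (\<Sum>i<length gs. c i * mpderiv v (gs ! i)) \<in> P) \<longrightarrow>
               (\<forall>i<length gs. c i \<in> P))))"


section \<open>Linear group schemes\<close>

record (overloaded) ('v, 'r::zero) group_scheme = "('v, 'r) affine" +
  gmul :: "'v \<Rightarrow> ('v + 'v, 'r) mpoly"
  gunit :: "'v \<Rightarrow> 'r"
  ginv :: "'v \<Rightarrow> ('v, 'r) mpoly"

text \<open>Product of two points with values in an algebra with structure map \<open>\<iota>\<close>.\<close>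

definition gmul_at :: "('v, 'r::comm_ring_1) group_scheme \<Rightarrow> ('r \<Rightarrow> 'a) \<Rightarrow> ('v \<Rightarrow> 'a) \<Rightarrow> ('v \<Rightarrow> 'a) \<Rightarrow>
    'v \<Rightarrow> 'a::comm_ring_1" where
  "gmul_at G \<iota> a b = (\<lambda>v. meval \<iota> (case_sum a b) (gmul G v))"

definition is_group_scheme :: "('v, 'r::comm_ring_1) group_scheme \<Rightarrow> bool" where
  "is_group_scheme G \<longleftrightarrow>
     is_affine_scheme G \<and>
     amor (aprod G G) G (gmul G) \<and>
     (\<forall>g\<in>eqs G. meval id (gunit G) g = 0) \<and>
     amor G G (ginv G) \<and>
     (let a = (\<lambda>v. mvar (Inl v)); b = (\<lambda>v. mvar (Inr (Inl v))); c = (\<lambda>v. mvar (Inr (Inr v)))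
      in amor_eq (aprod G (aprod G G)) G
           (gmul_at G mconst a (gmul_at G mconst b c)) (gmul_at G mconst (gmul_at G mconst a b) c)) \<and>
     (let x = mvar; e = (\<lambda>v. mconst (gunit G v)) in
        amor_eq G G (gmul_at G mconst e x) x \<and> amor_eq G G (gmul_at G mconst x e) x \<and>
        amor_eq G G (gmul_at G mconst (ginv G) x) e \<and> amor_eq G G (gmul_at G mconst x (ginv G)) e)"

definition group_hom :: "('v, 'r::comm_ring_1) group_scheme \<Rightarrow> ('w, 'r) group_scheme \<Rightarrow>
    ('w \<Rightarrow> ('v, 'r) mpoly) \<Rightarrow> bool" where
  "group_hom G H f \<longleftrightarrow> amor G H f \<and>
     amor_eq (aprod G G) H
       (\<lambda>w. msubst (gmul G) (f w))
       (gmul_at H mconst (\<lambda>w. msubst (\<lambda>v. mvar (Inl v)) (f w)) (\<lambda>w. msubst (\<lambda>v. mvar (Inr v)) (f w)))"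

definition group_iso :: "('v, 'r::comm_ring_1) group_scheme \<Rightarrow> ('w, 'r) group_scheme \<Rightarrow> bool" where
  "group_iso G H \<longleftrightarrow> (\<exists>f g. group_hom G H f \<and> group_hom H G g \<and>
     amor_eq G G (\<lambda>v. msubst f (g v)) mvar \<and> amor_eq H H (\<lambda>w. msubst g (f w)) mvar)"

text \<open>
  The variable \<open>Some (i, j)\<close> is the matrix coordinate \<open>x\<^sub>i\<^sub>j\<close>; the variable \<open>None\<close> is the
  inverse of the determinant.
\<close>

definition coord_mat :: "nat \<Rightarrow> ((nat \<times> nat) option \<Rightarrow> 'a) \<Rightarrow> 'a mat" where
  "coord_mat n a = mat n n (\<lambda>ij. a (Some ij))"

definition GL :: "nat \<Rightarrow> ((nat \<times> nat) option, 'r::comm_ring_1) group_scheme" where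
  "GL n = (let V = insert None (Some ` ({..<n} \<times> {..<n})) in
     \<lparr>vars = V,
      eqs = Idl\<^bsub>pol_ring V\<^esub> {mvar None * det (coord_mat n mvar) - 1},
      gmul = (\<lambda>v. case v of
          None \<Rightarrow> mvar (Inl None) * mvar (Inr None)
        | Some ij \<Rightarrow> (coord_mat n (\<lambda>v. mvar (Inl v)) * coord_mat n (\<lambda>v. mvar (Inr v))) $$ ij),
      gunit = (\<lambda>v. case v of None \<Rightarrow> 1 | Some ij \<Rightarrow> 1\<^sub>m n $$ ij),
      ginv = (\<lambda>v. case v of
          None \<Rightarrow> det (coord_mat n mvar)
        | Some ij \<Rightarrow> mvar None * adj_mat (coord_mat n mvar) $$ ij)\<rparr>)"

definition closed_subgroup :: "('v, 'r::comm_ring_1) group_scheme \<Rightarrow> ('v, 'r) group_scheme \<Rightarrow> bool" where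
  "closed_subgroup H G \<longleftrightarrow> is_group_scheme H \<and> vars H = vars G \<and> eqs G \<subseteq> eqs H \<and>
     gmul H = gmul G \<and> gunit H = gunit G \<and> ginv H = ginv G"

definition smooth_linear_group :: "('v, 'r::comm_ring_1) group_scheme \<Rightarrow> bool" where
  "smooth_linear_group G \<longleftrightarrow> is_group_scheme G \<and> smooth G \<and>
     (\<exists>n\<ge>1. \<exists>H. closed_subgroup H (GL n) \<and> group_iso G H)"

definition gcommutator :: "('v, 'r::comm_ring_1) group_scheme \<Rightarrow> ('v \<Rightarrow> 'r) \<Rightarrow> ('v \<Rightarrow> 'r) \<Rightarrow> 'v \<Rightarrow> 'r" where
  "gcommutator G a b = (let m = gmul_at G id; i = (\<lambda>c v. meval id c (ginv G v)) in
     restrict (m (m (m a b) (i a)) (i b)) (vars G))"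


section \<open>Formal power series in several variables\<close>

typedef ('v, 'r) mfps = "UNIV :: (('v \<Rightarrow>\<^sub>0 nat) \<Rightarrow> 'r) set"
  morphisms coeff Mfps ..

lemma coeff_Mfps [simp]: "mfps.coeff (Mfps f) = f"
  by (simp add: Mfps_inverse)

lemma mfps_eqI: "(\<And>k. mfps.coeff f k = mfps.coeff g k) \<Longrightarrow> f = g"
  by (metis coeff_inverse ext)

lemma finite_antidiagonal: "finite {(a, b). a + b = (k :: 'v \<Rightarrow>\<^sub>0 nat)}"
proof -
  let ?A = "{a. \<exists>b. a + b = k}"
  have le: "Poly_Mapping.lookup a v \<le> Poly_Mapping.lookup k v" if "a \<in> ?A" for a v
    using that by (auto simp: lookup_add)
  have "Poly_Mapping.lookup ` ?A \<subseteq> {f. f ` Poly_Mapping.keys k \<subseteq> {..Max (insert 0 (Poly_Mapping.lookup k ` Poly_Mapping.keys k))} \<and>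
      (\<forall>v. v \<notin> Poly_Mapping.keys k \<longrightarrow> f v = 0)}"
  proof (rule image_subsetI)
    fix a assume a: "a \<in> ?A"
    have "Poly_Mapping.lookup a v \<le> Max (insert 0 (Poly_Mapping.lookup k ` Poly_Mapping.keys k))"
      if "v \<in> Poly_Mapping.keys k" for v
      by (rule order_trans[OF le[OF a] Max_ge]) (use that in auto)
    moreover have "Poly_Mapping.lookup a v = 0" if "v \<notin> Poly_Mapping.keys k" for v
      using le[OF a, of v] that by (simp add: in_keys_iff)
    ultimately show "Poly_Mapping.lookup a \<in> {f. f ` Poly_Mapping.keys k \<subseteq>
        {..Max (insert 0 (Poly_Mapping.lookup k ` Poly_Mapping.keys k))} \<and>
        (\<forall>v. v \<notin> Poly_Mapping.keys k \<longrightarrow> f v = 0)}"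
      by auto
  qed
  moreover have "finite {f. f ` Poly_Mapping.keys k \<subseteq> {..Max (insert 0 (Poly_Mapping.lookup k ` Poly_Mapping.keys k))} \<and>
      (\<forall>v. v \<notin> Poly_Mapping.keys k \<longrightarrow> f v = (0::nat))}"
    using finite_set_of_finite_funs[of "Poly_Mapping.keys k"
        "{..Max (insert 0 (Poly_Mapping.lookup k ` Poly_Mapping.keys k))}" 0]
    by (rule rev_finite_subset) auto
  ultimately have "finite (Poly_Mapping.lookup ` ?A)"
    by (rule finite_subset)
  then have "finite ?A"
    by (rule finite_imageD) (simp add: inj_on_def)
  moreover have "{(a, b). a + b = k} \<subseteq> (\<lambda>a. (a, k - a)) ` ?A"
    by auto
  ultimately show ?thesis
    by (meson finite_imageI finite_subset)
qed

instantiation mfps :: (type, comm_ring_1) comm_ring_1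
begin

definition zero_mfps :: "('a, 'b) mfps" where "0 = Mfps (\<lambda>_. 0)"
definition one_mfps :: "('a, 'b) mfps" where "1 = Mfps (\<lambda>k. if k = 0 then 1 else 0)"
definition plus_mfps :: "('a, 'b) mfps \<Rightarrow> ('a, 'b) mfps \<Rightarrow> ('a, 'b) mfps" where
  "f + g = Mfps (\<lambda>k. mfps.coeff f k + mfps.coeff g k)"
definition minus_mfps :: "('a, 'b) mfps \<Rightarrow> ('a, 'b) mfps \<Rightarrow> ('a, 'b) mfps" where
  "f - g = Mfps (\<lambda>k. mfps.coeff f k - mfps.coeff g k)"
definition uminus_mfps :: "('a, 'b) mfps \<Rightarrow> ('a, 'b) mfps" where
  "- f = Mfps (\<lambda>k. - mfps.coeff f k)"
definition times_mfps :: "('a, 'b) mfps \<Rightarrow> ('a, 'b) mfps \<Rightarrow> ('a, 'b) mfps" where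
  "f * g = Mfps (\<lambda>k. \<Sum>(a, b)\<in>{(a, b). a + b = k}. mfps.coeff f a * mfps.coeff g b)"

instance
proof
  fix f g h :: "('a, 'b) mfps"
  note d = zero_mfps_def one_mfps_def plus_mfps_def minus_mfps_def uminus_mfps_def times_mfps_def
  show "f + g + h = f + (g + h)" "f + g = g + f" "0 + f = f" "- f + f = 0" "f - g = f + - g"
    by (simp_all add: d algebra_simps coeff_inverse)
  show "(0::('a, 'b) mfps) \<noteq> 1"
  proof
    assume "(0::('a, 'b) mfps) = 1"
    then have "mfps.coeff (0::('a, 'b) mfps) 0 = mfps.coeff 1 0" by simp
    then show False by (simp add: d)
  qed
  show "(f + g) * h = f * h + g * h"
    by (simp add: d ring_distribs sum.distrib case_prod_unfold)
  show "f * g = g * f"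
  proof (rule mfps_eqI)
    fix k
    show "mfps.coeff (f * g) k = mfps.coeff (g * f) k"
      unfolding times_mfps_def coeff_Mfps
      by (rule sum.reindex_bij_witness[where i = prod.swap and j = prod.swap])
        (auto simp: add.commute mult.commute)
  qed
  show "1 * f = f"
  proof (rule mfps_eqI)
    fix k
    have "mfps.coeff (1 * f) k =
        (\<Sum>(a, b)\<in>{(a, b). a + b = k}. if a = 0 then mfps.coeff f b else 0)"
      unfolding d coeff_Mfps by (intro sum.cong) auto
    also have "\<dots> = (\<Sum>(a, b)\<in>{(0 :: 'a \<Rightarrow>\<^sub>0 nat, k)}. mfps.coeff f b)"
      by (rule sum.mono_neutral_cong_right[OF finite_antidiagonal]) (auto split: if_splits)
    finally show "mfps.coeff (1 * f) k = mfps.coeff f k" by simp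
  qed
  show "f * g * h = f * (g * h)"
  proof (rule mfps_eqI)
    fix k
    let ?D = "\<lambda>k :: 'a \<Rightarrow>\<^sub>0 nat. {(a, b). a + b = k}"
    let ?f = "mfps.coeff f" and ?g = "mfps.coeff g" and ?h = "mfps.coeff h"
    have "mfps.coeff (f * g * h) k =
        (\<Sum>x\<in>?D k. \<Sum>y\<in>?D (fst x). ?f (fst y) * ?g (snd y) * ?h (snd x))"
      by (simp add: times_mfps_def case_prod_unfold sum_distrib_right)
    also have "\<dots> = (\<Sum>(x, y)\<in>Sigma (?D k) (\<lambda>x. ?D (fst x)). ?f (fst y) * ?g (snd y) * ?h (snd x))"
      by (rule sum.Sigma) (auto simp: finite_antidiagonal)
    also have "\<dots> = (\<Sum>(x, y)\<in>Sigma (?D k) (\<lambda>x. ?D (snd x)). ?f (fst x) * (?g (fst y) * ?h (snd y)))"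
      by (rule sum.reindex_bij_witness[where
            i = "\<lambda>((a, _), (b, c)). ((a + b, c), (a, b))" and
            j = "\<lambda>((_, c), (a, b)). ((a, b + c), (b, c))"]) (auto simp: algebra_simps)
    also have "\<dots> = (\<Sum>x\<in>?D k. \<Sum>y\<in>?D (snd x). ?f (fst x) * (?g (fst y) * ?h (snd y)))"
      by (rule sum.Sigma[symmetric]) (auto simp: finite_antidiagonal)
    also have "\<dots> = mfps.coeff (f * (g * h)) k"
      by (simp add: times_mfps_def case_prod_unfold sum_distrib_left)
    finally show "mfps.coeff (f * g * h) k = mfps.coeff (f * (g * h)) k" .
  qed
qed

end

definition fvar :: "'v \<Rightarrow> ('v, 'r::comm_ring_1) mfps" where
  "fvar v = Mfps (Poly_Mapping.lookup (mvar v))"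

definition of_poly :: "('v, 'r::comm_ring_1) mpoly \<Rightarrow> ('v, 'r) mfps" where
  "of_poly f = Mfps (Poly_Mapping.lookup f)"

text \<open>Sum of a family that tends to \<open>0\<close> \<open>p\<close>-adically along the cofinite filter.\<close>

definition psum :: "nat \<Rightarrow> ('i \<Rightarrow> 'r::comm_ring_1) \<Rightarrow> 'r" where
  "psum p c = (THE s. \<forall>m. of_nat p ^ m dvd s - (\<Sum>i | \<not> of_nat p ^ m dvd c i. c i))"

text \<open>
  As \<open>R\<close> is \<open>p\<close>-adically complete, the \<open>p\<close>-adic completion of \<open>R[V]\<close> is the ring of power
  series whose coefficients tend to \<open>0\<close>.
\<close>

definition rps_ring :: "nat \<Rightarrow> 'v set \<Rightarrow> ('v, 'r::comm_ring_1) mfps ring" where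
  "rps_ring p V = \<lparr>carrier = {f. (\<forall>k. mfps.coeff f k \<noteq> 0 \<longrightarrow> Poly_Mapping.keys k \<subseteq> V) \<and>
       (\<forall>m. finite {k. \<not> of_nat p ^ m dvd mfps.coeff f k})},
     monoid.mult = (*), one = 1, ring.zero = 0, add = (+)\<rparr>"

lemma cring_rps_ring: "cring (rps_ring p V)"
proof -
  note d = zero_mfps_def one_mfps_def plus_mfps_def times_mfps_def
  have coeff_uminus: "mfps.coeff (- f) k = - mfps.coeff f k" for f :: "('a, 'b) mfps" and k
    by (simp add: uminus_mfps_def)
  define q :: "nat \<Rightarrow> 'b" where "q m = of_nat p ^ m" for m
  have mult: "f * g \<in> carrier (rps_ring p V)"
    if f: "f \<in> carrier (rps_ring p V)" and g: "g \<in> carrier (rps_ring p V)" for f g :: "('a, 'b) mfps"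
  proof -
    let ?f = "mfps.coeff f" and ?g = "mfps.coeff g"
    have nz: "\<exists>a b. a + b = k \<and> P (?f a * ?g b)"
      if P: "P (mfps.coeff (f * g) k)" and "\<not> P 0"
        and closed: "\<And>x y. \<not> P x \<Longrightarrow> \<not> P y \<Longrightarrow> \<not> P (x + y)" for P k
    proof (rule ccontr)
      assume *: "\<not> ?thesis"
      have "\<not> P (\<Sum>x\<in>A. ?f (fst x) * ?g (snd x))"
        if "finite A" "A \<subseteq> {(a, b). a + b = k}" for A
        using that
      proof (induction A rule: finite_induct)
        case empty
        then show ?case using \<open>\<not> P 0\<close> by simp
      next
        case (insert x A)
        then have "\<not> P (?f (fst x) * ?g (snd x))"
          using * by auto
        then show ?case
          using insert closed by simp
      qed
      from this[OF finite_antidiagonal subset_refl] P show False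
        by (simp add: times_mfps_def case_prod_unfold)
    qed
    have "Poly_Mapping.keys k \<subseteq> V" if k: "mfps.coeff (f * g) k \<noteq> 0" for k
    proof -
      obtain a b where "a + b = k" "?f a * ?g b \<noteq> 0"
        using nz[of "\<lambda>x. x \<noteq> 0" k] k by auto
      then have "?f a \<noteq> 0" "?g b \<noteq> 0"
        by auto
      then have "Poly_Mapping.keys a \<subseteq> V" "Poly_Mapping.keys b \<subseteq> V"
        using f g by (simp_all add: rps_ring_def)
      then show ?thesis
        using keys_add[of a b] \<open>a + b = k\<close> by blast
    qed
    moreover have "finite {k. \<not> q m dvd mfps.coeff (f * g) k}" for m
    proof (rule finite_subset)
      show "{k. \<not> q m dvd mfps.coeff (f * g) k} \<subseteq>
          (\<lambda>(a, b). a + b) ` ({a. \<not> q m dvd ?f a} \<times> {b. \<not> q m dvd ?g b})"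
      proof
        fix k assume "k \<in> {k. \<not> q m dvd mfps.coeff (f * g) k}"
        then obtain a b where "a + b = k" "\<not> q m dvd ?f a * ?g b"
          using nz[of "\<lambda>x. \<not> q m dvd x" k] by auto
        moreover from this have "\<not> q m dvd ?f a" "\<not> q m dvd ?g b"
          using dvd_mult dvd_mult2 by blast+
        ultimately show "k \<in> (\<lambda>(a, b). a + b) ` ({a. \<not> q m dvd ?f a} \<times> {b. \<not> q m dvd ?g b})"
          by (intro image_eqI[of _ _ "(a, b)"]) auto
      qed
      show "finite ((\<lambda>(a, b). a + b) ` ({a. \<not> q m dvd ?f a} \<times> {b. \<not> q m dvd ?g b}))"
        using f g by (auto simp: rps_ring_def q_def)
    qed
    ultimately show ?thesis
      by (simp add: rps_ring_def q_def)
  qed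
  have add: "f + g \<in> carrier (rps_ring p V)"
    if f: "f \<in> carrier (rps_ring p V)" and g: "g \<in> carrier (rps_ring p V)" for f g :: "('a, 'b) mfps"
  proof -
    have "finite {k. \<not> q m dvd mfps.coeff (f + g) k}" for m
      by (rule finite_subset[of _ "{k. \<not> q m dvd mfps.coeff f k} \<union> {k. \<not> q m dvd mfps.coeff g k}"])
        (use f g in \<open>auto simp: rps_ring_def q_def d\<close>)
    moreover have "Poly_Mapping.keys k \<subseteq> V" if "mfps.coeff (f + g) k \<noteq> 0" for k
      using that f g by (cases "mfps.coeff f k = 0") (auto simp: rps_ring_def d)
    ultimately show ?thesis
      by (simp add: rps_ring_def q_def)
  qed
  have neg: "\<exists>g\<in>carrier (rps_ring p V). g + f = 0"
    if "f \<in> carrier (rps_ring p V)" for f :: "('a, 'b) mfps"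
    using that by (intro bexI[of _ "- f"]) (auto simp: rps_ring_def coeff_uminus)
  have one: "1 \<in> carrier (rps_ring p V :: ('a, 'b) mfps ring)"
  proof -
    have "finite {k. \<not> q m dvd mfps.coeff (1 :: ('a, 'b) mfps) k}" for m
      by (rule finite_subset[of _ "{0}"]) (auto simp: d)
    then show ?thesis
      by (simp add: rps_ring_def q_def d)
  qed
  have zero: "0 \<in> carrier (rps_ring p V :: ('a, 'b) mfps ring)"
    by (simp add: rps_ring_def d)
  let ?A = "rps_ring p V :: ('a, 'b) mfps ring"
  have sel: "monoid.mult ?A = (*)" "add ?A = (+)" "\<one>\<^bsub>?A\<^esub> = 1" "\<zero>\<^bsub>?A\<^esub> = 0"
    by (simp_all add: rps_ring_def)
  show ?thesis
    by (intro cringI abelian_groupI comm_monoidI; unfold sel)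
      (use mult add neg one zero in \<open>simp_all add: algebra_simps\<close>)
qed

definition feval :: "nat \<Rightarrow> ('v \<Rightarrow> 'r) \<Rightarrow> ('v, 'r::comm_ring_1) mfps \<Rightarrow> 'r" where
  "feval p a f = psum p (\<lambda>k. mfps.coeff f k * (\<Prod>v\<in>Poly_Mapping.keys k. a v ^ Poly_Mapping.lookup k v))"

text \<open>The map \<open>\<Sum> c\<^sub>k x\<^sup>k \<mapsto> \<Sum> \<sigma>(c\<^sub>k) F\<^sup>k\<close>.\<close>

definition fsubst :: "nat \<Rightarrow> ('r \<Rightarrow> 'r) \<Rightarrow> ('v \<Rightarrow> ('w, 'r) mfps) \<Rightarrow> ('v, 'r::comm_ring_1) mfps \<Rightarrow>
    ('w, 'r) mfps" where
  "fsubst p \<sigma> F f = Mfps (\<lambda>l. psum p (\<lambda>k. \<sigma> (mfps.coeff f k) *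
     mfps.coeff (\<Prod>v\<in>Poly_Mapping.keys k. F v ^ Poly_Mapping.lookup k v) l))"


section \<open>Affine p-formal schemes\<close>

text \<open>The formal spectrum of the completion of \<open>R[fvars]\<close> modulo the ideal \<open>feqs\<close>.\<close>

record ('v, 'r) pformal =
  fvars :: "'v set"
  feqs :: "('v, 'r) mfps set"

definition completion :: "nat \<Rightarrow> ('v, 'r::comm_ring_1, 'z) affine_scheme \<Rightarrow> ('v, 'r) pformal" where
  "completion p S = \<lparr>fvars = vars S, feqs = Idl\<^bsub>rps_ring p (vars S)\<^esub> (of_poly ` eqs S)\<rparr>"

definition fprod :: "nat \<Rightarrow> ('v, 'r::comm_ring_1) pformal \<Rightarrow> ('w, 'r) pformal \<Rightarrow> ('v + 'w, 'r) pformal" where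
  "fprod p S T = \<lparr>fvars = Sum_Type.Plus (fvars S) (fvars T),
     feqs = Idl\<^bsub>rps_ring p (Sum_Type.Plus (fvars S) (fvars T))\<^esub>
       (fsubst p id (\<lambda>v. fvar (Inl v)) ` feqs S \<union> fsubst p id (\<lambda>w. fvar (Inr w)) ` feqs T)\<rparr>"

definition fpts :: "nat \<Rightarrow> ('v, 'r::comm_ring_1) pformal \<Rightarrow> ('v \<Rightarrow> 'r) set" where
  "fpts p S = {a \<in> fvars S \<rightarrow>\<^sub>E UNIV. \<forall>g\<in>feqs S. feval p a g = 0}"

definition fpair :: "('v, 'r) pformal \<Rightarrow> ('w, 'r) pformal \<Rightarrow> ('v \<Rightarrow> 'r) \<Rightarrow> ('w \<Rightarrow> 'r) \<Rightarrow> 'v + 'w \<Rightarrow> 'r" where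
  "fpair S T a b = restrict (case_sum a b) (Sum_Type.Plus (fvars S) (fvars T))"

definition pt_cong :: "nat \<Rightarrow> nat \<Rightarrow> ('v, 'r::comm_ring_1) pformal \<Rightarrow> ('v \<Rightarrow> 'r) \<Rightarrow> ('v \<Rightarrow> 'r) \<Rightarrow> bool" where
  "pt_cong p m S a b \<longleftrightarrow> (\<forall>v\<in>fvars S. of_nat p ^ m dvd a v - b v)"

text \<open>
  Morphisms of p-formal schemes \<open>S \<rightarrow> T\<close>: points of \<open>T\<close> with values in the coordinate ring
  of \<open>S\<close>, i.e. tuples of restricted series satisfying the equations of \<open>T\<close> modulo the ideal
  of \<open>S\<close>. A morphism is a class of such tuples modulo the ideal of \<open>S\<close>.
\<close>

definition fhom :: "nat \<Rightarrow> ('v, 'r::comm_ring_1) pformal \<Rightarrow> ('w, 'r) pformal \<Rightarrow>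
    ('w \<Rightarrow> ('v, 'r) mfps) set set" where
  "fhom p S T =
     {F \<in> fvars T \<rightarrow>\<^sub>E carrier (rps_ring p (fvars S)). \<forall>g\<in>feqs T. fsubst p id F g \<in> feqs S} //
     {(F, F'). F \<in> fvars T \<rightarrow>\<^sub>E carrier (rps_ring p (fvars S)) \<and>
               F' \<in> fvars T \<rightarrow>\<^sub>E carrier (rps_ring p (fvars S)) \<and>
               (\<forall>w\<in>fvars T. F w - F' w \<in> feqs S)}"

definition fapp :: "nat \<Rightarrow> ('w, 'r::comm_ring_1) pformal \<Rightarrow> ('w \<Rightarrow> ('v, 'r) mfps) \<Rightarrow> ('v \<Rightarrow> 'r) \<Rightarrow>
    'w \<Rightarrow> 'r" where
  "fapp p T F a = (\<lambda>w\<in>fvars T. feval p a (F w))"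


section \<open>p-jets\<close>

text \<open>
  The variable \<open>(v, i)\<close> is the \<open>i\<close>-th derivative of the variable \<open>v\<close>. All rings of
  restricted series in the variables \<open>V \<times> {..n}\<close> are subrings of a single type, so the
  inclusions defining \<open>\<pi>\<close> are inclusions of sets.
\<close>

definition jet_frob :: "nat \<Rightarrow> ('r \<Rightarrow> 'r) \<Rightarrow> ('v \<times> nat, 'r::idom) mfps \<Rightarrow> ('v \<times> nat, 'r) mfps" where
  "jet_frob p \<phi> = fsubst p \<phi> (\<lambda>(v, i). fvar (v, i) ^ p + of_nat p * fvar (v, Suc i))"

definition jet_lift :: "nat \<Rightarrow> ('r \<Rightarrow> 'r) \<Rightarrow> nat \<Rightarrow> ('v, 'r::idom) mfps \<Rightarrow> ('v \<times> nat, 'r) mfps" where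
  "jet_lift p \<phi> i f = (pderivation p (jet_frob p \<phi>) ^^ i) (fsubst p id (\<lambda>v. fvar (v, 0)) f)"

definition Jet :: "nat \<Rightarrow> ('r \<Rightarrow> 'r) \<Rightarrow> nat \<Rightarrow> ('v, 'r::idom) pformal \<Rightarrow> ('v \<times> nat, 'r) pformal" where
  "Jet p \<phi> n S = \<lparr>fvars = fvars S \<times> {..n},
     feqs = Idl\<^bsub>rps_ring p (fvars S \<times> {..n})\<^esub> {jet_lift p \<phi> i f | i f. i \<le> n \<and> f \<in> feqs S}\<rparr>"

text \<open>The morphism of jet spaces induced by the morphism with tuple \<open>F\<close>.\<close>

definition jet_mor :: "nat \<Rightarrow> ('r \<Rightarrow> 'r) \<Rightarrow> ('w \<Rightarrow> ('v, 'r::idom) mfps) \<Rightarrow> 'w \<times> nat \<Rightarrow>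
    ('v \<times> nat, 'r) mfps" where
  "jet_mor p \<phi> F = (\<lambda>(w, i). jet_lift p \<phi> i (F w))"

definition nabla :: "nat \<Rightarrow> ('r \<Rightarrow> 'r) \<Rightarrow> nat \<Rightarrow> 'v set \<Rightarrow> ('v \<Rightarrow> 'r::idom) \<Rightarrow> 'v \<times> nat \<Rightarrow> 'r" where
  "nabla p \<phi> n V a = (\<lambda>(v, i)\<in>V \<times> {..n}. (pderivation p \<phi> ^^ i) (a v))"

definition delta_map :: "nat \<Rightarrow> ('r \<Rightarrow> 'r) \<Rightarrow> nat \<Rightarrow> ('v, 'r::idom) pformal \<Rightarrow> ('w, 'r) pformal \<Rightarrow>
    ('w \<Rightarrow> ('v \<times> nat, 'r) mfps) set set" where
  "delta_map p \<phi> n S T = fhom p (Jet p \<phi> n S) T"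

text \<open>
  The map on \<open>R\<close>-points. The choice of the tuple \<open>F\<close> representing the morphism does not
  matter, as the ideal of the jet space vanishes at \<open>\<nabla>\<^sup>n(a)\<close>.
\<close>

definition delta_app :: "nat \<Rightarrow> ('r \<Rightarrow> 'r) \<Rightarrow> nat \<Rightarrow> ('v, 'r::idom) pformal \<Rightarrow> ('w, 'r) pformal \<Rightarrow>
    ('w \<Rightarrow> ('v \<times> nat, 'r) mfps) set \<Rightarrow> ('v \<Rightarrow> 'r) \<Rightarrow> 'w \<Rightarrow> 'r" where
  "delta_app p \<phi> n S T H a = fapp p T (SOME F. F \<in> H) (nabla p \<phi> n (fvars S) a)"


section \<open>The delta Lie algebras\<close>

text \<open>The identity of \<open>J\<^sup>n(G)\<close>, which is also the identity of the order \<open>n\<close> Lie algebra.\<close>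

definition jet_unit :: "nat \<Rightarrow> ('r \<Rightarrow> 'r) \<Rightarrow> nat \<Rightarrow> ('v, 'r::idom) group_scheme \<Rightarrow> 'v \<times> nat \<Rightarrow> 'r" where
  "jet_unit p \<phi> n G = nabla p \<phi> n (vars G) (gunit G)"

text \<open>
  The kernel of \<open>\<pi> : J\<^sup>r(G) \<rightarrow> J\<^sup>r\<^sup>-\<^sup>1(G)\<close> for \<open>r \<ge> 1\<close>: the closed subscheme cut out by the
  pullback of the ideal of the identity section of \<open>J\<^sup>r\<^sup>-\<^sup>1(G)\<close>.
\<close>

definition Lie :: "nat \<Rightarrow> ('r \<Rightarrow> 'r) \<Rightarrow> nat \<Rightarrow> ('v, 'r::idom) group_scheme \<Rightarrow> ('v \<times> nat, 'r) pformal" where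
  "Lie p \<phi> r G = \<lparr>fvars = vars G \<times> {..r},
     feqs = Idl\<^bsub>rps_ring p (vars G \<times> {..r})\<^esub>
       (feqs (Jet p \<phi> r (completion p G)) \<union>
        {f \<in> carrier (rps_ring p (vars G \<times> {..r - 1})). feval p (jet_unit p \<phi> (r - 1) G) f = 0})\<rparr>"

abbreviation Lie_pts :: "nat \<Rightarrow> ('r \<Rightarrow> 'r) \<Rightarrow> nat \<Rightarrow> ('v, 'r::idom) group_scheme \<Rightarrow>
    ('v \<times> nat \<Rightarrow> 'r) set" where
  "Lie_pts p \<phi> r G \<equiv> fpts p (Lie p \<phi> r G)"

text \<open>
  The group law of \<open>J\<^sup>r(G)\<close> on \<open>R\<close>-points, under \<open>J\<^sup>r(G \<times> G) = J\<^sup>r(G) \<times> J\<^sup>r(G)\<close>; restricted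
  to the kernel it is \<open>+\<^sub>\<delta>\<^sub>,\<^sub>r\<close>.
\<close>

definition Lie_add :: "nat \<Rightarrow> ('r \<Rightarrow> 'r) \<Rightarrow> nat \<Rightarrow> ('v, 'r::idom) group_scheme \<Rightarrow>
    ('v \<times> nat \<Rightarrow> 'r) \<Rightarrow> ('v \<times> nat \<Rightarrow> 'r) \<Rightarrow> 'v \<times> nat \<Rightarrow> 'r" where
  "Lie_add p \<phi> r G a b =
     fapp p (Lie p \<phi> r G) (jet_mor p \<phi> (\<lambda>v. of_poly (gmul G v)))
       (\<lambda>(u, i). case u of Inl v \<Rightarrow> a (v, i) | Inr v \<Rightarrow> b (v, i))"

definition Lie_map :: "nat \<Rightarrow> ('r \<Rightarrow> 'r) \<Rightarrow> nat \<Rightarrow> ('w, 'r::idom) group_scheme \<Rightarrow> ('w \<Rightarrow> ('v, 'r) mpoly) \<Rightarrow>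
    ('v \<times> nat \<Rightarrow> 'r) \<Rightarrow> 'w \<times> nat \<Rightarrow> 'r" where
  "Lie_map p \<phi> r G' f a = fapp p (Lie p \<phi> r G') (jet_mor p \<phi> (\<lambda>w. of_poly (f w))) a"

text \<open>
  The semilinear morphism \<open>\<pi>\<^sub>\<phi> : J\<^sup>n(S) \<rightarrow> J\<^sup>n\<^sup>-\<^sup>1(S)\<close>, for \<open>V\<close> the variables of \<open>S\<close>, acting on
  points by \<open>P \<mapsto> \<pi>\<^sub>\<phi> \<circ> P \<circ> \<phi>\<^sup>-\<^sup>1\<close>.
\<close>

definition pi_phi :: "nat \<Rightarrow> ('r \<Rightarrow> 'r) \<Rightarrow> 'v set \<Rightarrow> nat \<Rightarrow> ('v \<times> nat \<Rightarrow> 'r::idom) \<Rightarrow> 'v \<times> nat \<Rightarrow> 'r" where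
  "pi_phi p \<phi> V n a =
     (\<lambda>vi\<in>V \<times> {..n - 1}. inv_into UNIV \<phi> (feval p a (jet_frob p \<phi> (fvar vi))))"

primrec pi_phi_iter :: "nat \<Rightarrow> ('r \<Rightarrow> 'r) \<Rightarrow> 'v set \<Rightarrow> nat \<Rightarrow> ('v \<times> nat \<Rightarrow> 'r::idom) \<Rightarrow> 'v \<times> nat \<Rightarrow> 'r" where
  "pi_phi_iter p \<phi> V 0 a = a"
| "pi_phi_iter p \<phi> V (Suc n) a = pi_phi_iter p \<phi> V n (pi_phi p \<phi> V (Suc n) a)"

text \<open>The last step identifies \<open>J\<^sup>0(G)\<close> with the completion of \<open>G\<close>.\<close>

definition ex_map :: "nat \<Rightarrow> ('r \<Rightarrow> 'r) \<Rightarrow> nat \<Rightarrow> ('v, 'r::idom) group_scheme \<Rightarrow>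
    ('v \<times> nat \<Rightarrow> 'r) \<Rightarrow> 'v \<Rightarrow> 'r" where
  "ex_map p \<phi> r G a = (\<lambda>v\<in>vars G. pi_phi_iter p \<phi> (vars G) r a (v, 0))"

abbreviation Lie_prod :: "nat \<Rightarrow> ('r \<Rightarrow> 'r) \<Rightarrow> nat \<Rightarrow> nat \<Rightarrow> ('v, 'r::idom) group_scheme \<Rightarrow>
    ('v \<times> nat + 'v \<times> nat, 'r) pformal" where
  "Lie_prod p \<phi> r s G \<equiv> fprod p (Lie p \<phi> r G) (Lie p \<phi> s G)"

definition bracket_app :: "nat \<Rightarrow> ('r \<Rightarrow> 'r) \<Rightarrow> nat \<Rightarrow> nat \<Rightarrow> ('v, 'r::idom) group_scheme \<Rightarrow>
    ('v \<times> nat \<Rightarrow> (('v \<times> nat + 'v \<times> nat) \<times> nat, 'r) mfps) set \<Rightarrow>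
    ('v \<times> nat \<Rightarrow> 'r) \<Rightarrow> ('v \<times> nat \<Rightarrow> 'r) \<Rightarrow> 'v \<times> nat \<Rightarrow> 'r" where
  "bracket_app p \<phi> r s G B \<alpha> \<beta> =
     delta_app p \<phi> (max r s) (Lie_prod p \<phi> r s G) (Lie p \<phi> (r + s) G) B
       (fpair (Lie p \<phi> r G) (Lie p \<phi> s G) \<alpha> \<beta>)"

definition is_bracket :: "nat \<Rightarrow> ('r \<Rightarrow> 'r) \<Rightarrow> nat \<Rightarrow> nat \<Rightarrow> ('v, 'r::idom) group_scheme \<Rightarrow>
    ('v \<times> nat \<Rightarrow> (('v \<times> nat + 'v \<times> nat) \<times> nat, 'r) mfps) set \<Rightarrow> bool" where
  "is_bracket p \<phi> r s G B \<longleftrightarrow>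
     B \<in> delta_map p \<phi> (max r s) (Lie_prod p \<phi> r s G) (Lie p \<phi> (r + s) G) \<and>
     (\<forall>\<alpha>\<in>Lie_pts p \<phi> r G. \<forall>\<beta>\<in>Lie_pts p \<phi> s G.
        ex_map p \<phi> (r + s) G (bracket_app p \<phi> r s G B \<alpha> \<beta>) =
        gcommutator G (ex_map p \<phi> r G \<alpha>) (ex_map p \<phi> s G \<beta>))"

definition bracket :: "nat \<Rightarrow> ('r \<Rightarrow> 'r) \<Rightarrow> nat \<Rightarrow> nat \<Rightarrow> ('v, 'r::idom) group_scheme \<Rightarrow>
    ('v \<times> nat \<Rightarrow> 'r) \<Rightarrow> ('v \<times> nat \<Rightarrow> 'r) \<Rightarrow> 'v \<times> nat \<Rightarrow> 'r" where
  "bracket p \<phi> r s G = bracket_app p \<phi> r s G (THE B. is_bracket p \<phi> r s G B)"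

text \<open>The matrix of a point of the order \<open>r\<close> Lie algebra of \<open>GL n\<close>: the value of \<open>x\<^sup>(\<^sup>r\<^sup>)\<close>.\<close>

definition gl_mat :: "nat \<Rightarrow> nat \<Rightarrow> ((nat \<times> nat) option \<times> nat \<Rightarrow> 'r) \<Rightarrow> 'r mat" where
  "gl_mat n r \<alpha> = coord_mat n (\<lambda>v. \<alpha> (v, r))"

definition gl_bracket :: "'r::comm_ring_1 mat \<Rightarrow> 'r mat \<Rightarrow> 'r mat" where
  "gl_bracket a b = a * b - b * a"

definition mat_cong :: "'r::comm_ring_1 \<Rightarrow> 'r mat \<Rightarrow> 'r mat \<Rightarrow> bool" where
  "mat_cong q a b \<longleftrightarrow> dim_row a = dim_row b \<and> dim_col a = dim_col b \<and>
     (\<forall>i<dim_row a. \<forall>j<dim_col a. q dvd a $$ (i, j) - b $$ (i, j))"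

end

theory Submission
  imports Defs
begin

text \<open>
  On \<open>R\<close>-points \<open>ex\<^sup>r\<close> identifies the order \<open>r\<close> Lie algebra with the group of points congruent to the
  unit \<open>e\<close> modulo \<open>p\<^sup>r\<close>: if the coordinates of order below \<open>r\<close> are those of the unit, it is
  \<open>e + p\<^sup>r \<phi>\<^sup>-\<^sup>r(x\<^sup>(\<^sup>r\<^sup>) - \<delta>\<^sup>r e)\<close>. In \<open>GL\<^sub>n\<close> the commutator of \<open>A = 1 + p\<^sup>r a\<close> and \<open>B = 1 + p\<^sup>s b\<close> is
  \<open>1 + p\<^sup>r\<^sup>+\<^sup>s (ab - ba) A\<^sup>-\<^sup>1 B\<^sup>-\<^sup>1\<close>, which gives the bracket on points and all its congruences.

  The bracket on points comes from a unique delta-map because the Lie algebra of a smooth group is,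
  by Newton's method, a retract of an affine space by restricted series. In affine space a
  restricted series in the derivatives vanishes if it vanishes at all points, as the derivatives of
  a point take arbitrary residues; through the retraction, a series in the coordinates of a jet
  space of the Lie algebra that vanishes at all points lies in the ideal of the jet space. After the
  twist by \<open>\<phi>\<^sup>r\<^sup>+\<^sup>s\<close> the commutator depends on \<open>\<phi>\<^sup>s(x\<^sup>(\<^sup>r\<^sup>))\<close> and \<open>\<phi>\<^sup>r(y\<^sup>(\<^sup>s\<^sup>))\<close>, which explains the order \<open>max r s\<close>.
\<close>

section \<open>The base ring and its lift of Frobenius\<close>

text \<open>A delta-map is a class of tuples modulo an ideal of a jet space, so equality of values
  at points has to be turned into membership in this ideal, which is the algebraic one generated by
  the equations and their derivatives. Error terms are therefore kept as explicit finite
  combinations of generators with restricted series as coefficients: the Newton limit comes with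
  convergent coefficients \<open>C v i\<close>, and \<open>diff_analytic\<close> expands differences
  of values. Smoothness is applied at the prime of polynomials whose value at the unit is divisible
  by p, as all points in question are congruent to the unit modulo p. Linearity enters through
  \<open>matrix_rep\<close>, which preserves and reflects congruences modulo every power of p; this
  makes the commutator congruent to the unit modulo \<open>p^(r+s)\<close>. Dividing by this power
  stays within restricted series because a series with all values divisible by p is itself divisible
  by p. The last fact uses that there are infinitely many residues, and the inverse twist that the
  residue field is perfect; both come from its algebraic closedness.\<close>

lemma (in cring) ideal_closedI:
  assumes "J \<subseteq> carrier R" "\<zero> \<in> J"
    and add: "\<And>x y. x \<in> J \<Longrightarrow> y \<in> J \<Longrightarrow> x \<oplus> y \<in> J"
    and mult: "\<And>a x. a \<in> carrier R \<Longrightarrow> x \<in> J \<Longrightarrow> a \<otimes> x \<in> J"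
  shows "ideal J R"
proof (rule idealI)
  show "subgroup J (add_monoid R)"
  proof (rule group.subgroupI)
    show "Group.group (add_monoid R)"
      using add.is_group .
    fix a assume a: "a \<in> J"
    then have "\<ominus> a = (\<ominus> \<one>) \<otimes> a"
      using assms(1) by (simp add: l_minus subset_iff)
    then show "inv\<^bsub>add_monoid R\<^esub> a \<in> J"
      using mult[of "\<ominus> \<one>" a] a by (simp add: a_inv_def)
  qed (use assms in auto)
next
  fix a x assume "a \<in> J" "x \<in> carrier R"
  then show "x \<otimes> a \<in> J" "a \<otimes> x \<in> J"
    using mult[of x a] m_comm[of a x] assms(1) by auto
qed (rule ring_axioms)

lemma dvd_diff_swap: "d dvd a - b \<longleftrightarrow> d dvd b - (a :: 'a :: comm_ring_1)"
  by (metis dvd_minus_iff minus_diff_eq)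

locale pring =
  fixes p :: nat and \<phi> :: "'r::idom \<Rightarrow> 'r"
  assumes base_ring: "base_ring p \<phi>"
begin

abbreviation q :: 'r where "q \<equiv> of_nat p"

abbreviation R0 :: "'r ring" where "R0 \<equiv> ring_of_type_algebra"
abbreviation pR :: "'r set" where "pR \<equiv> PIdl\<^bsub>R0\<^esub> q"

lemma prime_p: "Factorial_Ring.prime p"
  using base_ring by (auto simp: base_ring_def)

lemma p_pos: "p > 0"
  using prime_p prime_gt_0_nat by blast

lemma q_nz [simp]: "q \<noteq> 0"
  and pid: "principal_domain R0"
  and max_pR: "maximalideal pR R0"
  and complete: "\<And>a :: nat \<Rightarrow> 'r. (\<And>n. q ^ n dvd a (Suc n) - a n) \<Longrightarrow> \<exists>l. \<forall>n. q ^ n dvd l - a n"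
  and alg_cl: "algebraic_closure (R0 Quot pR) ((\<lambda>z::int. pR +>\<^bsub>R0\<^esub> of_int z) ` UNIV)"
  using base_ring by (auto simp: base_ring_def complete_dvr_def Let_def)

lemma \<phi>_1 [simp]: "\<phi> 1 = 1" and \<phi>_add: "\<phi> (a + b) = \<phi> a + \<phi> b"
  and \<phi>_mult: "\<phi> (a * b) = \<phi> a * \<phi> b" and \<phi>_frob: "q dvd \<phi> a - a ^ p"
  using base_ring by (auto simp: base_ring_def frobenius_lift_def)

lemma R0_simps [simp]: "carrier R0 = UNIV" "\<one>\<^bsub>R0\<^esub> = 1" "\<zero>\<^bsub>R0\<^esub> = 0"
   "x \<otimes>\<^bsub>R0\<^esub> y = x * y" "x \<oplus>\<^bsub>R0\<^esub> y = x + y"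
  by (auto simp: ring_of_type_algebra_def)

lemma pR_eq: "pR = {x. q dvd x}"
  by (auto simp: cgenideal_def dvd_def mult.commute)

lemma q_not_dvd_1: "\<not> q dvd 1"
proof
  assume "q dvd 1"
  then have "pR = UNIV" by (auto simp: pR_eq intro: dvd_trans)
  then show False using max_pR by (auto simp: maximalideal_def maximalideal_axioms_def)
qed

lemma cring_R0: "cring R0"
  by (rule cring_from_type_algebra)

lemma ideal_R0I:
  assumes "0 \<in> J" "\<And>x y. x \<in> J \<Longrightarrow> y \<in> J \<Longrightarrow> x + y \<in> J" "\<And>a x. x \<in> J \<Longrightarrow> a * x \<in> J"
  shows "ideal J R0"
  by (rule cring.ideal_closedI[OF cring_R0]) (use assms in auto)

text \<open>The quotients \<open>f n\<close> of x by the powers of p satisfy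
  \<open>f n = q * f (Suc n)\<close>, so the ideals they generate increase. Their union is
  principal, hence equal to one of them; for nonzero x this would make p invertible.\<close>

lemma separated:
  assumes "\<And>n. q ^ n dvd x"
  shows "x = 0"
proof -
  have "\<forall>n. \<exists>y. x = q ^ n * y" using assms by (auto simp: dvd_def)
  then obtain f where f: "\<And>n. x = q ^ n * f n" by metis
  have f1: "f n = q * f (Suc n)" for n
  proof -
    have "q ^ n * f n = q ^ n * (q * f (Suc n))"
      using f[of n] f[of "Suc n"] by (simp add: mult_ac)
    then show ?thesis by simp
  qed
  have f2: "f m dvd f n" if "n \<le> m" for n m
    using that by (induction rule: dec_induct) (auto intro: dvd_trans[OF dvdI[OF f1[unfolded mult.commute[of q]]]])
  let ?J = "{y. \<exists>n. f n dvd y}"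
  have "ideal ?J R0"
  proof (rule ideal_R0I)
    fix y z assume "y \<in> ?J" "z \<in> ?J"
    then obtain n m where "f n dvd y" "f m dvd z" by auto
    then have "f (max n m) dvd y + z"
      by (meson dvd_add dvd_trans f2 max.cobounded1 max.cobounded2)
    then show "y + z \<in> ?J" by blast
  qed (auto intro: dvd_mult)
  then obtain g where "?J = PIdl\<^bsub>R0\<^esub> g"
    using principal_domain.exists_gen[OF pid \<open>ideal ?J R0\<close>] by blast
  also have "\<dots> = {y. g dvd y}"
    by (auto simp: cgenideal_def dvd_def mult.commute)
  finally have g: "?J = {y. g dvd y}" .
  have "g \<in> ?J" unfolding g by simp
  then obtain n where n: "f n dvd g" by blast
  have "f (Suc n) \<in> ?J" by (blast intro: dvd_refl)
  then have "f n dvd f (Suc n)" using g n dvd_trans by auto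
  then obtain c where c: "f (Suc n) = f n * c" by auto
  show ?thesis
  proof (rule ccontr)
    assume "x \<noteq> 0"
    then have "f (Suc n) \<noteq> 0" using f[of "Suc n"] by auto
    moreover have "f (Suc n) * 1 = f (Suc n) * (q * c)" using c f1[of n] by (simp add: mult_ac)
    ultimately have "1 = q * c" by (metis mult_cancel_left)
    then show False using q_not_dvd_1 by (metis dvd_triv_left)
  qed
qed

text \<open>By maximality of \<open>pR\<close>, an element a outside it generates the unit ideal
  together with p, so \<open>a * b = 1 - q * c\<close> for some b and c. The right-hand side is
  inverted by its geometric series, which converges by completeness.\<close>

lemma unit_iff: "a dvd 1 \<longleftrightarrow> \<not> q dvd a"
proof
  assume "a dvd 1" then show "\<not> q dvd a" using q_not_dvd_1 dvd_trans by blast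
next
  assume a: "\<not> q dvd a"
  let ?J = "{x. \<exists>b c. x = a * b + q * c}"
  have "ideal ?J R0"
  proof (rule ideal_R0I)
    show "0 \<in> ?J" by (auto intro: exI[of _ 0])
    fix x y assume "x \<in> ?J" "y \<in> ?J"
    then obtain b c b' c' where "x = a * b + q * c" "y = a * b' + q * c'" by auto
    then have "x + y = a * (b + b') + q * (c + c')" by (simp add: algebra_simps)
    then show "x + y \<in> ?J" by blast
  next
    fix d x assume "x \<in> ?J"
    then obtain b c where "x = a * b + q * c" by auto
    then have "d * x = a * (d * b) + q * (d * c)" by (simp add: algebra_simps)
    then show "d * x \<in> ?J" by blast
  qed
  moreover have "pR \<subseteq> ?J"
    unfolding pR_eq dvd_def by (force intro: exI[of _ 0])
  moreover have "a \<in> ?J" using exI[of "\<lambda>b. \<exists>c. a = a * b + q * c" 1] by (force intro: exI[of _ 0])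
  ultimately have "?J = UNIV"
    using max_pR a unfolding maximalideal_def maximalideal_axioms_def pR_eq R0_simps
    by (metis (mono_tags, lifting) mem_Collect_eq subset_UNIV)
  then obtain b c where bc: "1 = a * b + q * c" by blast
  define s where "s n = (\<Sum>i<n. (q * c) ^ i)" for n
  have "q ^ n dvd s (Suc n) - s n" for n
    by (simp add: s_def power_mult_distrib)
  then obtain l where l: "\<And>n. q ^ n dvd l - s n" using complete by blast
  have ab: "a * b = 1 - q * c" using bc by (simp add: algebra_simps)
  have s1: "(1 - q * c) * s n = 1 - (q * c) ^ n" for n
    unfolding s_def by (rule one_diff_power_eq[symmetric])
  have *: "q ^ n dvd 1 - a * b * l" for n
  proof -
    have "1 - a * b * l = q ^ n * c ^ n - a * b * (l - s n)"
      using s1[of n] by (simp add: ab algebra_simps power_mult_distrib)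
    then show ?thesis using l[of n] by simp
  qed
  then have "1 - a * b * l = 0" by (rule separated)
  then have "1 = a * (b * l)" by (simp add: mult.assoc)
  then show "a dvd 1" by (rule dvdI)
qed

lemma q_prime: "q dvd a * b \<longleftrightarrow> q dvd a \<or> q dvd b"
  using unit_iff[of a] unit_iff[of b] unit_iff[of "a * b"] by (auto simp: is_unit_mult_iff)

lemma q_dvd_power: "q dvd a ^ n \<longleftrightarrow> n > 0 \<and> q dvd a"
  by (induction n) (auto simp: q_prime q_not_dvd_1)

lemma eq_by_approx: "(\<And>n. q ^ n dvd x - y) \<Longrightarrow> x = y"
  using separated[of "x - y"] by simp

lemma q_power_dvd_cancel: "q ^ (m + n) dvd q ^ m * x \<longleftrightarrow> q ^ n dvd x"
  by (simp add: power_add)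

lemma qsum_exists: "\<exists>s. \<forall>n. q ^ n dvd s - (\<Sum>i<n. q ^ i * f i)"
  by (rule complete) simp

lemma \<phi>_0 [simp]: "\<phi> 0 = 0"
  using \<phi>_add[of 0 0] by (metis add.right_neutral add_left_cancel)

lemma \<phi>_uminus: "\<phi> (- a) = - \<phi> a"
  using \<phi>_add[of a "- a"] by (simp add: eq_neg_iff_add_eq_0 add.commute)

lemma \<phi>_diff: "\<phi> (a - b) = \<phi> a - \<phi> b"
  using \<phi>_add[of a "- b"] by (simp add: \<phi>_uminus)

lemma \<phi>_of_nat [simp]: "\<phi> (of_nat n) = of_nat n"
  by (induction n) (simp_all add: \<phi>_add)

lemma \<phi>_power: "\<phi> (a ^ n) = \<phi> a ^ n"
  by (induction n) (simp_all add: \<phi>_mult)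

lemma \<phi>_sum: "\<phi> (sum f A) = (\<Sum>i\<in>A. \<phi> (f i))"
  by (induction A rule: infinite_finite_induct) (simp_all add: \<phi>_add)

lemma q_dvd_\<phi>: "q dvd \<phi> a \<longleftrightarrow> q dvd a"
proof -
  have "q dvd \<phi> a \<longleftrightarrow> q dvd a ^ p" using \<phi>_frob[of a] by (metis dvd_diff_left_iff dvd_diff_right_iff)
  then show ?thesis using p_pos by (simp add: q_dvd_power)
qed

text \<open>Modulo p the map is the p-th power, so an element of the kernel is divisible by p; the
  quotient is again in the kernel.\<close>

lemma \<phi>_eq_0: "\<phi> a = 0 \<longleftrightarrow> a = 0"
proof
  assume a: "\<phi> a = 0"
  have "q ^ n dvd a" for n
  proof (induction n)
    case (Suc n)
    then obtain b where b: "a = q ^ n * b" by auto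
    then have "\<phi> b = 0" using a by (simp add: \<phi>_mult \<phi>_power)
    then have "q dvd b" using q_dvd_\<phi>[of b] by simp
    then show ?case using b by (simp add: mult.commute mult_dvd_mono)
  qed simp
  then show "a = 0" by (rule separated)
qed simp

lemma \<phi>_inj: "inj \<phi>"
  by (rule injI) (metis \<phi>_eq_0 \<phi>_diff right_minus_eq)

section \<open>The residue field: roots, perfectness, infinitely many residues\<close>

text \<open>The reduction of f splits over the residue field, and a root of it is the class of some
  a. The work lies in the translation to the list-based polynomials over the quotient ring, which
  store the leading coefficient first; hence the \<open>rev\<close>.\<close>

lemma root_mod:
  fixes f :: "'r poly"
  assumes "Polynomial.lead_coeff f = 1" "Polynomial.degree f > 0"
  shows "\<exists>a. q dvd poly f a"
proof -
  let ?K = "R0 Quot pR"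
  let ?h = "\<lambda>a. pR +>\<^bsub>R0\<^esub> a"
  interpret R0: cring R0 by (rule cring_R0)
  interpret I: ideal pR R0 using max_pR by (simp add: maximalideal_def)
  interpret algebraic_closure ?K "(\<lambda>z::int. ?h (of_int z)) ` UNIV" by (rule alg_cl)
  interpret h: ring_hom_ring R0 ?K ?h by (rule I.rcos_ring_hom_ring)
  have h0: "?h a = \<zero>\<^bsub>?K\<^esub> \<longleftrightarrow> q dvd a" for a
    using I.a_rcos_const I.a_rcos_self[of a] by (auto simp: FactRing_def pR_eq)
  have hsurj: "\<exists>a. x = ?h a" if "x \<in> carrier ?K" for x
    using that by (auto simp: FactRing_def A_RCOSETS_def')
  have hm: "?h (a * b) = ?h a \<otimes>\<^bsub>?K\<^esub> ?h b" and ha: "?h (a + b) = ?h a \<oplus>\<^bsub>?K\<^esub> ?h b"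
    and h1: "?h 1 = \<one>\<^bsub>?K\<^esub>" and hc: "?h a \<in> carrier ?K" for a b
    using h.hom_mult[of a b] h.hom_add[of a b] h.hom_one h.hom_closed[of a] by simp_all
  have hp: "?h (a ^ n) = ?h a [^]\<^bsub>?K\<^esub> n" for a and n :: nat
    by (induction n) (simp_all add: h1 hm hc m_comm)
  define P where "P = map ?h (rev (Polynomial.coeffs f))"
  have f0: "f \<noteq> 0" using assms(1) by auto
  have deg: "length P = Suc (Polynomial.degree f)"
    using f0 by (simp add: P_def length_coeffs_degree)
  have carrier_P: "P \<in> carrier (poly_ring ?K)"
    using assms(1) f0 by (auto simp: univ_poly_def polynomial_def P_def hd_map hd_rev last_coeffs_eq_coeff_degree h1 hc)
  then have "splitted P" using roots_over_carrier by blast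
  then have "roots P \<noteq> {#}"
    unfolding splitted_def using deg assms by auto
  then obtain x where "x \<in># roots P" by blast
  then have x: "is_root P x"
    using roots_mem_iff_is_root[OF carrier_P] by auto
  then obtain a where a: "x = ?h a" using hsurj by (auto simp: is_root_def)
  have "eval (map ?h xs) (?h a) = ?h (poly (Poly (rev xs)) a)" for xs
  proof (induction xs)
    case Nil
    then show ?case using h0[of 0] by simp
  next
    case (Cons y ys)
    then show ?case
      by (simp add: Poly_append poly_monom hm ha hp hc a_comm m_comm)
  qed
  from this[of "rev (Polynomial.coeffs f)"] have "eval P x = ?h (poly f a)"
    by (simp add: P_def a)
  then show ?thesis using x h0 by (auto simp: is_root_def)
qed

lemma frob_mod_surj: "\<exists>b. q dvd a - b ^ p"
proof -
  let ?f = "monom 1 p + [:- a:] :: 'r poly"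
  have deg: "Polynomial.degree ?f = p"
    using p_pos by (subst degree_add_eq_left) (auto simp: degree_monom_eq)
  have "Polynomial.coeff [:- a:] p = 0" using p_pos by (simp add: coeff_pCons split: nat.split)
  then have "Polynomial.lead_coeff ?f = 1" unfolding deg by simp
  then obtain b where "q dvd poly ?f b" using root_mod[of ?f] deg p_pos by auto
  then have "q dvd b ^ p - a" by (simp add: poly_monom)
  then have "q dvd a - b ^ p" by (simp add: dvd_diff_swap[of q a])
  then show ?thesis by blast
qed

text \<open>Euclid's argument: a root modulo p of \<open>1 + (\<Prod>a\<in>A. x - a)\<close> is
  congruent to no element of A. The polynomial has to be nonconstant, so the step from the empty set
  is separate.\<close>

lemma incongruent_set: "\<exists>A. finite A \<and> card A = n \<and> (\<forall>a\<in>A. \<forall>b\<in>A. q dvd a - b \<longrightarrow> a = b)"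
proof (induction n)
  case (Suc n)
  then obtain A where A: "finite A" "card A = n" "\<forall>a\<in>A. \<forall>b\<in>A. q dvd a - b \<longrightarrow> a = b" by blast
  show ?case
  proof (cases "n = 0")
    case True
    then show ?thesis by (intro exI[of _ "{0}"]) auto
  next
    case False
    let ?g = "\<Prod>a\<in>A. [:- a, 1:]"
    have deg: "Polynomial.degree ?g = n" using A(1,2) by (subst degree_prod_sum_eq) auto
    have lc: "Polynomial.lead_coeff ?g = 1" by (simp add: lead_coeff_prod)
    have "Polynomial.degree (?g + 1) = n" using deg False by (subst degree_add_eq_left) auto
    moreover have "Polynomial.coeff (?g + 1) n = 1" using lc deg False by simp
    ultimately obtain b where "q dvd poly (?g + 1) b" using root_mod[of "?g + 1"] False by auto
    then have b: "q dvd (\<Prod>a\<in>A. b - a) + 1" by (simp add: poly_prod)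
    have nd: "\<not> q dvd b - a" if "a \<in> A" for a
    proof
      assume "q dvd b - a"
      also have "b - a dvd (\<Prod>a\<in>A. b - a)" using A(1) that by (rule dvd_prodI)
      finally show False using b q_not_dvd_1 by (simp add: dvd_add_right_iff)
    qed
    have nd': "\<not> q dvd a - b" if "a \<in> A" for a
      using nd[OF that] by (simp add: dvd_diff_swap[of q a b])
    have "b \<notin> A" using nd by force
    then show ?thesis using A nd nd' by (intro exI[of _ "insert b A"]) auto
  qed
qed (auto intro: exI[of _ "{}"])

text \<open>The residue field is perfect by \<open>frob_mod_surj\<close>, so every x has the form
  \<open>\<phi> b + q * c\<close>. Repeating this with the remainder c yields the p-adic expansion
  of a preimage.\<close>

lemma \<phi>_surj: "surj \<phi>"
proof (unfold surj_def, intro allI)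
  fix a :: 'r
  show "\<exists>b. a = \<phi> b"
  proof -
    have "\<exists>b c. x = \<phi> b + q * c" for x
    proof -
      obtain b where b: "q dvd x - b ^ p" using frob_mod_surj by blast
      have "q dvd (x - b ^ p) - (\<phi> b - b ^ p)" by (rule dvd_diff[OF b \<phi>_frob])
      then obtain c where "x - \<phi> b = q * c" by (auto simp: dvd_def)
      then have "x = \<phi> b + q * c" by (simp add: algebra_simps)
      then show ?thesis by blast
    qed
    then obtain B C where BC: "\<And>x. x = \<phi> (B x) + q * C x" by metis
    define r where "r n = (C ^^ n) a" for n
    have r: "a = (\<Sum>i<n. q ^ i * \<phi> (B (r i))) + q ^ n * r n" for n
    proof (induction n)
      case (Suc n)
      have "r n = \<phi> (B (r n)) + q * r (Suc n)" using BC[of "r n"] by (simp add: r_def)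
      then have "q ^ n * r n = q ^ n * (\<phi> (B (r n)) + q * r (Suc n))" by (rule arg_cong)
      then show ?case using Suc by (simp add: algebra_simps)
    qed (simp add: r_def)
    obtain s where s: "\<And>n. q ^ n dvd s - (\<Sum>i<n. q ^ i * B (r i))"
      using qsum_exists[of "\<lambda>i. B (r i)"] by blast
    have "q ^ n dvd a - \<phi> s" for n
    proof -
      obtain t where "s - (\<Sum>i<n. q ^ i * B (r i)) = q ^ n * t" using s[of n] by auto
      then have "s = (\<Sum>i<n. q ^ i * B (r i)) + q ^ n * t" by (simp add: algebra_simps)
      then have "\<phi> s = (\<Sum>i<n. q ^ i * \<phi> (B (r i))) + q ^ n * \<phi> t"
        by (simp add: \<phi>_add \<phi>_sum \<phi>_mult \<phi>_power)
      then have "a - \<phi> s = q ^ n * (r n - \<phi> t)" using r[of n] by (simp add: algebra_simps)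
      then show ?thesis by simp
    qed
    then have "a = \<phi> s" by (rule eq_by_approx)
    then show ?thesis by blast
  qed
qed

lemma \<phi>_bij: "bij \<phi>"
  using \<phi>_inj \<phi>_surj by (simp add: bij_def)

abbreviation \<psi> :: "'r \<Rightarrow> 'r" where "\<psi> \<equiv> inv_into UNIV \<phi>"

lemma \<phi>_\<psi> [simp]: "\<phi> (\<psi> a) = a" and \<psi>_\<phi> [simp]: "\<psi> (\<phi> a) = a"
  using \<phi>_bij by (simp_all add: bij_def surj_f_inv_f)

lemma \<psi>_eqI: "\<phi> b = a \<Longrightarrow> \<psi> a = b"
  by auto

lemma \<psi>_add: "\<psi> (a + b) = \<psi> a + \<psi> b" and \<psi>_mult: "\<psi> (a * b) = \<psi> a * \<psi> b"
  and \<psi>_1 [simp]: "\<psi> 1 = 1" and \<psi>_0 [simp]: "\<psi> 0 = 0"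
  and \<psi>_power: "\<psi> (a ^ n) = \<psi> a ^ n" and \<psi>_of_nat [simp]: "\<psi> (of_nat n) = of_nat n"
  by (rule \<psi>_eqI, simp add: \<phi>_add \<phi>_mult \<phi>_diff \<phi>_power)+

lemma q_power_dvd_\<phi>: "q ^ n dvd \<phi> a \<longleftrightarrow> q ^ n dvd a"
proof
  assume "q ^ n dvd \<phi> a"
  then obtain c where "\<phi> a = q ^ n * c" by auto
  then have "a = q ^ n * \<psi> c" by (metis \<psi>_\<phi> \<psi>_mult \<psi>_power \<psi>_of_nat)
  then show "q ^ n dvd a" by simp
qed (auto simp: \<phi>_mult \<phi>_power)

end

section \<open>Polynomials and power series as algebras\<close>

text \<open>A predicate on functions, so that \<phi> and its inverse, the embeddings
  \<open>mconst\<close>, \<open>of_poly\<close>, \<open>cst\<close> and all evaluations share the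
  rewrite rules \<open>rhomD\<close>.\<close>

definition rhom :: "('a::comm_ring_1 \<Rightarrow> 'b::comm_ring_1) \<Rightarrow> bool" where
  "rhom h \<longleftrightarrow> h 1 = 1 \<and> (\<forall>a b. h (a + b) = h a + h b) \<and> (\<forall>a b. h (a * b) = h a * h b)"

lemma rhomD:
  assumes "rhom h"
  shows "h 1 = 1" "h (a + b) = h a + h b" "h (a * b) = h a * h b" "h 0 = 0"
    "h (- a) = - h a" "h (a - b) = h a - h b" "h (a ^ n) = h a ^ n" "h (of_nat n) = of_nat n"
    "h (sum f A) = (\<Sum>i\<in>A. h (f i))" "h (prod f A) = (\<Prod>i\<in>A. h (f i))"
proof -
  show 1: "h 1 = 1" "h (a * b) = h a * h b" and add: "h (a + b) = h a + h b" for a b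
    using assms by (auto simp: rhom_def)
  show 0: "h 0 = 0" using add[of 0 0] by (metis add.right_neutral add_left_cancel)
  show um: "h (- a) = - h a" for a using add[of a "- a"] 0 by (simp add: eq_neg_iff_add_eq_0 add.commute)
  show "h (a - b) = h a - h b" using add[of a "- b"] um by simp
  show "h (a ^ n) = h a ^ n" by (induction n) (simp_all add: 1)
  show "h (of_nat n) = of_nat n" by (induction n) (simp_all add: 1 0 add)
  show "h (sum f A) = (\<Sum>i\<in>A. h (f i))" by (induction A rule: infinite_finite_induct) (simp_all add: 0 add)
  show "h (prod f A) = (\<Prod>i\<in>A. h (f i))" by (induction A rule: infinite_finite_induct) (simp_all add: 1)
qed

lemma rhom_id [simp]: "rhom id" "rhom (\<lambda>x. x)"
  by (simp_all add: rhom_def)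

lemma rhom_comp: "rhom f \<Longrightarrow> rhom g \<Longrightarrow> rhom (\<lambda>x. f (g x))"
  by (simp add: rhom_def)

definition mon :: "('v \<Rightarrow> 'a::comm_ring_1) \<Rightarrow> ('v \<Rightarrow>\<^sub>0 nat) \<Rightarrow> 'a" where
  "mon F k = (\<Prod>v\<in>Poly_Mapping.keys k. F v ^ Poly_Mapping.lookup k v)"

lemma mon_superset:
  "finite S \<Longrightarrow> Poly_Mapping.keys k \<subseteq> S \<Longrightarrow> mon F k = (\<Prod>v\<in>S. F v ^ Poly_Mapping.lookup k v)"
  unfolding mon_def by (rule prod.mono_neutral_left) (auto simp: in_keys_iff)

lemma mon_add: "mon F (k + l) = mon F k * mon F l"
  by (simp add: mon_superset[of "Poly_Mapping.keys k \<union> Poly_Mapping.keys l"] keys_add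
      lookup_add power_add prod.distrib)

lemma mon_0 [simp]: "mon F 0 = 1"
  by (simp add: mon_def)

lemma mon_single: "mon F (Poly_Mapping.single v n) = F v ^ n"
  by (subst mon_superset[of "{v}"]) auto

lemma mon_cong: "(\<And>v. v \<in> Poly_Mapping.keys k \<Longrightarrow> F v = F' v) \<Longrightarrow> mon F k = mon F' k"
  by (simp add: mon_def)

lemma mon_hom: "rhom h \<Longrightarrow> h (mon F k) = mon (\<lambda>v. h (F v)) k"
  by (simp add: mon_def rhomD)

lemma meval_mon: "meval \<iota> F f = (\<Sum>k\<in>Poly_Mapping.keys f. \<iota> (Poly_Mapping.lookup f k) * mon F k)"
  by (simp add: meval_def mon_def)

lemma meval_superset:
  "rhom \<iota> \<Longrightarrow> finite S \<Longrightarrow> Poly_Mapping.keys f \<subseteq> S \<Longrightarrow>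
    meval \<iota> F f = (\<Sum>k\<in>S. \<iota> (Poly_Mapping.lookup f k) * mon F k)"
  unfolding meval_mon by (rule sum.mono_neutral_left) (auto simp: in_keys_iff rhomD)

lemma meval_add:
  assumes "rhom \<iota>"
  shows "meval \<iota> F (f + g) = meval \<iota> F f + meval \<iota> F g"
  using assms by (simp add: meval_superset[of \<iota> "Poly_Mapping.keys f \<union> Poly_Mapping.keys g"]
      Poly_Mapping.keys_add lookup_add rhomD distrib_right sum.distrib)

lemma meval_single: "rhom \<iota> \<Longrightarrow> meval \<iota> F (Poly_Mapping.single k c) = \<iota> c * mon F k"
  by (subst meval_superset[of _ "{k}"]) auto

lemma mpoly_sum_single: "f = (\<Sum>k\<in>Poly_Mapping.keys f. Poly_Mapping.single k (Poly_Mapping.lookup f k))"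
  by (rule poly_mapping_eqI) (simp add: lookup_sum lookup_single when_def in_keys_iff)

lemma meval_0 [simp]: "meval \<iota> F 0 = 0"
  by (simp add: meval_def)

lemma meval_sum: "rhom \<iota> \<Longrightarrow> meval \<iota> F (sum f A) = (\<Sum>i\<in>A. meval \<iota> F (f i))"
  by (induction A rule: infinite_finite_induct) (simp_all add: meval_add)

lemma meval_mult:
  assumes "rhom \<iota>"
  shows "meval \<iota> F (f * g) = meval \<iota> F f * meval \<iota> F g"
proof -
  let ?s = "\<lambda>f k. Poly_Mapping.single k (Poly_Mapping.lookup f k)"
  have "f * g = (\<Sum>k\<in>Poly_Mapping.keys f. ?s f k) * (\<Sum>l\<in>Poly_Mapping.keys g. ?s g l)"
    using mpoly_sum_single[of f] mpoly_sum_single[of g] by simp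
  also have "\<dots> = (\<Sum>k\<in>Poly_Mapping.keys f. \<Sum>l\<in>Poly_Mapping.keys g. ?s f k * ?s g l)"
    by (simp add: sum_product)
  also have "meval \<iota> F \<dots> = meval \<iota> F f * meval \<iota> F g"
    using assms by (simp add: meval_sum mult_single meval_single meval_mon[of _ _ f]
        meval_mon[of _ _ g] sum_product rhomD mon_add algebra_simps)
  finally show ?thesis .
qed

lemma meval_mconst [simp]: "rhom \<iota> \<Longrightarrow> meval \<iota> F (mconst c) = \<iota> c"
  by (simp add: mconst_def meval_single)

lemma meval_mvar [simp]: "rhom \<iota> \<Longrightarrow> meval \<iota> F (mvar v) = F v"
  by (simp add: mvar_def meval_single mon_single rhomD)

lemma rhom_meval: "rhom \<iota> \<Longrightarrow> rhom (meval \<iota> F)"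
  by (simp add: rhom_def[of "meval \<iota> F"] meval_add meval_mult)
    (simp add: rhomD(1) meval_single flip: single_one)

lemma rhom_mconst [simp]: "rhom mconst"
  by (auto simp: rhom_def mconst_def single_add mult_single)

lemma meval_hom: "rhom h \<Longrightarrow> h (meval \<iota> F f) = meval (\<lambda>c. h (\<iota> c)) (\<lambda>v. h (F v)) f"
  by (simp add: meval_mon rhomD mon_hom)

lemma meval_msubst:
  "rhom \<iota> \<Longrightarrow> meval \<iota> F (msubst S g) = meval \<iota> (\<lambda>w. meval \<iota> F (S w)) g"
  by (subst meval_hom[OF rhom_meval]) simp_all

lemma meval_cong:
  "(\<And>k v. k \<in> Poly_Mapping.keys f \<Longrightarrow> v \<in> Poly_Mapping.keys k \<Longrightarrow> F v = F' v) \<Longrightarrow> meval \<iota> F f = meval \<iota> F' f"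
  unfolding meval_mon by (intro sum.cong refl arg_cong2[of _ _ _ _ "(*)"] mon_cong) auto

lemma meval_cong_pol:
  "f \<in> carrier (pol_ring V) \<Longrightarrow> (\<And>v. v \<in> V \<Longrightarrow> F v = F' v) \<Longrightarrow> meval \<iota> F f = meval \<iota> F' f"
  by (rule meval_cong) (auto simp: pol_ring_def)

lemma pol_ring_simps [simp]: "\<one>\<^bsub>pol_ring V\<^esub> = 1" "\<zero>\<^bsub>pol_ring V\<^esub> = 0"
   "x \<otimes>\<^bsub>pol_ring V\<^esub> y = x * y" "x \<oplus>\<^bsub>pol_ring V\<^esub> y = x + y"
  by (auto simp: pol_ring_def)

lemma pol_closed:
  assumes "f \<in> carrier (pol_ring V)" "g \<in> carrier (pol_ring V)"
  shows "f + g \<in> carrier (pol_ring V)" "f * g \<in> carrier (pol_ring V)"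
proof -
  interpret cring "pol_ring V" by (rule cring_pol_ring)
  show "f + g \<in> carrier (pol_ring V)" "f * g \<in> carrier (pol_ring V)"
    using a_closed[OF assms] m_closed[OF assms] by simp_all
qed

lemma pol_mconst [simp]: "mconst c \<in> carrier (pol_ring V)"
  by (auto simp: pol_ring_def mconst_def split: if_splits)

lemma pol_mvar [simp]: "mvar v \<in> carrier (pol_ring V) \<longleftrightarrow> v \<in> V"
  by (auto simp: pol_ring_def mvar_def)

lemma pol_0 [simp]: "0 \<in> carrier (pol_ring V)" and pol_1 [simp]: "1 \<in> carrier (pol_ring V)"
  by (auto simp: pol_ring_def)

lemma pol_sum: "(\<And>i. i \<in> A \<Longrightarrow> f i \<in> carrier (pol_ring V)) \<Longrightarrow> sum f A \<in> carrier (pol_ring V)"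
  by (induction A rule: infinite_finite_induct) (auto simp: pol_closed)

lemma pol_uminus: "f \<in> carrier (pol_ring V) \<Longrightarrow> - f \<in> carrier (pol_ring V)"
  by (simp add: pol_ring_def in_keys_iff)

lemma pol_diff: "f \<in> carrier (pol_ring V) \<Longrightarrow> g \<in> carrier (pol_ring V) \<Longrightarrow> f - g \<in> carrier (pol_ring V)"
  using pol_closed(1)[of f V "- g"] pol_uminus[of g V] by simp

lemma mon_mvar: "mon mvar k = (Poly_Mapping.single k 1 :: ('a, 'b::comm_ring_1) mpoly)"
proof -
  have mon1: "mon mvar k = (Poly_Mapping.single k 1 :: ('a, 'b) mpoly)" if "finite S" "Poly_Mapping.keys k = S" for S k
    using that
  proof (induction S arbitrary: k rule: finite_induct)
    case empty
    then show ?case by simp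
  next
    case (insert v S)
    define n where "n = Poly_Mapping.lookup k v"
    define k' where "k' = k - Poly_Mapping.single v n"
    have k: "k = k' + Poly_Mapping.single v n"
      by (rule poly_mapping_eqI) (simp add: k'_def n_def lookup_add lookup_minus lookup_single when_def)
    have "Poly_Mapping.keys k' = S"
      using insert(2,4) unfolding k'_def n_def
      by (auto simp: in_keys_iff lookup_minus lookup_single when_def set_eq_iff split: if_splits)
    then have IH: "mon mvar k' = (Poly_Mapping.single k' 1 :: ('a, 'b) mpoly)" by (rule insert.IH)
    have pw: "mvar v ^ n = (Poly_Mapping.single (Poly_Mapping.single v n) 1 :: ('a, 'b) mpoly)" for n
      by (induction n) (simp_all add: mvar_def mult_single flip: single_add)
    show ?case
      unfolding k by (simp add: mon_add mon_single IH pw mult_single)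
  qed
  from this[OF finite_keys refl] show ?thesis .
qed

lemma single_eq_mon: "Poly_Mapping.single k c = mconst c * mon mvar k"
  by (simp add: mon_mvar mconst_def mult_single)

text \<open>The induction is carried out for \<open>Q\<close>, which adds membership in the ring to
  P: only then are both arguments known to lie in the ring in the steps for sums and
  products.\<close>

lemma pol_induct [consumes 1, case_names const var add mult]:
  fixes f :: "('a, 'b::comm_ring_1) mpoly"
  assumes f: "f \<in> carrier (pol_ring V)"
    and const: "\<And>c. P (mconst c)" and var: "\<And>v. v \<in> V \<Longrightarrow> P (mvar v)"
    and add: "\<And>f g. f \<in> carrier (pol_ring V) \<Longrightarrow> g \<in> carrier (pol_ring V) \<Longrightarrow> P f \<Longrightarrow> P g \<Longrightarrow> P (f + g)"
    and mult: "\<And>f g. f \<in> carrier (pol_ring V) \<Longrightarrow> g \<in> carrier (pol_ring V) \<Longrightarrow> P f \<Longrightarrow> P g \<Longrightarrow> P (f * g)"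
  shows "P f"
proof -
  define Q where "Q f \<longleftrightarrow> f \<in> carrier (pol_ring V) \<and> P f" for f
  have Qa: "Q f \<Longrightarrow> Q g \<Longrightarrow> Q (f + g)" for f g
    using add[of f g] pol_closed[of f V g] by (simp add: Q_def)
  have Qm: "Q f \<Longrightarrow> Q g \<Longrightarrow> Q (f * g)" for f g
    using mult[of f g] pol_closed[of f V g] by (simp add: Q_def)
  have Qc: "Q (mconst c)" for c by (simp add: Q_def const)
  have Qv: "Q (mvar v)" if "v \<in> V" for v using that by (simp add: Q_def var)
  have Q0: "Q 0" using Qc[of 0] by (simp add: mconst_def)
  have Q1: "Q 1" using Qc[of 1] by (simp add: mconst_def)
  have Qs: "(\<And>i. i \<in> A \<Longrightarrow> Q (h i)) \<Longrightarrow> Q (sum h A)" for h and A :: "('a \<Rightarrow>\<^sub>0 nat) set"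
    by (induction A rule: infinite_finite_induct) (auto simp: Q0 intro: Qa)
  have Qp: "(\<And>i. i \<in> A \<Longrightarrow> Q (h i)) \<Longrightarrow> Q (prod h A)" for h and A :: "'a set"
    by (induction A rule: infinite_finite_induct) (auto simp: Q1 intro: Qm)
  have Qpow: "Q g \<Longrightarrow> Q (g ^ n)" for g and n :: nat
    by (induction n) (auto simp: Q1 intro: Qm)
  have "Q (\<Sum>k\<in>Poly_Mapping.keys f. Poly_Mapping.single k (Poly_Mapping.lookup f k))"
  proof (rule Qs)
    fix k assume k: "k \<in> Poly_Mapping.keys f"
    have "Q (mon mvar k)"
      unfolding mon_def
    proof (rule Qp)
      fix v assume "v \<in> Poly_Mapping.keys k"
      then have "v \<in> V" using f k by (auto simp: pol_ring_def)
      then show "Q (mvar v ^ Poly_Mapping.lookup k v)" by (intro Qpow Qv)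
    qed
    then show "Q (Poly_Mapping.single k (Poly_Mapping.lookup f k))"
      unfolding single_eq_mon by (intro Qm Qc)
  qed
  then show ?thesis using mpoly_sum_single[of f] by (simp add: Q_def)
qed


section \<open>Polynomials inside formal power series\<close>

definition cst :: "'r \<Rightarrow> ('v, 'r::comm_ring_1) mfps" where
  "cst a = of_poly (mconst a)"

lemmas mfps_defs = zero_mfps_def one_mfps_def plus_mfps_def minus_mfps_def uminus_mfps_def times_mfps_def

lemma coeff_simps [simp]:
  "mfps.coeff 0 k = 0" "mfps.coeff 1 k = (if k = 0 then 1 else 0)"
  "mfps.coeff (f + g) k = mfps.coeff f k + mfps.coeff g k"
  "mfps.coeff (f - g) k = mfps.coeff f k - mfps.coeff g k"
  "mfps.coeff (- f) k = - mfps.coeff f k"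
  by (simp_all add: mfps_defs)

lemma coeff_sum: "mfps.coeff (sum f A) k = (\<Sum>i\<in>A. mfps.coeff (f i) k)"
  by (induction A rule: infinite_finite_induct) simp_all

lemma coeff_of_poly [simp]: "mfps.coeff (of_poly f) k = Poly_Mapping.lookup f k"
  by (simp add: of_poly_def)

lemma fvar_of_poly: "fvar = (\<lambda>v. of_poly (mvar v))"
  by (simp add: fvar_def of_poly_def fun_eq_iff)

lemma coeff_mult: "mfps.coeff (f * g) k = (\<Sum>(a, b)\<in>{(a, b). a + b = k}. mfps.coeff f a * mfps.coeff g b)"
  by (simp add: times_mfps_def)

lemma of_poly_add: "of_poly (f + g) = of_poly f + of_poly g"
  by (rule mfps_eqI) (simp add: lookup_add)

lemma of_poly_sum: "of_poly (sum f A) = (\<Sum>i\<in>A. of_poly (f i))"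
  by (rule mfps_eqI) (simp add: lookup_sum coeff_sum)

lemma coeff_cst_mult [simp]: "mfps.coeff (cst a * f) k = a * mfps.coeff f k"
proof -
  have "mfps.coeff (cst a * f) k = (\<Sum>x\<in>{(a, b). a + b = k}. if x = (0, k) then a * mfps.coeff f k else 0)"
    unfolding coeff_mult cst_def
    by (rule sum.cong) (auto simp: mconst_def lookup_single when_def split: if_splits)
  then show ?thesis by (simp add: sum.delta'[OF finite_antidiagonal] sum.delta[OF finite_antidiagonal])
qed

lemma of_poly_mult_single:
  "of_poly (Poly_Mapping.single k c) * of_poly (Poly_Mapping.single l d) =
    of_poly (Poly_Mapping.single (k + l) (c * d))"
proof (rule mfps_eqI)
  fix j
  have "(\<Sum>(a, b)\<in>{(a, b). a + b = j}. Poly_Mapping.lookup (Poly_Mapping.single k c) a * Poly_Mapping.lookup (Poly_Mapping.single l d) b)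
      = (\<Sum>x\<in>{(a, b). a + b = j}. if x = (k, l) then c * d else 0)"
    by (rule sum.cong) (auto simp: lookup_single when_def split: if_splits)
  then show "mfps.coeff (of_poly (Poly_Mapping.single k c) * of_poly (Poly_Mapping.single l d)) j =
      mfps.coeff (of_poly (Poly_Mapping.single (k + l) (c * d))) j"
    by (simp add: coeff_mult lookup_single when_def sum.delta'[OF finite_antidiagonal] sum.delta[OF finite_antidiagonal])
qed

lemma of_poly_mult: "of_poly (f * g) = of_poly f * of_poly g"
proof -
  let ?s = "\<lambda>f k. Poly_Mapping.single k (Poly_Mapping.lookup f k)"
  have "f * g = (\<Sum>k\<in>Poly_Mapping.keys f. ?s f k) * (\<Sum>l\<in>Poly_Mapping.keys g. ?s g l)"
    using mpoly_sum_single[of f] mpoly_sum_single[of g] by simp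
  then have "of_poly (f * g) = (\<Sum>k\<in>Poly_Mapping.keys f. \<Sum>l\<in>Poly_Mapping.keys g. of_poly (?s f k * ?s g l))"
    by (simp add: sum_product of_poly_sum)
  also have "\<dots> = of_poly (\<Sum>k\<in>Poly_Mapping.keys f. ?s f k) * of_poly (\<Sum>k\<in>Poly_Mapping.keys g. ?s g k)"
    by (simp add: mult_single of_poly_sum sum_product of_poly_mult_single)
  finally show ?thesis
    using mpoly_sum_single[of f] mpoly_sum_single[of g] by simp
qed

lemma rhom_of_poly [simp]: "rhom (of_poly :: ('a, 'b::comm_ring_1) mpoly \<Rightarrow> _)"
proof -
  have "of_poly 1 = (1 :: ('a, 'b) mfps)"
    by (rule mfps_eqI) (simp add: lookup_one when_def)
  then show ?thesis by (simp add: rhom_def of_poly_add of_poly_mult)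
qed

lemma rhom_cst [simp]: "rhom cst"
  unfolding cst_def by (rule rhom_comp) simp_all

lemma coeff_qpow_mult [simp]: "mfps.coeff (of_nat n * f) k = of_nat n * mfps.coeff f k"
  using coeff_cst_mult[of "of_nat n" f k] by (simp add: rhomD(8)[OF rhom_cst])

lemma coeff_qpow_mult' [simp]: "mfps.coeff (of_nat n ^ m * f) k = of_nat n ^ m * mfps.coeff f k"
  using coeff_qpow_mult[of "n ^ m" f k] by simp

lemma rps_ring_simps [simp]: "\<one>\<^bsub>rps_ring p V\<^esub> = 1" "\<zero>\<^bsub>rps_ring p V\<^esub> = 0"
   "x \<otimes>\<^bsub>rps_ring p V\<^esub> y = x * y" "x \<oplus>\<^bsub>rps_ring p V\<^esub> y = x + y"
  by (auto simp: rps_ring_def)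

context pring
begin

abbreviation rs :: "'v set \<Rightarrow> ('v, 'r) mfps set" where
  "rs V \<equiv> carrier (rps_ring p V)"

section \<open>Sums of families that tend to zero\<close>

definition tends_zero :: "('i \<Rightarrow> 'r) \<Rightarrow> bool" where
  "tends_zero c \<longleftrightarrow> (\<forall>m. finite {i. \<not> q ^ m dvd c i})"

lemma tends_zeroD: "tends_zero c \<Longrightarrow> finite {i. \<not> q ^ m dvd c i}"
  by (simp add: tends_zero_def)

lemma psum_eqI:
  assumes "\<And>m. q ^ m dvd s - (\<Sum>i | \<not> q ^ m dvd c i. c i)"
  shows "psum p c = s"
  unfolding psum_def
proof (rule the_equality)
  fix t assume t: "\<forall>m. q ^ m dvd t - (\<Sum>i | \<not> q ^ m dvd c i. c i)"
  have "q ^ m dvd t - s" for m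
    using dvd_diff[OF spec[OF t, of m] assms[of m]] by simp
  then show "t = s" by (rule eq_by_approx)
qed (use assms in blast)

lemma psum_spec:
  assumes "tends_zero c"
  shows "q ^ m dvd psum p c - (\<Sum>i | \<not> q ^ m dvd c i. c i)"
proof -
  have "\<exists>s. \<forall>m. q ^ m dvd s - (\<Sum>i | \<not> q ^ m dvd c i. c i)"
  proof (rule complete)
    fix n
    have "(\<Sum>i | \<not> q ^ Suc n dvd c i. c i) - (\<Sum>i | \<not> q ^ n dvd c i. c i) =
        sum c ({i. \<not> q ^ Suc n dvd c i} - {i. \<not> q ^ n dvd c i})"
      by (rule sum_diff[OF tends_zeroD[OF assms], symmetric]) (auto intro: power_le_dvd)
    also have "q ^ n dvd \<dots>"
      by (rule dvd_sum) auto
    finally show "q ^ n dvd (\<Sum>i | \<not> q ^ Suc n dvd c i. c i) - (\<Sum>i | \<not> q ^ n dvd c i. c i)" .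
  qed
  then obtain s where s: "\<And>m. q ^ m dvd s - (\<Sum>i | \<not> q ^ m dvd c i. c i)" by blast
  then show ?thesis using psum_eqI[OF s] by simp
qed

text \<open>Any finite set containing the terms not divisible by \<open>q^m\<close> serves, so that
  the sums of several families can be compared over a common index set.\<close>

lemma psum_approx:
  assumes "tends_zero c" "finite T" "{i. \<not> q ^ m dvd c i} \<subseteq> T"
  shows "q ^ m dvd psum p c - sum c T"
proof -
  have "sum c T - (\<Sum>i | \<not> q ^ m dvd c i. c i) = sum c (T - {i. \<not> q ^ m dvd c i})"
    using assms by (simp add: sum_diff)
  also have "q ^ m dvd \<dots>"
    by (rule dvd_sum) auto
  finally have "q ^ m dvd (psum p c - (\<Sum>i | \<not> q ^ m dvd c i. c i)) - (sum c T - (\<Sum>i | \<not> q ^ m dvd c i. c i))"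
    by (rule dvd_diff[OF psum_spec[OF assms(1), of m]])
  then show ?thesis by simp
qed

lemma psum_eqI':
  assumes "tends_zero c" "\<And>m. \<exists>T. finite T \<and> {i. \<not> q ^ m dvd c i} \<subseteq> T \<and> q ^ m dvd s - sum c T"
  shows "psum p c = s"
proof (rule eq_by_approx)
  fix m
  from assms(2)[of m]
  obtain T where T: "finite T" "{i. \<not> q ^ m dvd c i} \<subseteq> T" "q ^ m dvd s - sum c T"
    by (elim exE conjE)
  show "q ^ m dvd psum p c - s"
    using dvd_diff[OF psum_approx[OF assms(1) T(1,2)] T(3)] by simp
qed

lemma tends_zero_add:
  assumes "tends_zero c" "tends_zero d"
  shows "tends_zero (\<lambda>i. c i + d i)"
  unfolding tends_zero_def
proof
  fix m
  show "finite {i. \<not> q ^ m dvd c i + d i}"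
    by (rule finite_subset[OF _ finite_UnI[OF tends_zeroD[OF assms(1), of m] tends_zeroD[OF assms(2), of m]]])
      (use dvd_add in blast)
qed

lemma tends_zero_dvd:
  assumes "tends_zero c" "\<And>i m. q ^ m dvd c i \<Longrightarrow> q ^ m dvd d i"
  shows "tends_zero d"
  unfolding tends_zero_def
proof
  fix m
  show "finite {i. \<not> q ^ m dvd d i}"
    by (rule finite_subset[OF _ tends_zeroD[OF assms(1), of m]]) (use assms(2) in blast)
qed

lemma psum_add:
  assumes "tends_zero c" "tends_zero d"
  shows "psum p (\<lambda>i. c i + d i) = psum p c + psum p d"
proof (rule psum_eqI'[OF tends_zero_add[OF assms]])
  fix m
  let ?T = "{i. \<not> q ^ m dvd c i} \<union> {i. \<not> q ^ m dvd d i}"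
  have T: "finite ?T" using assms by (simp add: tends_zeroD)
  have "q ^ m dvd (psum p c - sum c ?T) + (psum p d - sum d ?T)"
    by (intro dvd_add psum_approx assms T) auto
  also have "\<dots> = psum p c + psum p d - (\<Sum>i\<in>?T. c i + d i)"
    by (simp add: sum.distrib)
  finally show "\<exists>T. finite T \<and> {i. \<not> q ^ m dvd c i + d i} \<subseteq> T \<and> q ^ m dvd psum p c + psum p d - (\<Sum>i\<in>T. c i + d i)"
    using T by (intro exI[of _ ?T]) auto
qed

lemma psum_cmult:
  assumes "tends_zero c"
  shows "psum p (\<lambda>i. a * c i) = a * psum p c"
proof (rule psum_eqI')
  show "tends_zero (\<lambda>i. a * c i)" using assms by (rule tends_zero_dvd) simp
  fix m
  let ?T = "{i. \<not> q ^ m dvd c i}"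
  have "q ^ m dvd a * (psum p c - sum c ?T)"
    by (intro dvd_mult psum_approx assms tends_zeroD) auto
  also have "\<dots> = a * psum p c - (\<Sum>i\<in>?T. a * c i)"
    by (simp add: sum_distrib_left algebra_simps)
  finally show "\<exists>T. finite T \<and> {i. \<not> q ^ m dvd a * c i} \<subseteq> T \<and> q ^ m dvd a * psum p c - (\<Sum>i\<in>T. a * c i)"
    using tends_zeroD[OF assms, of m] by (intro exI[of _ ?T]) auto
qed

lemma psum_finite:
  fixes c :: "'i \<Rightarrow> 'r"
  assumes "finite S" "\<And>i. i \<notin> S \<Longrightarrow> c i = 0"
  shows "psum p c = sum c S"
proof (rule psum_eqI)
  fix m
  let ?D = "{i. \<not> q ^ m dvd c i}"
  have sub: "?D \<subseteq> S"
  proof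
    fix i assume "i \<in> ?D"
    then have "c i \<noteq> 0" by auto
    then show "i \<in> S" using assms(2)[of i] by blast
  qed
  have "sum c S - sum c ?D = sum c (S - ?D)" by (rule sum_diff[OF assms(1) sub, symmetric])
  also have "q ^ m dvd \<dots>" by (rule dvd_sum) auto
  finally show "q ^ m dvd sum c S - sum c ?D" .
qed

section \<open>Restricted power series\<close>

lemma feval_mon: "feval p b f = psum p (\<lambda>k. mfps.coeff f k * mon b k)"
  by (simp add: feval_def mon_def)

lemma fsubst_mon: "fsubst p \<sigma> F f = Mfps (\<lambda>l. psum p (\<lambda>k. \<sigma> (mfps.coeff f k) * mfps.coeff (mon F k) l))"
  by (simp add: fsubst_def mon_def)

lemma rs_iff: "f \<in> rs V \<longleftrightarrow> (\<forall>k. mfps.coeff f k \<noteq> 0 \<longrightarrow> Poly_Mapping.keys k \<subseteq> V) \<and> tends_zero (mfps.coeff f)"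
  by (simp add: rps_ring_def tends_zero_def)

lemma rs_tends_zero: "f \<in> rs V \<Longrightarrow> tends_zero (mfps.coeff f)" and rs_keys: "f \<in> rs V \<Longrightarrow> mfps.coeff f k \<noteq> 0 \<Longrightarrow> Poly_Mapping.keys k \<subseteq> V"
  by (auto simp: rs_iff)

lemma rs_mono: "f \<in> rs V \<Longrightarrow> V \<subseteq> V' \<Longrightarrow> f \<in> rs V'"
  by (auto simp: rs_iff)

lemma rs_add: "f \<in> rs V \<Longrightarrow> g \<in> rs V \<Longrightarrow> f + g \<in> rs V"
  and rs_mult: "f \<in> rs V \<Longrightarrow> g \<in> rs V \<Longrightarrow> f * g \<in> rs V"
  and rs_0: "0 \<in> rs V" and rs_1: "1 \<in> rs V"
proof -
  interpret cring "rps_ring p V :: ('a, 'r) mfps ring" by (rule cring_rps_ring)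
  show "f \<in> rs V \<Longrightarrow> g \<in> rs V \<Longrightarrow> f + g \<in> rs V" "f \<in> rs V \<Longrightarrow> g \<in> rs V \<Longrightarrow> f * g \<in> rs V"
    "0 \<in> rs V" "1 \<in> rs V"
    using a_closed[of f g] m_closed[of f g] zero_closed one_closed by simp_all
qed

lemma tends_zero_finite_support: "finite S \<Longrightarrow> (\<And>i. i \<notin> S \<Longrightarrow> c i = 0) \<Longrightarrow> tends_zero c"
  unfolding tends_zero_def by (intro allI, rule finite_subset[of _ S]) (metis (mono_tags, lifting) dvd_0_right mem_Collect_eq subsetI, assumption)

lemma rs_of_poly: "f \<in> carrier (pol_ring V) \<Longrightarrow> of_poly f \<in> rs V"
  by (auto simp: rs_iff pol_ring_def in_keys_iff intro!: tends_zero_finite_support[of "Poly_Mapping.keys f"])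

lemma rs_cst: "cst c \<in> rs V"
  unfolding cst_def by (rule rs_of_poly) simp

lemma rs_of_nat: "of_nat n \<in> rs V"
  using rs_cst[of "of_nat n" V] by (simp add: rhomD(8)[OF rhom_cst])

lemma rs_fvar: "v \<in> V \<Longrightarrow> fvar v \<in> rs V"
  by (simp add: fvar_of_poly rs_of_poly)

lemma rs_uminus: "f \<in> rs V \<Longrightarrow> - f \<in> rs V"
  using rs_mult[OF rs_cst[of "- 1"], of f V] by (simp add: rhomD[OF rhom_cst])

lemma rs_diff: "f \<in> rs V \<Longrightarrow> g \<in> rs V \<Longrightarrow> f - g \<in> rs V"
  using rs_add[of f V "- g"] rs_uminus[of g V] by simp

lemma rs_power: "f \<in> rs V \<Longrightarrow> f ^ n \<in> rs V"
  by (induction n) (simp_all add: rs_1 rs_mult)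

lemma rs_sum: "(\<And>i. i \<in> A \<Longrightarrow> f i \<in> rs V) \<Longrightarrow> sum f A \<in> rs V"
  by (induction A rule: infinite_finite_induct) (simp_all add: rs_0 rs_add)

lemmas rs_intros = rs_add rs_mult rs_0 rs_1 rs_of_poly rs_cst rs_of_nat rs_fvar rs_uminus rs_diff rs_power rs_sum

text \<open>The terms not divisible by \<open>q^m\<close> are finitely many and form P. Through this
  splitting, statements on restricted series reduce to polynomials modulo \<open>q^m\<close> for
  arbitrary m.\<close>

lemma rs_split:
  assumes f: "f \<in> rs V"
  obtains P g where "P \<in> carrier (pol_ring V)" "g \<in> rs V" "f = of_poly P + of_nat p ^ m * g"
proof -
  let ?c = "mfps.coeff f"
  define P where "P = Abs_poly_mapping (\<lambda>k. if q ^ m dvd ?c k then 0 else ?c k)"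
  define g where "g = Mfps (\<lambda>k. if q ^ m dvd ?c k then SOME y. ?c k = q ^ m * y else 0)"
  have "finite {k. (if q ^ m dvd ?c k then 0 else ?c k) \<noteq> 0}"
    by (rule finite_subset[OF _ tends_zeroD[OF rs_tends_zero[OF f], of m]]) auto
  then have P: "Poly_Mapping.lookup P k = (if q ^ m dvd ?c k then 0 else ?c k)" for k
    by (simp add: P_def Abs_poly_mapping_inverse)
  have g1: "?c k = q ^ m * mfps.coeff g k" if "q ^ m dvd ?c k" for k
    using that someI_ex[of "\<lambda>y. ?c k = q ^ m * y"] by (auto simp: g_def dvd_def)
  have g2: "mfps.coeff g k = 0" if "\<not> q ^ m dvd ?c k" for k
    using that by (simp add: g_def)
  have eq: "f = of_poly P + of_nat p ^ m * g"
  proof (rule mfps_eqI)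
    fix k show "?c k = mfps.coeff (of_poly P + of_nat p ^ m * g) k"
      using g1[of k] g2[of k] P[of k] by (cases "q ^ m dvd ?c k") simp_all
  qed
  have "P \<in> carrier (pol_ring V)"
    unfolding pol_ring_def
  proof (simp, intro ballI)
    fix k assume "k \<in> Poly_Mapping.keys P"
    then have "?c k \<noteq> 0" by (auto simp: in_keys_iff P split: if_splits)
    then show "Poly_Mapping.keys k \<subseteq> V" by (rule rs_keys[OF f])
  qed
  moreover have "g \<in> rs V"
    unfolding rs_iff
  proof
    show "\<forall>k. mfps.coeff g k \<noteq> 0 \<longrightarrow> Poly_Mapping.keys k \<subseteq> V"
    proof (intro allI impI)
      fix k assume k: "mfps.coeff g k \<noteq> 0"
      then have "q ^ m dvd ?c k" using g2[of k] by blast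
      then have "?c k \<noteq> 0" using g1[of k] k by simp
      then show "Poly_Mapping.keys k \<subseteq> V" by (rule rs_keys[OF f])
    qed
    show "tends_zero (mfps.coeff g)"
      unfolding tends_zero_def
    proof
      fix j
      have "{k. \<not> q ^ j dvd mfps.coeff g k} \<subseteq> {k. \<not> q ^ (m + j) dvd ?c k}"
      proof (intro subsetI CollectI notI)
        fix k assume k: "k \<in> {k. \<not> q ^ j dvd mfps.coeff g k}" and d: "q ^ (m + j) dvd ?c k"
        then have "q ^ m dvd ?c k" by (metis dvd_trans power_add dvd_triv_left)
        then show False using k d g1[of k] by (simp add: q_power_dvd_cancel)
      qed
      then show "finite {k. \<not> q ^ j dvd mfps.coeff g k}"
        by (rule finite_subset) (rule tends_zeroD[OF rs_tends_zero[OF f]])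
    qed
  qed
  ultimately show thesis using eq that by blast
qed

lemma tends_zero_mult_right: "tends_zero c \<Longrightarrow> tends_zero (\<lambda>i. c i * d i)"
  by (erule tends_zero_dvd) simp

lemma rhom_q_dvd: "rhom \<sigma> \<Longrightarrow> q ^ m dvd x \<Longrightarrow> q ^ m dvd (\<sigma> x :: 'r)"
  by (auto simp: dvd_def rhomD)

lemma tends_zero_hom: "rhom \<sigma> \<Longrightarrow> tends_zero c \<Longrightarrow> tends_zero (\<lambda>i. \<sigma> (c i))"
  by (erule tends_zero_dvd) (rule rhom_q_dvd)

lemma feval_add: "f \<in> rs V \<Longrightarrow> g \<in> rs V \<Longrightarrow> feval p b (f + g) = feval p b f + feval p b g"
  by (simp add: feval_mon distrib_right psum_add tends_zero_mult_right rs_tends_zero)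

lemma feval_cst_mult: "f \<in> rs V \<Longrightarrow> feval p b (cst a * f) = a * feval p b f"
  by (simp add: feval_mon mult.assoc psum_cmult[OF tends_zero_mult_right] rs_tends_zero)

lemma feval_q_mult: "f \<in> rs V \<Longrightarrow> feval p b (of_nat p ^ m * f) = q ^ m * feval p b f"
  using feval_cst_mult[of f V b "q ^ m"] by (simp add: rhomD[OF rhom_cst])

lemma feval_of_poly: "feval p b (of_poly f) = meval id b (f :: ('v, 'r) mpoly)"
  unfolding feval_mon meval_mon
  by (subst psum_finite[of "Poly_Mapping.keys f"]) (simp_all add: in_keys_iff)

lemma feval_cst [simp]: "feval p b (cst c) = (c :: 'r)"
  by (simp add: cst_def feval_of_poly)

lemma feval_0 [simp]: "feval p b 0 = (0 :: 'r)" and feval_1 [simp]: "feval p b 1 = (1 :: 'r)"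
  using feval_of_poly[of b 0] feval_cst[of b 1] by (simp_all add: rhomD[OF rhom_of_poly] rhomD[OF rhom_cst])

lemma feval_fvar [simp]: "feval p b (fvar v) = (b v :: 'r)"
  by (simp add: fvar_of_poly feval_of_poly)

text \<open>No double series is rearranged: modulo \<open>q^m\<close> both factors are polynomials,
  on which evaluation is multiplicative, and m is arbitrary.\<close>

lemma feval_mult:
  assumes f: "f \<in> rs V" and g: "g \<in> rs V"
  shows "feval p b (f * g) = feval p b f * feval p b g"
proof (rule eq_by_approx)
  fix m
  obtain P f' where P: "P \<in> carrier (pol_ring V)" "f' \<in> rs V" "f = of_poly P + of_nat p ^ m * f'"
    using rs_split[OF f] by blast
  obtain Q g' where Q: "Q \<in> carrier (pol_ring V)" "g' \<in> rs V" "g = of_poly Q + of_nat p ^ m * g'"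
    using rs_split[OF g] by blast
  define h where "h = of_poly P * g' + f' * of_poly Q + of_nat p ^ m * (f' * g')"
  have h: "h \<in> rs V" unfolding h_def using P Q by (intro rs_intros) auto
  have fg: "f * g = of_poly (P * Q) + of_nat p ^ m * h"
    unfolding P(3) Q(3) h_def by (simp add: algebra_simps rhomD[OF rhom_of_poly])
  have R: "of_poly (P * Q) \<in> rs V" "of_nat p ^ m * h \<in> rs V" "of_poly P \<in> rs V" "of_poly Q \<in> rs V"
     "of_nat p ^ m * f' \<in> rs V" "of_nat p ^ m * g' \<in> rs V"
    using P Q h by (auto intro!: rs_intros pol_closed)
  have "feval p b (f * g) = meval id b P * meval id b Q + q ^ m * feval p b h"
    unfolding fg using R h by (simp add: feval_add[of _ V] feval_q_mult[of _ V] feval_of_poly meval_mult)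
  moreover have "feval p b f = meval id b P + q ^ m * feval p b f'"
    unfolding P(3) using R P by (simp add: feval_add[of _ V] feval_q_mult[of _ V] feval_of_poly)
  moreover have "feval p b g = meval id b Q + q ^ m * feval p b g'"
    unfolding Q(3) using R Q by (simp add: feval_add[of _ V] feval_q_mult[of _ V] feval_of_poly)
  ultimately have "feval p b (f * g) - feval p b f * feval p b g = q ^ m *
     (feval p b h - meval id b P * feval p b g' - feval p b f' * meval id b Q - q ^ m * (feval p b f' * feval p b g'))"
    by (simp add: algebra_simps)
  then show "q ^ m dvd feval p b (f * g) - feval p b f * feval p b g" by simp
qed

lemma feval_uminus: "f \<in> rs V \<Longrightarrow> feval p b (- f) = - feval p b f"
  using feval_cst_mult[of f V b "- 1"] by (simp add: rhomD[OF rhom_cst])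

lemma feval_diff: "f \<in> rs V \<Longrightarrow> g \<in> rs V \<Longrightarrow> feval p b (f - g) = feval p b f - feval p b g"
  using feval_add[of f V "- g" b] rs_uminus[of g V] by (simp add: feval_uminus)

lemma feval_sum: "(\<And>i. i \<in> A \<Longrightarrow> f i \<in> rs V) \<Longrightarrow> feval p b (sum f A) = (\<Sum>i\<in>A. feval p b (f i))"
  by (induction A rule: infinite_finite_induct) (simp_all add: feval_add[of _ V] rs_sum)

lemma feval_power: "f \<in> rs V \<Longrightarrow> feval p b (f ^ n) = feval p b f ^ n"
  by (induction n) (simp_all add: feval_mult[of _ V] rs_power)

lemmas meval_id_hom = rhomD[OF rhom_meval[OF rhom_id(1)]]

lemma feval_cong_mod:
  assumes f: "f \<in> rs V" and ab: "\<And>v. v \<in> V \<Longrightarrow> q ^ m dvd a v - b v"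
  shows "q ^ m dvd feval p a f - feval p b f"
proof -
  obtain P g where P: "P \<in> carrier (pol_ring V)" "g \<in> rs V" "f = of_poly P + of_nat p ^ m * g"
    using rs_split[OF f] by blast
  from P(1) have "q ^ m dvd meval id a P - meval id b P"
  proof (induction rule: pol_induct)
    case (add f g)
    have "q ^ m dvd (meval id a f - meval id b f) + (meval id a g - meval id b g)"
      by (rule dvd_add) fact+
    then show ?case unfolding meval_id_hom by (simp add: algebra_simps)
  next
    case (mult f g)
    have "q ^ m dvd (meval id a f - meval id b f) * meval id a g + meval id b f * (meval id a g - meval id b g)"
      by (intro dvd_add dvd_mult dvd_mult2) fact+
    then show ?case unfolding meval_id_hom by (simp add: algebra_simps)
  qed (simp_all add: ab)
  then have "q ^ m dvd (meval id a P - meval id b P) + q ^ m * (feval p a g - feval p b g)" by simp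
  moreover have fa: "feval p a f = meval id a P + q ^ m * feval p a g" for a
    unfolding P(3) using P(1,2)
    by (simp add: feval_add[of _ V] feval_q_mult[of _ V] feval_of_poly rs_intros)
  have "(meval id a P - meval id b P) + q ^ m * (feval p a g - feval p b g) = feval p a f - feval p b f"
    by (simp add: fa algebra_simps)
  ultimately show ?thesis by simp
qed

lemma feval_cong: "f \<in> rs V \<Longrightarrow> (\<And>v. v \<in> V \<Longrightarrow> a v = b v) \<Longrightarrow> feval p a f = feval p b f"
  by (rule eq_by_approx, rule feval_cong_mod) auto

lemma coeff_fsubst: "mfps.coeff (fsubst p \<sigma> F f) l = psum p (\<lambda>k. \<sigma> (mfps.coeff f k) * mfps.coeff (mon F k) l)"
  by (simp add: fsubst_mon)

lemma fsubst_add: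
  "rhom \<sigma> \<Longrightarrow> f \<in> rs V \<Longrightarrow> g \<in> rs V \<Longrightarrow> fsubst p \<sigma> F (f + g) = fsubst p \<sigma> F f + fsubst p \<sigma> F g"
  by (rule mfps_eqI)
    (simp add: coeff_fsubst rhomD distrib_right psum_add tends_zero_mult_right tends_zero_hom rs_tends_zero)

lemma fsubst_q_mult:
  assumes "rhom \<sigma>" "f \<in> rs V"
  shows "fsubst p \<sigma> F (of_nat p ^ m * f) = of_nat p ^ m * fsubst p \<sigma> F f"
  by (rule mfps_eqI)
    (simp add: coeff_fsubst rhomD[OF assms(1)] mult.assoc
      psum_cmult[OF tends_zero_mult_right[OF tends_zero_hom[OF assms(1) rs_tends_zero[OF assms(2)]]]])

lemma fsubst_of_poly:
  fixes \<sigma> :: "'r \<Rightarrow> 'r"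
  assumes "rhom \<sigma>"
  shows "fsubst p \<sigma> F (of_poly P) = meval (\<lambda>c. cst (\<sigma> c)) F P"
proof (rule mfps_eqI)
  fix l
  show "mfps.coeff (fsubst p \<sigma> F (of_poly P)) l = mfps.coeff (meval (\<lambda>c. cst (\<sigma> c)) F P) l"
    unfolding coeff_fsubst meval_mon coeff_sum
    by (subst psum_finite[of "Poly_Mapping.keys P"]) (simp_all add: in_keys_iff rhomD assms)
qed

lemma meval_cst_rs:
  assumes "rhom \<sigma>" "P \<in> carrier (pol_ring V)" "\<And>v. v \<in> V \<Longrightarrow> F v \<in> rs W"
  shows "meval (\<lambda>c. cst (\<sigma> c)) F P \<in> rs W"
  using assms(2)
  by (induction rule: pol_induct)
    (simp_all add: rhom_comp[OF rhom_cst assms(1)] rs_cst assms(3) meval_add meval_mult rs_add rs_mult)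

lemma feval_meval_cst:
  assumes "rhom \<sigma>" "P \<in> carrier (pol_ring V)" "\<And>v. v \<in> V \<Longrightarrow> F v \<in> rs W"
  shows "feval p b (meval (\<lambda>c. cst (\<sigma> c)) F P) = meval \<sigma> (\<lambda>v. feval p b (F v)) P"
  using assms(2)
  by (induction rule: pol_induct)
    (simp_all add: assms(1) rhom_comp[OF rhom_cst assms(1)] meval_add meval_mult feval_add[of _ W] feval_mult[of _ W]
       meval_cst_rs[OF assms(1) _ assms(3)])

lemma fsubst_rs:
  assumes \<sigma>: "rhom \<sigma>" and f: "f \<in> rs V" and F: "\<And>v. v \<in> V \<Longrightarrow> F v \<in> rs W"
  shows "fsubst p \<sigma> F f \<in> rs W"
  unfolding rs_iff
proof
  show "\<forall>l. mfps.coeff (fsubst p \<sigma> F f) l \<noteq> 0 \<longrightarrow> Poly_Mapping.keys l \<subseteq> W"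
  proof (intro allI impI)
    fix l assume l: "mfps.coeff (fsubst p \<sigma> F f) l \<noteq> 0"
    have "\<exists>k. \<sigma> (mfps.coeff f k) * mfps.coeff (mon F k) l \<noteq> 0"
    proof (rule ccontr)
      assume "\<nexists>k. \<sigma> (mfps.coeff f k) * mfps.coeff (mon F k) l \<noteq> 0"
      then have "psum p (\<lambda>k. \<sigma> (mfps.coeff f k) * mfps.coeff (mon F k) l) = 0"
        by (subst psum_finite[of "{}"]) auto
      then show False using l by (simp add: coeff_fsubst)
    qed
    then obtain k where k: "\<sigma> (mfps.coeff f k) \<noteq> 0" "mfps.coeff (mon F k) l \<noteq> 0" by auto
    then have "mfps.coeff f k \<noteq> 0" using rhomD(4)[OF \<sigma>] by metis
    then have "Poly_Mapping.keys k \<subseteq> V" by (rule rs_keys[OF f])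
    then have "Poly_Mapping.single k 1 \<in> carrier (pol_ring V)" by (auto simp: pol_ring_def)
    then have "meval (\<lambda>c. cst (id c)) F (Poly_Mapping.single k 1) \<in> rs W"
      by (rule meval_cst_rs[OF rhom_id(1) _ F])
    then have "mon F k \<in> rs W" by (simp add: meval_single rhomD[OF rhom_cst])
    then show "Poly_Mapping.keys l \<subseteq> W" using rs_keys k(2) by blast
  qed
  show "tends_zero (mfps.coeff (fsubst p \<sigma> F f))"
    unfolding tends_zero_def
  proof
    fix m
    obtain P g where P: "P \<in> carrier (pol_ring V)" "g \<in> rs V" "f = of_poly P + of_nat p ^ m * g"
      using rs_split[OF f] by blast
    let ?h = "meval (\<lambda>c. cst (\<sigma> c)) F P"
    have h: "?h \<in> rs W" by (rule meval_cst_rs[OF \<sigma> P(1) F])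
    have "fsubst p \<sigma> F f = ?h + of_nat p ^ m * fsubst p \<sigma> F g"
      unfolding P(3) using P(1,2)
      by (simp add: fsubst_add[of _ _ V] \<sigma> rs_intros fsubst_q_mult[of _ _ V] fsubst_of_poly)
    then have "q ^ m dvd mfps.coeff (fsubst p \<sigma> F f) l \<longleftrightarrow> q ^ m dvd mfps.coeff ?h l" for l
      by (simp add: dvd_add_left_iff)
    then show "finite {l. \<not> q ^ m dvd mfps.coeff (fsubst p \<sigma> F f) l}"
      using tends_zeroD[OF rs_tends_zero[OF h], of m] by simp
  qed
qed

text \<open>For \<sigma> = id this is the value of a composition. For \<sigma> = \<phi> only the
  coefficients of f are twisted, so the point has to be moved back by a right inverse \<tau> before
  \<sigma> can be applied to the whole value.\<close>

lemma feval_fsubst: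
  assumes \<sigma>: "rhom \<sigma>" and f: "f \<in> rs V" and F: "\<And>v. v \<in> V \<Longrightarrow> F v \<in> rs W"
    and \<tau>: "\<And>x. \<sigma> (\<tau> x) = x"
  shows "feval p b (fsubst p \<sigma> F f) = \<sigma> (feval p (\<lambda>v. \<tau> (feval p b (F v))) f)"
proof (rule eq_by_approx)
  fix m
  let ?b = "\<lambda>v. \<tau> (feval p b (F v))"
  obtain P g where P: "P \<in> carrier (pol_ring V)" "g \<in> rs V" "f = of_poly P + of_nat p ^ m * g"
    using rs_split[OF f] by blast
  have "fsubst p \<sigma> F f = meval (\<lambda>c. cst (\<sigma> c)) F P + of_nat p ^ m * fsubst p \<sigma> F g"
    unfolding P(3) using P(1,2)
    by (simp add: fsubst_add[of _ _ V] \<sigma> rs_intros fsubst_q_mult[of _ _ V] fsubst_of_poly)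
  then have "feval p b (fsubst p \<sigma> F f) = meval \<sigma> (\<lambda>v. feval p b (F v)) P + q ^ m * feval p b (fsubst p \<sigma> F g)"
    using fsubst_rs[OF \<sigma> P(2) F] meval_cst_rs[OF \<sigma> P(1) F] feval_meval_cst[OF \<sigma> P(1) F]
    by (simp add: feval_add[of _ W] feval_q_mult[of _ W] rs_intros)
  moreover have "\<sigma> (feval p ?b f) = meval \<sigma> (\<lambda>v. feval p b (F v)) P + q ^ m * \<sigma> (feval p ?b g)"
    unfolding P(3) using P(1,2) meval_hom[OF \<sigma>, of id ?b P]
    by (simp add: feval_add[of _ V] feval_q_mult[of _ V] rs_intros feval_of_poly rhomD[OF \<sigma>] \<tau>)
  ultimately have "feval p b (fsubst p \<sigma> F f) - \<sigma> (feval p ?b f) =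
      q ^ m * (feval p b (fsubst p \<sigma> F g) - \<sigma> (feval p ?b g))"
    by (simp add: algebra_simps)
  then show "q ^ m dvd feval p b (fsubst p \<sigma> F f) - \<sigma> (feval p ?b f)" by simp
qed

section \<open>Series are controlled by their values\<close>

text \<open>The bound on the number of roots over the residue field, expressed in R: synthetic
  division splits off the root a modulo p, and at the other points primality of p cancels the factor
  \<open>b - a\<close>.\<close>

lemma univ_dvd_aux:
  "finite A \<Longrightarrow> card A = n \<Longrightarrow> \<forall>a\<in>A. \<forall>b\<in>A. q dvd a - b \<longrightarrow> a = b \<Longrightarrow> Polynomial.degree f < n \<Longrightarrow>
    \<forall>a\<in>A. q dvd poly f a \<Longrightarrow> q dvd Polynomial.coeff f i"
proof (induction n arbitrary: A f i)
  case (Suc n)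
  obtain a A' where A: "A = insert a A'" "a \<notin> A'" "card A' = n"
    using Suc.prems(2) by (metis card_Suc_eq)
  have fin: "finite A'" using Suc.prems(1) A(1) by simp
  define g where "g = synthetic_div f a"
  have eq: "f + smult a g = pCons (poly f a) g" unfolding g_def by (rule synthetic_div_correct)
  have fa: "q dvd poly f a" using Suc.prems(5) A by simp
  show ?case
  proof (cases "Polynomial.degree f = 0")
    case True
    then obtain c where "f = [:c:]" by (rule degree_eq_zeroE)
    then show ?thesis using fa by (simp add: coeff_pCons split: nat.split)
  next
    case False
    then have "Polynomial.degree g < n" using Suc.prems(4) by (simp add: g_def degree_synthetic_div)
    moreover have "\<forall>b\<in>A'. q dvd poly g b"
    proof
      fix b assume b: "b \<in> A'"
      have "poly (f + smult a g) b = poly (pCons (poly f a) g) b" by (simp only: eq)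
      then have "(b - a) * poly g b = poly f b - poly f a" by (simp add: algebra_simps)
      moreover have "q dvd poly f b - poly f a" using Suc.prems(5) A b fa by (intro dvd_diff) auto
      moreover have "\<not> q dvd b - a" using Suc.prems(3) A b by auto
      ultimately show "q dvd poly g b" using q_prime by metis
    qed
    moreover have "\<forall>a\<in>A'. \<forall>b\<in>A'. q dvd a - b \<longrightarrow> a = b" using Suc.prems(3) A(1) by simp
    ultimately have IH: "q dvd Polynomial.coeff g j" for j by (intro Suc.IH[of A' g j] fin A(3))
    have "f = pCons (poly f a) g - smult a g" using eq by (simp add: algebra_simps)
    then have "Polynomial.coeff f i = Polynomial.coeff (pCons (poly f a) g) i - a * Polynomial.coeff g i"
      by (metis coeff_diff coeff_smult)
    moreover have "q dvd Polynomial.coeff (pCons (poly f a) g) i"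
      using fa IH by (simp add: coeff_pCons split: nat.split)
    ultimately show ?thesis using IH[of i] by (simp add: dvd_diff)
  qed
qed simp

lemma univ_dvd: "(\<And>t. q dvd poly f t) \<Longrightarrow> q dvd Polynomial.coeff f i"
proof -
  assume f: "\<And>t. q dvd poly f t"
  obtain A where "finite A" "card A = Suc (Polynomial.degree f)" "\<forall>a\<in>A. \<forall>b\<in>A. q dvd a - b \<longrightarrow> a = b"
    using incongruent_set by blast
  then show ?thesis by (rule univ_dvd_aux) (simp_all add: f)
qed

text \<open>Induction on the variables. As a polynomial in the value at v, the sum has as its
  coefficients the partial sums over the fibres \<open>?K j\<close> of equal exponent at v;
  \<open>univ_dvd\<close> makes them divisible by p, and they involve one variable less. Indexing by
  an arbitrary K with exponents \<open>e\<close> gives these partial sums the same shape as the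
  whole.\<close>

lemma multi_dvd:
  fixes e :: "'k \<Rightarrow> 'v \<Rightarrow> nat" and c :: "'k \<Rightarrow> 'r"
  assumes "finite V" "finite K"
    and "\<And>k l. k \<in> K \<Longrightarrow> l \<in> K \<Longrightarrow> (\<And>v. v \<in> V \<Longrightarrow> e k v = e l v) \<Longrightarrow> k = l"
    and "\<And>b. q dvd (\<Sum>k\<in>K. c k * (\<Prod>v\<in>V. b v ^ e k v))"
    and "k \<in> K"
  shows "q dvd c k"
  using assms
proof (induction V arbitrary: K k rule: finite_induct)
  case empty
  have "K = {k}" using empty.prems(2,4) by auto
  then show ?case using empty.prems(3) by simp
next
  case (insert v V)
  let ?K = "\<lambda>j. {k \<in> K. e k v = j}"
  have *: "q dvd (\<Sum>k\<in>?K j. c k * (\<Prod>v\<in>V. b v ^ e k v))" for j and b :: "'v \<Rightarrow> 'r"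
  proof -
    define d where "d j = (\<Sum>k\<in>?K j. c k * (\<Prod>v\<in>V. b v ^ e k v))" for j
    define f where "f = (\<Sum>j\<in>(\<lambda>k. e k v) ` K. Polynomial.monom (d j) j)"
    have "q dvd poly f t" for t
    proof -
      have "poly f t = (\<Sum>j\<in>(\<lambda>k. e k v) ` K. \<Sum>k\<in>?K j. c k * (\<Prod>w\<in>insert v V. (b(v := t)) w ^ e k w))"
        unfolding f_def poly_sum d_def
      proof (rule sum.cong[OF refl])
        fix j
        have "(\<Prod>w\<in>V. (b(v := t)) w ^ e k w) = (\<Prod>w\<in>V. b w ^ e k w)" for k
          using insert.hyps(2) by (intro prod.cong) auto
        then show "poly (Polynomial.monom (\<Sum>k\<in>?K j. c k * (\<Prod>v\<in>V. b v ^ e k v)) j) t =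
            (\<Sum>k\<in>?K j. c k * (\<Prod>w\<in>insert v V. (b(v := t)) w ^ e k w))"
          using insert.hyps by (simp add: poly_monom sum_distrib_left sum_distrib_right mult_ac)
      qed
      also have "\<dots> = (\<Sum>k\<in>K. c k * (\<Prod>w\<in>insert v V. (b(v := t)) w ^ e k w))"
        by (rule sum.image_gen[OF insert.prems(1), symmetric])
      finally show ?thesis using insert.prems(3) by simp
    qed
    then have "q dvd Polynomial.coeff f j" by (rule univ_dvd)
    moreover have "Polynomial.coeff f j = (if j \<in> (\<lambda>k. e k v) ` K then d j else 0)"
      using insert.prems(1) by (simp add: f_def coeff_sum Polynomial.coeff_sum)
    moreover have "d j = 0" if "j \<notin> (\<lambda>k. e k v) ` K"
    proof -
      have "?K j = {}" using that by auto
      then show ?thesis unfolding d_def by (simp only: sum.empty)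
    qed
    ultimately have "q dvd d j" by (cases "j \<in> (\<lambda>k. e k v) ` K") simp_all
    then show ?thesis by (simp add: d_def)
  qed
  show ?case
  proof (rule insert.IH[of "?K (e k v)"])
    show "finite (?K (e k v))" using insert.prems(1) by simp
    show "k \<in> ?K (e k v)" using insert.prems(4) by simp
    fix k' l assume "k' \<in> ?K (e k v)" "l \<in> ?K (e k v)" "\<And>v. v \<in> V \<Longrightarrow> e k' v = e l v"
    then show "k' = l" by (intro insert.prems(2)) auto
  qed (rule *)
qed

lemma mpoly_dvd:
  assumes "\<And>b. q dvd meval id b P"
  shows "q dvd Poly_Mapping.lookup P k"
proof (cases "k \<in> Poly_Mapping.keys P")
  case True
  let ?V = "\<Union> (Poly_Mapping.keys ` Poly_Mapping.keys P)"
  show ?thesis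
  proof (rule multi_dvd[of ?V "Poly_Mapping.keys P" Poly_Mapping.lookup])
    fix b
    have "meval id b P = (\<Sum>k\<in>Poly_Mapping.keys P. Poly_Mapping.lookup P k * (\<Prod>v\<in>?V. b v ^ Poly_Mapping.lookup k v))"
      unfolding meval_mon by (intro sum.cong refl) (simp, subst mon_superset[of ?V], auto)
    then show "q dvd (\<Sum>k\<in>Poly_Mapping.keys P. Poly_Mapping.lookup P k * (\<Prod>v\<in>?V. b v ^ Poly_Mapping.lookup k v))"
      using assms[of b] by simp
  next
    fix k l assume kl: "k \<in> Poly_Mapping.keys P" "l \<in> Poly_Mapping.keys P"
      "\<And>v. v \<in> ?V \<Longrightarrow> Poly_Mapping.lookup k v = Poly_Mapping.lookup l v"
    show "k = l"
    proof (rule poly_mapping_eqI)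
      fix v
      show "Poly_Mapping.lookup k v = Poly_Mapping.lookup l v"
      proof (cases "v \<in> ?V")
        case False
        then have "v \<notin> Poly_Mapping.keys k" "v \<notin> Poly_Mapping.keys l" using kl(1,2) by blast+
        then show ?thesis by (simp add: in_keys_iff)
      qed (rule kl(3))
    qed
  qed (use True in auto)
qed (simp add: in_keys_iff)

text \<open>Density modulo p only: T meets every residue class in the coordinates of V. Higher
  powers of p are reached by dividing the series repeatedly.\<close>

definition dense_pts :: "'v set \<Rightarrow> ('v \<Rightarrow> 'r) set \<Rightarrow> bool" where
  "dense_pts V T \<longleftrightarrow> (\<forall>c. \<exists>t\<in>T. \<forall>v\<in>V. q dvd t v - c v)"

lemma dense_UNIV: "dense_pts V UNIV"
  unfolding dense_pts_def
proof
  fix c :: "'a \<Rightarrow> 'r"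
  show "\<exists>t\<in>UNIV. \<forall>v\<in>V. q dvd t v - c v" by (rule bexI[of _ c]) auto
qed

text \<open>Modulo p the series is a polynomial. Its values are divisible by p on T, hence at all
  points by density, and then its coefficients are divisible by p.\<close>

lemma density_dvd:
  assumes T: "dense_pts V T" and f: "f \<in> rs V" and z: "\<And>t. t \<in> T \<Longrightarrow> q dvd feval p t f"
  obtains g where "g \<in> rs V" "f = of_nat p * g"
proof -
  obtain P g where P: "P \<in> carrier (pol_ring V)" "g \<in> rs V" "f = of_poly P + of_nat p ^ 1 * g"
    using rs_split[OF f] by blast
  have fe: "feval p t f = meval id t P + q * feval p t g" for t
    unfolding P(3) using P(1,2) feval_q_mult[OF P(2), of t 1]
    by (simp add: feval_add[of _ V] rs_intros feval_of_poly)
  have "q dvd meval id c P" for c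
  proof -
    obtain t where t: "t \<in> T" "\<And>v. v \<in> V \<Longrightarrow> q dvd t v - c v" using T unfolding dense_pts_def by blast
    have "q ^ 1 dvd feval p t (of_poly P) - feval p c (of_poly P)"
      by (rule feval_cong_mod[OF rs_of_poly[OF P(1)]]) (use t in simp)
    then have 1: "q dvd meval id t P - meval id c P" by (simp add: feval_of_poly)
    have 2: "q dvd meval id t P" using z[OF t(1)] fe[of t] by (simp add: dvd_add_left_iff)
    show ?thesis using dvd_diff[OF 2 1] by simp
  qed
  then have "q dvd Poly_Mapping.lookup P k" for k by (rule mpoly_dvd)
  then have "\<forall>k. \<exists>y. Poly_Mapping.lookup P k = q * y" by (auto simp: dvd_def)
  then obtain y where y: "\<And>k. Poly_Mapping.lookup P k = q * y k" by metis
  define h where "h = Mfps y"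
  have h: "of_poly P = of_nat p * h" by (rule mfps_eqI) (simp add: h_def y)
  have y0: "y k = 0" if "k \<notin> Poly_Mapping.keys P" for k using y[of k] that by (simp add: in_keys_iff)
  have "h \<in> rs V"
    unfolding rs_iff
  proof
    show "\<forall>k. mfps.coeff h k \<noteq> 0 \<longrightarrow> Poly_Mapping.keys k \<subseteq> V"
      using y0 P(1) by (auto simp: h_def pol_ring_def)
    show "tends_zero (mfps.coeff h)" by (rule tends_zero_finite_support[of "Poly_Mapping.keys P"]) (simp_all add: h_def y0)
  qed
  then have "h + g \<in> rs V" "f = of_nat p * (h + g)" using P(2,3) h by (simp_all add: rs_add distrib_left)
  then show thesis by (rule that)
qed

text \<open>The quotient provided by \<open>density_dvd\<close> vanishes on T as well, R being a
  domain, so p can be divided out arbitrarily often.\<close>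

lemma density:
  assumes T: "dense_pts V T" and f: "f \<in> rs V" and z: "\<And>t. t \<in> T \<Longrightarrow> feval p t f = 0"
  shows "f = 0"
proof -
  have "\<exists>g\<in>rs V. f = of_nat p ^ n * g \<and> (\<forall>t\<in>T. feval p t g = 0)" for n
  proof (induction n)
    case (Suc n)
    then obtain g where g: "g \<in> rs V" "f = of_nat p ^ n * g" "\<forall>t\<in>T. feval p t g = 0" by blast
    obtain h where h: "h \<in> rs V" "g = of_nat p * h" by (rule density_dvd[OF T g(1)]) (use g(3) in simp)
    have "feval p t h = 0" if "t \<in> T" for t
      using g(3) that h feval_q_mult[OF h(1), of t 1] by simp
    then show ?case using g(2) h by (intro bexI[of _ h]) simp_all
  qed (use f z in auto)
  then have "\<exists>g. f = of_nat p ^ n * g" for n by blast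
  then have "q ^ n dvd mfps.coeff f k" for n k by (metis coeff_qpow_mult' dvd_triv_left)
  then show ?thesis by (intro mfps_eqI) (simp add: separated)
qed

section \<open>Functions defined by restricted series\<close>

definition pev :: "('v \<Rightarrow> 'r) \<Rightarrow> ('v, 'r) mpoly \<Rightarrow> 'r" where
  "pev b P = meval id b P"

lemma rhom_pev: "rhom (pev b)"
  unfolding pev_def[abs_def] by (rule rhom_meval[OF rhom_id(1)])

lemmas pev_hom = rhomD[OF rhom_pev]

lemma pev_mconst [simp]: "pev b (mconst c) = c" and pev_mvar [simp]: "pev b (mvar v) = b v"
  by (simp_all add: pev_def)

lemma feval_pev: "feval p b (of_poly f) = pev b f"
  by (simp add: pev_def feval_of_poly)

lemma pev_cong: "f \<in> carrier (pol_ring V) \<Longrightarrow> (\<And>v. v \<in> V \<Longrightarrow> a v = b v) \<Longrightarrow> pev a f = pev b f"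
  unfolding pev_def by (rule meval_cong_pol)

lemma feval_q1: "f \<in> rs V \<Longrightarrow> feval p b (of_nat p * f) = q * feval p b f"
  using feval_q_mult[of f V b 1] by simp

section \<open>The p-derivation of R and the residues of iterated derivatives\<close>

abbreviation \<delta> :: "'r \<Rightarrow> 'r" where "\<delta> \<equiv> pderivation p \<phi>"

lemma q_\<delta>: "q * \<delta> a = \<phi> a - a ^ p"
proof -
  obtain b where b: "q * b = \<phi> a - a ^ p" using \<phi>_frob[of a] by (metis dvdE)
  then have "\<delta> a = b" unfolding pderivation_def by (intro the_equality) (auto simp flip: b)
  then show ?thesis using b by simp
qed

lemma \<phi>_\<delta>: "\<phi> a = a ^ p + q * \<delta> a"
  by (simp add: q_\<delta>)

lemma \<delta>_eqI: "q * b = \<phi> a - a ^ p \<Longrightarrow> \<delta> a = b"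
  using q_\<delta>[of a] by (metis mult_left_cancel q_nz)

lemma \<delta>_0 [simp]: "\<delta> 0 = 0" and \<delta>_1 [simp]: "\<delta> 1 = 0"
  using p_pos by (auto intro!: \<delta>_eqI)

lemma \<delta>_pow_0 [simp]: "(\<delta> ^^ i) 0 = 0"
  by (induction i) simp_all

text \<open>In the factorization of \<open>x^p - y^p\<close> by \<open>x - y\<close>, each of the p
  summands of the cofactor is congruent to \<open>y^(p-1)\<close> modulo p, so the cofactor
  contributes one more factor p.\<close>

lemma power_p_cong:
  fixes x y :: 'r
  assumes "q ^ Suc k dvd x - y"
  shows "q ^ Suc (Suc k) dvd x ^ p - y ^ p"
proof -
  have xy: "q dvd x - y" using assms by (metis dvd_trans dvd_triv_left power_Suc)
  have "q dvd y ^ (p - Suc i) * x ^ i - y ^ (p - 1)" if "i < p" for i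
  proof -
    have "x ^ i - y ^ i = (x - y) * (\<Sum>j<i. y ^ (i - Suc j) * x ^ j)" by (rule power_diff_sumr2)
    then have "q dvd y ^ (p - Suc i) * (x ^ i - y ^ i)" using xy by simp
    moreover have "y ^ (p - Suc i) * y ^ i = y ^ (p - 1)" using that by (simp flip: power_add)
    ultimately show ?thesis by (simp add: right_diff_distrib)
  qed
  then have "q dvd (\<Sum>i<p. y ^ (p - Suc i) * x ^ i - y ^ (p - 1))" by (intro dvd_sum) simp
  then have "q dvd (\<Sum>i<p. y ^ (p - Suc i) * x ^ i)" by (simp add: sum_subtractf dvd_diff_left_iff)
  then have "q ^ Suc k * q dvd (x - y) * (\<Sum>i<p. y ^ (p - Suc i) * x ^ i)" using assms by (rule mult_dvd_mono[rotated])
  then show ?thesis by (simp add: power_diff_sumr2 mult_ac)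
qed

text \<open>The equation \<open>\<phi> a = a^p + q * y\<close> is solved by iterating
  \<open>\<lambda>x. \<psi> (x^p + q * y)\<close> from c, a contraction by
  \<open>power_p_cong\<close>. Already the first step preserves the residue, since \<phi> is the
  p-th power modulo p.\<close>

lemma \<delta>_surj_residue: "\<exists>a. q dvd a - c \<and> \<delta> a = y"
proof -
  define a where "a n = ((\<lambda>x. \<psi> (x ^ p + q * y)) ^^ n) c" for n
  have aS: "\<phi> (a (Suc n)) = a n ^ p + q * y" for n by (simp add: a_def)
  have d: "q ^ Suc n dvd a (Suc n) - a n" for n
  proof (induction n)
    case 0
    have "q dvd q * y - (\<phi> c - c ^ p)" by (rule dvd_diff) (simp_all add: \<phi>_frob)
    moreover have "\<phi> (a 1 - a 0) = q * y - (\<phi> c - c ^ p)" using aS[of 0] by (simp add: \<phi>_diff a_def)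
    ultimately show ?case using q_dvd_\<phi>[of "a 1 - a 0"] by simp
  next
    case (Suc n)
    have "\<phi> (a (Suc (Suc n)) - a (Suc n)) = a (Suc n) ^ p - a n ^ p" by (simp add: \<phi>_diff aS)
    then show ?case using power_p_cong[OF Suc] q_power_dvd_\<phi>[of "Suc (Suc n)" "a (Suc (Suc n)) - a (Suc n)"] by simp
  qed
  then have "q ^ n dvd a (Suc n) - a n" for n by (metis dvd_trans dvd_triv_right power_Suc)
  then obtain l where l: "\<And>n. q ^ n dvd l - a n" using complete by blast
  have "q dvd (l - a 1) + (a 1 - a 0)" using l[of 1] d[of 0] by (intro dvd_add) simp_all
  then have lc: "q dvd l - c" by (simp add: a_def)
  have "\<phi> l = l ^ p + q * y"
  proof (rule eq_by_approx)
    fix n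
    have 1: "q ^ n dvd \<phi> l - \<phi> (a (Suc n))"
      using l[of "Suc n"] q_power_dvd_\<phi>[of n "l - a (Suc n)"] by (metis \<phi>_diff dvd_trans dvd_triv_right power_Suc)
    have "l ^ p - a n ^ p = (l - a n) * (\<Sum>i<p. a n ^ (p - Suc i) * l ^ i)" by (rule power_diff_sumr2)
    then have 2: "q ^ n dvd l ^ p - a n ^ p" using l[of n] by simp
    show "q ^ n dvd \<phi> l - (l ^ p + q * y)" using dvd_diff[OF 1 2] by (simp add: aS algebra_simps)
  qed
  then have "\<delta> l = y" by (intro \<delta>_eqI) simp
  then show ?thesis using lc by blast
qed

text \<open>The induction works from the highest derivative down: y is chosen with the residues
  prescribed for orders 1 to \<open>Suc n\<close>, and then a with \<open>\<delta> a = y\<close> and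
  its own residue prescribed.\<close>

lemma \<delta>_residues: "\<exists>a. \<forall>i\<le>n. q dvd (\<delta> ^^ i) a - c i"
proof (induction n arbitrary: c)
  case 0
  show ?case by (rule exI[of _ "c 0"]) simp
next
  case (Suc n)
  obtain y where y: "\<forall>i\<le>n. q dvd (\<delta> ^^ i) y - c (Suc i)" using Suc[of "\<lambda>i. c (Suc i)"] by blast
  obtain a where a: "q dvd a - c 0" "\<delta> a = y" using \<delta>_surj_residue by blast
  have "q dvd (\<delta> ^^ i) a - c i" if "i \<le> Suc n" for i
    using that a y by (cases i) (simp_all add: funpow_swap1)
  then show ?case by blast
qed

text \<open>The jet of a point to unbounded order, as a total function; \<open>nabla\<close> is its
  restriction to a set of variables and to finitely many orders.\<close>

definition D :: "('v \<Rightarrow> 'r) \<Rightarrow> 'v \<times> nat \<Rightarrow> 'r" where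
  "D a = (\<lambda>(v, i). (\<delta> ^^ i) (a v))"

lemma D_apply [simp]: "D a (v, i) = (\<delta> ^^ i) (a v)"
  by (simp add: D_def)

lemma dense_D: "dense_pts (V \<times> {..n}) (range D)"
  unfolding dense_pts_def
proof
  fix c :: "'a \<times> nat \<Rightarrow> 'r"
  obtain a where "\<And>v i. i \<le> n \<Longrightarrow> q dvd (\<delta> ^^ i) (a v) - c (v, i)"
    using \<delta>_residues[of n "\<lambda>i. c (_, i)"] by metis
  then show "\<exists>t\<in>range D. \<forall>w\<in>V \<times> {..n}. q dvd t w - c w" by (intro bexI[of _ "D a"]) auto
qed

text \<open>
  Restricted series are handled through the functions \<open>a \<mapsto> f (e a)\<close> that they define: for
  \<open>e = D\<close>, the iterated derivatives, these are the delta-functions of finite order.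
\<close>

definition FR :: "'w set \<Rightarrow> ('a \<Rightarrow> 'w \<Rightarrow> 'r) \<Rightarrow> ('a \<Rightarrow> 'r) set" where
  "FR W e = {P. \<exists>f\<in>rs W. \<forall>a. P a = feval p (e a) f}"

abbreviation An :: "'w set \<Rightarrow> (('w \<Rightarrow> 'r) \<Rightarrow> 'r) set" where
  "An W \<equiv> FR W (\<lambda>a. a)"

lemma FR_I: "f \<in> rs W \<Longrightarrow> (\<And>a. P a = feval p (e a) f) \<Longrightarrow> P \<in> FR W e"
  by (auto simp: FR_def)

lemma FR_E: "P \<in> FR W e \<Longrightarrow> (\<And>f. f \<in> rs W \<Longrightarrow> (\<And>a. P a = feval p (e a) f) \<Longrightarrow> thesis) \<Longrightarrow> thesis"
  by (auto simp: FR_def)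

lemma FR_mono: "P \<in> FR W e \<Longrightarrow> W \<subseteq> W' \<Longrightarrow> P \<in> FR W' e"
  unfolding FR_def using rs_mono by blast

lemma FR_const: "(\<lambda>a. c) \<in> FR W e"
  by (rule FR_I[OF rs_cst[of c]]) simp

lemma FR_coord: "w \<in> W \<Longrightarrow> (\<lambda>a. e a w) \<in> FR W e"
  by (rule FR_I[OF rs_fvar]) simp_all

lemma
  assumes "P \<in> FR W e" "Q \<in> FR W e"
  shows FR_add: "(\<lambda>a. P a + Q a) \<in> FR W e"
    and FR_mult: "(\<lambda>a. P a * Q a) \<in> FR W e"
    and FR_diff: "(\<lambda>a. P a - Q a) \<in> FR W e"
proof -
  obtain f g where fg: "f \<in> rs W" "g \<in> rs W" "\<And>a. P a = feval p (e a) f" "\<And>a. Q a = feval p (e a) g"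
    using assms by (auto simp: FR_def)
  show "(\<lambda>a. P a + Q a) \<in> FR W e" by (rule FR_I[of "f + g"]) (simp_all add: fg rs_add feval_add[OF fg(1,2)])
  show "(\<lambda>a. P a * Q a) \<in> FR W e" by (rule FR_I[of "f * g"]) (simp_all add: fg rs_mult feval_mult[OF fg(1,2)])
  show "(\<lambda>a. P a - Q a) \<in> FR W e" by (rule FR_I[of "f - g"]) (simp_all add: fg rs_diff feval_diff[OF fg(1,2)])
qed

lemma FR_uminus: "P \<in> FR W e \<Longrightarrow> (\<lambda>a. - P a) \<in> FR W e"
  using FR_diff[OF FR_const[of 0], of P W e] by simp

lemma FR_power: "P \<in> FR W e \<Longrightarrow> (\<lambda>a. P a ^ n) \<in> FR W e"
  by (induction n) (simp_all add: FR_const FR_mult)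

lemma FR_sum: "(\<And>i. i \<in> A \<Longrightarrow> P i \<in> FR W e) \<Longrightarrow> (\<lambda>a. \<Sum>i\<in>A. P i a) \<in> FR W e"
  by (induction A rule: infinite_finite_induct) (simp_all add: FR_const FR_add)

lemma FR_comp:
  assumes "h \<in> An W'" "\<And>w. w \<in> W' \<Longrightarrow> Q w \<in> FR W e"
  shows "(\<lambda>a. h (\<lambda>w. Q w a)) \<in> FR W e"
proof -
  obtain f where f: "f \<in> rs W'" "\<And>a. h a = feval p a f" using assms(1) by (auto simp: FR_def)
  have "\<forall>w\<in>W'. \<exists>g. g \<in> rs W \<and> (\<forall>a. Q w a = feval p (e a) g)" using assms(2) by (auto simp: FR_def)
  then obtain g where g: "\<And>w. w \<in> W' \<Longrightarrow> g w \<in> rs W" "\<And>w a. w \<in> W' \<Longrightarrow> Q w a = feval p (e a) (g w)" by metis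
  show ?thesis
  proof (rule FR_I)
    show "fsubst p id g f \<in> rs W" by (rule fsubst_rs[OF rhom_id(1) f(1) g(1)])
    fix a
    have "feval p (e a) (fsubst p id g f) = id (feval p (\<lambda>v. id (feval p (e a) (g v))) f)"
      by (rule feval_fsubst[OF rhom_id(1) f(1) g(1)]) simp_all
    also have "\<dots> = feval p (\<lambda>w. Q w a) f"
      unfolding id_apply by (rule feval_cong[OF f(1)]) (simp add: g(2))
    finally show "h (\<lambda>w. Q w a) = feval p (e a) (fsubst p id g f)" by (simp add: f(2))
  qed
qed

lemma An_poly: "P \<in> carrier (pol_ring V) \<Longrightarrow> (\<lambda>a. pev a P) \<in> An V"
  by (rule FR_I[OF rs_of_poly]) (simp_all add: feval_pev)

lemma FR_unique:
  assumes "dense_pts W (range e)" "f \<in> rs W" "g \<in> rs W" "\<And>a. feval p (e a) f = feval p (e a) g"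
  shows "f = g"
proof -
  have "f - g = 0" by (rule density[OF assms(1)]) (use assms in \<open>auto simp: rs_diff feval_diff\<close>)
  then show ?thesis by simp
qed

text \<open>Divisibility of the values on a dense set passes to the series, so the quotient of the
  functions is again given by a restricted series. The top coordinate of the bracket is obtained in
  this way.\<close>

lemma FR_div:
  assumes W: "dense_pts W (range e)" and "P \<in> FR W e" "\<And>a. P a = q ^ n * Q a"
  shows "Q \<in> FR W e"
  using assms(2,3)
proof (induction n arbitrary: P)
  case 0
  then have "P = Q" by auto
  then show ?case using 0 by simp
next
  case (Suc n)
  obtain f where f: "f \<in> rs W" "\<And>a. P a = feval p (e a) f" using Suc.prems(1) by (rule FR_E) blast
  obtain g where g: "g \<in> rs W" "f = of_nat p * g"
    by (rule density_dvd[OF W f(1)]) (use f(2) Suc.prems(2) in \<open>auto simp flip: f(2)\<close>)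
  have "q * feval p (e a) g = q * (q ^ n * Q a)" for a
    using Suc.prems(2)[of a] f(2)[of a] g(2) feval_q_mult[OF g(1), of "e a" 1] by (simp add: mult.assoc)
  then have "feval p (e a) g = q ^ n * Q a" for a by simp
  moreover have "(\<lambda>a. feval p (e a) g) \<in> FR W e" by (rule FR_I[OF g(1)]) simp
  ultimately show ?case by (intro Suc.IH[of "\<lambda>a. feval p (e a) g"])
qed

text \<open>The inverse twist of the arguments cancels the twist of the monomials, which leaves the
  series with \<phi> applied to its coefficients.\<close>

lemma An_twist:
  assumes "P \<in> An V"
  shows "(\<lambda>a. \<phi> (P (\<lambda>v. \<psi> (a v)))) \<in> An V"
proof -
  have r: "rhom \<phi>" by (simp add: rhom_def \<phi>_add \<phi>_mult)
  obtain f where f: "f \<in> rs V" "\<And>a. P a = feval p a f" using assms by (rule FR_E) blast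
  have F: "v \<in> V \<Longrightarrow> fvar v \<in> rs V" for v by (rule rs_fvar)
  show ?thesis
  proof (rule FR_I)
    show "fsubst p \<phi> fvar f \<in> rs V" by (rule fsubst_rs[OF r f(1) F])
    fix a
    have "feval p a (fsubst p \<phi> fvar f) = \<phi> (feval p (\<lambda>v. \<psi> (feval p a (fvar v))) f)"
      by (rule feval_fsubst[OF r f(1) F]) simp_all
    then show "\<phi> (P (\<lambda>v. \<psi> (a v))) = feval p a (fsubst p \<phi> fvar f)" by (simp add: f(2))
  qed
qed

lemma An_twist_pow:
  assumes "P \<in> An V"
  shows "(\<lambda>a. (\<phi> ^^ n) (P (\<lambda>v. (\<psi> ^^ n) (a v)))) \<in> An V"
proof (induction n)
  case (Suc n)
  show ?case using An_twist[OF Suc] by (simp add: funpow_swap1)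
qed (use assms in simp)

lemma feval_dvd: "f \<in> rs W \<Longrightarrow> (\<And>k. q ^ n dvd mfps.coeff f k) \<Longrightarrow> q ^ n dvd feval p a f"
  unfolding feval_mon using psum_approx[OF tends_zero_mult_right[OF rs_tends_zero], of f W "{}" n "mon a"] by simp

text \<open>The sum is formed coefficientwise. Modulo \<open>q^n\<close> only its first n terms
  count, and finitely many restricted series have finitely many coefficients not divisible by
  \<open>q^n\<close>.\<close>

lemma rs_qsum:
  assumes f: "\<And>k. f k \<in> rs W"
  obtains F where "F \<in> rs W" "\<And>n a. q ^ n dvd feval p a F - (\<Sum>k<n. q ^ k * feval p a (f k))"
proof -
  have "\<forall>l. \<exists>s. \<forall>n. q ^ n dvd s - (\<Sum>k<n. q ^ k * mfps.coeff (f k) l)"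
    by (rule allI, rule qsum_exists)
  then obtain s where s: "\<And>l n. q ^ n dvd s l - (\<Sum>k<n. q ^ k * mfps.coeff (f k) l)" by metis
  define F where "F = Mfps s"
  have F: "F \<in> rs W"
    unfolding rs_iff
  proof
    show "\<forall>l. mfps.coeff F l \<noteq> 0 \<longrightarrow> Poly_Mapping.keys l \<subseteq> W"
    proof (intro allI impI, rule ccontr)
      fix l assume l: "mfps.coeff F l \<noteq> 0" "\<not> Poly_Mapping.keys l \<subseteq> W"
      then have "mfps.coeff (f k) l = 0" for k using rs_keys[OF f] by blast
      then have "q ^ n dvd s l" for n using s[of n l] by simp
      then have "s l = 0" by (rule separated)
      then show False using l(1) by (simp add: F_def)
    qed
    show "tends_zero (mfps.coeff F)"
      unfolding tends_zero_def
    proof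
      fix n
      have "{l. \<not> q ^ n dvd mfps.coeff F l} \<subseteq> (\<Union>k<n. {l. \<not> q ^ n dvd mfps.coeff (f k) l})"
      proof (rule subsetI, rule ccontr)
        fix l assume l: "l \<in> {l. \<not> q ^ n dvd mfps.coeff F l}" "l \<notin> (\<Union>k<n. {l. \<not> q ^ n dvd mfps.coeff (f k) l})"
        then have "q ^ n dvd (\<Sum>k<n. q ^ k * mfps.coeff (f k) l)" by (intro dvd_sum) simp
        then have "q ^ n dvd s l" using s[of n l] by (simp add: dvd_diff_left_iff)
        then show False using l(1) by (simp add: F_def)
      qed
      then show "finite {l. \<not> q ^ n dvd mfps.coeff F l}"
        by (rule finite_subset) (intro finite_UN_I tends_zeroD rs_tends_zero[OF f] finite_lessThan)
    qed
  qed
  have "q ^ n dvd feval p a F - (\<Sum>k<n. q ^ k * feval p a (f k))" for n a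
  proof -
    let ?S = "\<Sum>k<n. of_nat p ^ k * f k"
    have S: "?S \<in> rs W" by (intro rs_sum rs_mult rs_power rs_of_nat f)
    have "q ^ n dvd feval p a (F - ?S)"
      by (rule feval_dvd[OF rs_diff[OF F S]]) (simp add: F_def coeff_sum s)
    also have "feval p a (F - ?S) = feval p a F - (\<Sum>k<n. q ^ k * feval p a (f k))"
      by (simp add: feval_diff[OF F S] feval_sum[of _ _ W] f rs_intros feval_q_mult[OF f])
    finally show ?thesis .
  qed
  then show thesis using that F by blast
qed

lemma FR_qsum:
  assumes "\<And>k. P k \<in> FR W e"
  obtains S where "S \<in> FR W e" "\<And>n a. q ^ n dvd S a - (\<Sum>k<n. q ^ k * P k a)"
proof -
  have "\<forall>k. \<exists>f. f \<in> rs W \<and> (\<forall>a. P k a = feval p (e a) f)" using assms by (auto simp: FR_def)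
  then obtain f where f: "\<And>k. f k \<in> rs W" "\<And>k a. P k a = feval p (e a) (f k)" by metis
  obtain F where F: "F \<in> rs W" "\<And>n a. q ^ n dvd feval p a F - (\<Sum>k<n. q ^ k * feval p a (f k))"
    using rs_qsum[of f W] f(1) by blast
  show thesis
    by (rule that[of "\<lambda>a. feval p (e a) F"]) (use F f(2) in \<open>auto intro: FR_I\<close>)
qed

section \<open>Digit expansions and differences of values\<close>

text \<open>The p-adic expansion of a restricted series with polynomials as digits; it is obtained
  by iterating the splitting modulo p on the remainder.\<close>

lemma An_split:
  assumes h: "h \<in> An W"
  obtains P where "\<And>k. P k \<in> carrier (pol_ring W)" "\<And>n a. q ^ n dvd h a - (\<Sum>k<n. q ^ k * pev a (P k))"
proof -
  obtain f where f: "f \<in> rs W" "\<And>a. h a = feval p a f" using h by (rule FR_E) blast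
  have "\<exists>P g'. P \<in> carrier (pol_ring W) \<and> g' \<in> rs W \<and> g = of_poly P + of_nat p * g'" if g: "g \<in> rs W" for g
  proof -
    obtain P g' where "P \<in> carrier (pol_ring W)" "g' \<in> rs W" "g = of_poly P + of_nat p ^ 1 * g'"
      using rs_split[OF g] by blast
    then show ?thesis by (intro exI[of _ P] exI[of _ g']) simp
  qed
  then obtain P N where PN: "\<And>g. g \<in> rs W \<Longrightarrow> P g \<in> carrier (pol_ring W) \<and> N g \<in> rs W \<and> g = of_poly (P g) + of_nat p * N g"
    by metis
  define g where "g k = (N ^^ k) f" for k
  have g: "g k \<in> rs W" for k by (induction k) (use f PN in \<open>auto simp: g_def\<close>)
  have st: "feval p a (g k) = pev a (P (g k)) + q * feval p a (g (Suc k))" for a k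
  proof -
    have *: "g k = of_poly (P (g k)) + of_nat p * g (Suc k)" using PN[OF g[of k]] by (simp add: g_def)
    have "feval p a (of_poly (P (g k)) + of_nat p * g (Suc k)) = pev a (P (g k)) + q * feval p a (g (Suc k))"
      using PN[OF g[of k]] g[of "Suc k"]
      by (subst feval_add[of _ W]) (auto intro!: rs_intros simp: feval_q1[OF g] feval_pev)
    then show ?thesis using * by simp
  qed
  have "feval p a f = (\<Sum>k<n. q ^ k * pev a (P (g k))) + q ^ n * feval p a (g n)" for n a
  proof (induction n)
    case (Suc n)
    then show ?case by (simp add: st[of a n] algebra_simps)
  qed (simp add: g_def)
  from this[folded f(2)] have "h a - (\<Sum>k<n. q ^ k * pev a (P (g k))) = q ^ n * feval p a (g n)" for n a
    by (simp add: algebra_simps)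
  then have "q ^ n dvd h a - (\<Sum>k<n. q ^ k * pev a (P (g k)))" for n a by simp
  then show thesis using that[of "\<lambda>k. P (g k)"] PN g by blast
qed

text \<open>The difference of two values lies in the ideal of the coordinate differences, with
  coefficients that are again restricted series. For products the difference is telescoped through
  the value of f at \<open>Q'\<close> times the value of g at Q.\<close>

lemma diff_poly:
  assumes "f \<in> carrier (pol_ring W)" and Q: "\<And>w. w \<in> W \<Longrightarrow> Q w \<in> FR U e" "\<And>w. w \<in> W \<Longrightarrow> Q' w \<in> FR U e"
    and fin: "finite W"
  shows "\<exists>E. (\<forall>w\<in>W. E w \<in> FR U e) \<and> (\<forall>a. pev (\<lambda>w. Q w a) f - pev (\<lambda>w. Q' w a) f =
    (\<Sum>w\<in>W. (Q w a - Q' w a) * E w a))"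
  using assms(1)
proof (induction rule: pol_induct)
  case (const c)
  show ?case by (rule exI[of _ "\<lambda>w a. 0"]) (simp add: FR_const)
next
  case (var v)
  then show ?case
    by (intro exI[of _ "\<lambda>w a. if w = v then 1 else 0"]) (auto simp: FR_const fin if_distrib if_distribR cong: if_cong)
next
  case (add f g)
  from add(3) obtain E where E: "\<forall>w\<in>W. E w \<in> FR U e" "\<forall>a. pev (\<lambda>w. Q w a) f - pev (\<lambda>w. Q' w a) f =
    (\<Sum>w\<in>W. (Q w a - Q' w a) * E w a)" by blast
  from add(4) obtain E' where E': "\<forall>w\<in>W. E' w \<in> FR U e" "\<forall>a. pev (\<lambda>w. Q w a) g - pev (\<lambda>w. Q' w a) g =
    (\<Sum>w\<in>W. (Q w a - Q' w a) * E' w a)" by blast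
  note E = E[rule_format] and E' = E'[rule_format]
  have "pev (\<lambda>w. Q w a) (f + g) - pev (\<lambda>w. Q' w a) (f + g) = (\<Sum>w\<in>W. (Q w a - Q' w a) * (E w a + E' w a))" for a
    unfolding distrib_left sum.distrib E(2)[symmetric] E'(2)[symmetric] pev_hom by simp
  then show ?case by (intro exI[of _ "\<lambda>w a. E w a + E' w a"]) (auto simp: FR_add E E')
next
  case (mult f g)
  from mult(3) obtain E where E: "\<forall>w\<in>W. E w \<in> FR U e" "\<forall>a. pev (\<lambda>w. Q w a) f - pev (\<lambda>w. Q' w a) f =
    (\<Sum>w\<in>W. (Q w a - Q' w a) * E w a)" by blast
  from mult(4) obtain E' where E': "\<forall>w\<in>W. E' w \<in> FR U e" "\<forall>a. pev (\<lambda>w. Q w a) g - pev (\<lambda>w. Q' w a) g =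
    (\<Sum>w\<in>W. (Q w a - Q' w a) * E' w a)" by blast
  note E = E[rule_format] and E' = E'[rule_format]
  let ?E = "\<lambda>w a. E w a * pev (\<lambda>w. Q w a) g + E' w a * pev (\<lambda>w. Q' w a) f"
  have "pev (\<lambda>w. Q w a) (f * g) - pev (\<lambda>w. Q' w a) (f * g) = (\<Sum>w\<in>W. (Q w a - Q' w a) * ?E w a)" for a
    unfolding distrib_left sum.distrib mult.assoc[symmetric] sum_distrib_right[symmetric]
      E(2)[symmetric] E'(2)[symmetric] pev_hom by (simp add: algebra_simps)
  moreover have "?E w \<in> FR U e" if "w \<in> W" for w
    by (intro FR_add FR_mult E E' that FR_comp[OF An_poly[OF mult(1)]] FR_comp[OF An_poly[OF mult(2)]] Q)
  ultimately show ?case by (intro exI[of _ ?E]) auto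
qed

text \<open>\<open>diff_poly\<close> is applied to every polynomial digit of h, and the coefficients
  are summed with the weights \<open>q^k\<close>. Because the combination is explicit and finite,
  membership of the coordinate differences in an ideal passes to the difference of values.\<close>

lemma diff_analytic:
  assumes h: "h \<in> An W" and Q: "\<And>w. w \<in> W \<Longrightarrow> Q w \<in> FR U e" "\<And>w. w \<in> W \<Longrightarrow> Q' w \<in> FR U e"
    and fin: "finite W"
  obtains E where "\<And>w. w \<in> W \<Longrightarrow> E w \<in> FR U e"
    "\<And>a. h (\<lambda>w. Q w a) - h (\<lambda>w. Q' w a) = (\<Sum>w\<in>W. (Q w a - Q' w a) * E w a)"
proof -
  obtain P where P: "\<And>k. P k \<in> carrier (pol_ring W)" "\<And>n a. q ^ n dvd h a - (\<Sum>k<n. q ^ k * pev a (P k))"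
    using An_split[OF h] by blast
  have "\<forall>k. \<exists>E. (\<forall>w\<in>W. E w \<in> FR U e) \<and> (\<forall>a. pev (\<lambda>w. Q w a) (P k) - pev (\<lambda>w. Q' w a) (P k) =
    (\<Sum>w\<in>W. (Q w a - Q' w a) * E w a))"
    by (intro allI diff_poly P(1) Q fin)
  then obtain E where E: "\<And>k w. w \<in> W \<Longrightarrow> E k w \<in> FR U e"
    "\<And>k a. pev (\<lambda>w. Q w a) (P k) - pev (\<lambda>w. Q' w a) (P k) = (\<Sum>w\<in>W. (Q w a - Q' w a) * E k w a)" by metis
  have "\<forall>w. \<exists>S. w \<in> W \<longrightarrow> S \<in> FR U e \<and> (\<forall>n a. q ^ n dvd S a - (\<Sum>k<n. q ^ k * E k w a))"
    using FR_qsum[of "\<lambda>k. E k _" U e] E(1) by metis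
  then obtain S where S: "\<And>w. w \<in> W \<Longrightarrow> S w \<in> FR U e" "\<And>w n a. w \<in> W \<Longrightarrow> q ^ n dvd S w a - (\<Sum>k<n. q ^ k * E k w a)"
    by metis
  have "h (\<lambda>w. Q w a) - h (\<lambda>w. Q' w a) = (\<Sum>w\<in>W. (Q w a - Q' w a) * S w a)" for a
  proof (rule eq_by_approx)
    fix n
    let ?s = "\<lambda>b. \<Sum>k<n. q ^ k * pev b (P k)"
    have gen: "(a - b) - (c - d) - (t - (b - d)) = a - c - t" for a b c d t :: 'r by simp
    have 1: "q ^ n dvd (h (\<lambda>w. Q w a) - ?s (\<lambda>w. Q w a)) - (h (\<lambda>w. Q' w a) - ?s (\<lambda>w. Q' w a))"
      by (intro dvd_diff P)
    have "?s (\<lambda>w. Q w a) - ?s (\<lambda>w. Q' w a) = (\<Sum>k<n. q ^ k * (\<Sum>w\<in>W. (Q w a - Q' w a) * E k w a))"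
      unfolding E(2)[symmetric] by (simp add: sum_subtractf right_diff_distrib)
    also have "\<dots> = (\<Sum>k<n. \<Sum>w\<in>W. (Q w a - Q' w a) * (q ^ k * E k w a))"
      unfolding sum_distrib_left by (intro sum.cong refl) (rule mult.left_commute)
    also have "\<dots> = (\<Sum>w\<in>W. \<Sum>k<n. (Q w a - Q' w a) * (q ^ k * E k w a))"
      by (rule sum.swap)
    also have "\<dots> = (\<Sum>w\<in>W. (Q w a - Q' w a) * (\<Sum>k<n. q ^ k * E k w a))"
      by (simp add: sum_distrib_left)
    finally have 2: "?s (\<lambda>w. Q w a) - ?s (\<lambda>w. Q' w a) = (\<Sum>w\<in>W. (Q w a - Q' w a) * (\<Sum>k<n. q ^ k * E k w a))" .
    have "q ^ n dvd (\<Sum>w\<in>W. (Q w a - Q' w a) * (S w a - (\<Sum>k<n. q ^ k * E k w a)))"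
      by (intro dvd_sum dvd_mult S)
    then have 3: "q ^ n dvd (\<Sum>w\<in>W. (Q w a - Q' w a) * S w a) - (?s (\<lambda>w. Q w a) - ?s (\<lambda>w. Q' w a))"
      unfolding 2 right_diff_distrib[of "_ - _" "S _ a"] sum_subtractf .
    show "q ^ n dvd h (\<lambda>w. Q w a) - h (\<lambda>w. Q' w a) - (\<Sum>w\<in>W. (Q w a - Q' w a) * S w a)"
      using dvd_diff[OF 1 3] by (simp only: gen)
  qed
  then show thesis using S(1) by (intro that[of S])
qed

end

section \<open>Points of jet spaces\<close>

lemma rhom_funpow:
  fixes h :: "'a::comm_ring_1 \<Rightarrow> 'a"
  shows "rhom h \<Longrightarrow> rhom (h ^^ n)"
  by (induction n) (simp_all add: rhom_def)

context pring
begin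

lemma rhom_\<phi>: "rhom \<phi>" and rhom_\<psi>: "rhom \<psi>"
  by (simp_all add: rhom_def \<phi>_add \<phi>_mult \<psi>_add \<psi>_mult)

lemmas \<phi>_pow_hom = rhomD[OF rhom_funpow[OF rhom_\<phi>]]
lemmas \<psi>_pow_hom = rhomD[OF rhom_funpow[OF rhom_\<psi>]]

lemma \<phi>_\<psi>_pow [simp]: "(\<phi> ^^ n) ((\<psi> ^^ n) a) = a" and \<psi>_\<phi>_pow [simp]: "(\<psi> ^^ n) ((\<phi> ^^ n) a) = a"
  by (induction n arbitrary: a) (simp_all add: funpow_swap1)

lemma q_power_dvd_\<phi>_pow: "q ^ m dvd (\<phi> ^^ n) a \<longleftrightarrow> q ^ m dvd a"
  by (induction n) (simp_all add: q_power_dvd_\<phi>)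

lemma q_power_dvd_\<psi>_pow: "q ^ m dvd (\<psi> ^^ n) a \<longleftrightarrow> q ^ m dvd a"
  using q_power_dvd_\<phi>_pow[of m n "(\<psi> ^^ n) a"] by simp

text \<open>\<open>pi_phi\<close> for jets of unbounded order. It fixes the jets \<open>D a\<close>,
  as \<open>\<phi> x = x^p + q * \<delta> x\<close>.\<close>

definition sh :: "('v \<times> nat \<Rightarrow> 'r) \<Rightarrow> 'v \<times> nat \<Rightarrow> 'r" where
  "sh b = (\<lambda>(v, i). \<psi> (b (v, i) ^ p + q * b (v, Suc i)))"

text \<open>The effect of \<open>sh\<close> on the sequence of derivatives of one coordinate. The
  same recursion governs the values of the lifts of any series, which is the reason for treating
  sequences on their own.\<close>

definition shs :: "(nat \<Rightarrow> 'r) \<Rightarrow> nat \<Rightarrow> 'r" where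
  "shs c i = \<psi> (c i ^ p + q * c (Suc i))"

lemma jet_frob_var_rs:
  "w \<in> V \<times> {..n} \<Longrightarrow> (\<lambda>(v, i). fvar (v, i) ^ p + of_nat p * fvar (v, Suc i)) w \<in> rs (V \<times> {..Suc n})"
  by (auto intro!: rs_intros)

lemma jet_frob_rs: "f \<in> rs (V \<times> {..n}) \<Longrightarrow> jet_frob p \<phi> f \<in> rs (V \<times> {..Suc n})"
  unfolding jet_frob_def by (rule fsubst_rs[OF rhom_\<phi> _ jet_frob_var_rs])

lemma feval_jet_frob_var:
  "feval p b (fvar (v, i) ^ p + of_nat p * fvar (v, Suc i)) = b (v, i) ^ p + q * b (v, Suc i)"
proof -
  have "fvar w \<in> rs UNIV" for w :: "'a \<times> nat" by (rule rs_fvar) simp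
  then show ?thesis
    by (subst feval_add[of _ UNIV]) (auto intro: rs_intros simp: feval_power[of _ UNIV] feval_q1[of _ UNIV])
qed

lemma feval_jet_frob:
  assumes "f \<in> rs (V \<times> {..n})"
  shows "feval p b (jet_frob p \<phi> f) = \<phi> (feval p (sh b) f)"
proof -
  have "feval p b (jet_frob p \<phi> f) =
      \<phi> (feval p (\<lambda>w. \<psi> (feval p b ((\<lambda>(v, i). fvar (v, i) ^ p + of_nat p * fvar (v, Suc i)) w))) f)"
    unfolding jet_frob_def by (rule feval_fsubst[OF rhom_\<phi> assms jet_frob_var_rs]) simp_all
  also have "(\<lambda>w. \<psi> (feval p b ((\<lambda>(v, i). fvar (v, i) ^ p + of_nat p * fvar (v, Suc i)) w))) = sh b"
    by (auto simp: sh_def fun_eq_iff feval_jet_frob_var)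
  finally show ?thesis .
qed

lemma sh_D: "sh (D a) = D a"
proof
  fix w :: "'a \<times> nat"
  obtain v i where w: "w = (v, i)" by force
  have "\<phi> ((\<delta> ^^ i) (a v)) = (\<delta> ^^ i) (a v) ^ p + q * (\<delta> ^^ Suc i) (a v)"
    using \<phi>_\<delta>[of "(\<delta> ^^ i) (a v)"] by simp
  then show "sh (D a) w = D a w" unfolding w sh_def D_def prod.case by (rule \<psi>_eqI)
qed

definition lift0 :: "('v, 'r) mfps \<Rightarrow> ('v \<times> nat, 'r) mfps" where
  "lift0 f = fsubst p id (\<lambda>v. fvar (v, 0)) f"

lemma lift0_rs: "f \<in> rs V \<Longrightarrow> lift0 f \<in> rs (V \<times> {..0})"
  unfolding lift0_def by (rule fsubst_rs[OF rhom_id(1)]) (auto intro: rs_fvar)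

lemma feval_lift0: "f \<in> rs V \<Longrightarrow> feval p b (lift0 f) = feval p (\<lambda>v. b (v, 0)) f"
  unfolding lift0_def
  by (subst feval_fsubst[OF rhom_id(1), of f V _ "V \<times> {..0}" id]) (auto intro: rs_fvar)

lemma mfps_q_cancel: "of_nat p * f = of_nat p * (g :: ('v, 'r) mfps) \<Longrightarrow> f = g"
proof (rule mfps_eqI)
  fix k assume "of_nat p * f = of_nat p * g"
  then have "mfps.coeff (of_nat p * f) k = mfps.coeff (of_nat p * g) k" by (rule arg_cong)
  then show "mfps.coeff f k = mfps.coeff g k" by simp
qed

text \<open>\<open>pderivation\<close> is a definite description, so p must be shown to divide
  \<open>jet_frob p \<phi> f - f^p\<close>. At a jet \<open>D a\<close> the value of this series is
  \<open>\<phi> x - x^p\<close> with x the value of f, and such jets are dense; no binomial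
  coefficients have to be examined.\<close>

lemma pderivation_mfps:
  assumes f: "f \<in> rs (V \<times> {..n})"
  shows "pderivation p (jet_frob p \<phi>) f \<in> rs (V \<times> {..Suc n}) \<and>
    of_nat p * pderivation p (jet_frob p \<phi>) f = jet_frob p \<phi> f - f ^ p"
proof -
  have f': "f \<in> rs (V \<times> {..Suc n})" by (rule rs_mono[OF f]) auto
  have R: "jet_frob p \<phi> f - f ^ p \<in> rs (V \<times> {..Suc n})" by (intro rs_diff rs_power f' jet_frob_rs f)
  obtain g where g: "g \<in> rs (V \<times> {..Suc n})" "jet_frob p \<phi> f - f ^ p = of_nat p * g"
  proof (rule density_dvd[OF dense_D R])
    fix t assume "t \<in> range (D :: ('a \<Rightarrow> 'r) \<Rightarrow> _)"
    then obtain a :: "'a \<Rightarrow> 'r" where t: "t = D a" by blast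
    have "feval p t (jet_frob p \<phi> f - f ^ p) = \<phi> (feval p t f) - feval p t f ^ p"
      unfolding t by (simp add: feval_diff[OF jet_frob_rs[OF f] rs_power[OF f']] feval_jet_frob[OF f] sh_D feval_power[OF f'])
    then show "q dvd feval p t (jet_frob p \<phi> f - f ^ p)" by (simp add: \<phi>_frob)
  qed
  have "pderivation p (jet_frob p \<phi>) f = g"
    unfolding pderivation_def g(2) by (rule the_equality) (auto intro: mfps_q_cancel)
  then show ?thesis using g by simp
qed

lemma jet_lift_0: "jet_lift p \<phi> 0 f = lift0 f"
  and jet_lift_Suc: "jet_lift p \<phi> (Suc i) f = pderivation p (jet_frob p \<phi>) (jet_lift p \<phi> i f)"
  by (simp_all add: jet_lift_def lift0_def)

lemma jet_lift_rs: "f \<in> rs V \<Longrightarrow> jet_lift p \<phi> i f \<in> rs (V \<times> {..i})"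
  by (induction i) (simp_all only: jet_lift_0 lift0_rs jet_lift_Suc pderivation_mfps)

lemma feval_jet_lift_Suc:
  assumes "f \<in> rs V"
  shows "q * feval p b (jet_lift p \<phi> (Suc i) f) =
    \<phi> (feval p (sh b) (jet_lift p \<phi> i f)) - feval p b (jet_lift p \<phi> i f) ^ p"
proof -
  note r = jet_lift_rs[OF assms, of i]
  have r': "jet_lift p \<phi> i f \<in> rs (V \<times> {..Suc i})" by (rule rs_mono[OF r]) auto
  have "q * feval p b (jet_lift p \<phi> (Suc i) f) = feval p b (of_nat p * jet_lift p \<phi> (Suc i) f)"
    using jet_lift_rs[OF assms, of "Suc i"] by (simp add: feval_q1)
  also have "of_nat p * jet_lift p \<phi> (Suc i) f = jet_frob p \<phi> (jet_lift p \<phi> i f) - jet_lift p \<phi> i f ^ p"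
    using pderivation_mfps[OF r] by (simp add: jet_lift_Suc)
  also have "feval p b \<dots> = \<phi> (feval p (sh b) (jet_lift p \<phi> i f)) - feval p b (jet_lift p \<phi> i f) ^ p"
    using feval_diff[OF jet_frob_rs[OF r] rs_power[OF r']] by (simp add: feval_jet_frob[OF r] feval_power[OF r])
  finally show ?thesis .
qed

text \<open>The values of the successive lifts of f at a point are shifted exactly like the
  derivatives of a single coordinate: both satisfy the recursion that defines \<delta> from
  \<phi>.\<close>

lemma feval_sh_jet_lift:
  "f \<in> rs V \<Longrightarrow> feval p (sh b) (jet_lift p \<phi> i f) = shs (\<lambda>i. feval p b (jet_lift p \<phi> i f)) i"
  unfolding shs_def by (rule \<psi>_eqI[symmetric]) (simp add: feval_jet_lift_Suc)

lemma feval_D_jet_lift: "f \<in> rs V \<Longrightarrow> feval p (D a) (jet_lift p \<phi> i f) = (\<delta> ^^ i) (feval p a f)"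
proof (induction i)
  case 0
  then show ?case by (simp add: jet_lift_0 feval_lift0)
next
  case (Suc i)
  have "\<delta> (feval p (D a) (jet_lift p \<phi> i f)) = feval p (D a) (jet_lift p \<phi> (Suc i) f)"
    by (rule \<delta>_eqI) (simp add: feval_jet_lift_Suc[OF Suc.prems] sh_D)
  then show ?case using Suc by simp
qed

lemma feval_sh_pow:
  "f \<in> rs V \<Longrightarrow> feval p ((sh ^^ n) b) (jet_lift p \<phi> i f) = (shs ^^ n) (\<lambda>i. feval p b (jet_lift p \<phi> i f)) i"
proof (induction n arbitrary: b i)
  case (Suc n)
  have "(\<lambda>i. feval p (sh b) (jet_lift p \<phi> i f)) = shs (\<lambda>i. feval p b (jet_lift p \<phi> i f))"
    using feval_sh_jet_lift[OF Suc.prems] by blast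
  then show ?case using Suc.IH[OF Suc.prems, of "sh b" i] by (simp only: funpow_Suc_right o_apply)
qed simp

lemma sh_pow: "(sh ^^ n) b (v, i) = (shs ^^ n) (\<lambda>i. b (v, i)) i"
proof (induction n arbitrary: b)
  case (Suc n)
  have "(\<lambda>i. sh b (v, i)) = shs (\<lambda>i. b (v, i))" by (simp add: sh_def shs_def fun_eq_iff)
  then show ?case using Suc[of "sh b"] by (simp only: funpow_Suc_right o_apply)
qed simp

lemma shs_pow_cong: "(\<And>i. i \<le> n + j \<Longrightarrow> c i = c' i) \<Longrightarrow> (shs ^^ n) c j = (shs ^^ n) c' j"
  by (induction n arbitrary: j) (simp_all add: shs_def)

text \<open>Entries equal to the derivatives of e are preserved by \<open>shs\<close>, except the
  last of them: there the deviation of the next entry arrives, multiplied by p and untwisted once.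
  After n steps the deviation of entry n has moved down to entry 0.\<close>

lemma shs_pow:
  "(\<And>i. i < n \<Longrightarrow> c i = (\<delta> ^^ i) e) \<Longrightarrow> (shs ^^ n) c 0 = e + q ^ n * (\<psi> ^^ n) (c n - (\<delta> ^^ n) e)"
proof (induction n arbitrary: c)
  case (Suc n)
  have s: "shs c i = (\<delta> ^^ i) e + q * \<psi> (c (Suc i) - (\<delta> ^^ Suc i) e)" if "i < Suc n" for i
  proof -
    have "\<phi> ((\<delta> ^^ i) e) = c i ^ p + q * (\<delta> ^^ Suc i) e" using Suc.prems[OF that] \<phi>_\<delta>[of "(\<delta> ^^ i) e"] by simp
    then show ?thesis
      unfolding shs_def by (intro \<psi>_eqI) (simp add: \<phi>_add \<phi>_mult algebra_simps)
  qed
  have "shs c i = (\<delta> ^^ i) e" if "i < n" for i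
    using s[of i] Suc.prems[of "Suc i"] that by simp
  then have "(shs ^^ n) (shs c) 0 = e + q ^ n * (\<psi> ^^ n) (shs c n - (\<delta> ^^ n) e)" by (rule Suc.IH)
  also have "shs c n - (\<delta> ^^ n) e = q * \<psi> (c (Suc n) - (\<delta> ^^ Suc n) e)" using s[of n] by simp
  finally show ?case
    by (simp only: funpow_Suc_right o_apply \<psi>_pow_hom power_Suc2 mult.assoc)
qed simp

text \<open>\<open>ex_map\<close> before its restriction to the variables of G.\<close>

definition exq :: "nat \<Rightarrow> ('v \<times> nat \<Rightarrow> 'r) \<Rightarrow> 'v \<Rightarrow> 'r" where
  "exq r a v = (sh ^^ r) a (v, 0)"

lemma exq_shs: "exq r a v = (shs ^^ r) (\<lambda>i. a (v, i)) 0"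
  by (simp add: exq_def sh_pow)

lemma pi_phi_iter_eq: "v \<in> V \<Longrightarrow> pi_phi_iter p \<phi> V n a (v, 0) = (shs ^^ n) (\<lambda>i. a (v, i)) 0"
proof (induction n arbitrary: a)
  case (Suc n)
  have "pi_phi p \<phi> V (Suc n) a (v, i) = shs (\<lambda>i. a (v, i)) i" if "i \<le> n" for i
  proof -
    have "fvar (v, i) \<in> rs (V \<times> {..i})" using Suc.prems by (intro rs_fvar) auto
    then have "feval p a (jet_frob p \<phi> (fvar (v, i))) = \<phi> (sh a (v, i))" by (simp add: feval_jet_frob)
    then show ?thesis using Suc.prems that by (simp add: pi_phi_def shs_def sh_def)
  qed
  then have "(shs ^^ n) (\<lambda>i. pi_phi p \<phi> V (Suc n) a (v, i)) 0 = (shs ^^ n) (shs (\<lambda>i. a (v, i))) 0"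
    by (intro shs_pow_cong) simp
  then show ?case using Suc.IH[OF Suc.prems] by (simp only: pi_phi_iter.simps funpow_Suc_right o_apply)
qed simp

lemma ex_map_eq: "ex_map p \<phi> r G a = restrict (exq r a) (vars G)"
  by (auto simp: ex_map_def restrict_def exq_shs pi_phi_iter_eq)

text \<open>Compares the equations of the jet space at a with those of G at \<open>exq r a\<close>;
  combined with \<open>shs_pow\<close> for e = 0 it shows which of them are equivalent.\<close>

lemma exq_jet_lift: "f \<in> rs V \<Longrightarrow> feval p (exq r a) f = (shs ^^ r) (\<lambda>i. feval p a (jet_lift p \<phi> i f)) 0"
  using feval_sh_pow[of f V r a 0] unfolding jet_lift_0 by (simp add: feval_lift0 exq_def[abs_def])

lemma vanishing_ideal: "ideal {f \<in> rs W. feval p b f = 0} (rps_ring p W :: ('w, 'r) mfps ring)"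
  by (rule cring.ideal_closedI[OF cring_rps_ring])
    (auto simp: rs_0 rs_add rs_mult feval_add feval_mult)

lemma genideal_vanishes:
  assumes "S \<subseteq> rs W" "\<And>f. f \<in> S \<Longrightarrow> feval p b f = 0" "f \<in> Idl\<^bsub>rps_ring p W\<^esub> S"
  shows "feval p b f = 0"
proof -
  interpret cring "rps_ring p W :: ('a, 'r) mfps ring" by (rule cring_rps_ring)
  have "Idl\<^bsub>rps_ring p W\<^esub> S \<subseteq> {f \<in> rs W. feval p b f = 0}"
    by (rule genideal_minimal[OF vanishing_ideal]) (use assms in auto)
  then show ?thesis using assms(3) by auto
qed

lemma genideal_rs:
  fixes S :: "('w, 'r) mfps set"
  assumes "S \<subseteq> rs W"
  shows "ideal (Idl\<^bsub>rps_ring p W\<^esub> S) (rps_ring p W)" "S \<subseteq> Idl\<^bsub>rps_ring p W\<^esub> S" "Idl\<^bsub>rps_ring p W\<^esub> S \<subseteq> rs W"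
proof -
  interpret cring "rps_ring p W :: ('w, 'r) mfps ring" by (rule cring_rps_ring)
  show I: "ideal (Idl\<^bsub>rps_ring p W\<^esub> S) (rps_ring p W)" by (rule genideal_ideal[OF assms])
  show "S \<subseteq> Idl\<^bsub>rps_ring p W\<^esub> S" by (rule genideal_self[OF assms])
  show "Idl\<^bsub>rps_ring p W\<^esub> S \<subseteq> rs W" using ideal.Icarr[OF I] by blast
qed

lemma rps_ideal_closed:
  assumes "ideal I (rps_ring p W :: ('w, 'r) mfps ring)"
  shows "f \<in> I \<Longrightarrow> g \<in> I \<Longrightarrow> f + g \<in> I" "f \<in> I \<Longrightarrow> c \<in> rs W \<Longrightarrow> c * f \<in> I" "0 \<in> I" "f \<in> I \<Longrightarrow> f \<in> rs W"
  using ideal.Icarr[OF assms, of f] ideal.I_l_closed[OF assms, of f c]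
    additive_subgroup.a_closed[OF ideal.axioms(1)[OF assms], of f g]
    additive_subgroup.zero_closed[OF ideal.axioms(1)[OF assms]]
  by simp_all

end

section \<open>Group schemes and their Lie algebras on points\<close>

lemma genideal_pol_ring:
  assumes "S \<subseteq> carrier (pol_ring W)"
  shows "ideal (Idl\<^bsub>pol_ring W\<^esub> S) (pol_ring W)" "S \<subseteq> Idl\<^bsub>pol_ring W\<^esub> S" "Idl\<^bsub>pol_ring W\<^esub> S \<subseteq> carrier (pol_ring W)"
proof -
  interpret cring "pol_ring W" by (rule cring_pol_ring)
  show I: "ideal (Idl\<^bsub>pol_ring W\<^esub> S) (pol_ring W)" by (rule genideal_ideal[OF assms])
  show "S \<subseteq> Idl\<^bsub>pol_ring W\<^esub> S" by (rule genideal_self[OF assms])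
  show "Idl\<^bsub>pol_ring W\<^esub> S \<subseteq> carrier (pol_ring W)" using ideal.Icarr[OF I] by blast
qed

lemma msubst_pol:
  assumes "f \<in> carrier (pol_ring V)" "\<And>v. v \<in> V \<Longrightarrow> S v \<in> carrier (pol_ring W)"
  shows "msubst S f \<in> carrier (pol_ring W)"
  using assms(1) by (induction rule: pol_induct) (simp_all add: assms(2) meval_add meval_mult pol_closed)

context pring
begin

lemma pev_msubst: "pev b (msubst S f) = pev (\<lambda>v. pev b (S v)) f"
  unfolding pev_def by (rule meval_msubst) (rule rhom_id)

lemma pev_cong_mod:
  assumes "f \<in> carrier (pol_ring V)" "\<And>v. v \<in> V \<Longrightarrow> q ^ m dvd a v - b v"
  shows "q ^ m dvd pev a f - pev b f"
  using feval_cong_mod[OF rs_of_poly[OF assms(1)] assms(2)] by (simp add: feval_pev)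

lemma pol_vanishing_ideal: "ideal {f \<in> carrier (pol_ring W). pev b f = 0} (pol_ring W)"
  by (rule cring.ideal_closedI[OF cring_pol_ring]) (auto simp: pol_closed pev_hom)

lemma pol_genideal_vanishes:
  assumes "S \<subseteq> carrier (pol_ring W)" "\<And>f. f \<in> S \<Longrightarrow> pev b f = 0" "f \<in> Idl\<^bsub>pol_ring W\<^esub> S"
  shows "pev b f = 0"
proof -
  interpret cring "pol_ring W :: ('a, 'r) mpoly ring" by (rule cring_pol_ring)
  have "Idl\<^bsub>pol_ring W\<^esub> S \<subseteq> {f \<in> carrier (pol_ring W). pev b f = 0}"
    by (rule genideal_minimal[OF pol_vanishing_ideal]) (use assms in auto)
  then show ?thesis using assms(3) by auto
qed

text \<open>Points of G as total functions; by \<open>zpt_cong\<close> the values at other variables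
  do not matter. Most of the group computations take place on such functions, without extensionality
  conditions.\<close>

definition zpt :: "('v, 'r, 'z) affine_scheme \<Rightarrow> ('v \<Rightarrow> 'r) \<Rightarrow> bool" where
  "zpt G a \<longleftrightarrow> (\<forall>f\<in>eqs G. pev a f = 0)"

definition gm :: "('v, 'r) group_scheme \<Rightarrow> ('v \<Rightarrow> 'r) \<Rightarrow> ('v \<Rightarrow> 'r) \<Rightarrow> 'v \<Rightarrow> 'r" where
  "gm G a b v = pev (case_sum a b) (gmul G v)"

definition gi :: "('v, 'r) group_scheme \<Rightarrow> ('v \<Rightarrow> 'r) \<Rightarrow> 'v \<Rightarrow> 'r" where
  "gi G a v = pev a (ginv G v)"

definition gcomm :: "('v, 'r) group_scheme \<Rightarrow> ('v \<Rightarrow> 'r) \<Rightarrow> ('v \<Rightarrow> 'r) \<Rightarrow> 'v \<Rightarrow> 'r" where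
  "gcomm G a b = gm G (gm G (gm G a b) (gi G a)) (gi G b)"

lemma gcommutator_eq: "gcommutator G a b = restrict (gcomm G a b) (vars G)"
  by (simp add: gcommutator_def gcomm_def gm_def[abs_def] gi_def[abs_def] gmul_at_def pev_def Let_def)

lemma aprod_vanishes:
  assumes "is_affine_scheme S" "is_affine_scheme T" "zpt S a" "zpt T b" "f \<in> eqs (aprod S T)"
  shows "pev (case_sum a b) f = 0"
proof (rule pol_genideal_vanishes)
  let ?W = "Sum_Type.Plus (vars S) (vars T)"
  let ?A = "msubst (\<lambda>v. mvar (Inl v)) ` eqs S \<union> msubst (\<lambda>w. mvar (Inr w)) ` eqs T"
  have e: "eqs S \<subseteq> carrier (pol_ring (vars S))" "eqs T \<subseteq> carrier (pol_ring (vars T))"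
    using assms(1,2) ideal.Icarr by (auto simp: is_affine_scheme_def)
  then show "?A \<subseteq> carrier (pol_ring ?W)"
    by (auto intro!: msubst_pol)
  show "f \<in> Idl\<^bsub>pol_ring ?W\<^esub> ?A" using assms(5) by (simp add: aprod_def)
  show "pev (case_sum a b) g = 0" if "g \<in> ?A" for g
    using that assms(3,4) by (auto simp: pev_msubst zpt_def)
qed

lemma
  assumes "is_group_scheme G"
  shows gs_affine: "is_affine_scheme G" and gs_finite: "finite (vars G)"
    and gs_ideal: "ideal (eqs G) (pol_ring (vars G))" and gs_eqs: "f \<in> eqs G \<Longrightarrow> f \<in> carrier (pol_ring (vars G))"
    and gs_unit: "zpt G (gunit G)"
    and gs_mul_pol: "v \<in> vars G \<Longrightarrow> gmul G v \<in> carrier (pol_ring (Sum_Type.Plus (vars G) (vars G)))"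
    and gs_inv_pol: "v \<in> vars G \<Longrightarrow> ginv G v \<in> carrier (pol_ring (vars G))"
proof -
  show a: "is_affine_scheme G" using assms by (simp add: is_group_scheme_def)
  show "finite (vars G)" "ideal (eqs G) (pol_ring (vars G))" using a by (simp_all add: is_affine_scheme_def)
  then show "f \<in> eqs G \<Longrightarrow> f \<in> carrier (pol_ring (vars G))"
    using ideal.Icarr[of "eqs G" "pol_ring (vars G)" f] by simp
  show "zpt G (gunit G)" using assms by (simp add: is_group_scheme_def zpt_def pev_def)
  have "amor (aprod G G) G (gmul G)" "amor G G (ginv G)"
    using assms by (simp_all add: is_group_scheme_def)
  then show "v \<in> vars G \<Longrightarrow> gmul G v \<in> carrier (pol_ring (Sum_Type.Plus (vars G) (vars G)))"
    "v \<in> vars G \<Longrightarrow> ginv G v \<in> carrier (pol_ring (vars G))"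
    by (simp_all add: amor_def aprod_def)
qed

lemma zpt_cong:
  assumes "is_affine_scheme G" "\<And>v. v \<in> vars G \<Longrightarrow> a v = b v"
  shows "zpt G a \<longleftrightarrow> zpt G b"
proof -
  have "pev a f = pev b f" if "f \<in> eqs G" for f
    using assms(1) that by (intro pev_cong[OF _ assms(2)]) (auto simp: is_affine_scheme_def ideal.Icarr)
  then show ?thesis by (simp add: zpt_def)
qed

lemma gm_zpt:
  assumes G: "is_group_scheme G" and "zpt G a" "zpt G b"
  shows "zpt G (gm G a b)"
  unfolding zpt_def
proof
  fix f assume "f \<in> eqs G"
  then have "msubst (gmul G) f \<in> eqs (aprod G G)" using G by (simp add: is_group_scheme_def amor_def)
  then have "pev (case_sum a b) (msubst (gmul G) f) = 0" by (rule aprod_vanishes[OF gs_affine[OF G] gs_affine[OF G] assms(2,3)])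
  then show "pev (gm G a b) f = 0" by (simp add: pev_msubst gm_def[abs_def])
qed

lemma gi_zpt:
  assumes G: "is_group_scheme G" and "zpt G a"
  shows "zpt G (gi G a)"
  unfolding zpt_def
proof
  fix f assume "f \<in> eqs G"
  then have "msubst (ginv G) f \<in> eqs G" using G by (simp add: is_group_scheme_def amor_def)
  then have "pev a (msubst (ginv G) f) = 0" using assms(2) by (simp add: zpt_def)
  then show "pev (gi G a) f = 0" by (simp add: pev_msubst gi_def[abs_def])
qed

lemma gcomm_zpt: "is_group_scheme G \<Longrightarrow> zpt G a \<Longrightarrow> zpt G b \<Longrightarrow> zpt G (gcomm G a b)"
  unfolding gcomm_def by (intro gm_zpt gi_zpt)

lemma gm_cong:
  assumes "is_group_scheme G" "\<And>v. v \<in> vars G \<Longrightarrow> a v = a' v" "\<And>v. v \<in> vars G \<Longrightarrow> b v = b' v" "v \<in> vars G"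
  shows "gm G a b v = gm G a' b' v"
  unfolding gm_def using assms(2,3) by (intro pev_cong[OF gs_mul_pol[OF assms(1,4)]]) (auto split: sum.splits)

lemma gi_cong:
  assumes "is_group_scheme G" "\<And>v. v \<in> vars G \<Longrightarrow> a v = a' v" "v \<in> vars G"
  shows "gi G a v = gi G a' v"
  unfolding gi_def using assms(2) by (intro pev_cong[OF gs_inv_pol[OF assms(1,3)]])

lemma gcomm_cong:
  assumes "is_group_scheme G" "\<And>v. v \<in> vars G \<Longrightarrow> a v = a' v" "\<And>v. v \<in> vars G \<Longrightarrow> b v = b' v" "v \<in> vars G"
  shows "gcomm G a b v = gcomm G a' b' v"
  unfolding gcomm_def by (intro gm_cong gi_cong assms)

lemma pev_gmul_at: "pev b (gmul_at G mconst S1 S2 v) = gm G (\<lambda>v. pev b (S1 v)) (\<lambda>v. pev b (S2 v)) v"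
proof -
  have "(\<lambda>u. pev b (case_sum S1 S2 u)) = case_sum (\<lambda>v. pev b (S1 v)) (\<lambda>v. pev b (S2 v))"
    by (auto simp: fun_eq_iff split: sum.splits)
  then show ?thesis by (simp add: gmul_at_def pev_msubst gm_def)
qed

lemma amor_eq_pev:
  assumes "amor_eq G H S1 S2" "zpt G a" "w \<in> vars H"
  shows "pev a (S1 w) = pev a (S2 w)"
proof -
  have "pev a (S1 w - S2 w) = 0" using assms by (auto simp: amor_eq_def zpt_def)
  then show ?thesis by (simp add: pev_hom)
qed

lemma group_laws:
  assumes G: "is_group_scheme G" and a: "zpt G a" and v: "v \<in> vars G"
  shows "gm G (gunit G) a v = a v" "gm G a (gunit G) v = a v"
    "gm G (gi G a) a v = gunit G v" "gm G a (gi G a) v = gunit G v"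
proof -
  let ?x = "mvar :: _ \<Rightarrow> ('a, 'r) mpoly" and ?e = "\<lambda>v. mconst (gunit G v)"
  have "amor_eq G G (gmul_at G mconst ?e ?x) ?x" "amor_eq G G (gmul_at G mconst ?x ?e) ?x"
    "amor_eq G G (gmul_at G mconst (ginv G) ?x) ?e" "amor_eq G G (gmul_at G mconst ?x (ginv G)) ?e"
    using G by (simp_all add: is_group_scheme_def Let_def)
  note * = this[THEN amor_eq_pev, OF a v, unfolded pev_gmul_at]
  show "gm G (gunit G) a v = a v" "gm G a (gunit G) v = a v"
    "gm G (gi G a) a v = gunit G v" "gm G a (gi G a) v = gunit G v"
    using * by (simp_all add: gi_def[abs_def])
qed

definition pmap :: "('w \<Rightarrow> ('v, 'r) mpoly) \<Rightarrow> ('v \<Rightarrow> 'r) \<Rightarrow> 'w \<Rightarrow> 'r" where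
  "pmap f a w = pev a (f w)"

lemma hom_zpt:
  assumes "group_hom G H f" "zpt G a"
  shows "zpt H (pmap f a)"
  unfolding zpt_def
proof
  fix g assume "g \<in> eqs H"
  then have "msubst f g \<in> eqs G" using assms(1) by (simp add: group_hom_def amor_def)
  then have "pev a (msubst f g) = 0" using assms(2) by (simp add: zpt_def)
  then show "pev (pmap f a) g = 0" by (simp add: pev_msubst pmap_def[abs_def])
qed

lemma hom_pol: "group_hom G H f \<Longrightarrow> w \<in> vars H \<Longrightarrow> f w \<in> carrier (pol_ring (vars G))"
  by (simp add: group_hom_def amor_def)

lemma hom_gm:
  assumes G: "is_group_scheme G" and f: "group_hom G H f" and ab: "zpt G a" "zpt G b" and w: "w \<in> vars H"
  shows "pmap f (gm G a b) w = gm H (pmap f a) (pmap f b) w"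
proof -
  let ?X = "\<lambda>w. msubst (gmul G) (f w)"
  let ?Y = "gmul_at H mconst (\<lambda>w. msubst (\<lambda>v. mvar (Inl v)) (f w)) (\<lambda>w. msubst (\<lambda>v. mvar (Inr v)) (f w))"
  have "?X w - ?Y w \<in> eqs (aprod G G)" using f w by (simp add: group_hom_def amor_eq_def)
  then have "pev (case_sum a b) (?X w - ?Y w) = 0"
    by (rule aprod_vanishes[OF gs_affine[OF G] gs_affine[OF G] ab])
  then have "pev (case_sum a b) (?X w) = pev (case_sum a b) (?Y w)" by (simp add: pev_hom)
  then show ?thesis by (simp add: pev_msubst pev_gmul_at pmap_def[abs_def] gm_def[abs_def])
qed

section \<open>Ideals of completions, jet spaces and Lie algebras\<close>

abbreviation cmp :: "('v, 'r) group_scheme \<Rightarrow> ('v, 'r) mfps set" where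
  "cmp G \<equiv> feqs (completion p G)"

lemma cmp_props:
  assumes "is_group_scheme G"
  shows "ideal (cmp G) (rps_ring p (vars G))" "f \<in> eqs G \<Longrightarrow> of_poly f \<in> cmp G" "g \<in> cmp G \<Longrightarrow> g \<in> rs (vars G)"
proof -
  have "of_poly ` eqs G \<subseteq> rs (vars G)" using gs_eqs[OF assms] rs_of_poly by blast
  note * = genideal_rs[OF this]
  show "ideal (cmp G) (rps_ring p (vars G))" "f \<in> eqs G \<Longrightarrow> of_poly f \<in> cmp G" "g \<in> cmp G \<Longrightarrow> g \<in> rs (vars G)"
    using * by (auto simp: completion_def)
qed

lemma cmp_vanishes:
  assumes "is_group_scheme G" "zpt G a" "g \<in> cmp G"
  shows "feval p a g = 0"
proof (rule genideal_vanishes)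
  show "of_poly ` eqs G \<subseteq> rs (vars G)" using gs_eqs[OF assms(1)] rs_of_poly by blast
  show "g \<in> Idl\<^bsub>rps_ring p (vars G)\<^esub> (of_poly ` eqs G)" using assms(3) by (simp add: completion_def)
  show "feval p a f = 0" if "f \<in> of_poly ` eqs G" for f
    using that assms(2) by (auto simp: feval_pev zpt_def)
qed

definition jgens :: "nat \<Rightarrow> ('v, 'r) pformal \<Rightarrow> ('v \<times> nat, 'r) mfps set" where
  "jgens n S = {jet_lift p \<phi> i f | i f. i \<le> n \<and> f \<in> feqs S}"

lemma jgens_rs:
  assumes "feqs S \<subseteq> rs (fvars S)"
  shows "jgens n S \<subseteq> rs (fvars S \<times> {..n})"
proof
  fix g assume "g \<in> jgens n S"
  then obtain i f where g: "g = jet_lift p \<phi> i f" "i \<le> n" "f \<in> feqs S" by (auto simp: jgens_def)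
  then have "jet_lift p \<phi> i f \<in> rs (fvars S \<times> {..i})" using assms jet_lift_rs by blast
  then show "g \<in> rs (fvars S \<times> {..n})" unfolding g(1) by (rule rs_mono) (use g(2) in auto)
qed

lemma Jet_props:
  assumes "feqs S \<subseteq> rs (fvars S)"
  shows "ideal (feqs (Jet p \<phi> n S)) (rps_ring p (fvars S \<times> {..n}))" "jgens n S \<subseteq> feqs (Jet p \<phi> n S)"
    "feqs (Jet p \<phi> n S) \<subseteq> rs (fvars S \<times> {..n})"
    "(\<And>g. g \<in> jgens n S \<Longrightarrow> feval p b g = 0) \<Longrightarrow> f \<in> feqs (Jet p \<phi> n S) \<Longrightarrow> feval p b f = 0"
proof -
  have eq: "feqs (Jet p \<phi> n S) = Idl\<^bsub>rps_ring p (fvars S \<times> {..n})\<^esub> (jgens n S)"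
    by (simp add: Jet_def jgens_def)
  show "ideal (feqs (Jet p \<phi> n S)) (rps_ring p (fvars S \<times> {..n}))" "jgens n S \<subseteq> feqs (Jet p \<phi> n S)"
    "feqs (Jet p \<phi> n S) \<subseteq> rs (fvars S \<times> {..n})"
    unfolding eq by (rule genideal_rs[OF jgens_rs[OF assms]])+
  assume "\<And>g. g \<in> jgens n S \<Longrightarrow> feval p b g = 0" "f \<in> feqs (Jet p \<phi> n S)"
  then show "feval p b f = 0"
    unfolding eq by (rule genideal_vanishes[OF jgens_rs[OF assms]])
qed

definition ugens :: "nat \<Rightarrow> ('v, 'r) group_scheme \<Rightarrow> ('v \<times> nat, 'r) mfps set" where
  "ugens r G = {f \<in> rs (vars G \<times> {..r - 1}). feval p (jet_unit p \<phi> (r - 1) G) f = 0}"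

lemma jet_unit_D: "v \<in> vars G \<Longrightarrow> i \<le> n \<Longrightarrow> jet_unit p \<phi> n G (v, i) = D (gunit G) (v, i)"
  by (simp add: jet_unit_def nabla_def)

lemma Lie_props:
  assumes G: "is_group_scheme G"
  shows "ideal (feqs (Lie p \<phi> r G)) (rps_ring p (vars G \<times> {..r}))" "feqs (Lie p \<phi> r G) \<subseteq> rs (vars G \<times> {..r})"
    "jgens r (completion p G) \<subseteq> feqs (Lie p \<phi> r G)" "ugens r G \<subseteq> feqs (Lie p \<phi> r G)"
    "(\<And>g. g \<in> jgens r (completion p G) \<Longrightarrow> feval p b g = 0) \<Longrightarrow> (\<And>g. g \<in> ugens r G \<Longrightarrow> feval p b g = 0) \<Longrightarrow>
      f \<in> feqs (Lie p \<phi> r G) \<Longrightarrow> feval p b f = 0"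
proof -
  have fv: "fvars (completion p G) = vars G" by (simp add: completion_def)
  have c: "feqs (completion p G) \<subseteq> rs (fvars (completion p G))" using cmp_props(3)[OF G] fv by auto
  note J = Jet_props[OF c, unfolded fv]
  have u: "ugens r G \<subseteq> rs (vars G \<times> {..r})"  proof
    fix f assume "f \<in> ugens r G"
    then have "f \<in> rs (vars G \<times> {..r - 1})" by (simp add: ugens_def)
    then show "f \<in> rs (vars G \<times> {..r})" by (rule rs_mono) auto
  qed
  have eq: "feqs (Lie p \<phi> r G) = Idl\<^bsub>rps_ring p (vars G \<times> {..r})\<^esub> (feqs (Jet p \<phi> r (completion p G)) \<union> ugens r G)"
    by (simp add: Lie_def ugens_def)
  have s: "feqs (Jet p \<phi> r (completion p G)) \<union> ugens r G \<subseteq> rs (vars G \<times> {..r})" using J(3) u by blast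
  note * = genideal_rs[OF s, folded eq]
  show "ideal (feqs (Lie p \<phi> r G)) (rps_ring p (vars G \<times> {..r}))" "feqs (Lie p \<phi> r G) \<subseteq> rs (vars G \<times> {..r})"
    "jgens r (completion p G) \<subseteq> feqs (Lie p \<phi> r G)" "ugens r G \<subseteq> feqs (Lie p \<phi> r G)"
    using * J(2)[of r] by (auto simp only: Un_subset_iff)
  assume b: "\<And>g. g \<in> jgens r (completion p G) \<Longrightarrow> feval p b g = 0" "\<And>g. g \<in> ugens r G \<Longrightarrow> feval p b g = 0"
    "f \<in> feqs (Lie p \<phi> r G)"
  have "feval p b g = 0" if "g \<in> feqs (Jet p \<phi> r (completion p G)) \<union> ugens r G" for g
    using that
  proof
    assume "g \<in> feqs (Jet p \<phi> r (completion p G))"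
    then show ?thesis by (rule J(4)[rotated]) (rule b(1))
  qed (rule b(2))
  then show "feval p b f = 0" by (rule genideal_vanishes[OF s _ b(3)[unfolded eq]])
qed

lemma Lie_fvars [simp]: "fvars (Lie p \<phi> r G) = vars G \<times> {..r}"
  by (simp add: Lie_def)

lemma exq_formula:
  assumes "\<And>i. i < r \<Longrightarrow> a (v, i) = (\<delta> ^^ i) (e v)"
  shows "exq r a v = e v + q ^ r * (\<psi> ^^ r) (a (v, r) - (\<delta> ^^ r) (e v))"
  unfolding exq_shs by (rule shs_pow) (rule assms)

text \<open>The pullback of the unit section fixes the coordinates of order below r. The lifts of an
  equation f of order below r then vanish, since f vanishes at the unit, and \<open>shs_pow\<close>
  makes the value of f at \<open>exq r a\<close> equal to \<open>q^r\<close> times the untwisted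
  lift of order r. So the remaining equations say exactly that \<open>exq r a\<close> is a point of
  G.\<close>

lemma Lie_pts_iff:
  assumes G: "is_group_scheme G" and r: "r \<ge> 1"
  shows "a \<in> Lie_pts p \<phi> r G \<longleftrightarrow> a \<in> vars G \<times> {..r} \<rightarrow>\<^sub>E UNIV \<and>
    (\<forall>v\<in>vars G. \<forall>i<r. a (v, i) = (\<delta> ^^ i) (gunit G v)) \<and> zpt G (exq r a)"
    (is "_ \<longleftrightarrow> ?E \<and> ?U \<and> ?Z")
proof
  assume "a \<in> Lie_pts p \<phi> r G"
  then have E: ?E and van: "\<And>g. g \<in> feqs (Lie p \<phi> r G) \<Longrightarrow> feval p a g = 0" by (auto simp: fpts_def)
  have U: "a (v, i) = (\<delta> ^^ i) (gunit G v)" if "v \<in> vars G" "i < r" for v i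
  proof -
    let ?W = "vars G \<times> {..r - 1}"
    have 1: "fvar (v, i) \<in> rs ?W" using that by (intro rs_fvar) auto
    have 2: "cst ((\<delta> ^^ i) (gunit G v)) \<in> rs ?W" by (rule rs_cst)
    have "fvar (v, i) - cst ((\<delta> ^^ i) (gunit G v)) \<in> ugens r G"
      unfolding ugens_def using that rs_diff[OF 1 2] by (auto simp: feval_diff[OF 1 2] jet_unit_D)
    then have "feval p a (fvar (v, i) - cst ((\<delta> ^^ i) (gunit G v))) = 0" using Lie_props(4)[OF G] van by blast
    then show ?thesis by (simp add: feval_diff[OF 1 2])
  qed
  have Z: ?Z
    unfolding zpt_def
  proof
    fix f assume f: "f \<in> eqs G"
    have fr: "of_poly f \<in> rs (vars G)" using gs_eqs[OF G f] by (rule rs_of_poly)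
    have c: "feval p a (jet_lift p \<phi> i (of_poly f)) = 0" if "i \<le> r" for i
    proof -
      have "jet_lift p \<phi> i (of_poly f) \<in> jgens r (completion p G)"
        using that cmp_props(2)[OF G f] by (auto simp: jgens_def)
      then show ?thesis using Lie_props(3)[OF G] van by blast
    qed
    have "feval p (exq r a) (of_poly f) = (shs ^^ r) (\<lambda>i. feval p a (jet_lift p \<phi> i (of_poly f))) 0"
      by (rule exq_jet_lift[OF fr])
    also have "\<dots> = 0" using c by (subst shs_pow[where e = 0]) (simp_all add: \<psi>_pow_hom)
    finally show "pev (exq r a) f = 0" by (simp add: feval_pev)
  qed
  show "?E \<and> ?U \<and> ?Z" using E U Z by blast
next
  assume "?E \<and> ?U \<and> ?Z"
  then have E: ?E and U: "\<And>v i. v \<in> vars G \<Longrightarrow> i < r \<Longrightarrow> a (v, i) = (\<delta> ^^ i) (gunit G v)" and Z: ?Z by auto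
  have low: "feval p a g = feval p (D (gunit G)) g" if "g \<in> rs (vars G \<times> {..i})" "i < r" for g i
    by (rule feval_cong[OF that(1)]) (use U that(2) in auto)
  have "feval p a g = 0" if g: "g \<in> feqs (Lie p \<phi> r G)" for g
  proof (rule Lie_props(5)[OF G _ _ g])
    fix h assume "h \<in> jgens r (completion p G)"
    then obtain i f where h: "h = jet_lift p \<phi> i f" "i \<le> r" "f \<in> cmp G" by (auto simp: jgens_def)
    have f: "f \<in> rs (vars G)" using h(3) cmp_props(3)[OF G] by blast
    have c0: "feval p a (jet_lift p \<phi> i f) = 0" if "i < r" for i
      using low[OF jet_lift_rs[OF f] that] cmp_vanishes[OF G gs_unit[OF G] h(3)]
      by (simp add: feval_D_jet_lift[OF f])
    have "0 = feval p (exq r a) f" using cmp_vanishes[OF G Z h(3)] by simp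
    also have "\<dots> = (shs ^^ r) (\<lambda>i. feval p a (jet_lift p \<phi> i f)) 0" by (rule exq_jet_lift[OF f])
    also have "\<dots> = q ^ r * (\<psi> ^^ r) (feval p a (jet_lift p \<phi> r f))"
      using c0 by (subst shs_pow[where e = 0]) simp_all
    finally have "(\<psi> ^^ r) (feval p a (jet_lift p \<phi> r f)) = 0" by simp
    then have "(\<phi> ^^ r) ((\<psi> ^^ r) (feval p a (jet_lift p \<phi> r f))) = 0" by (simp only: \<phi>_pow_hom)
    then have "feval p a (jet_lift p \<phi> r f) = 0" by simp
    then show "feval p a h = 0" unfolding h(1) using c0 h(2) by (cases "i = r") auto
  next
    fix h assume h: "h \<in> ugens r G"
    then have "h \<in> rs (vars G \<times> {..r - 1})" by (simp add: ugens_def)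
    then have "feval p a h = feval p (jet_unit p \<phi> (r - 1) G) h"
      by (rule feval_cong) (use U r in \<open>auto simp: jet_unit_D\<close>)
    then show "feval p a h = 0" using h by (simp add: ugens_def)
  qed
  then show "a \<in> Lie_pts p \<phi> r G" using E by (simp add: fpts_def)
qed

lemma Lie_pts_low: "is_group_scheme G \<Longrightarrow> r \<ge> 1 \<Longrightarrow> a \<in> Lie_pts p \<phi> r G \<Longrightarrow> v \<in> vars G \<Longrightarrow> i < r \<Longrightarrow> a (v, i) = (\<delta> ^^ i) (gunit G v)"
  and Lie_pts_zpt: "is_group_scheme G \<Longrightarrow> r \<ge> 1 \<Longrightarrow> a \<in> Lie_pts p \<phi> r G \<Longrightarrow> zpt G (exq r a)"
  and Lie_pts_ext: "is_group_scheme G \<Longrightarrow> r \<ge> 1 \<Longrightarrow> a \<in> Lie_pts p \<phi> r G \<Longrightarrow> a \<in> extensional (vars G \<times> {..r})"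
  by (simp_all add: Lie_pts_iff PiE_def)

lemma Lie_pts_exq:
  "is_group_scheme G \<Longrightarrow> r \<ge> 1 \<Longrightarrow> a \<in> Lie_pts p \<phi> r G \<Longrightarrow> v \<in> vars G \<Longrightarrow>
    exq r a v = gunit G v + q ^ r * (\<psi> ^^ r) (a (v, r) - (\<delta> ^^ r) (gunit G v))"
  by (rule exq_formula) (rule Lie_pts_low)

lemma Lie_pts_near:
  "is_group_scheme G \<Longrightarrow> r \<ge> 1 \<Longrightarrow> a \<in> Lie_pts p \<phi> r G \<Longrightarrow> v \<in> vars G \<Longrightarrow> q ^ r dvd exq r a v - gunit G v"
  by (simp add: Lie_pts_exq)

text \<open>Only the coordinates of order r can differ, and \<open>exq r\<close> multiplies their
  differences by \<open>q^r\<close>; the inverse twist does not affect divisibility.\<close>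

lemma Lie_cong_iff:
  assumes G: "is_group_scheme G" and r: "r \<ge> 1" and ab: "a \<in> Lie_pts p \<phi> r G" "b \<in> Lie_pts p \<phi> r G"
  shows "pt_cong p m (Lie p \<phi> r G) a b \<longleftrightarrow> (\<forall>v\<in>vars G. q ^ (r + m) dvd exq r a v - exq r b v)"
proof -
  have *: "exq r a v - exq r b v = q ^ r * (\<psi> ^^ r) (a (v, r) - b (v, r))" if "v \<in> vars G" for v
    using that by (simp add: Lie_pts_exq[OF G r ab(1)] Lie_pts_exq[OF G r ab(2)] \<psi>_pow_hom algebra_simps)
  have "pt_cong p m (Lie p \<phi> r G) a b \<longleftrightarrow> (\<forall>v\<in>vars G. \<forall>i\<le>r. q ^ m dvd a (v, i) - b (v, i))"
    by (auto simp: pt_cong_def)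
  also have "\<dots> \<longleftrightarrow> (\<forall>v\<in>vars G. q ^ m dvd a (v, r) - b (v, r))"
  proof (intro ball_cong refl iffI allI impI)
    fix v i assume v: "v \<in> vars G" and d: "q ^ m dvd a (v, r) - b (v, r)" and "i \<le> r"
    show "q ^ m dvd a (v, i) - b (v, i)"
    proof (cases "i = r")
      case False
      then have "i < r" using \<open>i \<le> r\<close> by simp
      then show ?thesis using Lie_pts_low[OF G r ab(1) v] Lie_pts_low[OF G r ab(2) v] by simp
    qed (use d in simp)
  qed simp
  also have "\<dots> \<longleftrightarrow> (\<forall>v\<in>vars G. q ^ (r + m) dvd exq r a v - exq r b v)"
    by (intro ball_cong refl) (simp add: * q_power_dvd_cancel q_power_dvd_\<psi>_pow)
  finally show ?thesis .
qed

lemma Lie_pts_inj: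
  assumes G: "is_group_scheme G" and r: "r \<ge> 1" and ab: "a \<in> Lie_pts p \<phi> r G" "b \<in> Lie_pts p \<phi> r G"
    and e: "\<And>v. v \<in> vars G \<Longrightarrow> exq r a v = exq r b v"
  shows "a = b"
proof (rule extensionalityI[OF Lie_pts_ext[OF G r ab(1)] Lie_pts_ext[OF G r ab(2)]])
  fix w assume w: "w \<in> vars G \<times> {..r}"
  show "a w = b w"
  proof (rule eq_by_approx)
    fix m
    have "pt_cong p m (Lie p \<phi> r G) a b" unfolding Lie_cong_iff[OF G r ab] using e by simp
    then show "q ^ m dvd a w - b w" using w by (cases w) (auto simp: pt_cong_def)
  qed
qed

text \<open>The inverse of \<open>exq r\<close> on points of G congruent to the unit modulo
  \<open>q^r\<close>. For such points the chosen y exists and is unique, as R is a domain.\<close>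

definition Lie_pt :: "nat \<Rightarrow> ('v, 'r) group_scheme \<Rightarrow> ('v \<Rightarrow> 'r) \<Rightarrow> 'v \<times> nat \<Rightarrow> 'r" where
  "Lie_pt r G g = (\<lambda>(v, i)\<in>vars G \<times> {..r}. if i < r then (\<delta> ^^ i) (gunit G v)
     else (\<delta> ^^ r) (gunit G v) + (\<phi> ^^ r) (SOME y. g v - gunit G v = q ^ r * y))"

lemma Lie_pt_top:
  assumes "v \<in> vars G" "g v = gunit G v + q ^ r * y"
  shows "Lie_pt r G g (v, r) = (\<delta> ^^ r) (gunit G v) + (\<phi> ^^ r) y"
proof -
  have "(SOME y'. g v - gunit G v = q ^ r * y') = y" by (rule some_equality) (use assms(2) in auto)
  then show ?thesis using assms(1) by (simp add: Lie_pt_def)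
qed

lemma exq_Lie_pt:
  assumes "v \<in> vars G" "q ^ r dvd g v - gunit G v"
  shows "exq r (Lie_pt r G g) v = g v"
proof -
  obtain y where "g v - gunit G v = q ^ r * y" using assms(2) by (rule dvdE)
  then have y: "g v = gunit G v + q ^ r * y" by (simp add: algebra_simps)
  have "exq r (Lie_pt r G g) v = gunit G v + q ^ r * (\<psi> ^^ r) (Lie_pt r G g (v, r) - (\<delta> ^^ r) (gunit G v))"
    by (rule exq_formula) (use assms(1) in \<open>simp add: Lie_pt_def\<close>)
  then show ?thesis by (simp add: Lie_pt_top[where g = g, OF assms(1) y] y)
qed

lemma Lie_pt_in:
  assumes G: "is_group_scheme G" and r: "r \<ge> 1" and g: "zpt G g" "\<And>v. v \<in> vars G \<Longrightarrow> q ^ r dvd g v - gunit G v"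
  shows "Lie_pt r G g \<in> Lie_pts p \<phi> r G"
  unfolding Lie_pts_iff[OF G r]
proof (intro conjI ballI allI impI)
  show "Lie_pt r G g \<in> vars G \<times> {..r} \<rightarrow>\<^sub>E UNIV" by (simp add: Lie_pt_def PiE_def)
  show "zpt G (exq r (Lie_pt r G g))"
    by (subst zpt_cong[OF gs_affine[OF G], of _ g]) (simp_all add: exq_Lie_pt g)
qed (simp add: Lie_pt_def)

end

section \<open>Smoothness and Newton iteration\<close>

lemma mpderiv_superset:
  "finite S \<Longrightarrow> Poly_Mapping.keys f \<subseteq> S \<Longrightarrow> mpderiv v f = (\<Sum>k\<in>S. Poly_Mapping.single (k - Poly_Mapping.single v 1)
      (of_nat (Poly_Mapping.lookup k v) * Poly_Mapping.lookup f k))"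
  unfolding mpderiv_def by (rule sum.mono_neutral_left) (auto simp: in_keys_iff)

lemma mpderiv_add: "mpderiv v (f + g) = mpderiv v f + mpderiv v g"
  by (simp add: mpderiv_superset[of "Poly_Mapping.keys f \<union> Poly_Mapping.keys g"] Poly_Mapping.keys_add
      lookup_add distrib_left single_add sum.distrib)

lemma mpderiv_single:
  "mpderiv v (Poly_Mapping.single k c) = Poly_Mapping.single (k - Poly_Mapping.single v 1) (of_nat (Poly_Mapping.lookup k v) * c)"
  by (subst mpderiv_superset[of "{k}"]) auto

lemma mpderiv_0 [simp]: "mpderiv v 0 = 0"
  by (simp add: mpderiv_def)

lemma mpderiv_sum: "mpderiv v (sum f A) = (\<Sum>i\<in>A. mpderiv v (f i))"
  by (induction A rule: infinite_finite_induct) (simp_all add: mpderiv_add)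

text \<open>Truncated subtraction of exponents is harmless: it fails to commute with addition only
  where v has exponent 0, and there the coefficient is 0 as well.\<close>

lemma mpderiv_mult_single:
  fixes c d :: "'r::comm_ring_1"
  shows "mpderiv v (Poly_Mapping.single k c * Poly_Mapping.single l d) =
    mpderiv v (Poly_Mapping.single k c) * Poly_Mapping.single l d + Poly_Mapping.single k c * mpderiv v (Poly_Mapping.single l d)"
proof -
  define e where "e = (Poly_Mapping.single v 1 :: 'a \<Rightarrow>\<^sub>0 nat)"
  have e: "Poly_Mapping.lookup e w = (if w = v then 1 else 0)" for w
    by (simp add: e_def lookup_single when_def)
  have "(k + l - e) = (k - e) + l" if "Poly_Mapping.lookup k v > 0" for k l
    by (rule poly_mapping_eqI) (use that in \<open>auto simp: lookup_minus lookup_add e\<close>)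
  then have 1: "Poly_Mapping.single (k + l - e) (of_nat (Poly_Mapping.lookup k v) * c * d) =
      Poly_Mapping.single (k - e + l) (of_nat (Poly_Mapping.lookup k v) * c * d)" for k l and c d :: 'r
    by (cases "Poly_Mapping.lookup k v > 0") simp_all
  have 2: "Poly_Mapping.single (k + l - e) (c * (of_nat (Poly_Mapping.lookup l v) * d)) =
      Poly_Mapping.single (k + (l - e)) (c * (of_nat (Poly_Mapping.lookup l v) * d))"
    using 1[of l k d c] by (simp add: mult_ac add_ac)
  have "of_nat (Poly_Mapping.lookup (k + l) v) * (c * d) =
      of_nat (Poly_Mapping.lookup k v) * c * d + c * (of_nat (Poly_Mapping.lookup l v) * d)"
    by (simp add: lookup_add algebra_simps)
  then show ?thesis
    unfolding mult_single mpderiv_single e_def[symmetric] by (simp only: single_add 1 2)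
qed

lemma mpderiv_mult: "mpderiv v (f * g) = mpderiv v f * g + f * mpderiv v g"
proof -
  let ?s = "\<lambda>f k. Poly_Mapping.single k (Poly_Mapping.lookup f k)"
  let ?f = "\<Sum>k\<in>Poly_Mapping.keys f. ?s f k" and ?g = "\<Sum>l\<in>Poly_Mapping.keys g. ?s g l"
  have "mpderiv v (?f * ?g) = mpderiv v ?f * ?g + ?f * mpderiv v ?g"
    unfolding sum_product mpderiv_sum mpderiv_mult_single sum.distrib ..
  then show ?thesis using mpoly_sum_single[of f] mpoly_sum_single[of g] by simp
qed

lemma mpderiv_mconst [simp]: "mpderiv v (mconst c) = 0"
  by (simp add: mconst_def mpderiv_single)

lemma mpderiv_mvar: "mpderiv v (mvar w) = (if v = w then 1 else 0)"
  by (simp add: mvar_def mpderiv_single lookup_single when_def)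

lemma mpderiv_pol:
  assumes "f \<in> carrier (pol_ring V)"
  shows "mpderiv v f \<in> carrier (pol_ring V)"
  using assms by (induction rule: pol_induct) (simp_all add: mpderiv_add mpderiv_mult mpderiv_mvar pol_closed)

context pring
begin

lemma unit_inverse: "\<not> q dvd a \<Longrightarrow> \<exists>b. b * a = 1"
  using unit_iff[of a] by (auto simp: dvd_def mult.commute)

text \<open>Gram--Schmidt over the local ring.\<close>

lemma dual_vectors:
  fixes J :: "nat \<Rightarrow> 'v \<Rightarrow> 'r"
  assumes V: "finite V" and ind: "\<And>c. (\<And>v. v \<in> V \<Longrightarrow> q dvd (\<Sum>i<k. c i * J i v)) \<Longrightarrow> (\<And>i. i < k \<Longrightarrow> q dvd c i)"
  shows "\<exists>M. \<forall>i<k. \<forall>j<k. (\<Sum>v\<in>V. J i v * M j v) = (if i = j then 1 else 0)"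
  using ind
proof (induction k)
  case (Suc k)
  have ind': "q dvd c i" if c: "\<And>v. v \<in> V \<Longrightarrow> q dvd (\<Sum>i<k. c i * J i v)" and i: "i < k" for c i
  proof -
    have "q dvd (if i < k then c i else 0)"
      by (rule Suc.prems[of "\<lambda>i. if i < k then c i else 0" i]) (use c i in simp_all)
    then show ?thesis using i by simp
  qed
  have "\<exists>M. \<forall>i<k. \<forall>j<k. (\<Sum>v\<in>V. J i v * M j v) = (if i = j then 1 else 0)"
    by (rule Suc.IH) (rule ind')
  then obtain M where M: "\<forall>i<k. \<forall>j<k. (\<Sum>v\<in>V. J i v * M j v) = (if i = j then 1 else 0)" ..
  note M = M[rule_format]
  define s where "s i = (\<Sum>v\<in>V. J k v * M i v)" for i
  \<comment> \<open>The row \<open>J k\<close> minus its projection to the earlier rows. In this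
    combination \<open>J k\<close> has coefficient 1, so by independence modulo p some entry of r is
    a unit.\<close>
  define r where "r v = J k v - (\<Sum>i<k. s i * J i v)" for v
  have "\<exists>v\<in>V. \<not> q dvd r v"
  proof (rule ccontr)
    assume "\<not> (\<exists>v\<in>V. \<not> q dvd r v)"
    then have rv: "q dvd r v" if "v \<in> V" for v using that by blast
    have "q dvd (if k < k then - s k else 1)"
    proof (rule Suc.prems[of "\<lambda>i. if i < k then - s i else 1" k])
      fix v assume "v \<in> V"
      have "(\<Sum>i<Suc k. (if i < k then - s i else 1) * J i v) = r v"
        by (simp add: r_def sum_negf)
      then show "q dvd (\<Sum>i<Suc k. (if i < k then - s i else 1) * J i v)" using rv[OF \<open>v \<in> V\<close>] by simp
    qed simp
    then show False using q_not_dvd_1 by simp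
  qed
  then obtain v0 u where v0: "v0 \<in> V" and u: "u * r v0 = 1" using unit_inverse by blast
  \<comment> \<open>The unit vector at v0 minus its projection: it is orthogonal to the earlier rows
    and pairs with \<open>J k\<close> to the unit \<open>r v0\<close>.\<close>
  define N where "N v = (if v = v0 then 1 else 0) - (\<Sum>i<k. J i v0 * M i v)" for v
  have JN: "(\<Sum>v\<in>V. J j v * N v) = J j v0 - (\<Sum>i<k. J i v0 * (\<Sum>v\<in>V. J j v * M i v))" for j
  proof -
    have "(\<Sum>v\<in>V. J j v * N v) = (\<Sum>v\<in>V. (if v = v0 then J j v else 0) - (\<Sum>i<k. J i v0 * (J j v * M i v)))"
      by (rule sum.cong) (simp_all add: N_def right_diff_distrib sum_distrib_left mult_ac)
    also have "\<dots> = J j v0 - (\<Sum>v\<in>V. \<Sum>i<k. J i v0 * (J j v * M i v))"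
      using V v0 by (simp add: sum_subtractf)
    also have "(\<Sum>v\<in>V. \<Sum>i<k. J i v0 * (J j v * M i v)) = (\<Sum>i<k. \<Sum>v\<in>V. J i v0 * (J j v * M i v))"
      by (rule sum.swap)
    finally show ?thesis by (simp add: sum_distrib_left)
  qed
  have JN0: "(\<Sum>v\<in>V. J j v * N v) = 0" if "j < k" for j
  proof -
    have "(\<Sum>i<k. J i v0 * (\<Sum>v\<in>V. J j v * M i v)) = (\<Sum>i<k. if j = i then J i v0 else 0)"
      by (rule sum.cong) (use M[OF that] in auto)
    then show ?thesis using JN[of j] that by simp
  qed
  have JN1: "(\<Sum>v\<in>V. J k v * N v) = r v0"
    unfolding JN r_def s_def by (simp add: mult.commute)
  \<comment> \<open>\<open>u * N\<close> is dual to the new row, and subtracting its multiple by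
    \<open>s j\<close> makes the old dual vectors orthogonal to that row.\<close>
  define M' where "M' j v = (if j < k then M j v - s j * (u * N v) else u * N v)" for j v
  have e: "(\<Sum>v\<in>V. J i v * (u * N v)) = u * (\<Sum>v\<in>V. J i v * N v)" for i
    by (simp add: sum_distrib_left mult_ac)
  have e': "(\<Sum>v\<in>V. J i v * M' j v) = (\<Sum>v\<in>V. J i v * M j v) - s j * (u * (\<Sum>v\<in>V. J i v * N v))" if "j < k" for i j
    using that by (simp add: M'_def right_diff_distrib sum_subtractf sum_distrib_left mult_ac)
  have "(\<Sum>v\<in>V. J i v * M' j v) = (if i = j then 1 else 0)" if "i < Suc k" "j < Suc k" for i j
  proof (cases "j < k")
    case True
    show ?thesis
    proof (cases "i < k")
      case True
      then show ?thesis using e'[OF \<open>j < k\<close>] M \<open>j < k\<close> JN0 by simp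
    next
      case False
      then have "i = k" using that by simp
      then show ?thesis using e'[OF \<open>j < k\<close>, of k] \<open>j < k\<close> by (simp add: JN1 u s_def)
    qed
  next
    case False
    then have "j = k" using that by simp
    then show ?thesis using that by (cases "i = k") (simp_all add: M'_def e JN0 JN1 u)
  qed
  then show ?case by blast
qed simp

lemma pev_shift:
  assumes f: "f \<in> carrier (pol_ring V)" and V: "finite V" and H: "\<And>v. v \<in> V \<Longrightarrow> H v \<in> FR U \<epsilon>" and r: "r \<ge> 1"
  obtains g where "g \<in> FR U \<epsilon>" "\<And>a. pev (\<lambda>v. e v + q ^ r * H v a) f = pev e f + q * g a"
proof -
  have Q: "(\<lambda>a. e v + q ^ r * H v a) \<in> FR U \<epsilon>" if "v \<in> V" for v
    by (intro FR_add FR_mult FR_const H that)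
  have "\<exists>E. (\<forall>w\<in>V. E w \<in> FR U \<epsilon>) \<and> (\<forall>a. pev (\<lambda>v. e v + q ^ r * H v a) f - pev (\<lambda>v. e v) f =
      (\<Sum>v\<in>V. (e v + q ^ r * H v a - e v) * E v a))"
    by (rule diff_poly[OF f Q FR_const V])
  then obtain E where E: "\<forall>w\<in>V. E w \<in> FR U \<epsilon>" "\<forall>a. pev (\<lambda>v. e v + q ^ r * H v a) f - pev (\<lambda>v. e v) f =
      (\<Sum>v\<in>V. (e v + q ^ r * H v a - e v) * E v a)" by blast
  obtain r' where r': "r = Suc r'" using r by (cases r) auto
  let ?g = "\<lambda>a. \<Sum>v\<in>V. q ^ r' * H v a * E v a"
  have "pev (\<lambda>v. e v + q ^ r * H v a) f - pev e f = q * ?g a" for a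
    using E(2)[rule_format, of a] by (simp add: r' sum_distrib_left mult_ac)
  then have "pev (\<lambda>v. e v + q ^ r * H v a) f = pev e f + q * ?g a" for a by (simp add: algebra_simps)
  moreover have "?g \<in> FR U \<epsilon>"
    by (intro FR_sum FR_mult FR_const H E(1)[rule_format])
  ultimately show thesis by (rule that[rotated])
qed

text \<open>The derivatives are taken at the fixed point e instead of the current point
  \<open>e + q^r * Z\<close>. As r is at least 1, this change and all terms of higher order are
  divisible by p beyond \<open>q^r\<close> and are absorbed by \<open>q * B v\<close>. One fixed
  Jacobian therefore serves for the whole Newton iteration.\<close>

lemma taylor:
  assumes g: "g \<in> carrier (pol_ring V)" and V: "finite V" and r: "r \<ge> 1"
    and Z: "\<And>v. v \<in> V \<Longrightarrow> Z v \<in> FR U \<epsilon>" and H: "\<And>v. v \<in> V \<Longrightarrow> H v \<in> FR U \<epsilon>"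
  shows "\<exists>B. (\<forall>v\<in>V. B v \<in> FR U \<epsilon>) \<and> (\<forall>a. pev (\<lambda>v. e v + q ^ r * (Z v a + H v a)) g - pev (\<lambda>v. e v + q ^ r * Z v a) g =
    q ^ r * (\<Sum>v\<in>V. H v a * (pev e (mpderiv v g) + q * B v a)))"
  using g
proof (induction rule: pol_induct)
  case (const c)
  show ?case by (rule exI[of _ "\<lambda>v a. 0"]) (simp add: FR_const pev_hom)
next
  case (var w)
  have "(\<Sum>v\<in>V. H v a * pev e (mpderiv v (mvar w))) = H w a" for a
  proof -
    have "(\<Sum>v\<in>V. H v a * pev e (mpderiv v (mvar w))) = (\<Sum>v\<in>V. if v = w then H v a else 0)"
      by (rule sum.cong) (simp_all add: mpderiv_mvar pev_hom)
    then show ?thesis using V var by simp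
  qed
  then show ?case by (intro exI[of _ "\<lambda>v a. 0"]) (simp add: FR_const algebra_simps)
next
  case (add f g)
  from add(3) obtain A where A: "\<forall>v\<in>V. A v \<in> FR U \<epsilon>" "\<forall>a. pev (\<lambda>v. e v + q ^ r * (Z v a + H v a)) f - pev (\<lambda>v. e v + q ^ r * Z v a) f =
    q ^ r * (\<Sum>v\<in>V. H v a * (pev e (mpderiv v f) + q * A v a))" by blast
  from add(4) obtain B where B: "\<forall>v\<in>V. B v \<in> FR U \<epsilon>" "\<forall>a. pev (\<lambda>v. e v + q ^ r * (Z v a + H v a)) g - pev (\<lambda>v. e v + q ^ r * Z v a) g =
    q ^ r * (\<Sum>v\<in>V. H v a * (pev e (mpderiv v g) + q * B v a))" by blast
  have "pev (\<lambda>v. e v + q ^ r * (Z v a + H v a)) (f + g) - pev (\<lambda>v. e v + q ^ r * Z v a) (f + g) =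
    q ^ r * (\<Sum>v\<in>V. H v a * (pev e (mpderiv v (f + g)) + q * (A v a + B v a)))" for a
  proof -
    have "(\<Sum>v\<in>V. H v a * (pev e (mpderiv v (f + g)) + q * (A v a + B v a))) =
      (\<Sum>v\<in>V. H v a * (pev e (mpderiv v f) + q * A v a)) + (\<Sum>v\<in>V. H v a * (pev e (mpderiv v g) + q * B v a))"
      by (simp add: mpderiv_add pev_hom(2) algebra_simps flip: sum.distrib)
    then have "q ^ r * (\<Sum>v\<in>V. H v a * (pev e (mpderiv v (f + g)) + q * (A v a + B v a))) =
      q ^ r * (\<Sum>v\<in>V. H v a * (pev e (mpderiv v f) + q * A v a)) + q ^ r * (\<Sum>v\<in>V. H v a * (pev e (mpderiv v g) + q * B v a))"
      by (simp only: distrib_left)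
    then show ?thesis unfolding A(2)[rule_format, symmetric] B(2)[rule_format, symmetric] pev_hom(2) by simp
  qed
  then show ?case
    using A(1) B(1) by (intro exI[of _ "\<lambda>v a. A v a + B v a"]) (simp add: FR_add)
next
  case (mult f g)
  let ?n = "\<lambda>a v. e v + q ^ r * (Z v a + H v a)" and ?o = "\<lambda>a v. e v + q ^ r * Z v a"
  from mult(3) obtain A where A: "\<forall>v\<in>V. A v \<in> FR U \<epsilon>" "\<forall>a. pev (?n a) f - pev (?o a) f =
    q ^ r * (\<Sum>v\<in>V. H v a * (pev e (mpderiv v f) + q * A v a))" by blast
  from mult(4) obtain B where B: "\<forall>v\<in>V. B v \<in> FR U \<epsilon>" "\<forall>a. pev (?n a) g - pev (?o a) g =
    q ^ r * (\<Sum>v\<in>V. H v a * (pev e (mpderiv v g) + q * B v a))" by blast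
  have ZH: "(\<lambda>a. Z v a + H v a) \<in> FR U \<epsilon>" if "v \<in> V" for v using that by (intro FR_add Z H)
  obtain \<gamma> where \<gamma>: "\<gamma> \<in> FR U \<epsilon>" "\<And>a. pev (?n a) g = pev e g + q * \<gamma> a"
    by (rule pev_shift[where e = e and H = "\<lambda>v a. Z v a + H v a", OF mult(2) V ZH r]) (assumption, rule that)
  obtain \<eta> where \<eta>: "\<eta> \<in> FR U \<epsilon>" "\<And>a. pev (?o a) f = pev e f + q * \<eta> a"
    by (rule pev_shift[where e = e and H = Z, OF mult(1) V Z r]) (assumption, rule that)
  have n: "(\<lambda>a. pev (?n a) g) \<in> FR U \<epsilon>" "(\<lambda>a. pev (?o a) f) \<in> FR U \<epsilon>"
    unfolding \<gamma>(2) \<eta>(2) by (intro FR_add FR_mult FR_const \<gamma>(1) \<eta>(1))+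
  \<comment> \<open>The difference of the products telescopes through the new value of g and the old
    value of f. Both agree with the values at e up to the multiples \<open>q * \<gamma>\<close> and
    \<open>q * \<eta>\<close>, which enter the correction term.\<close>
  let ?C = "\<lambda>v a. A v a * pev (?n a) g + pev e (mpderiv v f) * \<gamma> a + pev (?o a) f * B v a + \<eta> a * pev e (mpderiv v g)"
  have "?C v \<in> FR U \<epsilon>" if "v \<in> V" for v
    by (intro FR_add FR_mult FR_const n \<gamma>(1) \<eta>(1) A(1)[rule_format] B(1)[rule_format] that)
  moreover have "pev (?n a) (f * g) - pev (?o a) (f * g) = q ^ r * (\<Sum>v\<in>V. H v a * (pev e (mpderiv v (f * g)) + q * ?C v a))" for a
  proof -
    have "H v a * (pev e (mpderiv v (f * g)) + q * ?C v a) =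
      H v a * (pev e (mpderiv v f) + q * A v a) * pev (?n a) g + pev (?o a) f * (H v a * (pev e (mpderiv v g) + q * B v a))" for v
      unfolding mpderiv_mult pev_hom(2,3) \<gamma>(2) \<eta>(2) by (simp add: algebra_simps)
    then have "q ^ r * (\<Sum>v\<in>V. H v a * (pev e (mpderiv v (f * g)) + q * ?C v a)) =
      q ^ r * ((\<Sum>v\<in>V. H v a * (pev e (mpderiv v f) + q * A v a)) * pev (?n a) g +
        pev (?o a) f * (\<Sum>v\<in>V. H v a * (pev e (mpderiv v g) + q * B v a)))"
      by (simp only: sum.distrib sum_distrib_right sum_distrib_left)
    also have "\<dots> = (q ^ r * (\<Sum>v\<in>V. H v a * (pev e (mpderiv v f) + q * A v a))) * pev (?n a) g +
        pev (?o a) f * (q ^ r * (\<Sum>v\<in>V. H v a * (pev e (mpderiv v g) + q * B v a)))"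
      by (simp only: distrib_left mult.assoc mult.left_commute)
    also have "\<dots> = (pev (?n a) f - pev (?o a) f) * pev (?n a) g + pev (?o a) f * (pev (?n a) g - pev (?o a) g)"
      by (simp only: A(2)[rule_format] B(2)[rule_format])
    finally show ?thesis unfolding pev_hom(3) by (simp add: algebra_simps)
  qed
  ultimately show ?case by (intro exI[of _ ?C]) simp
qed

text \<open>Smoothness at the prime ideal of polynomials whose value at the unit is divisible by p.
  At this prime, \<open>h\<close> outside it means that the value of h at the unit is invertible,
  and independence of the differentials becomes independence modulo p of the rows of the Jacobian
  matrix at the unit.\<close>

lemma smooth_chart:
  assumes G: "is_group_scheme G" and sm: "smooth G"
  obtains gs h where "set gs \<subseteq> eqs G" "h \<in> carrier (pol_ring (vars G))" "\<not> q dvd pev (gunit G) h"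
    "\<And>f. f \<in> eqs G \<Longrightarrow> \<exists>N. h ^ N * f \<in> Idl\<^bsub>pol_ring (vars G)\<^esub> (set gs)"
    "\<And>c i. (\<And>v. v \<in> vars G \<Longrightarrow> q dvd (\<Sum>i<length gs. c i * pev (gunit G) (mpderiv v (gs ! i)))) \<Longrightarrow>
      i < length gs \<Longrightarrow> q dvd c i"
proof -
  let ?V = "vars G" and ?e = "gunit G"
  let ?A = "pol_ring ?V :: ('a, 'r) mpoly ring"
  let ?P = "{f \<in> carrier ?A. q dvd pev ?e f}"
  have idl: "ideal ?P ?A"
    by (rule cring.ideal_closedI[OF cring_pol_ring]) (auto simp: pol_closed pev_hom)
  have "primeideal ?P ?A"
  proof (rule primeidealI[OF idl cring_pol_ring])
    have "(1 :: ('a, 'r) mpoly) \<notin> ?P" by (simp add: pev_hom q_not_dvd_1)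
    then show "carrier ?A \<noteq> ?P" using pol_1 by blast
    fix a b assume "a \<in> carrier ?A" "b \<in> carrier ?A" "a \<otimes>\<^bsub>?A\<^esub> b \<in> ?P"
    then show "a \<in> ?P \<or> b \<in> ?P" by (simp add: pev_hom q_prime)
  qed
  moreover have "eqs G \<subseteq> ?P" using gs_eqs[OF G] gs_unit[OF G] by (auto simp: zpt_def)
  ultimately have PG: "primeideal ?P ?A \<and> eqs G \<subseteq> ?P" ..
  obtain gs where gs: "set gs \<subseteq> eqs G"
      "\<exists>h \<in> carrier ?A - ?P. \<forall>f\<in>eqs G. \<exists>N. h ^ N * f \<in> Idl\<^bsub>?A\<^esub> (set gs)"
      "\<forall>c. (\<forall>i<length gs. c i \<in> carrier ?A) \<and>
         (\<forall>v\<in>?V. (\<Sum>i<length gs. c i * mpderiv v (gs ! i)) \<in> ?P) \<longrightarrow> (\<forall>i<length gs. c i \<in> ?P)"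
    using sm[unfolded smooth_def Let_def, THEN spec, THEN mp, OF PG] by (elim exE conjE) (rule that)
  obtain h where h: "h \<in> carrier ?A - ?P" "\<forall>f\<in>eqs G. \<exists>N. h ^ N * f \<in> Idl\<^bsub>?A\<^esub> (set gs)" using gs(2) ..
  show thesis
  proof (rule that[of gs h])
    show "\<not> q dvd pev ?e h" using h(1) by simp
    show "\<exists>N. h ^ N * f \<in> Idl\<^bsub>?A\<^esub> (set gs)" if "f \<in> eqs G" for f using h(2) that by simp
    fix c i assume c: "\<And>v. v \<in> ?V \<Longrightarrow> q dvd (\<Sum>i<length gs. c i * pev ?e (mpderiv v (gs ! i)))" and i: "i < length gs"
    have gp: "gs ! i \<in> carrier ?A" if "i < length gs" for i using that gs(1) gs_eqs[OF G] nth_mem by blast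
    have "(\<Sum>i<length gs. mconst (c i) * mpderiv v (gs ! i)) \<in> ?P" if "v \<in> ?V" for v
      using c[OF that] by (auto intro!: pol_sum pol_closed mpderiv_pol gp simp: pev_hom)
    then have "\<forall>i<length gs. mconst (c i) \<in> ?P" using gs(3)[rule_format, of "\<lambda>i. mconst (c i)"] by simp
    then show "q dvd c i" using i by simp
  qed (use gs(1) h(1) in auto)
qed

text \<open>
  Newton iteration: subtracting from \<open>z\<close> the values of the equations, multiplied by a fixed
  right inverse of the Jacobian at the unit, makes these values divisible by one more power of \<open>p\<close>.
\<close>

lemma newton_retraction:
  assumes G: "is_group_scheme G" and sm: "smooth G" and r: "r \<ge> 1"
  obtains k g w C \<rho> where
    "\<And>i. i < k \<Longrightarrow> g i \<in> eqs G"
    "\<And>i z. i < k \<Longrightarrow> pev (\<lambda>v. gunit G v + q ^ r * z v) (g i) = q ^ r * w i z"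
    "\<And>v i. v \<in> vars G \<Longrightarrow> i < (k::nat) \<Longrightarrow> C v i \<in> An (vars G)"
    "\<And>v z. v \<in> vars G \<Longrightarrow> z v - \<rho> z v = (\<Sum>i<k. C v i z * w i z)"
    "\<And>z. zpt G (\<lambda>v. gunit G v + q ^ r * \<rho> z v)"
proof -
  let ?V = "vars G" and ?e = "gunit G"
  have V: "finite ?V" by (rule gs_finite[OF G])
  obtain gs h where gs: "set gs \<subseteq> eqs G" and h: "h \<in> carrier (pol_ring ?V)" "\<not> q dvd pev ?e h"
    and gen: "\<And>f. f \<in> eqs G \<Longrightarrow> \<exists>N. h ^ N * f \<in> Idl\<^bsub>pol_ring ?V\<^esub> (set gs)"
    and ind: "\<And>c i. (\<And>v. v \<in> ?V \<Longrightarrow> q dvd (\<Sum>i<length gs. c i * pev ?e (mpderiv v (gs ! i)))) \<Longrightarrow>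
      i < length gs \<Longrightarrow> q dvd c i"
    by (rule smooth_chart[OF G sm]) blast
  define k where "k = length gs"
  define g where "g i = gs ! i" for i
  define J where "J i v = pev ?e (mpderiv v (g i))" for i v
  have ge: "g i \<in> eqs G" if "i < k" for i using that gs nth_mem by (auto simp: g_def k_def)
  have gp: "g i \<in> carrier (pol_ring ?V)" if "i < k" for i by (rule gs_eqs[OF G ge[OF that]])
  have g0: "pev ?e (g i) = 0" if "i < k" for i using gs_unit[OF G] ge[OF that] by (simp add: zpt_def)
  have ind': "q dvd c i" if "\<And>v. v \<in> ?V \<Longrightarrow> q dvd (\<Sum>i<k. c i * J i v)" "i < k" for c i
    using ind[of c i] that by (simp add: k_def J_def g_def)
  have "\<exists>M. \<forall>i<k. \<forall>j<k. (\<Sum>v\<in>?V. J i v * M j v) = (if i = j then 1 else 0)"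
    by (rule dual_vectors[OF V]) (rule ind')
  then obtain M where "\<forall>i<k. \<forall>j<k. (\<Sum>v\<in>?V. J i v * M j v) = (if i = j then 1 else 0)" ..
  note M = this[rule_format]
  have coord: "(\<lambda>z. z v) \<in> An ?V" if "v \<in> ?V" for v using FR_coord[OF that, of "\<lambda>a. a"] by simp
  \<comment> \<open>Since \<open>g i\<close> vanishes at the unit, its value at
    \<open>e + q^r * z\<close> is divisible by \<open>q^r\<close>; the quotient is
    \<open>w i z\<close>.\<close>
  have w_ex: "\<exists>W. W \<in> An ?V \<and> (\<forall>z. pev (\<lambda>v. ?e v + q ^ r * z v) (g i) = q ^ r * W z)" if i: "i < k" for i
  proof -
    have "\<exists>B. (\<forall>v\<in>?V. B v \<in> An ?V) \<and> (\<forall>z. pev (\<lambda>v. ?e v + q ^ r * (0 + z v)) (g i) - pev (\<lambda>v. ?e v + q ^ r * 0) (g i) =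
      q ^ r * (\<Sum>v\<in>?V. z v * (pev ?e (mpderiv v (g i)) + q * B v z)))"
      by (rule taylor[OF gp[OF i] V r, where Z = "\<lambda>v z. 0" and H = "\<lambda>v z. z v"]) (rule FR_const, rule coord)
    then obtain B where B: "\<forall>v\<in>?V. B v \<in> An ?V" "\<forall>z. pev (\<lambda>v. ?e v + q ^ r * (0 + z v)) (g i) - pev (\<lambda>v. ?e v + q ^ r * 0) (g i) =
      q ^ r * (\<Sum>v\<in>?V. z v * (pev ?e (mpderiv v (g i)) + q * B v z))" by blast
    have "(\<lambda>z. \<Sum>v\<in>?V. z v * (pev ?e (mpderiv v (g i)) + q * B v z)) \<in> An ?V"
      by (intro FR_sum FR_mult FR_add FR_const coord B(1)[rule_format])
    moreover have "pev (\<lambda>v. ?e v + q ^ r * z v) (g i) = q ^ r * (\<Sum>v\<in>?V. z v * (pev ?e (mpderiv v (g i)) + q * B v z))" for z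
      using B(2)[rule_format, of z] g0[OF i] by simp
    ultimately show ?thesis by (intro exI conjI allI)
  qed
  define w where "w i = (SOME W. W \<in> An ?V \<and> (\<forall>z. pev (\<lambda>v. ?e v + q ^ r * z v) (g i) = q ^ r * W z))" for i
  have "w i \<in> An ?V \<and> (\<forall>z. pev (\<lambda>v. ?e v + q ^ r * z v) (g i) = q ^ r * w i z)" if "i < k" for i
    unfolding w_def by (rule someI_ex[OF w_ex[OF that]])
  note w = conjunct1[OF this] spec[OF conjunct2[OF this]]
  \<comment> \<open>The Newton step: M is a right inverse of the Jacobian matrix J at the
    unit.\<close>
  define H where "H v z = - (\<Sum>j<k. M j v * w j z)" for v z
  define N where "N z = (\<lambda>v. z v + H v z)" for z
  have HA: "H v \<in> An ?V" for v
    unfolding H_def by (intro FR_uminus FR_sum FR_mult FR_const w(1)) simp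
  \<comment> \<open>The linear terms cancel by the choice of M. What is left is not only divisible
    by p but a combination of the old values \<open>w j z\<close>, which keeps the iteration inside
    the ideal that they generate.\<close>
  have Dm_ex: "\<exists>Dm. (\<forall>j<k. Dm j \<in> An ?V) \<and> (\<forall>z. w i (N z) = q * (\<Sum>j<k. Dm j z * w j z))" if i: "i < k" for i
  proof -
    have "\<exists>B. (\<forall>v\<in>?V. B v \<in> An ?V) \<and> (\<forall>z. pev (\<lambda>v. ?e v + q ^ r * (z v + H v z)) (g i) - pev (\<lambda>v. ?e v + q ^ r * z v) (g i) =
      q ^ r * (\<Sum>v\<in>?V. H v z * (pev ?e (mpderiv v (g i)) + q * B v z)))"
      by (rule taylor[OF gp[OF i] V r, where Z = "\<lambda>v z. z v" and H = "\<lambda>v z. H v z"]) (rule coord, assumption, rule HA)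
    then obtain B where B: "\<forall>v\<in>?V. B v \<in> An ?V" "\<forall>z. pev (\<lambda>v. ?e v + q ^ r * (z v + H v z)) (g i) - pev (\<lambda>v. ?e v + q ^ r * z v) (g i) =
      q ^ r * (\<Sum>v\<in>?V. H v z * (J i v + q * B v z))" unfolding J_def by blast
    define Dm where "Dm j z = - (\<Sum>v\<in>?V. M j v * B v z)" for j z
    have "Dm j \<in> An ?V" for j
      unfolding Dm_def by (intro FR_uminus FR_sum FR_mult FR_const B(1)[rule_format])
    moreover have "w i (N z) = q * (\<Sum>j<k. Dm j z * w j z)" for z
    proof -
      have "q ^ r * (w i (N z) - w i z) = q ^ r * (\<Sum>v\<in>?V. H v z * (J i v + q * B v z))"
        using B(2)[rule_format, of z] w(2)[OF i, of z] w(2)[OF i, of "N z"] by (simp add: N_def algebra_simps)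
      then have 1: "w i (N z) - w i z = (\<Sum>v\<in>?V. H v z * (J i v + q * B v z))" by simp
      have "(\<Sum>v\<in>?V. H v z * J i v) = - (\<Sum>v\<in>?V. \<Sum>j<k. w j z * (J i v * M j v))"
        by (simp add: H_def sum_negf sum_distrib_left sum_distrib_right mult_ac)
      also have "(\<Sum>v\<in>?V. \<Sum>j<k. w j z * (J i v * M j v)) = (\<Sum>j<k. \<Sum>v\<in>?V. w j z * (J i v * M j v))"
        by (rule sum.swap)
      also have "\<dots> = (\<Sum>j<k. if j = i then w j z else 0)"
        by (rule sum.cong) (use M[OF i] in \<open>auto simp flip: sum_distrib_left\<close>)
      also have "\<dots> = w i z" using i by simp
      finally have 2: "(\<Sum>v\<in>?V. H v z * J i v) = - w i z" .
      have "(\<Sum>v\<in>?V. H v z * B v z) = - (\<Sum>v\<in>?V. \<Sum>j<k. w j z * (M j v * B v z))"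
        by (simp add: H_def sum_negf sum_distrib_left sum_distrib_right mult_ac)
      also have "(\<Sum>v\<in>?V. \<Sum>j<k. w j z * (M j v * B v z)) = (\<Sum>j<k. \<Sum>v\<in>?V. w j z * (M j v * B v z))"
        by (rule sum.swap)
      also have "- \<dots> = (\<Sum>j<k. Dm j z * w j z)"
        by (simp add: Dm_def sum_negf sum_distrib_left sum_distrib_right mult_ac)
      finally have 3: "(\<Sum>v\<in>?V. H v z * B v z) = (\<Sum>j<k. Dm j z * w j z)" .
      have "(\<Sum>v\<in>?V. H v z * (J i v + q * B v z)) = (\<Sum>v\<in>?V. H v z * J i v) + q * (\<Sum>v\<in>?V. H v z * B v z)"
        by (simp add: distrib_left sum.distrib sum_distrib_left mult_ac)
      then have "w i (N z) - w i z = - w i z + q * (\<Sum>j<k. Dm j z * w j z)" using 1 by (simp only: 2 3)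
      then show ?thesis by simp
    qed
    ultimately show ?thesis by (intro exI[of _ Dm] conjI allI impI)
  qed
  define Dm where "Dm i = (SOME Dm. (\<forall>j<k. Dm j \<in> An ?V) \<and> (\<forall>z. w i (N z) = q * (\<Sum>j<k. Dm j z * w j z)))" for i
  have "(\<forall>j<k. Dm i j \<in> An ?V) \<and> (\<forall>z. w i (N z) = q * (\<Sum>j<k. Dm i j z * w j z))" if "i < k" for i
    unfolding Dm_def by (rule someI_ex[OF Dm_ex[OF that]])
  note Dm = conjunct1[OF this, rule_format] conjunct2[OF this, rule_format]
  have NN: "(N ^^ Suc n) z v = (N ^^ n) z v + H v ((N ^^ n) z)" for n z v
    by (simp add: N_def)
  have NA: "(\<lambda>z. (N ^^ n) z v) \<in> An ?V" if "v \<in> ?V" for n v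
    using that
  proof (induction n arbitrary: v)
    case (Suc n)
    have "(\<lambda>z. H v (\<lambda>v. (N ^^ n) z v)) \<in> An ?V" by (rule FR_comp[OF HA Suc.IH])
    then have "(\<lambda>z. (N ^^ n) z v + H v ((N ^^ n) z)) \<in> An ?V" using FR_add[OF Suc.IH[OF Suc.prems]] by simp
    then show ?case unfolding NN .
  qed (simp add: coord)
  \<comment> \<open>The product of the matrices \<open>Dm\<close> along the first n steps; it
    expresses the values after n steps by the initial values \<open>w j z\<close>, up to the factor
    \<open>q^n\<close>.\<close>
  define DD where "DD = rec_nat (\<lambda>i j z. if i = j then 1 else 0) (\<lambda>n d i j z. \<Sum>l<k. Dm i l ((N ^^ n) z) * d l j z)"
  have DD0: "DD 0 i j z = (if i = j then 1 else 0)" and DDS: "DD (Suc n) i j z = (\<Sum>l<k. Dm i l ((N ^^ n) z) * DD n l j z)" for n i j z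
    by (simp_all add: DD_def)
  have DDA: "DD n i j \<in> An ?V" if "i < k" "j < k" for n i j
    using that(1)
  proof (induction n arbitrary: i)
    case 0
    have "DD 0 i j = (\<lambda>z. if i = j then 1 else 0)" by (rule ext) (rule DD0)
    then show ?case by (simp only: FR_const)
  next
    case (Suc n)
    have 1: "(\<lambda>z. Dm i l (\<lambda>v. (N ^^ n) z v)) \<in> An ?V" if "l < k" for l
      by (rule FR_comp[OF Dm(1)[OF Suc.prems that] NA])
    have "(\<lambda>z. \<Sum>l<k. Dm i l (\<lambda>v. (N ^^ n) z v) * DD n l j z) \<in> An ?V"
      by (intro FR_sum FR_mult 1 Suc.IH) simp_all
    moreover have "DD (Suc n) i j = (\<lambda>z. \<Sum>l<k. Dm i l (\<lambda>v. (N ^^ n) z v) * DD n l j z)" by (rule ext) (rule DDS)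
    ultimately show ?case by simp
  qed
  have wN: "w i ((N ^^ n) z) = q ^ n * (\<Sum>j<k. DD n i j z * w j z)" if "i < k" for i n z
    using that
  proof (induction n arbitrary: i)
    case 0
    have "(\<Sum>j<k. DD 0 i j z * w j z) = (\<Sum>j<k. if j = i then w j z else 0)"
      by (rule sum.cong) (simp_all add: DD0)
    then show ?case using 0 by simp
  next
    case (Suc n)
    have "w i ((N ^^ Suc n) z) = q * (\<Sum>l<k. Dm i l ((N ^^ n) z) * w l ((N ^^ n) z))"
      using Dm(2)[OF Suc.prems, of "(N ^^ n) z"] by simp
    also have "\<dots> = q * (\<Sum>l<k. \<Sum>j<k. q ^ n * (Dm i l ((N ^^ n) z) * DD n l j z * w j z))"
      using Suc.IH by (simp add: sum_distrib_left mult_ac)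
    also have "(\<Sum>l<k. \<Sum>j<k. q ^ n * (Dm i l ((N ^^ n) z) * DD n l j z * w j z)) =
       (\<Sum>j<k. \<Sum>l<k. q ^ n * (Dm i l ((N ^^ n) z) * DD n l j z * w j z))" by (rule sum.swap)
    also have "\<dots> = q ^ n * (\<Sum>j<k. DD (Suc n) i j z * w j z)"
      unfolding DDS sum_distrib_left sum_distrib_right ..
    finally show ?case by (simp only: power_Suc mult.assoc)
  qed
  \<comment> \<open>All Newton corrections are collected as coefficients of the initial
    \<open>w l z\<close>. These coefficients converge on their own, so the total correction is an
    exact combination of the \<open>w l z\<close>, and no closure of the ideal is taken.\<close>
  have "\<exists>S. S \<in> An ?V \<and> (\<forall>n z. q ^ n dvd S z - (\<Sum>m<n. q ^ m * (\<Sum>j<k. M j v * DD m j l z)))" if l: "l < k" for v l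
  proof -
    have "(\<lambda>z. \<Sum>j<k. M j v * DD m j l z) \<in> An ?V" for m
      by (intro FR_sum FR_mult FR_const DDA l) simp
    then obtain S where "S \<in> An ?V" "\<And>n z. q ^ n dvd S z - (\<Sum>m<n. q ^ m * (\<Sum>j<k. M j v * DD m j l z))"
      by (rule FR_qsum[of "\<lambda>m z. \<Sum>j<k. M j v * DD m j l z"]) (rule that)
    then show ?thesis by (intro exI[of _ S] conjI allI)
  qed
  note S_ex = this
  define C where "C v l = (SOME S. S \<in> An ?V \<and> (\<forall>n z. q ^ n dvd S z - (\<Sum>m<n. q ^ m * (\<Sum>j<k. M j v * DD m j l z))))" for v l
  have C: "C v l \<in> An ?V \<and> (\<forall>n z. q ^ n dvd C v l z - (\<Sum>m<n. q ^ m * (\<Sum>j<k. M j v * DD m j l z)))" if "l < k" for v l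
    unfolding C_def by (rule someI_ex[OF S_ex[OF that]])
  define \<rho> where "\<rho> z v = z v - (\<Sum>l<k. C v l z * w l z)" for z v
  have HN: "H v ((N ^^ m) z) = - (\<Sum>l<k. q ^ m * (\<Sum>j<k. M j v * DD m j l z) * w l z)" for v m z
  proof -
    have "H v ((N ^^ m) z) = - (\<Sum>j<k. \<Sum>l<k. q ^ m * (M j v * DD m j l z) * w l z)"
      unfolding H_def by (simp add: wN sum_distrib_left mult_ac)
    also have "(\<Sum>j<k. \<Sum>l<k. q ^ m * (M j v * DD m j l z) * w l z) = (\<Sum>l<k. \<Sum>j<k. q ^ m * (M j v * DD m j l z) * w l z)"
      by (rule sum.swap)
    finally show ?thesis by (simp only: sum_distrib_left sum_distrib_right)
  qed
  have NS: "(N ^^ n) z v = z v - (\<Sum>l<k. (\<Sum>m<n. q ^ m * (\<Sum>j<k. M j v * DD m j l z)) * w l z)" for n z v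
  proof (induction n)
    case (Suc n)
    show ?case unfolding NN HN Suc by (simp add: distrib_right sum.distrib)
  qed simp
  have \<rho>N: "q ^ n dvd \<rho> z v - (N ^^ n) z v" for n z v
  proof -
    have "\<rho> z v - (N ^^ n) z v = - (\<Sum>l<k. (C v l z - (\<Sum>m<n. q ^ m * (\<Sum>j<k. M j v * DD m j l z))) * w l z)"
      unfolding NS \<rho>_def by (simp add: left_diff_distrib sum_subtractf)
    moreover have "q ^ n dvd (\<Sum>l<k. (C v l z - (\<Sum>m<n. q ^ m * (\<Sum>j<k. M j v * DD m j l z))) * w l z)"
      by (rule dvd_sum, rule dvd_mult2, rule C[THEN conjunct2, rule_format]) simp
    ultimately show ?thesis by simp
  qed
  have g\<rho>: "pev (\<lambda>v. ?e v + q ^ r * \<rho> z v) (g i) = 0" if i: "i < k" for i z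
  proof (rule eq_by_approx)
    fix n
    have 1: "q ^ n dvd pev (\<lambda>v. ?e v + q ^ r * \<rho> z v) (g i) - pev (\<lambda>v. ?e v + q ^ r * (N ^^ n) z v) (g i)"
    proof (rule pev_cong_mod[OF gp[OF i]])
      fix v
      have "(?e v + q ^ r * \<rho> z v) - (?e v + q ^ r * (N ^^ n) z v) = q ^ r * (\<rho> z v - (N ^^ n) z v)"
        by (simp add: algebra_simps)
      then show "q ^ n dvd (?e v + q ^ r * \<rho> z v) - (?e v + q ^ r * (N ^^ n) z v)"
        using \<rho>N[of n z v] by simp
    qed
    have 2: "q ^ n dvd pev (\<lambda>v. ?e v + q ^ r * (N ^^ n) z v) (g i)"
      unfolding w(2)[OF i, of "(N ^^ n) z"] wN[OF i] by simp
    show "q ^ n dvd pev (\<lambda>v. ?e v + q ^ r * \<rho> z v) (g i) - 0" using dvd_add[OF 1 2] by simp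
  qed
  show thesis
  proof (rule that[of k g w C \<rho>])
    show "C v i \<in> An ?V" if "i < k" for v i by (rule conjunct1[OF C[OF that]])
    show "z v - \<rho> z v = (\<Sum>i<k. C v i z * w i z)" for z v by (simp add: \<rho>_def)
    fix z
    let ?b = "\<lambda>v. ?e v + q ^ r * \<rho> z v"
    show "zpt G ?b"
      unfolding zpt_def
    proof
      fix f assume f: "f \<in> eqs G"
      \<comment> \<open>A power of h times f lies in the ideal generated by \<open>gs\<close>, and
        the value of h at this point is congruent to its value at the unit, hence nonzero.\<close>
      obtain N where N: "h ^ N * f \<in> Idl\<^bsub>pol_ring ?V\<^esub> (set gs)" using gen[OF f] by blast
      have "pev ?b (h ^ N * f) = 0"
      proof (rule pol_genideal_vanishes[OF _ _ N])
        show "set gs \<subseteq> carrier (pol_ring ?V)" using gs gs_eqs[OF G] by blast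
        fix f assume "f \<in> set gs"
        then obtain i where "i < k" "f = g i" by (auto simp: in_set_conv_nth g_def k_def)
        then show "pev ?b f = 0" using g\<rho> by simp
      qed
      moreover have "pev ?b h \<noteq> 0"
      proof
        assume "pev ?b h = 0"
        moreover have "q ^ 1 dvd pev ?b h - pev ?e h"
          by (rule pev_cong_mod[OF h(1)]) (use r in \<open>simp add: dvd_mult2 dvd_power\<close>)
        ultimately show False using h(2) by simp
      qed
      ultimately show "pev ?b f = 0" by (simp add: pev_hom)
    qed
  qed (use ge w(2) in simp_all)
qed

section \<open>Retractions onto the Lie algebras\<close>

text \<open>Ideal membership expressed on functions, where compositions and twists are easier to
  handle. Evaluation on dense points is injective on series, which allows a return to membership of
  the series.\<close>

definition FId :: "('w, 'r) mfps set \<Rightarrow> ('a \<Rightarrow> 'w \<Rightarrow> 'r) \<Rightarrow> ('a \<Rightarrow> 'r) set" where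
  "FId I e = {P. \<exists>f\<in>I. \<forall>a. P a = feval p (e a) f}"

lemma FId_I: "f \<in> I \<Longrightarrow> (\<And>a. P a = feval p (e a) f) \<Longrightarrow> P \<in> FId I e"
  by (auto simp: FId_def)

lemma FId_closed:
  assumes "ideal I (rps_ring p W :: ('w, 'r) mfps ring)"
  shows FId_0: "(\<lambda>a. 0) \<in> FId I e"
    and FId_add: "P \<in> FId I e \<Longrightarrow> Q \<in> FId I e \<Longrightarrow> (\<lambda>a. P a + Q a) \<in> FId I e"
    and FId_mult: "c \<in> FR W e \<Longrightarrow> P \<in> FId I e \<Longrightarrow> (\<lambda>a. c a * P a) \<in> FId I e"
    and FId_FR: "P \<in> FId I e \<Longrightarrow> P \<in> FR W e"
proof -
  note I = rps_ideal_closed[OF assms]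
  show "(\<lambda>a. 0) \<in> FId I e" by (rule FId_I[OF I(3)]) simp
  show "P \<in> FR W e" if P: "P \<in> FId I e"
  proof -
    obtain f where "f \<in> I" "\<forall>a. P a = feval p (e a) f" using P unfolding FId_def by blast
    then show ?thesis using I(4) by (intro FR_I[of f]) auto
  qed
  show "(\<lambda>a. P a + Q a) \<in> FId I e" if P: "P \<in> FId I e" and Q: "Q \<in> FId I e"
  proof -
    obtain f g where f: "f \<in> I" "\<forall>a. P a = feval p (e a) f" and g: "g \<in> I" "\<forall>a. Q a = feval p (e a) g"
      using P Q unfolding FId_def by blast
    show ?thesis
      by (rule FId_I[OF I(1)[OF f(1) g(1)]]) (simp add: f(2) g(2) feval_add[OF I(4)[OF f(1)] I(4)[OF g(1)]])
  qed
  show "(\<lambda>a. c a * P a) \<in> FId I e" if c: "c \<in> FR W e" and P: "P \<in> FId I e"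
  proof -
    obtain g where g: "g \<in> rs W" "\<And>a. c a = feval p (e a) g" using c by (rule FR_E) blast
    obtain f where f: "f \<in> I" "\<forall>a. P a = feval p (e a) f" using P unfolding FId_def by blast
    show ?thesis
      by (rule FId_I[OF I(2)[OF f(1) g(1)]]) (simp add: f(2) g(2) feval_mult[OF g(1) I(4)[OF f(1)]])
  qed
qed

lemma FId_sum:
  assumes "ideal I (rps_ring p W :: ('w, 'r) mfps ring)" "\<And>i. i \<in> A \<Longrightarrow> P i \<in> FId I e"
  shows "(\<lambda>a. \<Sum>i\<in>A. P i a) \<in> FId I e"
  using assms(2)
  by (induction A rule: infinite_finite_induct) (simp_all add: FId_0[OF assms(1)] FId_add[OF assms(1)])

text \<open>The Newton retraction, conjugated by the formula for \<open>exq r\<close>: in order r it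
  is twisted by \<open>\<phi>^r\<close> and shifted by the derivative of the unit, and in lower
  orders it is constant. The point to prove is that the corrections lie in the ideal, i.e. that the
  twisted \<open>w i\<close> do.\<close>

lemma Lie_retraction:
  assumes G: "is_group_scheme G" and sm: "smooth G" and r: "r \<ge> 1"
  obtains \<rho> where "\<And>w. w \<in> vars G \<times> {..r} \<Longrightarrow> (\<lambda>a. a w - \<rho> a w) \<in> FId (feqs (Lie p \<phi> r G)) (\<lambda>a. a)"
    "\<And>a. restrict (\<rho> a) (vars G \<times> {..r}) \<in> Lie_pts p \<phi> r G"
proof -
  let ?V = "vars G" and ?e = "gunit G" and ?W = "vars G \<times> {..r}" and ?I = "feqs (Lie p \<phi> r G)"
  have V: "finite ?V" by (rule gs_finite[OF G])
  have I: "ideal ?I (rps_ring p ?W)" by (rule Lie_props(1)[OF G])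
  obtain k g w C \<sigma> where g: "\<And>i. i < k \<Longrightarrow> g i \<in> eqs G"
    and w: "\<And>i z. i < k \<Longrightarrow> pev (\<lambda>v. ?e v + q ^ r * z v) (g i) = q ^ r * w i z"
    and C: "\<And>v i. v \<in> ?V \<Longrightarrow> i < (k::nat) \<Longrightarrow> C v i \<in> An ?V"
    and \<sigma>: "\<And>v z. v \<in> ?V \<Longrightarrow> z v - \<sigma> z v = (\<Sum>i<k. C v i z * w i z)"
    and \<sigma>pt: "\<And>z. zpt G (\<lambda>v. ?e v + q ^ r * \<sigma> z v)"
    by (rule newton_retraction[OF G sm r]) (rule that)
  define Z where "Z a v = (\<psi> ^^ r) (a (v, r) - (\<delta> ^^ r) (?e v))" for a :: "'a \<times> nat \<Rightarrow> 'r" and v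
  define \<rho> where "\<rho> a = (\<lambda>(v, i). if i < r then (\<delta> ^^ i) (?e v) else (\<delta> ^^ r) (?e v) + (\<phi> ^^ r) (\<sigma> (Z a) v))" for a
  have coord: "u \<in> ?W \<Longrightarrow> (\<lambda>a. a u) \<in> An ?W" for u using FR_coord[of u ?W "\<lambda>a. a"] by simp
  have low: "(\<lambda>a. a (v, i) - (\<delta> ^^ i) (?e v)) \<in> FId ?I (\<lambda>a. a)" if v: "v \<in> ?V" and i: "i < r" for v i
  proof (rule FId_I)
    have 1: "fvar (v, i) \<in> rs (?V \<times> {..r - 1})" using v i by (intro rs_fvar) auto
    have 2: "cst ((\<delta> ^^ i) (?e v)) \<in> rs (?V \<times> {..r - 1})" by (rule rs_cst)
    have "fvar (v, i) - cst ((\<delta> ^^ i) (?e v)) \<in> ugens r G"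
      unfolding ugens_def using v i rs_diff[OF 1 2] by (auto simp: feval_diff[OF 1 2] jet_unit_D)
    then show "fvar (v, i) - cst ((\<delta> ^^ i) (?e v)) \<in> ?I" using Lie_props(4)[OF G] by blast
    show "a (v, i) - (\<delta> ^^ i) (?e v) = feval p a (fvar (v, i) - cst ((\<delta> ^^ i) (?e v)))" for a
      by (simp add: feval_diff[OF 1 2])
  qed
  have wI: "(\<lambda>a. (\<phi> ^^ r) (w i (Z a))) \<in> FId ?I (\<lambda>a. a)" if i: "i < k" for i
  proof -
    let ?j = "jet_lift p \<phi> r (of_poly (g i))"
    \<comment> \<open>After the coordinates of order below r are replaced by those of the unit, the
      lower lifts of \<open>g i\<close> vanish, and \<open>shs_pow\<close> identifies the twisted
      \<open>w i\<close> with the lift of order r.\<close>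
    define low' where "low' a = (\<lambda>(v, i). if i < r then (\<delta> ^^ i) (?e v) else a (v, i))" for a :: "'a \<times> nat \<Rightarrow> 'r"
    have gr: "of_poly (g i) \<in> rs ?V" by (rule rs_of_poly[OF gs_eqs[OF G g[OF i]]])
    have j: "?j \<in> rs ?W" by (rule jet_lift_rs[OF gr])
    have jI: "?j \<in> ?I" using Lie_props(3)[OF G] cmp_props(2)[OF G g[OF i]] by (auto simp: jgens_def)
    have val: "(\<phi> ^^ r) (w i (Z a)) = feval p (low' a) ?j" for a
    proof -
      have c0: "feval p (low' a) (jet_lift p \<phi> l (of_poly (g i))) = (\<delta> ^^ l) 0" if "l < r" for l
      proof -
        have "feval p (low' a) (jet_lift p \<phi> l (of_poly (g i))) = feval p (D ?e) (jet_lift p \<phi> l (of_poly (g i)))"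
          by (rule feval_cong[OF jet_lift_rs[OF gr]]) (use that in \<open>auto simp: low'_def\<close>)
        also have "\<dots> = (\<delta> ^^ l) (pev ?e (g i))" by (simp add: feval_D_jet_lift[OF gr] feval_pev)
        finally show ?thesis using gs_unit[OF G] g[OF i] by (simp add: zpt_def)
      qed
      have ex: "exq r (low' a) v = ?e v + q ^ r * Z a v" for v
        by (subst exq_formula[where e = ?e]) (simp_all add: low'_def Z_def)
      have "q ^ r * w i (Z a) = pev (exq r (low' a)) (g i)" using w[OF i, of "Z a"] by (simp add: ex[abs_def])
      also have "\<dots> = (shs ^^ r) (\<lambda>l. feval p (low' a) (jet_lift p \<phi> l (of_poly (g i)))) 0"
        using exq_jet_lift[OF gr, of r "low' a"] by (simp add: feval_pev)
      also have "\<dots> = 0 + q ^ r * (\<psi> ^^ r) (feval p (low' a) ?j - (\<delta> ^^ r) 0)"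
        by (rule shs_pow) (rule c0)
      finally have "w i (Z a) = (\<psi> ^^ r) (feval p (low' a) ?j)" by simp
      then show ?thesis by simp
    qed
    have h: "(\<lambda>a. feval p a ?j) \<in> An ?W" by (rule FR_I[OF j]) simp
    have Q': "(\<lambda>a. low' a u) \<in> An ?W" if "u \<in> ?W" for u
      using coord[OF that] by (cases "snd u < r") (simp_all add: low'_def FR_const case_prod_beta)
    \<comment> \<open>Undoing the replacement changes the value of the lift by a combination of the
      differences \<open>a u - low' a u\<close>, each of which is 0 or an equation of the Lie
      algebra.\<close>
    obtain E where E: "\<And>u. u \<in> ?W \<Longrightarrow> E u \<in> An ?W"
      "\<And>a. feval p (\<lambda>u. a u) ?j - feval p (\<lambda>u. low' a u) ?j = (\<Sum>u\<in>?W. (a u - low' a u) * E u a)"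
      by (rule diff_analytic[where Q = "\<lambda>u a. a u" and Q' = "\<lambda>u a. low' a u", OF h coord Q'])
        (use V in \<open>auto intro: that\<close>)
    have "(\<lambda>a. \<Sum>u\<in>?W. E u a * (a u - low' a u)) \<in> FId ?I (\<lambda>a. a)"
    proof (rule FId_sum[OF I], rule FId_mult[OF I E(1)])
      fix u assume u: "u \<in> ?W"
      show "(\<lambda>a. a u - low' a u) \<in> FId ?I (\<lambda>a. a)"
        using u low[of "fst u" "snd u"]
        by (cases "snd u < r") (auto simp: low'_def case_prod_beta FId_0[OF I])
    qed
    moreover have "(\<lambda>a. feval p a ?j) \<in> FId ?I (\<lambda>a. a)" by (rule FId_I[OF jI]) simp
    ultimately have "(\<lambda>a. feval p a ?j + (- 1) * (\<Sum>u\<in>?W. E u a * (a u - low' a u))) \<in> FId ?I (\<lambda>a. a)"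
      using FId_add[OF I] FId_mult[OF I FR_const[of "- 1"]] by blast
    moreover have "(\<phi> ^^ r) (w i (Z a)) = feval p a ?j + (- 1) * (\<Sum>u\<in>?W. E u a * (a u - low' a u))" for a
      using E(2)[of a] by (simp add: val mult.commute algebra_simps)
    ultimately show ?thesis by simp
  qed
  have CA: "(\<lambda>a. (\<phi> ^^ r) (C v i (Z a))) \<in> An ?W" if v: "v \<in> ?V" and i: "i < k" for v i
  proof -
    have "(\<lambda>a. a (v, r) - (\<delta> ^^ r) (?e v)) \<in> An ?W" if "v \<in> ?V" for v
      by (intro FR_diff FR_const coord) (use that in auto)
    from FR_comp[where Q = "\<lambda>v a. a (v, r) - (\<delta> ^^ r) (?e v)", OF An_twist_pow[OF C[OF v i], of r] this]
    show ?thesis by (simp add: Z_def[abs_def])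
  qed
  show thesis
  proof (rule that[of \<rho>])
    fix u assume u: "u \<in> ?W"
    obtain v i where ui: "u = (v, i)" by force
    then have v: "v \<in> ?V" and i: "i \<le> r" using u by auto
    show "(\<lambda>a. a u - \<rho> a u) \<in> FId ?I (\<lambda>a. a)"
    proof (cases "i < r")
      case True
      then show ?thesis using low[OF v True] by (simp add: ui \<rho>_def)
    next
      case False
      then have "i = r" using i by simp
      have "a u - \<rho> a u = (\<Sum>i<k. (\<phi> ^^ r) (C v i (Z a)) * (\<phi> ^^ r) (w i (Z a)))" for a
      proof -
        have "(\<phi> ^^ r) (Z a v - \<sigma> (Z a) v) = (\<Sum>i<k. (\<phi> ^^ r) (C v i (Z a)) * (\<phi> ^^ r) (w i (Z a)))"
          unfolding \<sigma>[OF v] by (simp add: \<phi>_pow_hom)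
        then show ?thesis using \<open>i = r\<close> by (simp add: ui \<rho>_def \<phi>_pow_hom Z_def diff_diff_eq)
      qed
      moreover have "(\<lambda>a. \<Sum>i<k. (\<phi> ^^ r) (C v i (Z a)) * (\<phi> ^^ r) (w i (Z a))) \<in> FId ?I (\<lambda>a. a)"
        by (rule FId_sum[OF I], rule FId_mult[OF I CA[OF v] wI]) simp_all
      ultimately show ?thesis by simp
    qed
  next
    fix a
    let ?b = "restrict (\<rho> a) ?W"
    have "exq r ?b v = ?e v + q ^ r * \<sigma> (Z a) v" if "v \<in> ?V" for v
      by (subst exq_formula[where e = ?e]) (use that in \<open>simp_all add: \<rho>_def\<close>)
    then have "zpt G (exq r ?b)"
      by (subst zpt_cong[OF gs_affine[OF G], of _ "\<lambda>v. ?e v + q ^ r * \<sigma> (Z a) v"]) (simp_all add: \<sigma>pt)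
    then show "?b \<in> Lie_pts p \<phi> r G"
      unfolding Lie_pts_iff[OF G r] by (simp add: \<rho>_def)
  qed
qed

section \<open>Retractions of p-formal schemes and their products\<close>

definition wf_pf :: "('w, 'r) pformal \<Rightarrow> bool" where
  "wf_pf S \<longleftrightarrow> finite (fvars S) \<and> ideal (feqs S) (rps_ring p (fvars S))"

text \<open>Beyond fixing the points of S, the difference \<open>a w - \<rho> a w\<close> must be
  represented by an element of the ideal of S. Only in this form can it be differentiated to give
  elements of the ideals of the jet spaces.\<close>

definition retr :: "('w, 'r) pformal \<Rightarrow> (('w \<Rightarrow> 'r) \<Rightarrow> 'w \<Rightarrow> 'r) \<Rightarrow> bool" where
  "retr S \<rho> \<longleftrightarrow> (\<forall>w\<in>fvars S. (\<lambda>a. a w - \<rho> a w) \<in> FId (feqs S) (\<lambda>a. a)) \<and>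
    (\<forall>a. restrict (\<rho> a) (fvars S) \<in> fpts p S)"

lemma wf_Lie: "is_group_scheme G \<Longrightarrow> wf_pf (Lie p \<phi> r G)"
  by (simp add: wf_pf_def Lie_props gs_finite)

lemma wf_rs: "wf_pf S \<Longrightarrow> f \<in> feqs S \<Longrightarrow> f \<in> rs (fvars S)"
  unfolding wf_pf_def using rps_ideal_closed(4) by blast

lemma fpts_vanish: "a \<in> fpts p S \<Longrightarrow> f \<in> feqs S \<Longrightarrow> feval p a f = 0"
  by (simp add: fpts_def)

lemma fpts_vanish':
  assumes "wf_pf S" "restrict a (fvars S) \<in> fpts p S" "f \<in> feqs S"
  shows "feval p a f = 0"
  using fpts_vanish[OF assms(2,3)] feval_cong[OF wf_rs[OF assms(1,3)], of a "restrict a (fvars S)"] by simp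

lemma feval_fsubst_Inl: "feval p b (fsubst p id (\<lambda>v. fvar (Inl v)) f) = feval p (\<lambda>v. b (Inl v)) f"
  and fsubst_Inl_rs: "fsubst p id (\<lambda>v. fvar (Inl v)) f \<in> rs (Sum_Type.Plus V V')" if "f \<in> rs V" for b :: "'a + 'b \<Rightarrow> 'r" and V :: "'a set" and V' :: "'b set"
proof -
  have F: "v \<in> V \<Longrightarrow> fvar (Inl v) \<in> rs (Sum_Type.Plus V V')" for v by (rule rs_fvar) auto
  show "fsubst p id (\<lambda>v. fvar (Inl v)) f \<in> rs (Sum_Type.Plus V V')" by (rule fsubst_rs[OF rhom_id(1) that F])
  have "feval p b (fsubst p id (\<lambda>v. fvar (Inl v)) f) = id (feval p (\<lambda>v. id (feval p b (fvar (Inl v)))) f)"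
    by (rule feval_fsubst[OF rhom_id(1) that F]) simp_all
  then show "feval p b (fsubst p id (\<lambda>v. fvar (Inl v)) f) = feval p (\<lambda>v. b (Inl v)) f" by simp
qed

lemma feval_fsubst_Inr: "feval p b (fsubst p id (\<lambda>v. fvar (Inr v)) f) = feval p (\<lambda>v. b (Inr v)) f"
  and fsubst_Inr_rs: "fsubst p id (\<lambda>v. fvar (Inr v)) f \<in> rs (Sum_Type.Plus V V')" if "f \<in> rs V'" for b :: "'a + 'b \<Rightarrow> 'r" and V :: "'a set" and V' :: "'b set"
proof -
  have F: "v \<in> V' \<Longrightarrow> fvar (Inr v) \<in> rs (Sum_Type.Plus V V')" for v by (rule rs_fvar) auto
  show "fsubst p id (\<lambda>v. fvar (Inr v)) f \<in> rs (Sum_Type.Plus V V')" by (rule fsubst_rs[OF rhom_id(1) that F])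
  have "feval p b (fsubst p id (\<lambda>v. fvar (Inr v)) f) = id (feval p (\<lambda>v. id (feval p b (fvar (Inr v)))) f)"
    by (rule feval_fsubst[OF rhom_id(1) that F]) simp_all
  then show "feval p b (fsubst p id (\<lambda>v. fvar (Inr v)) f) = feval p (\<lambda>v. b (Inr v)) f" by simp
qed

lemma fprod_props:
  fixes S :: "('a, 'r) pformal" and T :: "('b, 'r) pformal"
  assumes S: "wf_pf S" and T: "wf_pf T"
  shows "wf_pf (fprod p S T)"
    "f \<in> feqs S \<Longrightarrow> fsubst p id (\<lambda>v. fvar (Inl v)) f \<in> feqs (fprod p S T)"
    "g \<in> feqs T \<Longrightarrow> fsubst p id (\<lambda>v. fvar (Inr v)) g \<in> feqs (fprod p S T)"
    "a \<in> fpts p (fprod p S T) \<longleftrightarrow> a \<in> Sum_Type.Plus (fvars S) (fvars T) \<rightarrow>\<^sub>E UNIV \<and>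
       restrict (\<lambda>v. a (Inl v)) (fvars S) \<in> fpts p S \<and> restrict (\<lambda>v. a (Inr v)) (fvars T) \<in> fpts p T"
proof -
  let ?W = "Sum_Type.Plus (fvars S) (fvars T)"
  let ?A = "fsubst p id (\<lambda>v. fvar (Inl v)) ` feqs S \<union> fsubst p id (\<lambda>w. fvar (Inr w)) ` feqs T :: ('a + 'b, 'r) mfps set"
  have A: "?A \<subseteq> rs ?W" using fsubst_Inl_rs[OF wf_rs[OF S]] fsubst_Inr_rs[OF wf_rs[OF T]] by blast
  note * = genideal_rs[OF A]
  have eq: "feqs (fprod p S T) = Idl\<^bsub>rps_ring p ?W\<^esub> ?A" and fv: "fvars (fprod p S T) = ?W" by (simp_all add: fprod_def)
  show "wf_pf (fprod p S T)" using S T *(1) by (simp add: wf_pf_def eq fv)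
  show 1: "fsubst p id (\<lambda>v. fvar (Inl v)) f \<in> feqs (fprod p S T)" if "f \<in> feqs S" for f using *(2) that eq by blast
  show 2: "fsubst p id (\<lambda>v. fvar (Inr v)) f \<in> feqs (fprod p S T)" if "f \<in> feqs T" for f using *(2) that eq by blast
  show "a \<in> fpts p (fprod p S T) \<longleftrightarrow> a \<in> ?W \<rightarrow>\<^sub>E UNIV \<and>
       restrict (\<lambda>v. a (Inl v)) (fvars S) \<in> fpts p S \<and> restrict (\<lambda>v. a (Inr v)) (fvars T) \<in> fpts p T"
  proof
    assume a: "a \<in> fpts p (fprod p S T)"
    have "feval p (restrict (\<lambda>v. a (Inl v)) (fvars S)) f = 0" if f: "f \<in> feqs S" for f
      using fpts_vanish[OF a 1[OF f]] feval_cong[OF wf_rs[OF S f], of "restrict (\<lambda>v. a (Inl v)) (fvars S)" "\<lambda>v. a (Inl v)"]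
      by (simp add: feval_fsubst_Inl[OF wf_rs[OF S f]])
    moreover have "feval p (restrict (\<lambda>v. a (Inr v)) (fvars T)) f = 0" if f: "f \<in> feqs T" for f
      using fpts_vanish[OF a 2[OF f]] feval_cong[OF wf_rs[OF T f], of "restrict (\<lambda>v. a (Inr v)) (fvars T)" "\<lambda>v. a (Inr v)"]
      by (simp add: feval_fsubst_Inr[OF wf_rs[OF T f]])
    moreover have "a \<in> ?W \<rightarrow>\<^sub>E UNIV" using a fv by (simp add: fpts_def)
    ultimately show "a \<in> ?W \<rightarrow>\<^sub>E UNIV \<and>
       restrict (\<lambda>v. a (Inl v)) (fvars S) \<in> fpts p S \<and> restrict (\<lambda>v. a (Inr v)) (fvars T) \<in> fpts p T"
      by (simp add: fpts_def)
  next
    assume a: "a \<in> ?W \<rightarrow>\<^sub>E UNIV \<and>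
       restrict (\<lambda>v. a (Inl v)) (fvars S) \<in> fpts p S \<and> restrict (\<lambda>v. a (Inr v)) (fvars T) \<in> fpts p T"
    have v: "feval p a f = 0" if "f \<in> ?A" for f
      using that
    proof
      assume "f \<in> fsubst p id (\<lambda>v. fvar (Inl v)) ` feqs S"
      then obtain g where g: "g \<in> feqs S" "f = fsubst p id (\<lambda>v. fvar (Inl v)) g" by blast
      then show ?thesis using fpts_vanish'[OF S, of "\<lambda>v. a (Inl v)" g] a by (simp add: feval_fsubst_Inl[OF wf_rs[OF S g(1)]])
    next
      assume "f \<in> fsubst p id (\<lambda>v. fvar (Inr v)) ` feqs T"
      then obtain g where g: "g \<in> feqs T" "f = fsubst p id (\<lambda>v. fvar (Inr v)) g" by blast
      then show ?thesis using fpts_vanish'[OF T, of "\<lambda>v. a (Inr v)" g] a by (simp add: feval_fsubst_Inr[OF wf_rs[OF T g(1)]])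
    qed
    have "feval p a f = 0" if "f \<in> feqs (fprod p S T)" for f
      by (rule genideal_vanishes[OF A v that[unfolded eq]])
    then show "a \<in> fpts p (fprod p S T)" using a fv by (simp add: fpts_def)
  qed
qed

lemma retr_fprod:
  assumes S: "wf_pf S" and T: "wf_pf T" and \<rho>: "retr S \<rho>" and \<tau>: "retr T \<tau>"
  shows "retr (fprod p S T) (\<lambda>a. case_sum (\<rho> (\<lambda>v. a (Inl v))) (\<tau> (\<lambda>v. a (Inr v))))"
    (is "retr _ ?\<rho>")
proof -
  let ?W = "Sum_Type.Plus (fvars S) (fvars T)"
  have fv: "fvars (fprod p S T) = ?W" by (simp add: fprod_def)
  have l: "(\<lambda>a. a (Inl w) - \<rho> (\<lambda>v. a (Inl v)) w) \<in> FId (feqs (fprod p S T)) (\<lambda>a. a)" if "w \<in> fvars S" for w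
  proof -
    have "(\<lambda>a. a w - \<rho> a w) \<in> FId (feqs S) (\<lambda>a. a)" using \<rho> that by (simp add: retr_def)
    then obtain f where f: "f \<in> feqs S" "\<forall>a. a w - \<rho> a w = feval p a f" unfolding FId_def by blast
    show ?thesis
      by (rule FId_I[OF fprod_props(2)[OF S T f(1)]]) (simp add: feval_fsubst_Inl[OF wf_rs[OF S f(1)]] f(2)[rule_format, symmetric])
  qed
  have r: "(\<lambda>a. a (Inr w) - \<tau> (\<lambda>v. a (Inr v)) w) \<in> FId (feqs (fprod p S T)) (\<lambda>a. a)" if "w \<in> fvars T" for w
  proof -
    have "(\<lambda>a. a w - \<tau> a w) \<in> FId (feqs T) (\<lambda>a. a)" using \<tau> that by (simp add: retr_def)
    then obtain f where f: "f \<in> feqs T" "\<forall>a. a w - \<tau> a w = feval p a f" unfolding FId_def by blast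
    show ?thesis
      by (rule FId_I[OF fprod_props(3)[OF S T f(1)]]) (simp add: feval_fsubst_Inr[OF wf_rs[OF T f(1)]] f(2)[rule_format, symmetric])
  qed
  have "restrict (?\<rho> a) ?W \<in> fpts p (fprod p S T)" for a
    unfolding fprod_props(4)[OF S T] using \<rho> \<tau> by (simp add: retr_def InlI InrI cong: restrict_cong)
  then show ?thesis
    unfolding retr_def fv using l r by (auto elim!: PlusE)
qed

section \<open>Delta-maps are determined by their values on points\<close>

lemma FR_D_coord: "v \<in> V \<Longrightarrow> i \<le> n \<Longrightarrow> (\<lambda>a. (\<delta> ^^ i) (a v)) \<in> FR (V \<times> {..n}) D"
  using FR_coord[of "(v, i)" "V \<times> {..n}" D] by simp

lemma FR_D_mono: "P \<in> FR (V \<times> {..i}) D \<Longrightarrow> i \<le> j \<Longrightarrow> P \<in> FR (V \<times> {..j}) D"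
  by (erule FR_mono) auto

lemma FR_\<delta>:
  assumes "P \<in> FR (V \<times> {..n}) D"
  shows "(\<lambda>a. \<delta> (P a)) \<in> FR (V \<times> {..Suc n}) D"
proof -
  obtain f where f: "f \<in> rs (V \<times> {..n})" "\<And>a. P a = feval p (D a) f" using assms by (rule FR_E) blast
  let ?g = "pderivation p (jet_frob p \<phi>) f"
  have g: "?g \<in> rs (V \<times> {..Suc n})" "of_nat p * ?g = jet_frob p \<phi> f - f ^ p" using pderivation_mfps[OF f(1)] by auto
  have f': "f \<in> rs (V \<times> {..Suc n})" by (rule rs_mono[OF f(1)]) auto
  show ?thesis
  proof (rule FR_I[OF g(1)])
    fix a
    have "q * feval p (D a) ?g = feval p (D a) (jet_frob p \<phi> f - f ^ p)" unfolding g(2)[symmetric] by (simp add: feval_q1[OF g(1)])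
    also have "\<dots> = \<phi> (P a) - P a ^ p"
      by (simp add: feval_diff[OF jet_frob_rs[OF f(1)] rs_power[OF f']] feval_jet_frob[OF f(1)] sh_D feval_power[OF f'] f(2))
    finally show "\<delta> (P a) = feval p (D a) ?g" by (rule \<delta>_eqI)
  qed
qed

lemma FR_\<delta>_pow: "P \<in> FR (V \<times> {..n}) D \<Longrightarrow> (\<lambda>a. (\<delta> ^^ i) (P a)) \<in> FR (V \<times> {..n + i}) D"
  by (induction i) (simp_all add: FR_\<delta>)

lemma FR_\<phi>:
  assumes "P \<in> FR (V \<times> {..n}) D"
  shows "(\<lambda>a. \<phi> (P a)) \<in> FR (V \<times> {..Suc n}) D"
proof -
  have "P \<in> FR (V \<times> {..Suc n}) D" by (rule FR_D_mono[OF assms]) simp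
  from FR_add[OF FR_power[OF this] FR_mult[OF FR_const FR_\<delta>[OF assms]], of p q]
  show ?thesis by (simp only: \<phi>_\<delta>[symmetric])
qed

lemma FR_\<phi>_pow: "P \<in> FR (V \<times> {..n}) D \<Longrightarrow> (\<lambda>a. (\<phi> ^^ i) (P a)) \<in> FR (V \<times> {..n + i}) D"
  by (induction i) (simp_all add: FR_\<phi>)

section \<open>Derivatives of sums and products modulo an ideal\<close>

text \<open>By \<open>q_carry\<close>, \<open>c * carry c d\<close> is the quotient of
  \<open>(c + d)^p - c^p - d^p\<close> by p, the defect of additivity of \<delta>. One factor c is
  kept outside, so that the defect visibly lies in every ideal containing c.\<close>

definition carry :: "'r \<Rightarrow> 'r \<Rightarrow> 'r" where
  "carry c d = (\<Sum>k<p - 1. of_nat ((p choose Suc k) div p) * c ^ k * d ^ (p - Suc k))"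

lemma q_carry: "q * (c * carry c d) = (c + d) ^ p - c ^ p - d ^ p"
proof -
  obtain n where n: "p = Suc n" using p_pos by (cases p) auto
  have t: "q * (c * (of_nat ((p choose Suc k) div p) * c ^ k * d ^ (p - Suc k))) = of_nat (p choose Suc k) * c ^ Suc k * d ^ (p - Suc k)" if "k < n" for k
  proof -
    have "p dvd (p choose Suc k)" by (rule dvd_choose_prime) (use that n prime_p in auto)
    then have "of_nat (p choose Suc k) = q * of_nat ((p choose Suc k) div p)" by (metis dvd_mult_div_cancel of_nat_mult)
    then show ?thesis by (simp add: mult_ac)
  qed
  have "(c + d) ^ p = (\<Sum>k\<le>Suc n. of_nat (p choose k) * c ^ k * d ^ (p - k))"
    unfolding binomial_ring by (simp add: n)
  also have "\<dots> = d ^ p + (\<Sum>k\<le>n. of_nat (p choose Suc k) * c ^ Suc k * d ^ (p - Suc k))"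
    unfolding sum.atMost_Suc_shift by simp
  also have "(\<Sum>k\<le>n. of_nat (p choose Suc k) * c ^ Suc k * d ^ (p - Suc k)) =
      (\<Sum>k<n. of_nat (p choose Suc k) * c ^ Suc k * d ^ (p - Suc k)) + c ^ p"
    unfolding lessThan_Suc_atMost[symmetric] sum.lessThan_Suc by (simp add: n)
  also have "(\<Sum>k<n. of_nat (p choose Suc k) * c ^ Suc k * d ^ (p - Suc k)) = q * (c * carry c d)"
  proof -
    have "p - 1 = n" by (simp add: n)
    then show ?thesis
      unfolding carry_def sum_distrib_left by (intro sum.cong) (simp_all only: t lessThan_iff)
  qed
  finally show ?thesis by simp
qed

lemma \<delta>_add: "\<delta> (c + d) = \<delta> c + \<delta> d - c * carry c d"
  by (rule \<delta>_eqI) (simp add: right_diff_distrib distrib_left q_\<delta> q_carry \<phi>_add)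

text \<open>An asymmetric product rule: each summand has \<open>\<delta> c\<close> or c as a factor,
  as is needed to see that multiples of c remain in \<open>ker_jet\<close>.\<close>

lemma \<delta>_mult: "\<delta> (a * c) = \<phi> a * \<delta> c + (c ^ (p - 1) * \<delta> a) * c"
proof (rule \<delta>_eqI)
  have "c ^ (p - 1) * c = c ^ p" using p_pos by (simp flip: power_Suc2)
  then have "q * (c ^ (p - 1) * \<delta> a * c) = c ^ p * (q * \<delta> a)" by (metis mult.assoc mult.commute)
  moreover have "q * (\<phi> a * \<delta> c) = \<phi> a * (q * \<delta> c)" by (rule mult.left_commute)
  ultimately have "q * (\<phi> a * \<delta> c + c ^ (p - 1) * \<delta> a * c) = \<phi> a * (\<phi> c - c ^ p) + c ^ p * (\<phi> a - a ^ p)"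
    by (simp only: distrib_left q_\<delta>)
  then show "q * (\<phi> a * \<delta> c + c ^ (p - 1) * \<delta> a * c) = \<phi> (a * c) - (a * c) ^ p"
    by (simp add: \<phi>_mult power_mult_distrib algebra_simps)
qed

lemma FR_carry: "P \<in> FR W e \<Longrightarrow> Q \<in> FR W e \<Longrightarrow> (\<lambda>a. carry (P a) (Q a)) \<in> FR W e"
  unfolding carry_def by (intro FR_sum FR_mult FR_power FR_const)

text \<open>
  For the ideal \<open>I\<close> of a jet space these are the functions whose derivatives up to order \<open>i\<close>
  vanish on it; since \<open>\<delta>\<close> is not additive, \<open>carry\<close> is what makes them an ideal.
\<close>

definition ker_jet :: "'v set \<Rightarrow> (('v \<Rightarrow> 'r) \<Rightarrow> 'r) set \<Rightarrow> nat \<Rightarrow> nat \<Rightarrow> (('v \<Rightarrow> 'r) \<Rightarrow> 'r) set" where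
  "ker_jet V I i j = {c \<in> FR (V \<times> {..j}) D. \<forall>l\<le>i. (\<lambda>a. (\<delta> ^^ l) (c a)) \<in> I}"

lemma ker_jet_Suc:
  assumes "c \<in> ker_jet V I (Suc i) j"
  shows "c \<in> ker_jet V I i (Suc j)" "(\<lambda>a. \<delta> (c a)) \<in> ker_jet V I i (Suc j)"
proof -
  have c: "c \<in> FR (V \<times> {..j}) D" "\<And>l. l \<le> Suc i \<Longrightarrow> (\<lambda>a. (\<delta> ^^ l) (c a)) \<in> I"
    using assms by (auto simp: ker_jet_def)
  show "c \<in> ker_jet V I i (Suc j)" using c(2) FR_D_mono[OF c(1), of "Suc j"] by (simp add: ker_jet_def)
  have "(\<lambda>a. (\<delta> ^^ l) (\<delta> (c a))) \<in> I" if "l \<le> i" for l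
    using c(2)[of "Suc l"] that by (simp add: funpow_swap1)
  then show "(\<lambda>a. \<delta> (c a)) \<in> ker_jet V I i (Suc j)" using FR_\<delta>[OF c(1)] by (simp add: ker_jet_def)
qed

lemma ker_jet_SucI:
  assumes "c \<in> FR (V \<times> {..j}) D" "c \<in> I" "(\<lambda>a. \<delta> (c a)) \<in> ker_jet V I i (Suc j)"
  shows "c \<in> ker_jet V I (Suc i) j"
proof -
  have "(\<lambda>a. (\<delta> ^^ l) (c a)) \<in> I" if "l \<le> Suc i" for l
  proof (cases l)
    case (Suc l')
    then show ?thesis using assms(3) that by (simp add: ker_jet_def funpow_swap1)
  qed (use assms(2) in simp)
  then show ?thesis using assms(1) by (simp add: ker_jet_def)
qed

lemma ker_jet_I: "c \<in> ker_jet V I i j \<Longrightarrow> c \<in> I" and ker_jet_FR: "c \<in> ker_jet V I i j \<Longrightarrow> c \<in> FR (V \<times> {..j}) D"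
  unfolding ker_jet_def using le0 by force+

context
  fixes V :: "'v set" and I :: "(('v \<Rightarrow> 'r) \<Rightarrow> 'r) set" and m :: nat
  assumes I_add: "\<And>P Q. P \<in> I \<Longrightarrow> Q \<in> I \<Longrightarrow> (\<lambda>a. P a + Q a) \<in> I"
    and I_mult: "\<And>c P. c \<in> FR (V \<times> {..m}) D \<Longrightarrow> P \<in> I \<Longrightarrow> (\<lambda>a. c a * P a) \<in> I"
begin

text \<open>Sums and multiples are treated in one induction, because the derivative of a sum
  contains the multiple \<open>carry (c a) (d a) * c a\<close>, and the derivative of a multiple is
  a sum. Each differentiation lowers i and raises the order j, so the bound
  \<open>i + j \<le> m\<close> persists.\<close>

lemma ker_jet_ideal:
  "i + j \<le> m \<Longrightarrow> c \<in> ker_jet V I i j \<Longrightarrow>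
    (d \<in> ker_jet V I i j \<longrightarrow> (\<lambda>a. c a + d a) \<in> ker_jet V I i j) \<and>
    (b \<in> FR (V \<times> {..j}) D \<longrightarrow> (\<lambda>a. b a * c a) \<in> ker_jet V I i j)"
proof (induction i arbitrary: j c d b)
  case 0
  have m: "b \<in> FR (V \<times> {..m}) D" if "b \<in> FR (V \<times> {..j}) D" for b using FR_D_mono[OF that] 0 by simp
  show ?case using 0 I_add I_mult m by (simp add: ker_jet_def FR_add FR_mult)
next
  case (Suc i)
  have j: "i + Suc j \<le> m" using Suc.prems(1) by simp
  note c = ker_jet_Suc[OF Suc.prems(2)]
  have add: "x \<in> ker_jet V I i (Suc j) \<Longrightarrow> y \<in> ker_jet V I i (Suc j) \<Longrightarrow> (\<lambda>a. x a + y a) \<in> ker_jet V I i (Suc j)" for x y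
    using Suc.IH[OF j, of x y] by blast
  have mul: "x \<in> FR (V \<times> {..Suc j}) D \<Longrightarrow> y \<in> ker_jet V I i (Suc j) \<Longrightarrow> (\<lambda>a. x a * y a) \<in> ker_jet V I i (Suc j)" for x y
    using Suc.IH[OF j, of y] by blast
  have up: "x \<in> FR (V \<times> {..j}) D \<Longrightarrow> x \<in> FR (V \<times> {..Suc j}) D" "x \<in> FR (V \<times> {..j}) D \<Longrightarrow> x \<in> FR (V \<times> {..m}) D" for x
    using FR_D_mono[of x V j "Suc j"] FR_D_mono[of x V j m] j by simp_all
  note cF = ker_jet_FR[OF Suc.prems(2)] and cI = ker_jet_I[OF Suc.prems(2)]
  show ?case
  proof (intro conjI impI)
    assume dK: "d \<in> ker_jet V I (Suc i) j"
    note d = ker_jet_Suc[OF dK] and dF = ker_jet_FR[OF dK] and dI = ker_jet_I[OF dK]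
    show "(\<lambda>a. c a + d a) \<in> ker_jet V I (Suc i) j"
    proof (rule ker_jet_SucI)
      have "(\<lambda>a. \<delta> (c a) + \<delta> (d a) + - carry (c a) (d a) * c a) \<in> ker_jet V I i (Suc j)"
        by (intro add mul c d FR_uminus FR_carry up cF dF)
      then show "(\<lambda>a. \<delta> (c a + d a)) \<in> ker_jet V I i (Suc j)" by (simp add: \<delta>_add mult.commute)
    qed (intro FR_add cF dF, intro I_add cI dI)
  next
    assume b: "b \<in> FR (V \<times> {..j}) D"
    show "(\<lambda>a. b a * c a) \<in> ker_jet V I (Suc i) j"
    proof (rule ker_jet_SucI)
      have "(\<lambda>a. \<phi> (b a) * \<delta> (c a) + (c a ^ (p - 1) * \<delta> (b a)) * c a) \<in> ker_jet V I i (Suc j)"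
        by (intro add mul c FR_\<phi> FR_\<delta> FR_mult FR_power b up cF)
      then show "(\<lambda>a. \<delta> (b a * c a)) \<in> ker_jet V I i (Suc j)" by (simp add: \<delta>_mult)
    qed (intro FR_mult cF b, intro I_mult cI up b)
  qed
qed

text \<open>\<open>\<delta> (b + c)\<close> differs from \<open>\<delta> b\<close> by
  \<open>\<delta> c - carry c b * c\<close>, which is again in \<open>ker_jet\<close> with i lowered
  by one; the induction continues with this as the new increment.\<close>

lemma ker_jet_shift:
  "i + j \<le> m \<Longrightarrow> c \<in> ker_jet V I i j \<Longrightarrow> b \<in> FR (V \<times> {..j}) D \<Longrightarrow> (\<lambda>a. (\<delta> ^^ i) (b a + c a) - (\<delta> ^^ i) (b a)) \<in> I"
proof (induction i arbitrary: j b c)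
  case 0
  then show ?case by (simp add: ker_jet_def)
next
  case (Suc i)
  have j: "i + Suc j \<le> m" using Suc.prems(1) by simp
  note c = ker_jet_Suc[OF Suc.prems(2)] and cF = ker_jet_FR[OF Suc.prems(2)]
  have up: "x \<in> FR (V \<times> {..j}) D \<Longrightarrow> x \<in> FR (V \<times> {..Suc j}) D" for x
    using FR_D_mono[of x V j "Suc j"] by simp
  let ?c = "\<lambda>a. \<delta> (c a) + - carry (c a) (b a) * c a"
  have "(\<lambda>a. - carry (c a) (b a) * c a) \<in> ker_jet V I i (Suc j)"
    by (rule ker_jet_ideal[OF j c(1), THEN conjunct2, THEN mp]) (intro FR_uminus FR_carry up cF Suc.prems(3))
  then have "?c \<in> ker_jet V I i (Suc j)"
    by (rule ker_jet_ideal[OF j c(2), THEN conjunct1, THEN mp])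
  then have "(\<lambda>a. (\<delta> ^^ i) (\<delta> (b a) + ?c a) - (\<delta> ^^ i) (\<delta> (b a))) \<in> I"
    by (rule Suc.IH[OF j _ FR_\<delta>[OF Suc.prems(3)]])
  moreover have "\<delta> (b a + c a) = \<delta> (b a) + ?c a" for a
    using \<delta>_add[of "c a" "b a"] by (simp add: algebra_simps)
  ultimately show ?case by (simp only: funpow_Suc_right o_apply)
qed

end

lemma feval_D_lift0: "f \<in> rs V \<Longrightarrow> feval p (D a) (lift0 f) = feval p a f"
  by (simp add: feval_lift0)

text \<open>
  A retraction of the ambient affine space onto \<open>S\<close> makes the points of \<open>S\<close> dense in all its jet
  spaces: modulo the equations of the jet space, a series is its composition with the retraction.
\<close>

lemma jet_vanishing:
  assumes S: "wf_pf S" and \<rho>: "retr S \<rho>" and g: "g \<in> rs (fvars S \<times> {..m})"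
    and z: "\<And>a. restrict a (fvars S) \<in> fpts p S \<Longrightarrow> feval p (D a) g = 0"
  shows "g \<in> feqs (Jet p \<phi> m S)"
proof -
  let ?W = "fvars S" and ?I = "feqs (Jet p \<phi> m S)"
  let ?U = "fvars S \<times> {..m}"
  have Srs: "feqs S \<subseteq> rs ?W" using wf_rs[OF S] by blast
  note J = Jet_props[OF Srs, where n = m]
  have finU: "finite ?U" using S by (simp add: wf_pf_def)
  note Jadd = FId_add[OF J(1), where e = D] and Jmult = FId_mult[OF J(1), where e = D]
  have diff: "(\<lambda>a. (\<delta> ^^ i) (a w) - (\<delta> ^^ i) (\<rho> a w)) \<in> FId ?I D"
    and \<rho>F: "(\<lambda>a. \<rho> a w) \<in> FR (?W \<times> {..0}) D" if w: "w \<in> ?W" and i: "i \<le> m" for w i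
  proof -
    have "(\<lambda>a. a w - \<rho> a w) \<in> FId (feqs S) (\<lambda>a. a)" using \<rho> w by (simp add: retr_def)
    then obtain f where f: "f \<in> feqs S" "\<forall>a. a w - \<rho> a w = feval p a f" unfolding FId_def by blast
    have fr: "f \<in> rs ?W" by (rule wf_rs[OF S f(1)])
    \<comment> \<open>This difference is an equation of S, so all its derivatives are equations of
      the jet space. \<open>ker_jet_shift\<close> with increment \<open>?c\<close> then compares the
      derivatives of \<open>a w\<close> with those of \<open>\<rho> a w\<close>, although \<delta>
      is not additive.\<close>
    let ?c = "\<lambda>a. a w - \<rho> a w"
    have cF: "?c \<in> FR (?W \<times> {..0}) D"
      by (rule FR_I[OF lift0_rs[OF fr]]) (simp add: feval_D_lift0[OF fr] f(2)[rule_format, symmetric])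
    have "(\<lambda>a. (\<delta> ^^ l) (?c a)) \<in> FId ?I D" if "l \<le> i" for l
    proof (rule FId_I)
      have "jet_lift p \<phi> l f \<in> jgens m S"
        unfolding jgens_def using f(1) that i by (intro CollectI exI[of _ l] exI[of _ f]) simp
      then show "jet_lift p \<phi> l f \<in> ?I" using J(2) by blast
      show "(\<delta> ^^ l) (?c a) = feval p (D a) (jet_lift p \<phi> l f)" for a
        by (simp add: feval_D_jet_lift[OF fr] f(2)[rule_format, symmetric])
    qed
    then have c: "?c \<in> ker_jet ?W (FId ?I D) i 0" using cF by (simp add: ker_jet_def)
    have "(\<lambda>a. a w) \<in> FR (?W \<times> {..0}) D" using FR_D_coord[OF w, of 0 0] by simp
    from FR_diff[OF this cF] show r: "(\<lambda>a. \<rho> a w) \<in> FR (?W \<times> {..0}) D" by simp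
    have "(\<lambda>a. (\<delta> ^^ i) (\<rho> a w + ?c a) - (\<delta> ^^ i) (\<rho> a w)) \<in> FId ?I D"
      by (rule ker_jet_shift[OF Jadd Jmult _ c r]) (use i in simp_all)
    then show "(\<lambda>a. (\<delta> ^^ i) (a w) - (\<delta> ^^ i) (\<rho> a w)) \<in> FId ?I D" by simp
  qed
  have "\<exists>f. f \<in> rs ?U \<and> (\<forall>a. (\<delta> ^^ snd u) (\<rho> a (fst u)) = feval p (D a) f)" if "u \<in> ?U" for u
  proof -
    have u: "fst u \<in> ?W" "snd u \<le> m" using that by auto
    have "(\<lambda>a. (\<delta> ^^ snd u) (\<rho> a (fst u))) \<in> FR (?W \<times> {..0 + snd u}) D"
      by (rule FR_\<delta>_pow[OF \<rho>F[OF u(1) le0]])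
    then have "(\<lambda>a. (\<delta> ^^ snd u) (\<rho> a (fst u))) \<in> FR ?U D" by (rule FR_D_mono) (use u in simp)
    then show ?thesis unfolding FR_def by blast
  qed
  then have "\<forall>u\<in>?U. \<exists>f. f \<in> rs ?U \<and> (\<forall>a. (\<delta> ^^ snd u) (\<rho> a (fst u)) = feval p (D a) f)" by blast
  from bchoice[OF this] obtain R where R': "\<forall>u\<in>?U. R u \<in> rs ?U \<and> (\<forall>a. (\<delta> ^^ snd u) (\<rho> a (fst u)) = feval p (D a) (R u))" ..
  have R: "u \<in> ?U \<Longrightarrow> R u \<in> rs ?U" "u \<in> ?U \<Longrightarrow> feval p (D a) (R u) = (\<delta> ^^ snd u) (\<rho> a (fst u))" for u a
    using R'[THEN bspec, of u] by simp_all
  have tI: "fvar u - R u \<in> ?I" if u: "u \<in> ?U" for u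
  proof -
    have u': "fst u \<in> ?W" "snd u \<le> m" using u by auto
    obtain f where f: "f \<in> ?I" "\<forall>a. (\<delta> ^^ snd u) (a (fst u)) - (\<delta> ^^ snd u) (\<rho> a (fst u)) = feval p (D a) f"
      using diff[OF u'] unfolding FId_def by blast
    \<comment> \<open>So far the two series agree only as functions of jets \<open>D a\<close>;
      density of these jets makes them equal, and the difference can then be evaluated at arbitrary
      points.\<close>
    have "fvar u - R u = f"
    proof (rule FR_unique[OF dense_D])
      show "fvar u - R u \<in> rs ?U" "f \<in> rs ?U" using rs_fvar[OF u] R(1)[OF u] f(1) J(3) by (auto intro: rs_diff)
      show "feval p (D a) (fvar u - R u) = feval p (D a) f" for a
        unfolding feval_diff[OF rs_fvar[OF u] R(1)[OF u]] R(2)[OF u] f(2)[rule_format, symmetric]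
        by (simp add: D_def case_prod_beta)
    qed
    then show ?thesis using f(1) by simp
  qed
  have h: "(\<lambda>b. feval p b g) \<in> An ?U" by (rule FR_I[OF g]) simp
  have Q: "(\<lambda>b. b u) \<in> An ?U" if "u \<in> ?U" for u using FR_coord[OF that, of "\<lambda>a. a"] by simp
  have Q': "(\<lambda>b. feval p b (R u)) \<in> An ?U" if "u \<in> ?U" for u by (rule FR_I[OF R(1)[OF that]]) simp
  obtain E where E: "\<And>u. u \<in> ?U \<Longrightarrow> E u \<in> An ?U"
    "\<And>b. feval p (\<lambda>u. b u) g - feval p (\<lambda>u. feval p b (R u)) g = (\<Sum>u\<in>?U. (b u - feval p b (R u)) * E u b)"
    by (rule diff_analytic[where Q = "\<lambda>u b. b u" and Q' = "\<lambda>u b. feval p b (R u)", OF h Q Q' finU]) (assumption | rule that)+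
  have "(\<lambda>b. feval p (\<lambda>u. feval p b (R u)) g) \<in> An ?U"
    by (rule FR_comp[where Q = "\<lambda>u b. feval p b (R u)", OF h Q'])
  then obtain \<theta> where \<theta>: "\<theta> \<in> rs ?U" "\<And>b. feval p (\<lambda>u. feval p b (R u)) g = feval p b \<theta>" by (rule FR_E) blast
  \<comment> \<open>At a jet \<open>D a\<close> the series \<open>R\<close> take the coordinates of
    the jet of \<open>\<rho> a\<close>, where g vanishes because \<open>\<rho> a\<close> is a point
    of S.\<close>
  have "\<theta> = 0"
  proof (rule FR_unique[OF dense_D \<theta>(1) rs_0])
    fix a
    have "restrict (\<rho> a) ?W \<in> fpts p S" using \<rho> by (simp add: retr_def)
    then have 0: "feval p (D (\<rho> a)) g = 0" by (rule z)
    have "feval p (\<lambda>u. feval p (D a) (R u)) g = feval p (D (\<rho> a)) g"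
      by (rule feval_cong[OF g], subst R(2), assumption) (simp add: D_def case_prod_beta)
    then show "feval p (D a) \<theta> = feval p (D a) 0" using 0 \<theta>(2)[of "D a"] by simp
  qed
  then have zero: "feval p (\<lambda>u. feval p b (R u)) g = 0" for b using \<theta>(2)[of b] by simp
  have "(\<lambda>b. feval p b g) \<in> FId ?I (\<lambda>a. a)"
  proof -
    have "(\<lambda>b. \<Sum>u\<in>?U. E u b * (b u - feval p b (R u))) \<in> FId ?I (\<lambda>a. a)"
    proof (rule FId_sum[OF J(1)], rule FId_mult[OF J(1) E(1)])
      fix u assume u: "u \<in> ?U"
      show "(\<lambda>b. b u - feval p b (R u)) \<in> FId ?I (\<lambda>a. a)"
        by (rule FId_I[OF tI[OF u]]) (simp add: feval_diff[OF rs_fvar[OF u] R(1)[OF u]])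
    qed
    moreover have "feval p b g = (\<Sum>u\<in>?U. E u b * (b u - feval p b (R u)))" for b
      using E(2)[of b] zero[of b] by (simp add: mult.commute)
    ultimately show ?thesis by simp
  qed
  then obtain f where f: "f \<in> ?I" "\<forall>b. feval p b g = feval p b f" unfolding FId_def by blast
  have "g = f"
    by (rule FR_unique[of ?U "\<lambda>a. a"]) (use dense_UNIV g f J(3) in auto)
  then show ?thesis using f(1) by simp
qed

lemma Jet_vanishes:
  assumes S: "wf_pf S" and a: "restrict a (fvars S) \<in> fpts p S" and f: "f \<in> feqs (Jet p \<phi> m S)"
  shows "feval p (D a) f = 0"
proof -
  have Srs: "feqs S \<subseteq> rs (fvars S)" using wf_rs[OF S] by blast
  show ?thesis
  proof (rule Jet_props(4)[OF Srs _ f])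
    fix g assume "g \<in> jgens m S"
    then obtain i h where h: "g = jet_lift p \<phi> i h" "h \<in> feqs S" by (auto simp: jgens_def)
    then show "feval p (D a) g = 0"
      using fpts_vanish'[OF S a h(2)] by (simp add: feval_D_jet_lift[OF wf_rs[OF S h(2)]])
  qed
qed

section \<open>Classes of tuples and their values\<close>

definition tuples :: "nat \<Rightarrow> ('v, 'r) pformal \<Rightarrow> ('w, 'r) pformal \<Rightarrow> ('w \<Rightarrow> ('v \<times> nat, 'r) mfps) set" where
  "tuples m S T = fvars T \<rightarrow>\<^sub>E rs (fvars S \<times> {..m})"

definition tuple_eq :: "nat \<Rightarrow> ('v, 'r) pformal \<Rightarrow> ('w, 'r) pformal \<Rightarrow> (('w \<Rightarrow> ('v \<times> nat, 'r) mfps) \<times> ('w \<Rightarrow> ('v \<times> nat, 'r) mfps)) set" where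
  "tuple_eq m S T = {(F, F'). F \<in> tuples m S T \<and> F' \<in> tuples m S T \<and> (\<forall>w\<in>fvars T. F w - F' w \<in> feqs (Jet p \<phi> m S))}"

lemma delta_map_alt:
  "delta_map p \<phi> m S T = {F \<in> tuples m S T. \<forall>g\<in>feqs T. fsubst p id F g \<in> feqs (Jet p \<phi> m S)} // tuple_eq m S T"
  by (simp add: delta_map_def fhom_def tuples_def tuple_eq_def Jet_def)

text \<open>\<open>delta_app\<close> evaluates an unspecified representative. Any other
  representative differs from it by elements of the ideal of the jet space, and these vanish at the
  jets of points of S.\<close>

lemma delta_mapE:
  assumes S: "wf_pf S" and "B \<in> delta_map p \<phi> m S T"
  obtains F where "F \<in> tuples m S T" "\<And>g. g \<in> feqs T \<Longrightarrow> fsubst p id F g \<in> feqs (Jet p \<phi> m S)"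
    "B = tuple_eq m S T `` {F}" "\<And>a. restrict a (fvars S) \<in> fpts p S \<Longrightarrow>
      delta_app p \<phi> m S T B (restrict a (fvars S)) = (\<lambda>w\<in>fvars T. feval p (D a) (F w))"
proof -
  obtain F where F: "F \<in> tuples m S T" "\<forall>g\<in>feqs T. fsubst p id F g \<in> feqs (Jet p \<phi> m S)" and B: "B = tuple_eq m S T `` {F}"
    using assms(2) unfolding delta_map_alt quotient_def by blast
  have Srs: "feqs S \<subseteq> rs (fvars S)" using wf_rs[OF S] by blast
  note J = Jet_props[OF Srs, where n = m]
  have "F \<in> B" unfolding B tuple_eq_def using F(1) rps_ideal_closed(3)[OF J(1)] by simp
  then have "(SOME F. F \<in> B) \<in> B" by (rule someI[where P = "\<lambda>F. F \<in> B"])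
  then have F': "(SOME F. F \<in> B) \<in> tuples m S T" "\<forall>w\<in>fvars T. F w - (SOME F. F \<in> B) w \<in> feqs (Jet p \<phi> m S)"
    unfolding B tuple_eq_def by auto
  have "delta_app p \<phi> m S T B (restrict a (fvars S)) = (\<lambda>w\<in>fvars T. feval p (D a) (F w))"
    if a: "restrict a (fvars S) \<in> fpts p S" for a
    unfolding delta_app_def fapp_def
  proof (rule restrict_ext)
    fix w assume w: "w \<in> fvars T"
    let ?F' = "(SOME F. F \<in> B) w"
    have r: "F w \<in> rs (fvars S \<times> {..m})" "?F' \<in> rs (fvars S \<times> {..m})" using F(1) F'(1) w by (auto simp: tuples_def)
    have "feval p (nabla p \<phi> m (fvars S) (restrict a (fvars S))) ?F' = feval p (D a) ?F'"
      by (rule feval_cong[OF r(2)]) (auto simp: nabla_def)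
    moreover have "feval p (D a) (F w - ?F') = 0" using F'(2) w by (intro Jet_vanishes[OF S a, where m = m]) simp
    ultimately show "feval p (nabla p \<phi> m (fvars S) (restrict a (fvars S))) ?F' = feval p (D a) (F w)"
      by (simp add: feval_diff[OF r])
  qed
  then show thesis using that[of F] F B by simp
qed

lemma delta_app_pts:
  assumes S: "wf_pf S" and T: "wf_pf T" and B: "B \<in> delta_map p \<phi> m S T" and a: "a \<in> fpts p S"
  shows "delta_app p \<phi> m S T B a \<in> fpts p T"
proof -
  obtain F where F: "F \<in> tuples m S T" "\<And>g. g \<in> feqs T \<Longrightarrow> fsubst p id F g \<in> feqs (Jet p \<phi> m S)"
    "\<And>a. restrict a (fvars S) \<in> fpts p S \<Longrightarrow>
      delta_app p \<phi> m S T B (restrict a (fvars S)) = (\<lambda>w\<in>fvars T. feval p (D a) (F w))"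
    by (rule delta_mapE[OF S B]) (rule that)
  have ra: "restrict a (fvars S) = a" using a by (auto simp: fpts_def PiE_def extensional_restrict)
  have app: "delta_app p \<phi> m S T B a = (\<lambda>w\<in>fvars T. feval p (D a) (F w))" using F(3)[of a] a ra by simp
  have Fr: "w \<in> fvars T \<Longrightarrow> F w \<in> rs (fvars S \<times> {..m})" for w using F(1) by (auto simp: tuples_def)
  have "feval p (\<lambda>w\<in>fvars T. feval p (D a) (F w)) g = 0" if g: "g \<in> feqs T" for g
  proof -
    have "feval p (D a) (fsubst p id F g) = id (feval p (\<lambda>w. id (feval p (D a) (F w))) g)"
      by (rule feval_fsubst[OF rhom_id(1) wf_rs[OF T g] Fr]) simp_all
    moreover have "feval p (D a) (fsubst p id F g) = 0" by (rule Jet_vanishes[OF S _ F(2)[OF g]]) (simp add: ra a)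
    moreover have "feval p (\<lambda>w\<in>fvars T. feval p (D a) (F w)) g = feval p (\<lambda>w. feval p (D a) (F w)) g"
      by (rule feval_cong[OF wf_rs[OF T g]]) simp
    ultimately show ?thesis by simp
  qed
  then show ?thesis by (simp add: app fpts_def)
qed

text \<open>The difference of two representatives vanishes at the jets of all points of S, so
  \<open>jet_vanishing\<close> puts it in the ideal of the jet space and the classes
  coincide.\<close>

lemma delta_map_unique:
  assumes S: "wf_pf S" and \<rho>: "retr S \<rho>" and B: "B \<in> delta_map p \<phi> m S T" and B': "B' \<in> delta_map p \<phi> m S T"
    and eq: "\<And>a. a \<in> fpts p S \<Longrightarrow> delta_app p \<phi> m S T B a = delta_app p \<phi> m S T B' a"
  shows "B = B'"
proof -
  obtain F where F: "F \<in> tuples m S T" "B = tuple_eq m S T `` {F}"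
    "\<And>a. restrict a (fvars S) \<in> fpts p S \<Longrightarrow>
      delta_app p \<phi> m S T B (restrict a (fvars S)) = (\<lambda>w\<in>fvars T. feval p (D a) (F w))"
    by (rule delta_mapE[OF S B]) (rule that)
  obtain F' where F': "F' \<in> tuples m S T" "B' = tuple_eq m S T `` {F'}"
    "\<And>a. restrict a (fvars S) \<in> fpts p S \<Longrightarrow>
      delta_app p \<phi> m S T B' (restrict a (fvars S)) = (\<lambda>w\<in>fvars T. feval p (D a) (F' w))"
    by (rule delta_mapE[OF S B']) (rule that)
  have Srs: "feqs S \<subseteq> rs (fvars S)" using wf_rs[OF S] by blast
  note J = Jet_props[OF Srs, where n = m] and I = rps_ideal_closed[OF Jet_props(1)[OF Srs, where n = m]]
  have d: "F w - F' w \<in> feqs (Jet p \<phi> m S)" if w: "w \<in> fvars T" for w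
  proof (rule jet_vanishing[OF S \<rho>])
    have r: "F w \<in> rs (fvars S \<times> {..m})" "F' w \<in> rs (fvars S \<times> {..m})" using F(1) F'(1) w by (auto simp: tuples_def)
    then show "F w - F' w \<in> rs (fvars S \<times> {..m})" by (rule rs_diff)
    fix a assume a: "restrict a (fvars S) \<in> fpts p S"
    have "(\<lambda>w\<in>fvars T. feval p (D a) (F w)) w = (\<lambda>w\<in>fvars T. feval p (D a) (F' w)) w"
      using eq[OF a] F(3)[OF a] F'(3)[OF a] by simp
    then show "feval p (D a) (F w - F' w) = 0" using w by (simp add: feval_diff[OF r])
  qed
  have d': "F' w - F w \<in> feqs (Jet p \<phi> m S)" if w: "w \<in> fvars T" for w
    using I(2)[OF d[OF w] rs_cst[of "- 1"]] by (simp add: rhomD[OF rhom_cst])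
  have tr: "X1 - X3 \<in> feqs (Jet p \<phi> m S)" if "X1 - X2 \<in> feqs (Jet p \<phi> m S)" "X2 - X3 \<in> feqs (Jet p \<phi> m S)" for X1 X2 X3
    using I(1)[OF that] by simp
  have "(\<forall>w\<in>fvars T. F w - F1 w \<in> feqs (Jet p \<phi> m S)) \<longleftrightarrow> (\<forall>w\<in>fvars T. F' w - F1 w \<in> feqs (Jet p \<phi> m S))" for F1
    by (intro ball_cong refl iffI) (erule tr[OF d'], assumption, erule tr[OF d], assumption)
  then show ?thesis
    unfolding F(2) F'(2) tuple_eq_def using F(1) F'(1) by simp
qed

text \<open>The equations of T, pulled back along the tuple, vanish at the jets of all points of S,
  hence lie in the ideal of the jet space by \<open>jet_vanishing\<close>. Thus a delta-map can be
  constructed through its values.\<close>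

lemma delta_map_exists:
  assumes S: "wf_pf S" and \<rho>: "retr S \<rho>" and T: "wf_pf T"
    and P: "\<And>w. w \<in> fvars T \<Longrightarrow> P w \<in> FR (fvars S \<times> {..m}) D"
    and pt: "\<And>a. restrict a (fvars S) \<in> fpts p S \<Longrightarrow> (\<lambda>w\<in>fvars T. P w a) \<in> fpts p T"
  obtains B where "B \<in> delta_map p \<phi> m S T"
    "\<And>a. restrict a (fvars S) \<in> fpts p S \<Longrightarrow> delta_app p \<phi> m S T B (restrict a (fvars S)) = (\<lambda>w\<in>fvars T. P w a)"
proof -
  have "\<forall>w\<in>fvars T. \<exists>f. f \<in> rs (fvars S \<times> {..m}) \<and> (\<forall>a. P w a = feval p (D a) f)" using P unfolding FR_def by blast
  from bchoice[OF this] obtain F0 where F0: "\<forall>w\<in>fvars T. F0 w \<in> rs (fvars S \<times> {..m}) \<and> (\<forall>a. P w a = feval p (D a) (F0 w))" ..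
  define F where "F = restrict F0 (fvars T)"
  have Fr: "w \<in> fvars T \<Longrightarrow> F w \<in> rs (fvars S \<times> {..m})" and FP: "w \<in> fvars T \<Longrightarrow> P w a = feval p (D a) (F w)" for w a
    using F0 by (simp_all add: F_def)
  have Ft: "F \<in> tuples m S T" using F0 by (auto simp: tuples_def F_def)
  have Fg: "fsubst p id F g \<in> feqs (Jet p \<phi> m S)" if g: "g \<in> feqs T" for g
  proof (rule jet_vanishing[OF S \<rho>])
    show "fsubst p id F g \<in> rs (fvars S \<times> {..m})" by (rule fsubst_rs[OF rhom_id(1) wf_rs[OF T g] Fr])
    fix a assume a: "restrict a (fvars S) \<in> fpts p S"
    have "feval p (D a) (fsubst p id F g) = id (feval p (\<lambda>w. id (feval p (D a) (F w))) g)"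
      by (rule feval_fsubst[OF rhom_id(1) wf_rs[OF T g] Fr]) simp_all
    also have "\<dots> = feval p (\<lambda>w\<in>fvars T. P w a) g"
      unfolding id_apply by (rule feval_cong[OF wf_rs[OF T g]]) (simp add: FP)
    also have "\<dots> = 0" by (rule fpts_vanish[OF pt[OF a] g])
    finally show "feval p (D a) (fsubst p id F g) = 0" .
  qed
  define B where "B = tuple_eq m S T `` {F}"
  have B: "B \<in> delta_map p \<phi> m S T"
    unfolding delta_map_alt B_def by (rule quotientI) (use Ft Fg in simp)
  obtain F' where F': "F' \<in> tuples m S T" "B = tuple_eq m S T `` {F'}"
    "\<And>a. restrict a (fvars S) \<in> fpts p S \<Longrightarrow>
      delta_app p \<phi> m S T B (restrict a (fvars S)) = (\<lambda>w\<in>fvars T. feval p (D a) (F' w))"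
    by (rule delta_mapE[OF S B]) (rule that)
  have Srs: "feqs S \<subseteq> rs (fvars S)" using wf_rs[OF S] by blast
  have "F \<in> B" unfolding B_def tuple_eq_def
    using Ft rps_ideal_closed(3)[OF Jet_props(1)[OF Srs, where n = m]] by simp
  then have d: "\<forall>w\<in>fvars T. F' w - F w \<in> feqs (Jet p \<phi> m S)" unfolding F'(2) tuple_eq_def by simp
  show thesis
  proof (rule that[OF B])
    fix a assume a: "restrict a (fvars S) \<in> fpts p S"
    show "delta_app p \<phi> m S T B (restrict a (fvars S)) = (\<lambda>w\<in>fvars T. P w a)"
      unfolding F'(3)[OF a]
    proof (rule restrict_ext)
      fix w assume w: "w \<in> fvars T"
      have r: "F' w \<in> rs (fvars S \<times> {..m})" using F'(1) w by (auto simp: tuples_def)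
      have "feval p (D a) (F' w - F w) = 0" using d w by (intro Jet_vanishes[OF S a, where m = m]) simp
      then show "feval p (D a) (F' w) = P w a" using w by (simp add: feval_diff[OF r Fr] FP)
    qed
  qed
qed

end

section \<open>Matrices congruent to the identity\<close>

lemma det_pol:
  assumes "A \<in> carrier_mat n n" "\<And>i j. i < n \<Longrightarrow> j < n \<Longrightarrow> A $$ (i, j) \<in> carrier (pol_ring V)"
  shows "det A \<in> carrier (pol_ring V)"
proof -
  have prod: "(\<And>i. i \<in> S \<Longrightarrow> f i \<in> carrier (pol_ring V)) \<Longrightarrow> prod f S \<in> carrier (pol_ring V)" for f and S :: "nat set"
    by (induction S rule: infinite_finite_induct) (simp_all add: pol_closed)
  have sign: "signof \<pi> \<in> carrier (pol_ring V)" for \<pi>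
    by (cases "evenperm \<pi>") (simp_all add: sign_def pol_uminus)
  have "signof \<pi> * (\<Prod>i = 0..<n. A $$ (i, \<pi> i)) \<in> carrier (pol_ring V)" if "\<pi> permutes {0..<n}" for \<pi>
    using permutes_in_image[OF that] by (intro pol_closed sign prod assms(2)) auto
  then show ?thesis unfolding det_def'[OF assms(1)] by (intro pol_sum) simp
qed

lemma coord_mat_carrier [simp]: "coord_mat n a \<in> carrier_mat n n" "dim_row (coord_mat n a) = n" "dim_col (coord_mat n a) = n"
  by (simp_all add: coord_mat_def)

lemma coord_mat_index [simp]: "i < n \<Longrightarrow> j < n \<Longrightarrow> coord_mat n a $$ (i, j) = a (Some (i, j))"
  by (simp add: coord_mat_def)

lemma rhom_comm_ring_hom: "rhom h \<Longrightarrow> comm_ring_hom h"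
  by unfold_locales (simp_all add: rhomD)

lemma map_coord_mat: "map_mat h (coord_mat n a) = coord_mat n (\<lambda>v. h (a v))"
  by (rule eq_matI) simp_all

lemma rhom_det: "rhom h \<Longrightarrow> h (det (coord_mat n a)) = det (coord_mat n (\<lambda>v. h (a v)))"
  using comm_ring_hom.hom_det[OF rhom_comm_ring_hom, of h "coord_mat n a"] by (simp add: map_coord_mat)

lemma mat_mult_index: "A \<in> carrier_mat n n \<Longrightarrow> B \<in> carrier_mat n n \<Longrightarrow> i < n \<Longrightarrow> j < n \<Longrightarrow>
    (A * B) $$ (i, j) = (\<Sum>k<n. A $$ (i, k) * B $$ (k, j))"
  by (simp add: scalar_prod_def atLeast0LessThan)

definition GLvars :: "nat \<Rightarrow> (nat \<times> nat) option set" where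
  "GLvars n = insert None (Some ` ({..<n} \<times> {..<n}))"

definition GLeq :: "nat \<Rightarrow> ((nat \<times> nat) option, 'r::comm_ring_1) mpoly" where
  "GLeq n = mvar None * det (coord_mat n mvar) - 1"

lemma GL_simps: "vars (GL n) = GLvars n" "eqs (GL n) = Idl\<^bsub>pol_ring (GLvars n)\<^esub> {GLeq n}"
  "gmul (GL n) None = mvar (Inl None) * mvar (Inr None)"
  "i < n \<Longrightarrow> j < n \<Longrightarrow> gmul (GL n) (Some (i, j)) = (\<Sum>k<n. mvar (Inl (Some (i, k))) * mvar (Inr (Some (k, j))))"
  by (simp_all add: GL_def GLvars_def GLeq_def Let_def
      mat_mult_index[OF coord_mat_carrier(1) coord_mat_carrier(1)] del: index_mult_mat)

lemma det_coord_pol: "det (coord_mat n mvar) \<in> carrier (pol_ring (Some ` ({..<n} \<times> {..<n})))"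
  by (rule det_pol[of _ n]) auto

lemma pol_mono: "f \<in> carrier (pol_ring V) \<Longrightarrow> V \<subseteq> V' \<Longrightarrow> f \<in> carrier (pol_ring V')"
  by (auto simp: pol_ring_def)

lemma GLeq_pol: "GLeq n \<in> carrier (pol_ring (GLvars n))"
  unfolding GLeq_def by (intro pol_diff pol_closed pol_mono[OF det_coord_pol]) (auto simp: GLvars_def)

lemma GLeq_in: "GLeq n \<in> eqs (GL n)"
  unfolding GL_simps by (rule subsetD[OF genideal_pol_ring(2)]) (simp_all add: GLeq_pol)

context pring
begin

lemma pev_det: "pev b (det (coord_mat n mvar)) = det (coord_mat n b)"
  by (simp add: rhom_det[OF rhom_pev])

lemma pev_GLeq: "pev b (GLeq n) = b None * det (coord_mat n b) - 1"
  by (simp add: GLeq_def pev_hom pev_det)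

definition mat_near :: "nat \<Rightarrow> nat \<Rightarrow> 'r mat \<Rightarrow> 'r mat \<Rightarrow> bool" where
  "mat_near n k A B \<longleftrightarrow> A \<in> carrier_mat n n \<and> B \<in> carrier_mat n n \<and> (\<forall>i<n. \<forall>j<n. q ^ k dvd A $$ (i, j) - B $$ (i, j))"

text \<open>What is kept of a closed embedding in \<open>GL n\<close>: the map on points, which is
  multiplicative and both preserves and reflects congruence modulo every power of p. The last
  property includes injectivity, by letting k grow.\<close>

definition matrix_rep :: "('v, 'r) group_scheme \<Rightarrow> nat \<Rightarrow> (('v \<Rightarrow> 'r) \<Rightarrow> 'r mat) \<Rightarrow> bool" where
  "matrix_rep G n \<Psi> \<longleftrightarrow> (\<forall>a. \<Psi> a \<in> carrier_mat n n) \<and> \<Psi> (gunit G) = 1\<^sub>m n \<and>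
     (\<forall>a b. zpt G a \<and> zpt G b \<longrightarrow> \<Psi> (gm G a b) = \<Psi> a * \<Psi> b) \<and>
     (\<forall>a b k. zpt G a \<and> zpt G b \<longrightarrow> ((\<forall>v\<in>vars G. q ^ k dvd a v - b v) \<longleftrightarrow> mat_near n k (\<Psi> a) (\<Psi> b)))"

lemma mat_near_coord_mat: "mat_near n k (coord_mat n a) (coord_mat n b) \<longleftrightarrow> (\<forall>i<n. \<forall>j<n. q ^ k dvd a (Some (i, j)) - b (Some (i, j)))"
  by (simp add: mat_near_def)

text \<open>The coordinate \<open>None\<close> is the inverse of the determinant, so its congruence
  follows from that of the matrix entries by \<open>1/x - 1/y = (y - x)/(x y)\<close>.\<close>

lemma GL_cong:
  assumes a: "a None * det (coord_mat n a) = 1" and b: "b None * det (coord_mat n b) = 1"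
    and ab: "mat_near n k (coord_mat n a) (coord_mat n b)"
  shows "\<forall>w\<in>GLvars n. q ^ k dvd a w - b w"
proof -
  have "q ^ k dvd pev b (det (coord_mat n mvar)) - pev a (det (coord_mat n mvar))"
    by (rule pev_cong_mod[OF det_coord_pol])
      (use ab in \<open>auto simp: mat_near_coord_mat dvd_diff_swap[of "q ^ k" "b _" "a _"]\<close>)
  then have d: "q ^ k dvd det (coord_mat n b) - det (coord_mat n a)" by (simp add: pev_det)
  have "a None - b None = a None * (b None * det (coord_mat n b)) - b None * (a None * det (coord_mat n a))"
    by (simp add: a b)
  also have "\<dots> = a None * b None * (det (coord_mat n b) - det (coord_mat n a))" by (simp add: algebra_simps)
  finally have "q ^ k dvd a None - b None" using d by simp
  then show ?thesis using ab by (auto simp: GLvars_def mat_near_coord_mat)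
qed

text \<open>Congruences are preserved by the polynomials of f and reflected by those of the inverse
  morphism g. For the latter also the inverse determinants have to be congruent, which is
  \<open>GL_cong\<close>.\<close>

lemma linear_rep:
  assumes "smooth_linear_group G"
  obtains n \<Psi> where "matrix_rep G n \<Psi>"
proof -
  have G: "is_group_scheme G" using assms by (simp add: smooth_linear_group_def)
  obtain n H f g where H: "closed_subgroup H (GL n)" and f: "group_hom G H f" and g: "group_hom H G g"
    and gf: "amor_eq G G (\<lambda>v. msubst f (g v)) mvar"
    using assms unfolding smooth_linear_group_def group_iso_def by blast
  have HG: "is_group_scheme H" and Hv: "vars H = GLvars n" and He: "eqs (GL n) \<subseteq> eqs H" and Hm: "gmul H = gmul (GL n)"
    using H by (simp_all add: closed_subgroup_def GL_simps)
  define F where "F = pmap f"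
  define \<Psi> where "\<Psi> a = coord_mat n (F a)" for a
  have Fz: "zpt H (F a)" if "zpt G a" for a unfolding F_def by (rule hom_zpt[OF f that])
  have det1: "F a None * det (coord_mat n (F a)) = 1" if "zpt G a" for a
  proof -
    have "pev (F a) (GLeq n) = 0" using Fz[OF that] He GLeq_in unfolding zpt_def by blast
    then show ?thesis by (simp add: pev_GLeq)
  qed
  have mul: "\<Psi> (gm G a b) = \<Psi> a * \<Psi> b" if "zpt G a" "zpt G b" for a b
  proof (rule eq_matI)
    fix i j assume "i < dim_row (\<Psi> a * \<Psi> b)" "j < dim_col (\<Psi> a * \<Psi> b)"
    then have ij: "i < n" "j < n" by (simp_all add: \<Psi>_def)
    have "F (gm G a b) (Some (i, j)) = gm H (F a) (F b) (Some (i, j))"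
      unfolding F_def by (rule hom_gm[OF G f that]) (use ij in \<open>simp add: Hv GLvars_def\<close>)
    also have "\<dots> = (\<Sum>k<n. F a (Some (i, k)) * F b (Some (k, j)))"
      by (simp add: gm_def Hm GL_simps ij pev_hom)
    finally show "\<Psi> (gm G a b) $$ (i, j) = (\<Psi> a * \<Psi> b) $$ (i, j)"
      using ij by (simp add: \<Psi>_def mat_mult_index[of _ n] del: index_mult_mat)
  qed (simp_all add: \<Psi>_def)
  have car: "\<Psi> a \<in> carrier_mat n n" for a by (simp add: \<Psi>_def)
  have cong: "(\<forall>v\<in>vars G. q ^ k dvd a v - b v) \<longleftrightarrow> mat_near n k (\<Psi> a) (\<Psi> b)" if a: "zpt G a" and b: "zpt G b" for a b k
  proof
    assume *: "\<forall>v\<in>vars G. q ^ k dvd a v - b v"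
    have "q ^ k dvd F a w - F b w" if "w \<in> vars H" for w
      unfolding F_def pmap_def by (rule pev_cong_mod[OF hom_pol[OF f that]]) (use * in simp)
    then show "mat_near n k (\<Psi> a) (\<Psi> b)" by (simp add: \<Psi>_def mat_near_coord_mat Hv GLvars_def)
  next
    assume "mat_near n k (\<Psi> a) (\<Psi> b)"
    then have *: "\<forall>w\<in>GLvars n. q ^ k dvd F a w - F b w"
      unfolding \<Psi>_def by (rule GL_cong[OF det1[OF a] det1[OF b]])
    have inv: "pev (F c) (g v) = c v" if "zpt G c" "v \<in> vars G" for c v
      using amor_eq_pev[OF gf that] by (simp add: pev_msubst F_def pmap_def[abs_def])
    show "\<forall>v\<in>vars G. q ^ k dvd a v - b v"
    proof
      fix v assume v: "v \<in> vars G"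
      have "q ^ k dvd pev (F a) (g v) - pev (F b) (g v)"
        by (rule pev_cong_mod[OF hom_pol[OF g v]]) (use * in \<open>simp add: Hv\<close>)
      then show "q ^ k dvd a v - b v" by (simp add: inv a b v)
    qed
  qed
  \<comment> \<open>\<open>group_hom\<close> records only compatibility with products. The image of
    the unit is therefore first seen to be idempotent; its determinant is invertible, so it is the
    identity matrix.\<close>
  have unit: "\<Psi> (gunit G) = 1\<^sub>m n"
  proof -
    let ?e = "gunit G" let ?E = "\<Psi> ?e" let ?d = "F ?e None"
    have e: "zpt G ?e" by (rule gs_unit[OF G])
    have "\<forall>v\<in>vars G. q ^ k dvd gm G ?e ?e v - ?e v" for k using group_laws(1)[OF G e] by simp
    then have "mat_near n k (?E * ?E) ?E" for k using cong[OF gm_zpt[OF G e e] e, of k] mul[OF e e] by simp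
    then have "(?E * ?E) $$ (i, j) = ?E $$ (i, j)" if "i < n" "j < n" for i j
      using that by (intro eq_by_approx) (simp add: mat_near_def del: index_mult_mat)
    then have EE: "?E * ?E = ?E" using car[of ?e] by (intro eq_matI) auto
    have adj: "adj_mat ?E \<in> carrier_mat n n" "adj_mat ?E * ?E = det ?E \<cdot>\<^sub>m 1\<^sub>m n"
      using adj_mat[OF car[of ?e]] by simp_all
    have "adj_mat ?E * ?E * ?E = adj_mat ?E * ?E"
      using EE adj(1) car[of ?e] by (simp add: assoc_mult_mat[of _ n n _ n _ n])
    then have "det ?E \<cdot>\<^sub>m ?E = det ?E \<cdot>\<^sub>m 1\<^sub>m n"
      unfolding adj(2) using car[of ?e] by (simp add: mult_smult_assoc_mat[of _ n n])
    then have "?d \<cdot>\<^sub>m (det ?E \<cdot>\<^sub>m ?E) = ?d \<cdot>\<^sub>m (det ?E \<cdot>\<^sub>m 1\<^sub>m n)" by simp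
    moreover have "?d * det ?E = 1" using det1[OF e] by (simp add: \<Psi>_def)
    ultimately show ?thesis
      using car[of ?e] by (auto simp: mat_eq_iff mult.assoc[symmetric])
  qed
  have "matrix_rep G n \<Psi>" unfolding matrix_rep_def using car unit mul cong by simp
  then show thesis by (rule that)
qed

section \<open>Congruences and first-order logarithms of matrices\<close>

lemma mat_near_refl: "A \<in> carrier_mat n n \<Longrightarrow> mat_near n k A A"
  by (simp add: mat_near_def)

lemma mat_near_sym: "mat_near n k A B \<Longrightarrow> mat_near n k B A"
  unfolding mat_near_def using dvd_diff_swap by blast

lemma mat_near_trans: "mat_near n k A B \<Longrightarrow> mat_near n k B C \<Longrightarrow> mat_near n k A C"
  unfolding mat_near_def
proof (elim conjE, intro conjI allI impI)
  fix i j assume *: "\<forall>i<n. \<forall>j<n. q ^ k dvd A $$ (i, j) - B $$ (i, j)" "\<forall>i<n. \<forall>j<n. q ^ k dvd B $$ (i, j) - C $$ (i, j)" "i < n" "j < n"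
  then have "q ^ k dvd (A $$ (i, j) - B $$ (i, j)) + (B $$ (i, j) - C $$ (i, j))" by (intro dvd_add) simp_all
  then show "q ^ k dvd A $$ (i, j) - C $$ (i, j)" by simp
qed

lemma mat_near_mono: "mat_near n k A B \<Longrightarrow> l \<le> k \<Longrightarrow> mat_near n l A B"
  unfolding mat_near_def using power_le_dvd by blast

lemma mat_near_add: "mat_near n k A B \<Longrightarrow> mat_near n k A' B' \<Longrightarrow> mat_near n k (A + A') (B + B')"
  unfolding mat_near_def
proof (elim conjE, intro conjI allI impI)
  fix i j assume *: "\<forall>i<n. \<forall>j<n. q ^ k dvd A $$ (i, j) - B $$ (i, j)" "\<forall>i<n. \<forall>j<n. q ^ k dvd A' $$ (i, j) - B' $$ (i, j)" "i < n" "j < n"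
    "A \<in> carrier_mat n n" "B \<in> carrier_mat n n" "A' \<in> carrier_mat n n" "B' \<in> carrier_mat n n"
  then have "q ^ k dvd (A $$ (i, j) - B $$ (i, j)) + (A' $$ (i, j) - B' $$ (i, j))" by (intro dvd_add) simp_all
  then show "q ^ k dvd (A + A') $$ (i, j) - (B + B') $$ (i, j)" using * by (simp add: algebra_simps)
qed auto

lemma mat_near_diff: "mat_near n k A B \<Longrightarrow> mat_near n k A' B' \<Longrightarrow> mat_near n k (A - A') (B - B')"
  unfolding mat_near_def
proof (elim conjE, intro conjI allI impI)
  fix i j assume *: "\<forall>i<n. \<forall>j<n. q ^ k dvd A $$ (i, j) - B $$ (i, j)" "\<forall>i<n. \<forall>j<n. q ^ k dvd A' $$ (i, j) - B' $$ (i, j)" "i < n" "j < n"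
    "A \<in> carrier_mat n n" "B \<in> carrier_mat n n" "A' \<in> carrier_mat n n" "B' \<in> carrier_mat n n"
  then have "q ^ k dvd (A $$ (i, j) - B $$ (i, j)) - (A' $$ (i, j) - B' $$ (i, j))"
    using dvd_diff[of "q ^ k" "A $$ (i, j) - B $$ (i, j)" "A' $$ (i, j) - B' $$ (i, j)"] by blast
  then show "q ^ k dvd (A - A') $$ (i, j) - (B - B') $$ (i, j)" using * by (simp add: algebra_simps)
qed auto

lemma mat_near_mult: "mat_near n k A B \<Longrightarrow> mat_near n k A' B' \<Longrightarrow> mat_near n k (A * A') (B * B')"
  unfolding mat_near_def
proof (elim conjE, intro conjI allI impI)
  fix i j assume *: "\<forall>i<n. \<forall>j<n. q ^ k dvd A $$ (i, j) - B $$ (i, j)" "\<forall>i<n. \<forall>j<n. q ^ k dvd A' $$ (i, j) - B' $$ (i, j)" "i < n" "j < n"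
    "A \<in> carrier_mat n n" "B \<in> carrier_mat n n" "A' \<in> carrier_mat n n" "B' \<in> carrier_mat n n"
  have "(A * A') $$ (i, j) - (B * B') $$ (i, j) =
      (\<Sum>l<n. (A $$ (i, l) - B $$ (i, l)) * A' $$ (l, j) + B $$ (i, l) * (A' $$ (l, j) - B' $$ (l, j)))"
    unfolding mat_mult_index[OF *(5,7,3,4)] mat_mult_index[OF *(6,8,3,4)]
    by (simp add: sum_subtractf[symmetric] algebra_simps)
  also have "q ^ k dvd \<dots>"
    by (intro dvd_sum dvd_add dvd_mult dvd_mult2) (use * in simp_all)
  finally show "q ^ k dvd (A * A') $$ (i, j) - (B * B') $$ (i, j)" .
qed auto

text \<open>The matrix b in \<open>A = 1 + q^r b\<close>. It is determined when A is congruent to 1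
  modulo \<open>q^r\<close>, and for positive r it is additive modulo p by
  \<open>near_mult\<close>.\<close>

definition mat_log :: "nat \<Rightarrow> nat \<Rightarrow> 'r mat \<Rightarrow> 'r mat" where
  "mat_log n r A = mat n n (\<lambda>ij. SOME y. A $$ ij - 1\<^sub>m n $$ ij = q ^ r * y)"

lemma mat_log_carrier [simp]: "mat_log n r A \<in> carrier_mat n n"
  by (simp add: mat_log_def)

lemma mat_log_eqI:
  assumes "B \<in> carrier_mat n n" "A = 1\<^sub>m n + q ^ r \<cdot>\<^sub>m B"
  shows "mat_log n r A = B"
proof (rule eq_matI)
  fix i j assume "i < dim_row B" "j < dim_col B"
  then have ij: "i < n" "j < n" using assms(1) by auto
  have "(SOME y. A $$ (i, j) - 1\<^sub>m n $$ (i, j) = q ^ r * y) = B $$ (i, j)"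
    by (rule some_equality) (use assms ij in auto)
  then show "mat_log n r A $$ (i, j) = B $$ (i, j)" using ij by (simp add: mat_log_def)
qed (use assms in \<open>auto simp: mat_log_def\<close>)

lemma mat_log_eq:
  assumes "mat_near n r A (1\<^sub>m n)"
  shows "A = 1\<^sub>m n + q ^ r \<cdot>\<^sub>m mat_log n r A"
proof (rule eq_matI)
  fix i j assume "i < dim_row (1\<^sub>m n + q ^ r \<cdot>\<^sub>m mat_log n r A)" "j < dim_col (1\<^sub>m n + q ^ r \<cdot>\<^sub>m mat_log n r A)"
  then have ij: "i < n" "j < n" by (auto simp: mat_log_def)
  have "q ^ r dvd A $$ (i, j) - 1\<^sub>m n $$ (i, j)" using assms ij unfolding mat_near_def by blast
  then have "\<exists>y. A $$ (i, j) - 1\<^sub>m n $$ (i, j) = q ^ r * y" unfolding dvd_def .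
  from someI_ex[OF this] have "A $$ (i, j) - 1\<^sub>m n $$ (i, j) = q ^ r * mat_log n r A $$ (i, j)" using ij by (simp add: mat_log_def)
  then show "A $$ (i, j) = (1\<^sub>m n + q ^ r \<cdot>\<^sub>m mat_log n r A) $$ (i, j)" using ij by (simp add: mat_log_def algebra_simps)
qed (use assms in \<open>auto simp: mat_near_def mat_log_def\<close>)

lemma mat_near_log_iff:
  assumes "mat_near n r A (1\<^sub>m n)" "mat_near n r B (1\<^sub>m n)"
  shows "mat_near n (r + m) A B \<longleftrightarrow> mat_near n m (mat_log n r A) (mat_log n r B)"
proof -
  have "A $$ (i, j) - B $$ (i, j) = q ^ r * (mat_log n r A $$ (i, j) - mat_log n r B $$ (i, j))" if "i < n" "j < n" for i j
    using that by (subst mat_log_eq[OF assms(1)], subst mat_log_eq[OF assms(2)]) (simp add: mat_log_def algebra_simps)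
  then show ?thesis using assms by (simp add: mat_near_def q_power_dvd_cancel)
qed

lemma mat_near_smult: "A \<in> carrier_mat n n \<Longrightarrow> B \<in> carrier_mat n n \<Longrightarrow> mat_near n k (A + q ^ k \<cdot>\<^sub>m B) A"
  by (auto simp: mat_near_def)

lemma near_mult:
  assumes A: "mat_near n r A (1\<^sub>m n)" and B: "mat_near n r B (1\<^sub>m n)" and r: "r \<ge> 1"
  shows "mat_near n r (A * B) (1\<^sub>m n)" "mat_near n 1 (mat_log n r (A * B)) (mat_log n r A + mat_log n r B)"
proof -
  let ?a = "mat_log n r A" and ?b = "mat_log n r B"
  have ab: "?a * ?b \<in> carrier_mat n n" by (rule mult_carrier_mat[of _ n n]) simp_all
  show "mat_near n r (A * B) (1\<^sub>m n)" using mat_near_mult[OF A B] by simp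
  have "A * B = (1\<^sub>m n + q ^ r \<cdot>\<^sub>m ?a) * (1\<^sub>m n + q ^ r \<cdot>\<^sub>m ?b)" using mat_log_eq[OF A] mat_log_eq[OF B] by simp
  also have "\<dots> = 1\<^sub>m n + q ^ r \<cdot>\<^sub>m (?a + ?b + q ^ r \<cdot>\<^sub>m (?a * ?b))"
    by (simp add: add_mult_distrib_mat[of _ n n _ _ n] mult_add_distrib_mat[of _ n n _ n] mult_smult_distrib[of _ n n]
        mult_smult_assoc_mat[of _ n n])
      (rule eq_matI, auto simp: mat_log_def algebra_simps)
  finally have "mat_log n r (A * B) = ?a + ?b + q ^ r \<cdot>\<^sub>m (?a * ?b)" by (intro mat_log_eqI) (simp_all add: ab)
  then show "mat_near n 1 (mat_log n r (A * B)) (?a + ?b)"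
    using mat_near_mono[OF mat_near_smult[of "?a + ?b" n "?a * ?b" r] r] by (simp add: ab)
qed

text \<open>In \<open>A * B - B * A\<close> the identity and the linear terms cancel, leaving
  \<open>q^(r+s)\<close> times the commutator of the logarithms; then the inverses are multiplied on
  the right. The exact formula, not only its reduction modulo p, is kept for congruences modulo
  \<open>p^m\<close>.\<close>

lemma near_commutator:
  assumes A: "mat_near n r A (1\<^sub>m n)" and B: "mat_near n s B (1\<^sub>m n)"
    and A': "A' \<in> carrier_mat n n" "A * A' = 1\<^sub>m n" and B': "B' \<in> carrier_mat n n" "B * B' = 1\<^sub>m n"
  shows "mat_near n (r + s) (A * B * A' * B') (1\<^sub>m n)" "mat_log n (r + s) (A * B * A' * B') = gl_bracket (mat_log n r A) (mat_log n s B) * A' * B'"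
proof -
  let ?a = "mat_log n r A" and ?b = "mat_log n s B"
  have c: "A \<in> carrier_mat n n" "B \<in> carrier_mat n n" using A B by (simp_all add: mat_near_def)
  have AB: "A * B = B * A + q ^ (r + s) \<cdot>\<^sub>m gl_bracket ?a ?b"
  proof -
    have e: "(1\<^sub>m n + x \<cdot>\<^sub>m a) * (1\<^sub>m n + y \<cdot>\<^sub>m b) = 1\<^sub>m n + x \<cdot>\<^sub>m a + y \<cdot>\<^sub>m b + (x * y) \<cdot>\<^sub>m (a * b)"
      if "a \<in> carrier_mat n n" "b \<in> carrier_mat n n" for a b and x y :: 'r
      using that
      by (simp add: add_mult_distrib_mat[of _ n n _ _ n] mult_add_distrib_mat[of _ n n _ n] mult_smult_distrib[of _ n n]
          mult_smult_assoc_mat[of _ n n])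
        (rule eq_matI, auto simp: algebra_simps)
    have "A * B = (1\<^sub>m n + q ^ r \<cdot>\<^sub>m ?a) * (1\<^sub>m n + q ^ s \<cdot>\<^sub>m ?b)" "B * A = (1\<^sub>m n + q ^ s \<cdot>\<^sub>m ?b) * (1\<^sub>m n + q ^ r \<cdot>\<^sub>m ?a)"
      using mat_log_eq[OF A] mat_log_eq[OF B] by simp_all
    then show ?thesis
      by (simp only: e mat_log_carrier) (rule eq_matI, auto simp: gl_bracket_def mat_log_def power_add algebra_simps simp del: index_mult_mat(1))
  qed
  have brc: "gl_bracket ?a ?b \<in> carrier_mat n n"
    unfolding gl_bracket_def by (intro minus_carrier_mat mult_carrier_mat[of _ n n]) simp_all
  have "A * B * A' * B' = (B * A + q ^ (r + s) \<cdot>\<^sub>m gl_bracket ?a ?b) * A' * B'" by (simp only: AB)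
  also have "\<dots> = B * (A * A') * B' + q ^ (r + s) \<cdot>\<^sub>m (gl_bracket ?a ?b * A' * B')"
    using c A'(1) B'(1) brc
    by (simp add: add_mult_distrib_mat[of _ n n _ _ n] mult_smult_assoc_mat[of _ n n] assoc_mult_mat[of _ n n _ n _ n])
  also have "B * (A * A') * B' = 1\<^sub>m n" using c A'(2) B'(2) by simp
  finally have eq: "A * B * A' * B' = 1\<^sub>m n + q ^ (r + s) \<cdot>\<^sub>m (gl_bracket ?a ?b * A' * B')" .
  have bc: "gl_bracket ?a ?b * A' * B' \<in> carrier_mat n n" using brc A'(1) B'(1) by (intro mult_carrier_mat) auto
  show "mat_log n (r + s) (A * B * A' * B') = gl_bracket ?a ?b * A' * B'" by (rule mat_log_eqI[OF bc eq])
  show "mat_near n (r + s) (A * B * A' * B') (1\<^sub>m n)" unfolding eq by (rule mat_near_smult) (simp_all add: bc)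
qed

lemma near_inverse:
  assumes "mat_near n k A B" "A' \<in> carrier_mat n n" "B' \<in> carrier_mat n n" "A' * A = 1\<^sub>m n" "B * B' = 1\<^sub>m n"
  shows "mat_near n k A' B'"
proof -
  have c: "A \<in> carrier_mat n n" "B \<in> carrier_mat n n" using assms(1) by (simp_all add: mat_near_def)
  have "mat_near n k (A' * A * B') (A' * B * B')" by (intro mat_near_mult mat_near_refl assms)
  then have "mat_near n k B' A'" using assms c by (simp add: assoc_mult_mat[of _ n n _ n _ n])
  then show ?thesis by (rule mat_near_sym)
qed

lemma gl_bracket_carrier [simp]: "a \<in> carrier_mat n n \<Longrightarrow> b \<in> carrier_mat n n \<Longrightarrow> gl_bracket a b \<in> carrier_mat n n"
  unfolding gl_bracket_def by (intro minus_carrier_mat mult_carrier_mat[of _ n n])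

lemma mat_near_gl_bracket: "mat_near n k a a' \<Longrightarrow> mat_near n k b b' \<Longrightarrow> mat_near n k (gl_bracket a b) (gl_bracket a' b')"
  unfolding gl_bracket_def by (intro mat_near_diff mat_near_mult)

lemma mat_log_commutator:
  assumes A: "mat_near n r A (1\<^sub>m n)" and B: "mat_near n s B (1\<^sub>m n)" and rs: "r \<ge> 1" "s \<ge> 1"
    and A': "A' \<in> carrier_mat n n" "A * A' = 1\<^sub>m n" and B': "B' \<in> carrier_mat n n" "B * B' = 1\<^sub>m n"
  shows "mat_near n 1 (mat_log n (r + s) (A * B * A' * B')) (gl_bracket (mat_log n r A) (mat_log n s B))"
proof -
  have "mat_near n 1 (1\<^sub>m n) A'" by (rule near_inverse[OF mat_near_mono[OF mat_near_sym[OF A] rs(1)]]) (use A' in simp_all)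
  moreover have "mat_near n 1 (1\<^sub>m n) B'" by (rule near_inverse[OF mat_near_mono[OF mat_near_sym[OF B] rs(2)]]) (use B' in simp_all)
  ultimately have "mat_near n 1 (gl_bracket (mat_log n r A) (mat_log n s B) * A' * B') (gl_bracket (mat_log n r A) (mat_log n s B) * 1\<^sub>m n * 1\<^sub>m n)"
    by (intro mat_near_mult mat_near_refl gl_bracket_carrier mat_log_carrier) (erule mat_near_sym)+
  then show ?thesis
    unfolding near_commutator(2)[OF A B A' B'] by (simp add: right_mult_one_mat[OF gl_bracket_carrier])
qed

lemma gl_bracket_add_left:
  "a \<in> carrier_mat n n \<Longrightarrow> b \<in> carrier_mat n n \<Longrightarrow> c \<in> carrier_mat n n \<Longrightarrow> gl_bracket (a + b) c = gl_bracket a c + gl_bracket b c"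
  by (simp add: gl_bracket_def add_mult_distrib_mat[of _ n n _ _ n] mult_add_distrib_mat[of _ n n _ n])
    (rule eq_matI, auto simp del: index_mult_mat(1))

lemma gl_bracket_antisym: "a \<in> carrier_mat n n \<Longrightarrow> b \<in> carrier_mat n n \<Longrightarrow> gl_bracket a b + gl_bracket b a = 0\<^sub>m n n"
  by (rule eq_matI) (auto simp: gl_bracket_def simp del: index_mult_mat(1))

lemma gl_bracket_jacobi:
  fixes a b c :: "'a::comm_ring_1 mat"
  assumes "a \<in> carrier_mat n n" "b \<in> carrier_mat n n" "c \<in> carrier_mat n n"
  shows "gl_bracket (gl_bracket a b) c + gl_bracket (gl_bracket b c) a + gl_bracket (gl_bracket c a) b = 0\<^sub>m n n"
proof -
  have e: "gl_bracket (gl_bracket a b) c = (a * (b * c) - b * (a * c)) - (c * (a * b) - c * (b * a))"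
    if "a \<in> carrier_mat n n" "b \<in> carrier_mat n n" "c \<in> carrier_mat n n" for a b c :: "'a mat"
    using that by (simp add: gl_bracket_def minus_mult_distrib_mat[of _ n n _ _ n] mult_minus_distrib_mat[of _ n n _ n]
        assoc_mult_mat[of _ n n _ n _ n])
  show ?thesis
    unfolding e[OF assms] e[OF assms(2,3,1)] e[OF assms(3,1,2)]
    by (rule eq_matI) (use assms in \<open>auto simp del: index_mult_mat(1)\<close>)
qed

section \<open>Existence and uniqueness of the bracket\<close>

lemma slg_gs: "smooth_linear_group G \<Longrightarrow> is_group_scheme G" and slg_smooth: "smooth_linear_group G \<Longrightarrow> smooth G"
  by (simp_all add: smooth_linear_group_def)

lemma rep_carrier: "matrix_rep G n \<Psi> \<Longrightarrow> \<Psi> a \<in> carrier_mat n n"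
  and rep_unit: "matrix_rep G n \<Psi> \<Longrightarrow> \<Psi> (gunit G) = 1\<^sub>m n"
  and rep_mul: "matrix_rep G n \<Psi> \<Longrightarrow> zpt G a \<Longrightarrow> zpt G b \<Longrightarrow> \<Psi> (gm G a b) = \<Psi> a * \<Psi> b"
  and rep_cong: "matrix_rep G n \<Psi> \<Longrightarrow> zpt G a \<Longrightarrow> zpt G b \<Longrightarrow> (\<forall>v\<in>vars G. q ^ k dvd a v - b v) \<longleftrightarrow> mat_near n k (\<Psi> a) (\<Psi> b)"
  by (simp_all add: matrix_rep_def)

lemma mat_near_all_eq: "(\<And>k. mat_near n k A B) \<Longrightarrow> A = B"
proof -
  assume *: "\<And>k. mat_near n k A B"
  have "A \<in> carrier_mat n n" "B \<in> carrier_mat n n" using *[of 0] by (simp_all add: mat_near_def)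
  moreover have "A $$ (i, j) = B $$ (i, j)" if "i < n" "j < n" for i j
    using * that by (intro eq_by_approx) (simp add: mat_near_def)
  ultimately show ?thesis by (intro eq_matI) auto
qed

lemma rep_eq:
  assumes "matrix_rep G n \<Psi>" "zpt G a" "zpt G b" "\<And>v. v \<in> vars G \<Longrightarrow> a v = b v"
  shows "\<Psi> a = \<Psi> b"
proof (rule mat_near_all_eq)
  fix k
  have "\<forall>v\<in>vars G. q ^ k dvd a v - b v" using assms(4) by simp
  then show "mat_near n k (\<Psi> a) (\<Psi> b)" using rep_cong[OF assms(1-3)] by simp
qed

lemma rep_inj:
  assumes "matrix_rep G n \<Psi>" "zpt G a" "zpt G b" "\<Psi> a = \<Psi> b" "v \<in> vars G"
  shows "a v = b v"
proof (rule eq_by_approx)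
  fix k
  have "mat_near n k (\<Psi> a) (\<Psi> b)" using mat_near_refl[OF rep_carrier[OF assms(1)]] assms(4) by simp
  then show "q ^ k dvd a v - b v" using rep_cong[OF assms(1-3), of k] assms(5) by simp
qed

lemma rep_inverse:
  assumes G: "is_group_scheme G" and R: "matrix_rep G n \<Psi>" and a: "zpt G a"
  shows "\<Psi> a * \<Psi> (gi G a) = 1\<^sub>m n" "\<Psi> (gi G a) * \<Psi> a = 1\<^sub>m n"
proof -
  note ga = gi_zpt[OF G a] and e = gs_unit[OF G]
  show "\<Psi> a * \<Psi> (gi G a) = 1\<^sub>m n"
    using rep_eq[OF R gm_zpt[OF G a ga] e] group_laws(4)[OF G a] rep_mul[OF R a ga] rep_unit[OF R] by simp
  show "\<Psi> (gi G a) * \<Psi> a = 1\<^sub>m n"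
    using rep_eq[OF R gm_zpt[OF G ga a] e] group_laws(3)[OF G a] rep_mul[OF R ga a] rep_unit[OF R] by simp
qed

lemma rep_gcomm:
  assumes G: "is_group_scheme G" and R: "matrix_rep G n \<Psi>" and ab: "zpt G a" "zpt G b"
  shows "\<Psi> (gcomm G a b) = \<Psi> a * \<Psi> b * \<Psi> (gi G a) * \<Psi> (gi G b)"
  unfolding gcomm_def using G ab by (simp add: rep_mul[OF R] gm_zpt gi_zpt)

lemma rep_near:
  assumes G: "is_group_scheme G" and R: "matrix_rep G n \<Psi>" and a: "zpt G a"
  shows "(\<forall>v\<in>vars G. q ^ k dvd a v - gunit G v) \<longleftrightarrow> mat_near n k (\<Psi> a) (1\<^sub>m n)"
  using rep_cong[OF R a gs_unit[OF G]] rep_unit[OF R] by simp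

text \<open>The divisibility is read off from matrices and transported back to the coordinates of G,
  since \<open>matrix_rep\<close> reflects congruences.\<close>

lemma gcomm_near:
  assumes G: "smooth_linear_group G" and ab: "zpt G a" "zpt G b"
    and a: "\<And>v. v \<in> vars G \<Longrightarrow> q ^ r dvd a v - gunit G v" and b: "\<And>v. v \<in> vars G \<Longrightarrow> q ^ s dvd b v - gunit G v"
    and v: "v \<in> vars G"
  shows "q ^ (r + s) dvd gcomm G a b v - gunit G v"
proof -
  note gs = slg_gs[OF G]
  obtain n \<Psi> where R: "matrix_rep G n \<Psi>" by (rule linear_rep[OF G])
  have "mat_near n r (\<Psi> a) (1\<^sub>m n)" "mat_near n s (\<Psi> b) (1\<^sub>m n)" using rep_near[OF gs R] ab a b by auto
  then have "mat_near n (r + s) (\<Psi> (gcomm G a b)) (1\<^sub>m n)"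
    unfolding rep_gcomm[OF gs R ab]
    by (rule near_commutator(1)) (simp_all add: rep_carrier[OF R] rep_inverse[OF gs R] ab)
  then show ?thesis using rep_near[OF gs R gcomm_zpt[OF gs ab], of "r + s"] v by blast
qed

text \<open>The image of the unit is idempotent; in a matrix representation of H it can be
  cancelled, because its matrix is invertible.\<close>

lemma hom_unit:
  assumes G: "is_group_scheme G" and H: "smooth_linear_group H" and f: "group_hom G H f" and w: "w \<in> vars H"
  shows "pmap f (gunit G) w = gunit H w"
proof -
  note gs = slg_gs[OF H] and e = gs_unit[OF G]
  obtain n \<Psi> where R: "matrix_rep H n \<Psi>" by (rule linear_rep[OF H])
  let ?E = "pmap f (gunit G)"
  have z: "zpt H ?E" by (rule hom_zpt[OF f e])
  have "gm H ?E ?E w = ?E w" if "w \<in> vars H" for w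
  proof -
    have "?E w = pmap f (gm G (gunit G) (gunit G)) w"
      unfolding pmap_def by (rule pev_cong[OF hom_pol[OF f that]]) (simp add: group_laws(1)[OF G e])
    then show ?thesis using hom_gm[OF G f e e that] by simp
  qed
  then have "\<Psi> ?E * \<Psi> ?E = \<Psi> ?E"
    using rep_eq[OF R gm_zpt[OF gs z z] z] rep_mul[OF R z z] by simp
  then have "\<Psi> (gi H ?E) * (\<Psi> ?E * \<Psi> ?E) = 1\<^sub>m n" using rep_inverse(2)[OF gs R z] by simp
  then have "\<Psi> (gi H ?E) * \<Psi> ?E * \<Psi> ?E = 1\<^sub>m n" by (simp add: assoc_mult_mat[of _ n n _ n _ n] rep_carrier[OF R])
  then have "\<Psi> ?E = \<Psi> (gunit H)"
    by (simp add: rep_inverse(2)[OF gs R z] rep_unit[OF R] left_mult_one_mat[OF rep_carrier[OF R]])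
  then show ?thesis by (rule rep_inj[OF R z gs_unit[OF gs] _ w])
qed

text \<open>Compatibility with inverses is derived from that with products, in a matrix
  representation of H: the image of the inverse is a right inverse, and the inverse of the image a
  left inverse, of the same matrix.\<close>

lemma hom_gcomm:
  assumes G: "is_group_scheme G" and H: "smooth_linear_group H" and f: "group_hom G H f"
    and ab: "zpt G a" "zpt G b" and w: "w \<in> vars H"
  shows "pmap f (gcomm G a b) w = gcomm H (pmap f a) (pmap f b) w"
proof -
  note gs = slg_gs[OF H]
  obtain n \<Psi> where R: "matrix_rep H n \<Psi>" by (rule linear_rep[OF H])
  let ?F = "pmap f"
  have z: "zpt G c \<Longrightarrow> zpt H (?F c)" for c by (rule hom_zpt[OF f])
  have m: "\<Psi> (?F (gm G c d)) = \<Psi> (?F c) * \<Psi> (?F d)" if "zpt G c" "zpt G d" for c d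
    using rep_eq[OF R z[OF gm_zpt[OF G that]] gm_zpt[OF gs z[OF that(1)] z[OF that(2)]] hom_gm[OF G f that]]
      rep_mul[OF R z[OF that(1)] z[OF that(2)]] by simp
  have i: "\<Psi> (?F (gi G c)) = \<Psi> (gi H (?F c))" if c: "zpt G c" for c
  proof -
    note gc = gi_zpt[OF G c]
    have "\<Psi> (?F (gm G c (gi G c))) = \<Psi> (?F (gunit G))"
      by (rule rep_eq[OF R z[OF gm_zpt[OF G c gc]] z[OF gs_unit[OF G]]])
        (unfold pmap_def, rule pev_cong[OF hom_pol[OF f]], assumption, rule group_laws(4)[OF G c])
    also have "\<dots> = \<Psi> (gunit H)" by (rule rep_eq[OF R z[OF gs_unit[OF G]] gs_unit[OF gs]]) (rule hom_unit[OF G H f])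
    finally have 1: "\<Psi> (?F c) * \<Psi> (?F (gi G c)) = 1\<^sub>m n" using m[OF c gc] rep_unit[OF R] by simp
    have "\<Psi> (gi H (?F c)) * (\<Psi> (?F c) * \<Psi> (?F (gi G c))) = \<Psi> (gi H (?F c)) * \<Psi> (?F c) * \<Psi> (?F (gi G c))"
      by (simp add: assoc_mult_mat[of _ n n _ n _ n] rep_carrier[OF R])
    then show ?thesis unfolding 1 rep_inverse(2)[OF gs R z[OF c]]
      by (simp add: left_mult_one_mat[OF rep_carrier[OF R]] right_mult_one_mat[OF rep_carrier[OF R]])
  qed
  have "\<Psi> (?F (gcomm G a b)) = \<Psi> (gcomm H (?F a) (?F b))"
    unfolding rep_gcomm[OF gs R z[OF ab(1)] z[OF ab(2)]] using G ab by (simp add: gcomm_def[of G] m i gm_zpt gi_zpt)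
  then show ?thesis by (rule rep_inj[OF R z[OF gcomm_zpt[OF G ab]] gcomm_zpt[OF gs z[OF ab(1)] z[OF ab(2)]] _ w])
qed

lemma retr_An:
  assumes S: "wf_pf S" and \<rho>: "retr S \<rho>" and w: "w \<in> fvars S"
  shows "(\<lambda>a. \<rho> a w) \<in> An (fvars S)"
proof -
  have I: "ideal (feqs S) (rps_ring p (fvars S))" using S by (simp add: wf_pf_def)
  have "(\<lambda>a. a w - \<rho> a w) \<in> FId (feqs S) (\<lambda>a. a)" using \<rho> w by (simp add: retr_def)
  from FR_diff[OF FR_coord[OF w, of "\<lambda>a. a"] FId_FR[OF I this]] show ?thesis by simp
qed

lemma retr_FR_D:
  assumes S: "wf_pf S" and \<rho>: "retr S \<rho>" and w: "w \<in> fvars S"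
  shows "(\<lambda>a. \<rho> a w) \<in> FR (fvars S \<times> {..0}) D"
proof -
  have "(\<lambda>a. a w) \<in> FR (fvars S \<times> {..0}) D" if "w \<in> fvars S" for w using FR_D_coord[OF that, of 0 0] by simp
  from FR_comp[where Q = "\<lambda>w a. a w", OF retr_An[OF assms] this] show ?thesis by simp
qed

lemma retr_fix:
  assumes S: "wf_pf S" and \<rho>: "retr S \<rho>" and a: "restrict a (fvars S) \<in> fpts p S" and w: "w \<in> fvars S"
  shows "\<rho> a w = a w"
proof -
  have "(\<lambda>a. a w - \<rho> a w) \<in> FId (feqs S) (\<lambda>a. a)" using \<rho> w by (simp add: retr_def)
  then obtain f where f: "f \<in> feqs S" "\<forall>a. a w - \<rho> a w = feval p a f" unfolding FId_def by blast
  have "a w - \<rho> a w = 0" using f(2) fpts_vanish'[OF S a f(1)] by simp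
  then show ?thesis by simp
qed

lemma Lie_retr:
  assumes "smooth_linear_group G" "r \<ge> 1"
  obtains \<rho> where "retr (Lie p \<phi> r G) \<rho>"
proof -
  obtain \<rho> where "\<And>w. w \<in> vars G \<times> {..r} \<Longrightarrow> (\<lambda>a. a w - \<rho> a w) \<in> FId (feqs (Lie p \<phi> r G)) (\<lambda>a. a)"
    "\<And>a. restrict (\<rho> a) (vars G \<times> {..r}) \<in> Lie_pts p \<phi> r G"
    by (rule Lie_retraction[OF slg_gs[OF assms(1)] slg_smooth[OF assms(1)] assms(2)]) (rule that)
  then have "retr (Lie p \<phi> r G) \<rho>" by (simp add: retr_def)
  then show thesis by (rule that)
qed

lemma FR_gm:
  assumes "is_group_scheme G" "\<And>v. v \<in> vars G \<Longrightarrow> A v \<in> FR W e" "\<And>v. v \<in> vars G \<Longrightarrow> B v \<in> FR W e" "v \<in> vars G"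
  shows "(\<lambda>x. gm G (\<lambda>v. A v x) (\<lambda>v. B v x) v) \<in> FR W e"
proof -
  have "(\<lambda>x. case_sum (\<lambda>v. A v x) (\<lambda>v. B v x) u) \<in> FR W e" if "u \<in> Sum_Type.Plus (vars G) (vars G)" for u
    using that assms(2,3) by (cases u) auto
  from FR_comp[where Q = "\<lambda>u x. case_sum (\<lambda>v. A v x) (\<lambda>v. B v x) u", OF An_poly[OF gs_mul_pol[OF assms(1,4)]] this]
  show ?thesis by (simp add: gm_def)
qed

lemma FR_gi:
  assumes "is_group_scheme G" "\<And>v. v \<in> vars G \<Longrightarrow> A v \<in> FR W e" "v \<in> vars G"
  shows "(\<lambda>x. gi G (\<lambda>v. A v x) v) \<in> FR W e"
  using FR_comp[where Q = A, OF An_poly[OF gs_inv_pol[OF assms(1,3)]] assms(2)] by (simp add: gi_def)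

lemma An_gcomm:
  assumes G: "is_group_scheme G" and v: "v \<in> vars G"
  shows "(\<lambda>x. gcomm G (\<lambda>v. x (Inl v)) (\<lambda>v. x (Inr v)) v) \<in> An (Sum_Type.Plus (vars G) (vars G))"
proof -
  let ?W = "Sum_Type.Plus (vars G) (vars G)"
  have l: "(\<lambda>x. x (Inl v)) \<in> An ?W" and r: "(\<lambda>x. x (Inr v)) \<in> An ?W" if "v \<in> vars G" for v
    using FR_coord[of "Inl v" ?W "\<lambda>a. a"] FR_coord[of "Inr v" ?W "\<lambda>a. a"] that by (simp_all add: InlI InrI)
  note gl = FR_gi[OF G l] and gr = FR_gi[OF G r]
  note m1 = FR_gm[OF G l r]
  note m2 = FR_gm[where A = "\<lambda>v x. gm G (\<lambda>v. x (Inl v)) (\<lambda>v. x (Inr v)) v" and B = "\<lambda>v x. gi G (\<lambda>v. x (Inl v)) v", OF G m1 gl]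
  note m3 = FR_gm[where A = "\<lambda>v x. gm G (gm G (\<lambda>v. x (Inl v)) (\<lambda>v. x (Inr v))) (gi G (\<lambda>v. x (Inl v))) v"
      and B = "\<lambda>v x. gi G (\<lambda>v. x (Inr v)) v", OF G m2 gr v]
  show ?thesis unfolding gcomm_def by (rule m3) assumption+
qed

section \<open>Construction of the delta-map\<close>

text \<open>Through the two retractions, every point a of the ambient affine space yields points
  \<open>\<alpha> a\<close> and \<open>\<beta> a\<close> of the Lie algebras. So the commutator is
  defined everywhere, and \<open>Lie_pt\<close> carries it to a point of the order
  \<open>r + s\<close> Lie algebra; the coordinates of this point have to be shown to be
  delta-functions of order at most \<open>max r s\<close>.\<close>

lemma is_bracket_exists:
  assumes slg: "smooth_linear_group G" and r: "r \<ge> 1" and s: "s \<ge> 1"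
  shows "\<exists>B. is_bracket p \<phi> r s G B"
proof -
  note G = slg_gs[OF slg]
  let ?V = "vars G" and ?e = "gunit G" and ?m = "max r s" and ?N = "r + s"
  let ?S1 = "Lie p \<phi> r G" and ?S2 = "Lie p \<phi> s G" and ?T = "Lie p \<phi> (r + s) G"
  let ?S = "Lie_prod p \<phi> r s G"
  have N1: "?N \<ge> 1" using r by simp
  note w1 = wf_Lie[OF G, of r] and w2 = wf_Lie[OF G, of s] and wT = wf_Lie[OF G, of ?N]
  note wS = fprod_props(1)[OF w1 w2]
  obtain \<rho>1 where \<rho>1: "retr ?S1 \<rho>1" by (rule Lie_retr[OF slg r])
  obtain \<rho>2 where \<rho>2: "retr ?S2 \<rho>2" by (rule Lie_retr[OF slg s])
  note \<rho> = retr_fprod[OF w1 w2 \<rho>1 \<rho>2]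
  let ?W = "fvars ?S"
  have W: "?W = Sum_Type.Plus (?V \<times> {..r}) (?V \<times> {..s})" by (simp add: fprod_def)
  define \<alpha> where "\<alpha> a = restrict (\<rho>1 (\<lambda>v. a (Inl v))) (?V \<times> {..r})" for a :: "'a \<times> nat + 'a \<times> nat \<Rightarrow> 'r"
  define \<beta> where "\<beta> a = restrict (\<rho>2 (\<lambda>v. a (Inr v))) (?V \<times> {..s})" for a :: "'a \<times> nat + 'a \<times> nat \<Rightarrow> 'r"
  have \<alpha>p: "\<alpha> a \<in> Lie_pts p \<phi> r G" and \<beta>p: "\<beta> a \<in> Lie_pts p \<phi> s G" for a
    using \<rho>1 \<rho>2 by (simp_all add: retr_def \<alpha>_def \<beta>_def)
  define c where "c a = gcomm G (exq r (\<alpha> a)) (exq s (\<beta> a))" for a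
  have cz: "zpt G (c a)" for a
    unfolding c_def by (intro gcomm_zpt G Lie_pts_zpt[OF G r \<alpha>p] Lie_pts_zpt[OF G s \<beta>p])
  have cn: "q ^ ?N dvd c a v - ?e v" if "v \<in> ?V" for a v
    unfolding c_def using that
    by (intro gcomm_near[OF slg] Lie_pts_zpt[OF G r \<alpha>p] Lie_pts_zpt[OF G s \<beta>p] Lie_pts_near[OF G r \<alpha>p] Lie_pts_near[OF G s \<beta>p])
  define P where "P w a = Lie_pt ?N G (c a) w" for w a
  have Pp: "Lie_pt ?N G (c a) \<in> Lie_pts p \<phi> ?N G" for a by (rule Lie_pt_in[OF G N1 cz cn])
  \<comment> \<open>The retraction is a function of order 0, and the twist by
    \<open>\<phi>^s\<close> that remains after cancellation costs s derivatives.\<close>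
  have A: "(\<lambda>a. (\<phi> ^^ ?N) (exq r (\<alpha> a) v)) \<in> FR (?W \<times> {..?m}) D" if v: "v \<in> ?V" for v
  proof -
    have "(\<lambda>a. \<rho>1 (\<lambda>v. a (Inl v)) (v, r)) \<in> FR (?W \<times> {..0}) D"
      using retr_FR_D[OF wS \<rho>, of "Inl (v, r)"] v by (simp add: W InlI)
    then have "(\<lambda>a. (\<phi> ^^ s) (\<rho>1 (\<lambda>v. a (Inl v)) (v, r) - (\<delta> ^^ r) (?e v))) \<in> FR (?W \<times> {..0 + s}) D"
      by (intro FR_\<phi>_pow FR_diff FR_const)
    then have "(\<lambda>a. (\<phi> ^^ s) (\<rho>1 (\<lambda>v. a (Inl v)) (v, r) - (\<delta> ^^ r) (?e v))) \<in> FR (?W \<times> {..?m}) D"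
      by (rule FR_D_mono) simp
    then have "(\<lambda>a. (\<phi> ^^ ?N) (?e v) + q ^ r * (\<phi> ^^ s) (\<rho>1 (\<lambda>v. a (Inl v)) (v, r) - (\<delta> ^^ r) (?e v))) \<in> FR (?W \<times> {..?m}) D"
      by (intro FR_add FR_mult FR_const)
    moreover have "(\<phi> ^^ ?N) (exq r (\<alpha> a) v) = (\<phi> ^^ ?N) (?e v) + q ^ r * (\<phi> ^^ s) (\<rho>1 (\<lambda>v. a (Inl v)) (v, r) - (\<delta> ^^ r) (?e v))" for a
    proof -
      have "(\<phi> ^^ (s + r)) ((\<psi> ^^ r) x) = (\<phi> ^^ s) x" for x by (simp add: funpow_add)
      then have "(\<phi> ^^ ?N) ((\<psi> ^^ r) x) = (\<phi> ^^ s) x" for x by (simp add: add.commute)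
      then show ?thesis using v unfolding Lie_pts_exq[OF G r \<alpha>p v] \<phi>_pow_hom by (simp add: \<phi>_pow_hom \<alpha>_def)
    qed
    ultimately show ?thesis by simp
  qed
  have B: "(\<lambda>a. (\<phi> ^^ ?N) (exq s (\<beta> a) v)) \<in> FR (?W \<times> {..?m}) D" if v: "v \<in> ?V" for v
  proof -
    have "(\<lambda>a. \<rho>2 (\<lambda>v. a (Inr v)) (v, s)) \<in> FR (?W \<times> {..0}) D"
      using retr_FR_D[OF wS \<rho>, of "Inr (v, s)"] v by (simp add: W InrI)
    then have "(\<lambda>a. (\<phi> ^^ r) (\<rho>2 (\<lambda>v. a (Inr v)) (v, s) - (\<delta> ^^ s) (?e v))) \<in> FR (?W \<times> {..0 + r}) D"
      by (intro FR_\<phi>_pow FR_diff FR_const)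
    then have "(\<lambda>a. (\<phi> ^^ r) (\<rho>2 (\<lambda>v. a (Inr v)) (v, s) - (\<delta> ^^ s) (?e v))) \<in> FR (?W \<times> {..?m}) D"
      by (rule FR_D_mono) simp
    then have "(\<lambda>a. (\<phi> ^^ ?N) (?e v) + q ^ s * (\<phi> ^^ r) (\<rho>2 (\<lambda>v. a (Inr v)) (v, s) - (\<delta> ^^ s) (?e v))) \<in> FR (?W \<times> {..?m}) D"
      by (intro FR_add FR_mult FR_const)
    moreover have "(\<phi> ^^ ?N) (exq s (\<beta> a) v) = (\<phi> ^^ ?N) (?e v) + q ^ s * (\<phi> ^^ r) (\<rho>2 (\<lambda>v. a (Inr v)) (v, s) - (\<delta> ^^ s) (?e v))" for a
    proof -
      have "(\<phi> ^^ ?N) ((\<psi> ^^ s) x) = (\<phi> ^^ r) x" for x by (simp add: funpow_add)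
      then show ?thesis using v unfolding Lie_pts_exq[OF G s \<beta>p v] \<phi>_pow_hom by (simp add: \<phi>_pow_hom \<beta>_def)
    qed
    ultimately show ?thesis by simp
  qed
  \<comment> \<open>\<open>An_twist_pow\<close> moves the twist from the value of the commutator to
    the coefficients of its series, so that the arguments enter only in their twisted form.\<close>
  have C: "(\<lambda>a. (\<phi> ^^ ?N) (c a v)) \<in> FR (?W \<times> {..?m}) D" if v: "v \<in> ?V" for v
  proof -
    let ?Q = "\<lambda>u a. case_sum (\<lambda>v. (\<phi> ^^ ?N) (exq r (\<alpha> a) v)) (\<lambda>v. (\<phi> ^^ ?N) (exq s (\<beta> a) v)) u"
    have "?Q u \<in> FR (?W \<times> {..?m}) D" if "u \<in> Sum_Type.Plus ?V ?V" for u
      using that A B by (cases u) auto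
    from FR_comp[where Q = ?Q, OF An_twist_pow[OF An_gcomm[OF G v], of ?N] this]
    show ?thesis by (simp add: c_def)
  qed
  have PF: "P w \<in> FR (?W \<times> {..?m}) D" if w: "w \<in> fvars ?T" for w
  proof -
    obtain v i where vi: "w = (v, i)" "v \<in> ?V" "i \<le> ?N" using w by auto
    show ?thesis
    proof (cases "i < ?N")
      case True
      then have "P w = (\<lambda>a. (\<delta> ^^ i) (?e v))" using vi by (simp add: P_def Lie_pt_def fun_eq_iff)
      then show ?thesis by (simp add: FR_const)
    next
      case False
      then have i: "i = ?N" using vi(3) by simp
      \<comment> \<open>The division by \<open>q^(r+s)\<close> that defines the coordinate of order
        \<open>r + s\<close> of \<open>Lie_pt\<close>, written without inverse twists so that
        \<open>FR_div\<close> applies.\<close>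
      have eq: "(\<phi> ^^ ?N) (c a v) - (\<phi> ^^ ?N) (?e v) = q ^ ?N * (P w a - (\<delta> ^^ ?N) (?e v))" for a
      proof -
        obtain y where "c a v - ?e v = q ^ ?N * y" using cn[OF vi(2)] by (rule dvdE)
        then have y: "c a v = ?e v + q ^ ?N * y" by (simp add: algebra_simps)
        show ?thesis unfolding P_def vi(1) i Lie_pt_top[where g = "c a", OF vi(2) y] by (simp add: y \<phi>_pow_hom)
      qed
      have "(\<lambda>a. P w a - (\<delta> ^^ ?N) (?e v)) \<in> FR (?W \<times> {..?m}) D"
        by (rule FR_div[OF dense_D FR_diff[OF C[OF vi(2)] FR_const] eq])
      from FR_add[OF this FR_const[of "(\<delta> ^^ ?N) (?e v)"]] show ?thesis by simp
    qed
  qed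
  have rP: "(\<lambda>w\<in>fvars ?T. P w a) = Lie_pt ?N G (c a)" for a
    by (rule ext) (simp add: P_def Lie_pt_def restrict_def)
  obtain B where B: "B \<in> delta_map p \<phi> ?m ?S ?T"
    "\<And>a. restrict a ?W \<in> fpts p ?S \<Longrightarrow> delta_app p \<phi> ?m ?S ?T B (restrict a ?W) = (\<lambda>w\<in>fvars ?T. P w a)"
    by (rule delta_map_exists[where P = P and m = ?m, OF wS \<rho> wT PF]) (simp_all add: rP Pp that del: Lie_fvars)
  have "is_bracket p \<phi> r s G B"
    unfolding is_bracket_def
  proof (intro conjI ballI B(1))
    fix a b assume a: "a \<in> Lie_pts p \<phi> r G" and b: "b \<in> Lie_pts p \<phi> s G"
    let ?ab = "fpair ?S1 ?S2 a b"
    have l: "restrict (\<lambda>v. ?ab (Inl v)) (fvars ?S1) = a"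
      using Lie_pts_ext[OF G r a] by (auto simp: fpair_def fun_eq_iff extensional_def InlI)
    have rr: "restrict (\<lambda>v. ?ab (Inr v)) (fvars ?S2) = b"
      using Lie_pts_ext[OF G s b] by (auto simp: fpair_def fun_eq_iff extensional_def InrI)
    have ab: "?ab \<in> fpts p ?S"
      unfolding fprod_props(4)[OF w1 w2] l rr using a b by (simp add: fpair_def)
    have rab: "restrict ?ab ?W = ?ab" by (simp add: fpair_def W)
    \<comment> \<open>On points of the Lie algebras the retractions are the identity, so the
      commutator of the given points is recovered.\<close>
    have "\<alpha> ?ab = a"
    proof -
      have "\<rho>1 (\<lambda>v. ?ab (Inl v)) w = ?ab (Inl w)" if "w \<in> fvars ?S1" for w
        by (rule retr_fix[OF w1 \<rho>1 _ that]) (simp only: l a)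
      then have "\<alpha> ?ab = restrict (\<lambda>v. ?ab (Inl v)) (fvars ?S1)" by (auto simp: \<alpha>_def fun_eq_iff)
      then show ?thesis by (simp only: l)
    qed
    moreover have "\<beta> ?ab = b"
    proof -
      have "\<rho>2 (\<lambda>v. ?ab (Inr v)) w = ?ab (Inr w)" if "w \<in> fvars ?S2" for w
        by (rule retr_fix[OF w2 \<rho>2 _ that]) (simp only: rr b)
      then have "\<beta> ?ab = restrict (\<lambda>v. ?ab (Inr v)) (fvars ?S2)" by (auto simp: \<beta>_def fun_eq_iff)
      then show ?thesis by (simp only: rr)
    qed
    ultimately have c: "c ?ab = gcomm G (exq r a) (exq s b)" by (simp add: c_def)
    have "bracket_app p \<phi> r s G B a b = Lie_pt ?N G (c ?ab)"
      using B(2)[of ?ab] ab unfolding rab rP bracket_app_def by simp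
    then have "ex_map p \<phi> ?N G (bracket_app p \<phi> r s G B a b) = restrict (c ?ab) ?V"
      unfolding ex_map_eq by (auto simp: exq_Lie_pt cn intro!: restrict_ext)
    also have "\<dots> = gcommutator G (ex_map p \<phi> r G a) (ex_map p \<phi> s G b)"
      unfolding gcommutator_eq c ex_map_eq by (rule restrict_ext) (rule gcomm_cong[OF G], simp_all)
    finally show "ex_map p \<phi> ?N G (bracket_app p \<phi> r s G B a b) = gcommutator G (ex_map p \<phi> r G a) (ex_map p \<phi> s G b)" .
  qed
  then show ?thesis ..
qed

lemma is_bracket_app:
  assumes slg: "smooth_linear_group G" and r: "r \<ge> 1" and s: "s \<ge> 1" and B: "is_bracket p \<phi> r s G B"
    and a: "a \<in> Lie_pts p \<phi> r G" and b: "b \<in> Lie_pts p \<phi> s G"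
  shows "bracket_app p \<phi> r s G B a b \<in> Lie_pts p \<phi> (r + s) G"
    "v \<in> vars G \<Longrightarrow> exq (r + s) (bracket_app p \<phi> r s G B a b) v = gcomm G (exq r a) (exq s b) v"
proof -
  note G = slg_gs[OF slg]
  let ?S1 = "Lie p \<phi> r G" and ?S2 = "Lie p \<phi> s G" and ?T = "Lie p \<phi> (r + s) G"
  let ?S = "Lie_prod p \<phi> r s G" and ?ab = "fpair ?S1 ?S2 a b"
  note w1 = wf_Lie[OF G, of r] and w2 = wf_Lie[OF G, of s] and wT = wf_Lie[OF G, of "r + s"]
  note wS = fprod_props(1)[OF w1 w2]
  have l: "restrict (\<lambda>v. ?ab (Inl v)) (fvars ?S1) = a"
    using Lie_pts_ext[OF G r a] by (auto simp: fpair_def fun_eq_iff extensional_def InlI)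
  have rr: "restrict (\<lambda>v. ?ab (Inr v)) (fvars ?S2) = b"
    using Lie_pts_ext[OF G s b] by (auto simp: fpair_def fun_eq_iff extensional_def InrI)
  have ab: "?ab \<in> fpts p ?S"
    unfolding fprod_props(4)[OF w1 w2] l rr using a b by (simp add: fpair_def)
  show "bracket_app p \<phi> r s G B a b \<in> Lie_pts p \<phi> (r + s) G"
    unfolding bracket_app_def using B by (intro delta_app_pts[OF wS wT _ ab]) (simp add: is_bracket_def)
  assume v: "v \<in> vars G"
  have "ex_map p \<phi> (r + s) G (bracket_app p \<phi> r s G B a b) = gcommutator G (ex_map p \<phi> r G a) (ex_map p \<phi> s G b)"
    using B a b by (simp add: is_bracket_def)
  then have "restrict (exq (r + s) (bracket_app p \<phi> r s G B a b)) (vars G) v =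
      restrict (gcomm G (restrict (exq r a) (vars G)) (restrict (exq s b) (vars G))) (vars G) v"
    unfolding ex_map_eq gcommutator_eq by (rule fun_cong)
  then show "exq (r + s) (bracket_app p \<phi> r s G B a b) v = gcomm G (exq r a) (exq s b) v"
    using v gcomm_cong[OF G, of "restrict (exq r a) (vars G)" "exq r a" "restrict (exq s b) (vars G)" "exq s b" v] by simp
qed

text \<open>\<open>exq\<close> is injective on the points of the order \<open>r + s\<close> Lie
  algebra, so the commutator identity fixes all values; by the retraction of the source, a delta-map
  is determined by its values.\<close>

lemma is_bracket_unique:
  assumes slg: "smooth_linear_group G" and r: "r \<ge> 1" and s: "s \<ge> 1"
    and B: "is_bracket p \<phi> r s G B" and B': "is_bracket p \<phi> r s G B'"
  shows "B = B'"
proof -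
  note G = slg_gs[OF slg]
  let ?S1 = "Lie p \<phi> r G" and ?S2 = "Lie p \<phi> s G" and ?T = "Lie p \<phi> (r + s) G"
  let ?S = "Lie_prod p \<phi> r s G"
  have N1: "r + s \<ge> 1" using r by simp
  note w1 = wf_Lie[OF G, of r] and w2 = wf_Lie[OF G, of s]
  note wS = fprod_props(1)[OF w1 w2]
  obtain \<rho>1 where \<rho>1: "retr ?S1 \<rho>1" by (rule Lie_retr[OF slg r])
  obtain \<rho>2 where \<rho>2: "retr ?S2 \<rho>2" by (rule Lie_retr[OF slg s])
  show ?thesis
  proof (rule delta_map_unique[OF wS retr_fprod[OF w1 w2 \<rho>1 \<rho>2]])
    show "B \<in> delta_map p \<phi> (max r s) ?S ?T" "B' \<in> delta_map p \<phi> (max r s) ?S ?T"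
      using B B' by (simp_all add: is_bracket_def)
    fix x assume x: "x \<in> fpts p ?S"
    define a where "a = restrict (\<lambda>v. x (Inl v)) (fvars ?S1)"
    define b where "b = restrict (\<lambda>v. x (Inr v)) (fvars ?S2)"
    have xe: "x \<in> extensional (Sum_Type.Plus (fvars ?S1) (fvars ?S2))" and a: "a \<in> Lie_pts p \<phi> r G" and b: "b \<in> Lie_pts p \<phi> s G"
      using x unfolding fprod_props(4)[OF w1 w2] by (simp_all add: a_def b_def PiE_def)
    have "x = fpair ?S1 ?S2 a b"
    proof
      fix u show "x u = fpair ?S1 ?S2 a b u"
        using xe by (cases u) (auto simp: fpair_def a_def b_def extensional_def Plus_def restrict_def)
    qed
    moreover have "bracket_app p \<phi> r s G B a b = bracket_app p \<phi> r s G B' a b"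
      by (rule Lie_pts_inj[OF G N1 is_bracket_app(1)[OF slg r s B a b] is_bracket_app(1)[OF slg r s B' a b]])
        (simp add: is_bracket_app(2)[OF slg r s B a b] is_bracket_app(2)[OF slg r s B' a b])
    ultimately show "delta_app p \<phi> (max r s) ?S ?T B x = delta_app p \<phi> (max r s) ?S ?T B' x"
      by (simp add: bracket_app_def)
  qed
qed

lemma bracket_ex1:
  "smooth_linear_group G \<Longrightarrow> r \<ge> 1 \<Longrightarrow> s \<ge> 1 \<Longrightarrow> \<exists>!B. is_bracket p \<phi> r s G B"
  using is_bracket_exists[of G r s] is_bracket_unique[of G r s] by (intro ex_ex1I)

lemma bracket_pts:
  assumes "smooth_linear_group G" "r \<ge> 1" "s \<ge> 1" "a \<in> Lie_pts p \<phi> r G" "b \<in> Lie_pts p \<phi> s G"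
  shows "bracket p \<phi> r s G a b \<in> Lie_pts p \<phi> (r + s) G"
    "v \<in> vars G \<Longrightarrow> exq (r + s) (bracket p \<phi> r s G a b) v = gcomm G (exq r a) (exq s b) v"
  unfolding bracket_def
  using is_bracket_app[OF assms(1-3) theI'[OF bracket_ex1[OF assms(1-3)]] assms(4,5)] by simp_all

section \<open>Properties of the bracket\<close>

text \<open>The common core of \<open>Lie_map\<close> and \<open>Lie_add\<close>. Polynomials f that
  send e to the unit of H induce a map on jets which, seen through \<open>exq k\<close>, is f
  itself, because taking lifts commutes with the shift (\<open>exq_jet_lift\<close>).\<close>

lemma jet_mor_pt:
  assumes H: "is_group_scheme H" and k: "k \<ge> 1" and f: "\<And>w. w \<in> vars H \<Longrightarrow> f w \<in> carrier (pol_ring V)"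
    and low: "\<And>v i. v \<in> V \<Longrightarrow> i < k \<Longrightarrow> c (v, i) = (\<delta> ^^ i) (e v)"
    and unit: "\<And>w. w \<in> vars H \<Longrightarrow> pev e (f w) = gunit H w"
    and z: "zpt H (\<lambda>w. pev (exq k c) (f w))"
  shows "w \<in> vars H \<Longrightarrow> exq k (fapp p (Lie p \<phi> k H) (jet_mor p \<phi> (\<lambda>w. of_poly (f w))) c) w = pev (exq k c) (f w)"
    "fapp p (Lie p \<phi> k H) (jet_mor p \<phi> (\<lambda>w. of_poly (f w))) c \<in> Lie_pts p \<phi> k H"
proof -
  let ?b = "fapp p (Lie p \<phi> k H) (jet_mor p \<phi> (\<lambda>w. of_poly (f w))) c"
  have b: "?b (w, i) = feval p c (jet_lift p \<phi> i (of_poly (f w)))" if "w \<in> vars H" "i \<le> k" for w i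
    using that by (simp add: fapp_def jet_mor_def)
  have fr: "of_poly (f w) \<in> rs V" if "w \<in> vars H" for w by (rule rs_of_poly[OF f[OF that]])
  have ex: "exq k ?b w = pev (exq k c) (f w)" if w: "w \<in> vars H" for w
  proof -
    have "exq k ?b w = (shs ^^ k) (\<lambda>i. feval p c (jet_lift p \<phi> i (of_poly (f w)))) 0"
      unfolding exq_shs by (rule shs_pow_cong) (simp add: b w)
    also have "\<dots> = feval p (exq k c) (of_poly (f w))" by (rule exq_jet_lift[OF fr[OF w], symmetric])
    finally show ?thesis by (simp add: feval_pev)
  qed
  show "w \<in> vars H \<Longrightarrow> exq k ?b w = pev (exq k c) (f w)" by (rule ex)
  have "?b (w, i) = (\<delta> ^^ i) (gunit H w)" if w: "w \<in> vars H" and i: "i < k" for w i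
  proof -
    have "?b (w, i) = feval p c (jet_lift p \<phi> i (of_poly (f w)))" using b w i by simp
    also have "\<dots> = feval p (D e) (jet_lift p \<phi> i (of_poly (f w)))"
      by (rule feval_cong[OF jet_lift_rs[OF fr[OF w]]]) (use i low in auto)
    finally show ?thesis by (simp add: feval_D_jet_lift[OF fr[OF w]] feval_pev unit[OF w])
  qed
  moreover have "zpt H (exq k ?b)" using z zpt_cong[OF gs_affine[OF H] ex] by simp
  moreover have "?b \<in> vars H \<times> {..k} \<rightarrow>\<^sub>E UNIV" by (simp add: fapp_def)
  ultimately show "?b \<in> Lie_pts p \<phi> k H" by (simp add: Lie_pts_iff[OF H k])
qed

lemma Lie_map_props:
  assumes G: "is_group_scheme G" and H: "smooth_linear_group H" and f: "group_hom G H f" and k: "k \<ge> 1"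
    and a: "a \<in> Lie_pts p \<phi> k G"
  shows "w \<in> vars H \<Longrightarrow> exq k (Lie_map p \<phi> k H f a) w = pmap f (exq k a) w" "Lie_map p \<phi> k H f a \<in> Lie_pts p \<phi> k H"
proof -
  have "zpt H (\<lambda>w. pev (exq k a) (f w))" using hom_zpt[OF f Lie_pts_zpt[OF G k a]] by (simp add: pmap_def[abs_def])
  note * = jet_mor_pt[where c = a and e = "gunit G" and f = f and V = "vars G",
      OF slg_gs[OF H] k hom_pol[OF f] Lie_pts_low[OF G k a] hom_unit[OF G H f, unfolded pmap_def] this]
  show "w \<in> vars H \<Longrightarrow> exq k (Lie_map p \<phi> k H f a) w = pmap f (exq k a) w" "Lie_map p \<phi> k H f a \<in> Lie_pts p \<phi> k H"
    unfolding Lie_map_def pmap_def using * by blast+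
qed

lemma Lie_add_props:
  assumes G: "is_group_scheme G" and k: "k \<ge> 1" and a: "a \<in> Lie_pts p \<phi> k G" and b: "b \<in> Lie_pts p \<phi> k G"
  shows "v \<in> vars G \<Longrightarrow> exq k (Lie_add p \<phi> k G a b) v = gm G (exq k a) (exq k b) v" "Lie_add p \<phi> k G a b \<in> Lie_pts p \<phi> k G"
proof -
  let ?c = "\<lambda>(u, i). case u of Inl v \<Rightarrow> a (v, i) | Inr v \<Rightarrow> b (v, i)"
  let ?e = "case_sum (gunit G) (gunit G)"
  have ex: "exq k ?c = case_sum (exq k a) (exq k b)"
  proof
    fix u show "exq k ?c u = case_sum (exq k a) (exq k b) u" by (cases u) (simp_all add: exq_shs)
  qed
  have low: "?c (u, i) = (\<delta> ^^ i) (?e u)" if "u \<in> Sum_Type.Plus (vars G) (vars G)" "i < k" for u i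
    using that Lie_pts_low[OF G k a _ that(2)] Lie_pts_low[OF G k b _ that(2)] by (cases u) auto
  have unit: "pev ?e (gmul G w) = gunit G w" if "w \<in> vars G" for w
    using group_laws(1)[OF G gs_unit[OF G] that] by (simp add: gm_def)
  have z: "zpt G (\<lambda>w. pev (exq k ?c) (gmul G w))"
    using gm_zpt[OF G Lie_pts_zpt[OF G k a] Lie_pts_zpt[OF G k b]] unfolding ex by (simp add: gm_def[abs_def])
  note * = jet_mor_pt[where c = ?c and e = ?e and f = "gmul G" and V = "Sum_Type.Plus (vars G) (vars G)",
      OF G k gs_mul_pol[OF G] low unit z]
  show "v \<in> vars G \<Longrightarrow> exq k (Lie_add p \<phi> k G a b) v = gm G (exq k a) (exq k b) v" "Lie_add p \<phi> k G a b \<in> Lie_pts p \<phi> k G"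
    unfolding Lie_add_def gm_def using * unfolding ex by blast+
qed

lemma jet_unit_props:
  assumes G: "is_group_scheme G" and k: "k \<ge> 1"
  shows "v \<in> vars G \<Longrightarrow> exq k (jet_unit p \<phi> k G) v = gunit G v" "jet_unit p \<phi> k G \<in> Lie_pts p \<phi> k G"
proof -
  have low: "jet_unit p \<phi> k G (v, i) = (\<delta> ^^ i) (gunit G v)" if "v \<in> vars G" "i \<le> k" for v i
    using that by (simp add: jet_unit_def nabla_def)
  have ex: "exq k (jet_unit p \<phi> k G) v = gunit G v" if "v \<in> vars G" for v
    using exq_formula[of k "jet_unit p \<phi> k G" v "gunit G"] low[OF that] by (simp add: \<psi>_pow_hom)
  show "v \<in> vars G \<Longrightarrow> exq k (jet_unit p \<phi> k G) v = gunit G v" by (rule ex)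
  have "jet_unit p \<phi> k G \<in> vars G \<times> {..k} \<rightarrow>\<^sub>E UNIV" by (simp add: jet_unit_def nabla_def)
  then show "jet_unit p \<phi> k G \<in> Lie_pts p \<phi> k G"
    unfolding Lie_pts_iff[OF G k] using low zpt_cong[OF gs_affine[OF G] ex] gs_unit[OF G] by auto
qed

section \<open>Linear coordinates on the Lie algebra\<close>

text \<open>A matrix coordinate in which congruence modulo \<open>p^m\<close> can be tested
  (\<open>Lie_cong_lmat\<close>). Modulo p it turns \<open>Lie_add\<close> into the sum and the
  bracket into the commutator of matrices, which reduces the congruences modulo p to identities of
  matrices.\<close>

definition lmat :: "nat \<Rightarrow> (('v \<Rightarrow> 'r) \<Rightarrow> 'r mat) \<Rightarrow> nat \<Rightarrow> ('v \<times> nat \<Rightarrow> 'r) \<Rightarrow> 'r mat" where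
  "lmat n \<Psi> k \<alpha> = mat_log n k (\<Psi> (exq k \<alpha>))"

lemma lmat_carrier [simp]: "lmat n \<Psi> k \<alpha> \<in> carrier_mat n n"
  by (simp add: lmat_def)

lemma rep_Lie_near:
  assumes G: "is_group_scheme G" and R: "matrix_rep G n \<Psi>" and k: "k \<ge> 1" and a: "a \<in> Lie_pts p \<phi> k G"
  shows "mat_near n k (\<Psi> (exq k a)) (1\<^sub>m n)"
  using rep_near[OF G R Lie_pts_zpt[OF G k a], of k] Lie_pts_near[OF G k a] by simp

lemma Lie_cong_lmat:
  assumes G: "is_group_scheme G" and R: "matrix_rep G n \<Psi>" and k: "k \<ge> 1" and ab: "a \<in> Lie_pts p \<phi> k G" "b \<in> Lie_pts p \<phi> k G"
  shows "pt_cong p m (Lie p \<phi> k G) a b \<longleftrightarrow> mat_near n m (lmat n \<Psi> k a) (lmat n \<Psi> k b)"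
  unfolding Lie_cong_iff[OF G k ab] rep_cong[OF R Lie_pts_zpt[OF G k ab(1)] Lie_pts_zpt[OF G k ab(2)]] lmat_def
  by (rule mat_near_log_iff[OF rep_Lie_near[OF G R k ab(1)] rep_Lie_near[OF G R k ab(2)]])

lemma lmat_add:
  assumes G: "is_group_scheme G" and R: "matrix_rep G n \<Psi>" and k: "k \<ge> 1" and a: "a \<in> Lie_pts p \<phi> k G" and b: "b \<in> Lie_pts p \<phi> k G"
  shows "mat_near n 1 (lmat n \<Psi> k (Lie_add p \<phi> k G a b)) (lmat n \<Psi> k a + lmat n \<Psi> k b)"
proof -
  note za = Lie_pts_zpt[OF G k a] and zb = Lie_pts_zpt[OF G k b]
  have "\<Psi> (exq k (Lie_add p \<phi> k G a b)) = \<Psi> (exq k a) * \<Psi> (exq k b)"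
    using rep_eq[OF R Lie_pts_zpt[OF G k Lie_add_props(2)[OF G k a b]] gm_zpt[OF G za zb] Lie_add_props(1)[OF G k a b]]
      rep_mul[OF R za zb] by simp
  then show ?thesis unfolding lmat_def using near_mult(2)[OF rep_Lie_near[OF G R k a] rep_Lie_near[OF G R k b] k] by simp
qed

lemma lmat_unit:
  assumes G: "is_group_scheme G" and R: "matrix_rep G n \<Psi>" and k: "k \<ge> 1"
  shows "lmat n \<Psi> k (jet_unit p \<phi> k G) = 0\<^sub>m n n"
proof -
  have "\<Psi> (exq k (jet_unit p \<phi> k G)) = 1\<^sub>m n"
    using rep_eq[OF R Lie_pts_zpt[OF G k jet_unit_props(2)[OF G k]] gs_unit[OF G] jet_unit_props(1)[OF G k]] rep_unit[OF R] by simp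
  then show ?thesis unfolding lmat_def by (intro mat_log_eqI) simp_all
qed

lemma rep_bracket:
  assumes S: "smooth_linear_group G" and R: "matrix_rep G n \<Psi>" and r: "r \<ge> 1" and s: "s \<ge> 1"
    and a: "a \<in> Lie_pts p \<phi> r G" and b: "b \<in> Lie_pts p \<phi> s G"
  shows "\<Psi> (exq (r + s) (bracket p \<phi> r s G a b)) =
    \<Psi> (exq r a) * \<Psi> (exq s b) * \<Psi> (gi G (exq r a)) * \<Psi> (gi G (exq s b))"
proof -
  note G = slg_gs[OF S]
  note za = Lie_pts_zpt[OF G r a] and zb = Lie_pts_zpt[OF G s b]
  have rs: "r + s \<ge> 1" using r by simp
  show ?thesis
    using rep_eq[OF R Lie_pts_zpt[OF G rs bracket_pts(1)[OF S r s a b]] gcomm_zpt[OF G za zb] bracket_pts(2)[OF S r s a b]]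
      rep_gcomm[OF G R za zb] by simp
qed

lemma lmat_bracket:
  assumes S: "smooth_linear_group G" and R: "matrix_rep G n \<Psi>" and r: "r \<ge> 1" and s: "s \<ge> 1"
    and a: "a \<in> Lie_pts p \<phi> r G" and b: "b \<in> Lie_pts p \<phi> s G"
  shows "lmat n \<Psi> (r + s) (bracket p \<phi> r s G a b) =
      gl_bracket (lmat n \<Psi> r a) (lmat n \<Psi> s b) * \<Psi> (gi G (exq r a)) * \<Psi> (gi G (exq s b))"
    "mat_near n 1 (lmat n \<Psi> (r + s) (bracket p \<phi> r s G a b)) (gl_bracket (lmat n \<Psi> r a) (lmat n \<Psi> s b))"
proof -
  note G = slg_gs[OF S]
  note za = Lie_pts_zpt[OF G r a] and zb = Lie_pts_zpt[OF G s b]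
  note ia = rep_carrier[OF R, of "gi G (exq r a)"] rep_inverse(1)[OF G R za]
  note ib = rep_carrier[OF R, of "gi G (exq s b)"] rep_inverse(1)[OF G R zb]
  note na = rep_Lie_near[OF G R r a] and nb = rep_Lie_near[OF G R s b]
  show "lmat n \<Psi> (r + s) (bracket p \<phi> r s G a b) =
      gl_bracket (lmat n \<Psi> r a) (lmat n \<Psi> s b) * \<Psi> (gi G (exq r a)) * \<Psi> (gi G (exq s b))"
    unfolding lmat_def rep_bracket[OF assms] by (rule near_commutator(2)[OF na nb ia ib])
  show "mat_near n 1 (lmat n \<Psi> (r + s) (bracket p \<phi> r s G a b)) (gl_bracket (lmat n \<Psi> r a) (lmat n \<Psi> s b))"
    unfolding lmat_def rep_bracket[OF assms] by (rule mat_log_commutator[OF na nb r s ia ib])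
qed

text \<open>Under \<open>exq\<close> both sides become the commutator in H of the images of the two
  group elements, and \<open>exq\<close> is injective on the points of the Lie algebra of H.\<close>

lemma bracket_functorial:
  assumes S: "smooth_linear_group G" and S': "smooth_linear_group H" and f: "group_hom G H f" and r: "r \<ge> 1" and s: "s \<ge> 1"
    and a: "a \<in> Lie_pts p \<phi> r G" and b: "b \<in> Lie_pts p \<phi> s G"
  shows "bracket p \<phi> r s H (Lie_map p \<phi> r H f a) (Lie_map p \<phi> s H f b) = Lie_map p \<phi> (r + s) H f (bracket p \<phi> r s G a b)"
proof -
  note G = slg_gs[OF S] and H = slg_gs[OF S']
  have rs: "r + s \<ge> 1" using r by simp
  note La = Lie_map_props[OF G S' f r a] and Lb = Lie_map_props[OF G S' f s b]
  note Bp = bracket_pts[OF S r s a b]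
  note L = Lie_map_props[OF G S' f rs Bp(1)]
  note BH = bracket_pts[OF S' r s La(2) Lb(2)]
  show ?thesis
  proof (rule Lie_pts_inj[OF H rs BH(1) L(2)])
    fix w assume w: "w \<in> vars H"
    have "exq (r + s) (Lie_map p \<phi> (r + s) H f (bracket p \<phi> r s G a b)) w = pmap f (exq (r + s) (bracket p \<phi> r s G a b)) w"
      by (rule L(1)[OF w])
    also have "\<dots> = pmap f (gcomm G (exq r a) (exq s b)) w"
      unfolding pmap_def by (rule pev_cong[OF hom_pol[OF f w]]) (rule Bp(2))
    also have "\<dots> = gcomm H (pmap f (exq r a)) (pmap f (exq s b)) w"
      by (rule hom_gcomm[OF G S' f Lie_pts_zpt[OF G r a] Lie_pts_zpt[OF G s b] w])
    also have "\<dots> = gcomm H (exq r (Lie_map p \<phi> r H f a)) (exq s (Lie_map p \<phi> s H f b)) w"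
      by (rule gcomm_cong[OF H _ _ w]) (simp_all add: La(1) Lb(1))
    also have "\<dots> = exq (r + s) (bracket p \<phi> r s H (Lie_map p \<phi> r H f a) (Lie_map p \<phi> s H f b)) w"
      by (rule BH(2)[OF w, symmetric])
    finally show "exq (r + s) (bracket p \<phi> r s H (Lie_map p \<phi> r H f a) (Lie_map p \<phi> s H f b)) w =
      exq (r + s) (Lie_map p \<phi> (r + s) H f (bracket p \<phi> r s G a b)) w" by simp
  qed
qed

text \<open>The exact formula for \<open>lmat\<close> of a bracket contains only the two logarithms
  and the inverses of the two group elements. The logarithms are congruent modulo \<open>p^m\<close>
  by assumption, and the group elements, hence their inverses, even to a higher power.\<close>

lemma bracket_cong:
  assumes S: "smooth_linear_group G" and r: "r \<ge> 1" and s: "s \<ge> 1"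
    and a: "a \<in> Lie_pts p \<phi> r G" "a' \<in> Lie_pts p \<phi> r G" and b: "b \<in> Lie_pts p \<phi> s G" "b' \<in> Lie_pts p \<phi> s G"
    and aa: "pt_cong p m (Lie p \<phi> r G) a a'" and bb: "pt_cong p m (Lie p \<phi> s G) b b'"
  shows "pt_cong p m (Lie p \<phi> (r + s) G) (bracket p \<phi> r s G a b) (bracket p \<phi> r s G a' b')"
proof -
  note G = slg_gs[OF S]
  have rs: "r + s \<ge> 1" using r by simp
  obtain n \<Psi> where R: "matrix_rep G n \<Psi>" by (rule linear_rep[OF S])
  have inv: "mat_near n m (\<Psi> (gi G (exq k c))) (\<Psi> (gi G (exq k d)))"
    if "k \<ge> 1" "c \<in> Lie_pts p \<phi> k G" "d \<in> Lie_pts p \<phi> k G" "pt_cong p m (Lie p \<phi> k G) c d" for k c d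
  proof (rule near_inverse)
    note zc = Lie_pts_zpt[OF G that(1,2)] and zd = Lie_pts_zpt[OF G that(1,3)]
    show "\<Psi> (gi G (exq k c)) * \<Psi> (exq k c) = 1\<^sub>m n" by (rule rep_inverse(2)[OF G R zc])
    show "\<Psi> (exq k d) * \<Psi> (gi G (exq k d)) = 1\<^sub>m n" by (rule rep_inverse(1)[OF G R zd])
    have "mat_near n (k + m) (\<Psi> (exq k c)) (\<Psi> (exq k d))"
      using that(4) unfolding Lie_cong_iff[OF G that(1-3)] rep_cong[OF R zc zd] .
    then show "mat_near n m (\<Psi> (exq k c)) (\<Psi> (exq k d))" by (rule mat_near_mono) simp
  qed (rule rep_carrier[OF R])+
  show ?thesis
    unfolding Lie_cong_lmat[OF G R rs bracket_pts(1)[OF S r s a(1) b(1)] bracket_pts(1)[OF S r s a(2) b(2)]]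
      lmat_bracket(1)[OF S R r s a(1) b(1)] lmat_bracket(1)[OF S R r s a(2) b(2)]
    by (intro mat_near_mult mat_near_gl_bracket inv r s a b aa bb)
      (use aa bb in \<open>simp_all add: Lie_cong_lmat[OF G R r a] Lie_cong_lmat[OF G R s b]\<close>)
qed

text \<open>Congruence modulo p is tested on logarithms, where both sides reduce to the commutator
  of a sum of matrices with a third one.\<close>

lemma bracket_add_left:
  assumes S: "smooth_linear_group G" and r: "r \<ge> 1" and s: "s \<ge> 1"
    and a: "a \<in> Lie_pts p \<phi> r G" and a': "a' \<in> Lie_pts p \<phi> r G" and b: "b \<in> Lie_pts p \<phi> s G"
  shows "pt_cong p 1 (Lie p \<phi> (r + s) G) (bracket p \<phi> r s G (Lie_add p \<phi> r G a a') b)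
    (Lie_add p \<phi> (r + s) G (bracket p \<phi> r s G a b) (bracket p \<phi> r s G a' b))"
proof -
  note G = slg_gs[OF S]
  have rs: "r + s \<ge> 1" using r by simp
  obtain n \<Psi> where R: "matrix_rep G n \<Psi>" by (rule linear_rep[OF S])
  let ?L = "lmat n \<Psi>"
  note aa = Lie_add_props(2)[OF G r a a']
  note B = bracket_pts(1)[OF S r s a b] and B' = bracket_pts(1)[OF S r s a' b]
  have "mat_near n 1 (?L (r + s) (bracket p \<phi> r s G (Lie_add p \<phi> r G a a') b)) (gl_bracket (?L r a + ?L r a') (?L s b))"
    by (rule mat_near_trans[OF lmat_bracket(2)[OF S R r s aa b] mat_near_gl_bracket[OF lmat_add[OF G R r a a'] mat_near_refl]]) simp
  moreover have "mat_near n 1 (?L (r + s) (Lie_add p \<phi> (r + s) G (bracket p \<phi> r s G a b) (bracket p \<phi> r s G a' b)))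
      (gl_bracket (?L r a) (?L s b) + gl_bracket (?L r a') (?L s b))"
    by (rule mat_near_trans[OF lmat_add[OF G R rs B B'] mat_near_add[OF lmat_bracket(2)[OF S R r s a b] lmat_bracket(2)[OF S R r s a' b]]])
  ultimately show ?thesis
    unfolding Lie_cong_lmat[OF G R rs bracket_pts(1)[OF S r s aa b] Lie_add_props(2)[OF G rs B B']]
      gl_bracket_add_left[OF lmat_carrier lmat_carrier lmat_carrier]
    by (rule mat_near_trans[OF _ mat_near_sym])
qed

lemma bracket_antisym:
  assumes S: "smooth_linear_group G" and r: "r \<ge> 1" and s: "s \<ge> 1"
    and a: "a \<in> Lie_pts p \<phi> r G" and b: "b \<in> Lie_pts p \<phi> s G"
  shows "pt_cong p 1 (Lie p \<phi> (r + s) G)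
    (Lie_add p \<phi> (r + s) G (bracket p \<phi> r s G a b) (bracket p \<phi> s r G b a)) (jet_unit p \<phi> (r + s) G)"
proof -
  note G = slg_gs[OF S]
  have rs: "r + s \<ge> 1" using r by simp
  obtain n \<Psi> where R: "matrix_rep G n \<Psi>" by (rule linear_rep[OF S])
  note B = bracket_pts(1)[OF S r s a b] and B' = bracket_pts(1)[OF S s r b a, unfolded add.commute[of s r]]
  show ?thesis
    unfolding Lie_cong_lmat[OF G R rs Lie_add_props(2)[OF G rs B B'] jet_unit_props(2)[OF G rs]] lmat_unit[OF G R rs]
    using mat_near_trans[OF lmat_add[OF G R rs B B'] mat_near_add[OF lmat_bracket(2)[OF S R r s a b]
          lmat_bracket(2)[OF S R s r b a, unfolded add.commute[of s r]]]]
    unfolding gl_bracket_antisym[OF lmat_carrier lmat_carrier] .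
qed

lemma bracket_jacobi:
  assumes S: "smooth_linear_group G" and r: "r \<ge> 1" and s: "s \<ge> 1" and t: "t \<ge> 1"
    and a: "a \<in> Lie_pts p \<phi> r G" and b: "b \<in> Lie_pts p \<phi> s G" and c: "c \<in> Lie_pts p \<phi> t G"
  shows "pt_cong p 1 (Lie p \<phi> (r + s + t) G)
    (Lie_add p \<phi> (r + s + t) G (Lie_add p \<phi> (r + s + t) G
        (bracket p \<phi> (r + s) t G (bracket p \<phi> r s G a b) c) (bracket p \<phi> (s + t) r G (bracket p \<phi> s t G b c) a))
      (bracket p \<phi> (t + r) s G (bracket p \<phi> t r G c a) b)) (jet_unit p \<phi> (r + s + t) G)"
proof -
  note G = slg_gs[OF S]
  obtain n \<Psi> where R: "matrix_rep G n \<Psi>" by (rule linear_rep[OF S])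
  let ?k = "r + s + t" and ?L = "lmat n \<Psi>"
  have k: "?k \<ge> 1" using r by simp
  \<comment> \<open>The three double brackets live in orders that agree only after reordering the
    sums.\<close>
  have e: "s + t + r = ?k" "t + r + s = ?k" by simp_all
  have *: "bracket p \<phi> (i + j) l G (bracket p \<phi> i j G x y) z \<in> Lie_pts p \<phi> (i + j + l) G \<and>
      mat_near n 1 (?L (i + j + l) (bracket p \<phi> (i + j) l G (bracket p \<phi> i j G x y) z)) (gl_bracket (gl_bracket (?L i x) (?L j y)) (?L l z))"
    if i: "i \<ge> 1" and j: "j \<ge> 1" and l: "l \<ge> 1" and x: "x \<in> Lie_pts p \<phi> i G" and y: "y \<in> Lie_pts p \<phi> j G"
      and z: "z \<in> Lie_pts p \<phi> l G" for i j l x y z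
  proof
    have ij: "i + j \<ge> 1" using i by simp
    note B = bracket_pts(1)[OF S i j x y]
    show "bracket p \<phi> (i + j) l G (bracket p \<phi> i j G x y) z \<in> Lie_pts p \<phi> (i + j + l) G"
      by (rule bracket_pts(1)[OF S ij l B z])
    show "mat_near n 1 (?L (i + j + l) (bracket p \<phi> (i + j) l G (bracket p \<phi> i j G x y) z)) (gl_bracket (gl_bracket (?L i x) (?L j y)) (?L l z))"
      by (rule mat_near_trans[OF lmat_bracket(2)[OF S R ij l B z] mat_near_gl_bracket[OF lmat_bracket(2)[OF S R i j x y] mat_near_refl]]) simp
  qed
  note A1 = *[OF r s t a b c] and A2 = *[OF s t r b c a, unfolded e] and A3 = *[OF t r s c a b, unfolded e]
  note p1 = conjunct1[OF A1] and p2 = conjunct1[OF A2] and p3 = conjunct1[OF A3]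
  note p12 = Lie_add_props(2)[OF G k p1 p2]
  have "mat_near n 1 (?L ?k (Lie_add p \<phi> ?k G (Lie_add p \<phi> ?k G
        (bracket p \<phi> (r + s) t G (bracket p \<phi> r s G a b) c) (bracket p \<phi> (s + t) r G (bracket p \<phi> s t G b c) a))
      (bracket p \<phi> (t + r) s G (bracket p \<phi> t r G c a) b)))
      (gl_bracket (gl_bracket (?L r a) (?L s b)) (?L t c) + gl_bracket (gl_bracket (?L s b) (?L t c)) (?L r a) + gl_bracket (gl_bracket (?L t c) (?L r a)) (?L s b))"
    by (rule mat_near_trans[OF lmat_add[OF G R k p12 p3] mat_near_add[OF mat_near_trans[OF lmat_add[OF G R k p1 p2]
      mat_near_add[OF conjunct2[OF A1] conjunct2[OF A2]]] conjunct2[OF A3]]])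
  then show ?thesis
    unfolding Lie_cong_lmat[OF G R k Lie_add_props(2)[OF G k p12 p3] jet_unit_props(2)[OF G k]] lmat_unit[OF G R k]
      gl_bracket_jacobi[OF lmat_carrier lmat_carrier lmat_carrier] .
qed

end

section \<open>The general linear group\<close>

lemma pol_ideal_closed:
  assumes "ideal I (pol_ring W)"
  shows "f \<in> I \<Longrightarrow> g \<in> I \<Longrightarrow> f + g \<in> I" "f \<in> I \<Longrightarrow> c \<in> carrier (pol_ring W) \<Longrightarrow> c * f \<in> I" "0 \<in> I"
    "f \<in> I \<Longrightarrow> g \<in> I \<Longrightarrow> f - g \<in> I"
  using ideal.I_l_closed[OF assms, of f c] ideal.I_l_closed[OF assms, of g "- 1"]
    additive_subgroup.a_closed[OF ideal.axioms(1)[OF assms], of f g]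
    additive_subgroup.a_closed[OF ideal.axioms(1)[OF assms], of f "- g"]
    additive_subgroup.zero_closed[OF ideal.axioms(1)[OF assms]]
  by (simp_all add: pol_uminus)

lemma GL_eqs_iff: "g \<in> eqs (GL n) \<longleftrightarrow> (\<exists>c\<in>carrier (pol_ring (GLvars n)). g = c * GLeq n)"
  unfolding GL_simps cring.cgenideal_eq_genideal[OF cring_pol_ring GLeq_pol, symmetric] by (auto simp: cgenideal_def)

lemma GL_affine: "is_affine_scheme (GL n :: ((nat \<times> nat) option, 'r::comm_ring_1) group_scheme)"
proof -
  have "ideal (Idl\<^bsub>pol_ring (GLvars n)\<^esub> {GLeq n :: ((nat \<times> nat) option, 'r) mpoly}) (pol_ring (GLvars n))"
    by (rule genideal_pol_ring(1)) (simp add: GLeq_pol)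
  then show ?thesis by (simp add: is_affine_scheme_def GL_simps) (simp add: GLvars_def)
qed

lemma GL_ideal: "ideal (eqs (GL n :: ((nat \<times> nat) option, 'r::comm_ring_1) group_scheme)) (pol_ring (GLvars n))"
  using GL_affine[of n, where 'r = 'r] by (simp add: is_affine_scheme_def GL_simps(1))

lemma GLvars_cases: "v \<in> GLvars n \<Longrightarrow> (v = None \<Longrightarrow> P) \<Longrightarrow> (\<And>i j. i < n \<Longrightarrow> j < n \<Longrightarrow> v = Some (i, j) \<Longrightarrow> P) \<Longrightarrow> P"
  by (auto simp: GLvars_def)

lemma GLvars_in [simp]: "None \<in> GLvars n" "i < n \<Longrightarrow> j < n \<Longrightarrow> Some (i, j) \<in> GLvars n"
  by (auto simp: GLvars_def)

lemma aprod_ideal: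
  assumes "is_affine_scheme S" "is_affine_scheme T"
  shows "ideal (eqs (aprod S T)) (pol_ring (Sum_Type.Plus (vars S) (vars T)))"
    "f \<in> eqs S \<Longrightarrow> msubst (\<lambda>v. mvar (Inl v)) f \<in> eqs (aprod S T)"
    "g \<in> eqs T \<Longrightarrow> msubst (\<lambda>v. mvar (Inr v)) g \<in> eqs (aprod S T)"
proof -
  let ?W = "Sum_Type.Plus (vars S) (vars T)"
  let ?S = "msubst (\<lambda>v. mvar (Inl v)) ` eqs S \<union> msubst (\<lambda>w. mvar (Inr w)) ` eqs T"
  have "f \<in> carrier (pol_ring (vars S))" if "f \<in> eqs S" for f
    using assms(1) that additive_subgroup.a_Hcarr[OF ideal.axioms(1)] by (auto simp: is_affine_scheme_def)
  moreover have "f \<in> carrier (pol_ring (vars T))" if "f \<in> eqs T" for f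
    using assms(2) that additive_subgroup.a_Hcarr[OF ideal.axioms(1)] by (auto simp: is_affine_scheme_def)
  ultimately have s: "?S \<subseteq> carrier (pol_ring ?W)"
    by (auto intro!: msubst_pol simp: InlI InrI)
  have e: "eqs (aprod S T) = Idl\<^bsub>pol_ring ?W\<^esub> ?S" by (simp add: aprod_def)
  show "ideal (eqs (aprod S T)) (pol_ring ?W)" unfolding e by (rule genideal_pol_ring(1)[OF s])
  show "f \<in> eqs S \<Longrightarrow> msubst (\<lambda>v. mvar (Inl v)) f \<in> eqs (aprod S T)"
    "g \<in> eqs T \<Longrightarrow> msubst (\<lambda>v. mvar (Inr v)) g \<in> eqs (aprod S T)"
    unfolding e using genideal_pol_ring(2)[OF s] by auto
qed

lemma msubst_GLeq: "msubst F (GLeq n) = F None * det (coord_mat n F) - 1"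
proof -
  note h = rhomD[OF rhom_meval[OF rhom_mconst, of F]]
  show ?thesis by (simp add: GLeq_def h rhom_det[OF rhom_meval[OF rhom_mconst]])
qed

text \<open>The ideal of \<open>GL n\<close> is principal, so only its generator has to be pulled
  back.\<close>

lemma GL_amor:
  fixes S :: "('v, 'r::comm_ring_1, 'z) affine_scheme" and F :: "(nat \<times> nat) option \<Rightarrow> ('v, 'r) mpoly"
  assumes "\<And>v. v \<in> GLvars n \<Longrightarrow> F v \<in> carrier (pol_ring (vars S))" "ideal (eqs S) (pol_ring (vars S))"
    and "F None * det (coord_mat n F) - 1 \<in> eqs S"
  shows "amor S (GL n) F"
  unfolding amor_def
proof (intro conjI ballI)
  fix g :: "((nat \<times> nat) option, 'r) mpoly" assume "g \<in> eqs (GL n)"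
  then obtain c where c: "c \<in> carrier (pol_ring (GLvars n))" and g: "g = c * GLeq n" unfolding GL_eqs_iff by blast
  have "msubst F g = msubst F c * (F None * det (coord_mat n F) - 1)"
    by (simp add: g meval_mult msubst_GLeq)
  then show "msubst F g \<in> eqs S" using pol_ideal_closed(2)[OF assms(2,3) msubst_pol[OF c assms(1)]] by simp
qed (simp add: assms(1) GL_simps)

lemma GL_amor_eqI:
  assumes "ideal (eqs S) (pol_ring (vars S))" "F None - F' None \<in> eqs S"
    "\<And>i j. i < n \<Longrightarrow> j < n \<Longrightarrow> coord_mat n F $$ (i, j) - coord_mat n F' $$ (i, j) \<in> eqs S"
  shows "amor_eq S (GL n) F F'"
  unfolding amor_eq_def GL_simps
proof
  fix v assume "v \<in> GLvars n" then show "F v - F' v \<in> eqs S"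
    by (rule GLvars_cases) (use assms(2,3) in auto)
qed

lemma GL_gmul_at:
  assumes "rhom \<iota>"
  shows "gmul_at (GL n) \<iota> a b None = a None * b None"
    "coord_mat n (gmul_at (GL n) \<iota> a b) = coord_mat n a * coord_mat n b"
proof -
  show "gmul_at (GL n) \<iota> a b None = a None * b None" by (simp add: gmul_at_def GL_simps meval_mult[OF assms] assms)
  show "coord_mat n (gmul_at (GL n) \<iota> a b) = coord_mat n a * coord_mat n b"
  proof (rule eq_matI)
    fix i j assume "i < dim_row (coord_mat n a * coord_mat n b)" "j < dim_col (coord_mat n a * coord_mat n b)"
    then have "i < n" "j < n" by simp_all
    then show "coord_mat n (gmul_at (GL n) \<iota> a b) $$ (i, j) = (coord_mat n a * coord_mat n b) $$ (i, j)"
      by (simp add: gmul_at_def GL_simps meval_sum[OF assms] meval_mult[OF assms] assms mat_mult_index[of _ n] del: index_mult_mat)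
  qed simp_all
qed

lemma GL_gmul_coord: "coord_mat n (gmul (GL n)) = coord_mat n (\<lambda>v. mvar (Inl v)) * coord_mat n (\<lambda>v. mvar (Inr v))"
  by (rule eq_matI) (simp_all add: GL_simps mat_mult_index[of _ n] del: index_mult_mat(1))

lemma GL_ginv: "ginv (GL n) None = det (coord_mat n mvar)"
    "coord_mat n (ginv (GL n)) = mvar None \<cdot>\<^sub>m adj_mat (coord_mat n mvar)"
  by (simp add: GL_def Let_def)
    (rule eq_matI, auto simp: GL_def Let_def adj_mat_def)

lemma GL_gunit: "gunit (GL n) None = 1" "coord_mat n (gunit (GL n)) = 1\<^sub>m n"
  by (simp add: GL_def Let_def) (rule eq_matI, auto simp: GL_def Let_def)

lemma adj_coord_pol:
  assumes "i < n" "j < n"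
  shows "adj_mat (coord_mat n mvar) $$ (i, j) \<in> carrier (pol_ring (GLvars n) :: ((nat \<times> nat) option, 'r::comm_ring_1) mpoly ring)"
proof -
  have d: "det (mat_delete (coord_mat n mvar) j i) \<in> carrier (pol_ring (GLvars n) :: ((nat \<times> nat) option, 'r::comm_ring_1) mpoly ring)"
    by (rule det_pol[of _ "n - 1"]) (use assms in \<open>auto simp: mat_delete_def\<close>)
  have "(- 1) ^ k \<in> carrier (pol_ring (GLvars n) :: ((nat \<times> nat) option, 'r::comm_ring_1) mpoly ring)" for k
    by (induction k) (simp_all add: pol_uminus)
  then show ?thesis using assms d by (simp add: adj_mat_def cofactor_def pol_closed)
qed

text \<open>Serves the inversion morphism: with d for the variable \<open>None\<close>, the pullback
  of the equation \<open>d * det X - 1\<close> along it is \<open>(d * det X)^n - 1\<close>, by the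
  determinant of the adjugate.\<close>

lemma power_minus_one_GL: "(mvar None * det (coord_mat n mvar)) ^ k - 1 \<in> eqs (GL n :: ((nat \<times> nat) option, 'r::comm_ring_1) group_scheme)"
proof -
  let ?x = "mvar None * det (coord_mat n mvar) :: ((nat \<times> nat) option, 'r) mpoly"
  have "det (coord_mat n mvar) \<in> carrier (pol_ring (GLvars n) :: ((nat \<times> nat) option, 'r) mpoly ring)"
    by (rule pol_mono[OF det_coord_pol]) (auto simp: GLvars_def)
  then have x: "?x \<in> carrier (pol_ring (GLvars n))" by (simp add: pol_closed)
  have "?x ^ i \<in> carrier (pol_ring (GLvars n))" for i by (induction i) (simp_all add: pol_closed x)
  then have "(\<Sum>i<k. ?x ^ i) \<in> carrier (pol_ring (GLvars n))" by (rule pol_sum)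
  moreover have "?x ^ k - 1 = (\<Sum>i<k. ?x ^ i) * GLeq n"
    by (simp add: power_diff_1_eq GLeq_def mult.commute)
  ultimately show ?thesis unfolding GL_eqs_iff by blast
qed

text \<open>The formula for matrices applies the bracket to \<open>GL n\<close>, which therefore has
  to be verified to be a group scheme in the given sense. Every axiom becomes an identity of
  matrices of polynomials modulo the single equation \<open>GLeq n\<close>.\<close>

lemma GL_group_scheme: "is_group_scheme (GL n :: ((nat \<times> nat) option, 'r::comm_ring_1) group_scheme)"
proof -
  let ?G = "GL n :: ((nat \<times> nat) option, 'r) group_scheme" and ?V = "GLvars n"
  let ?X = "coord_mat n (mvar :: _ \<Rightarrow> ((nat \<times> nat) option, 'r) mpoly)" and ?N = "mvar None :: ((nat \<times> nat) option, 'r) mpoly"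
  let ?l = "\<lambda>v. mvar (Inl v) :: ((nat \<times> nat) option + (nat \<times> nat) option, 'r) mpoly"
    and ?r = "\<lambda>v. mvar (Inr v) :: ((nat \<times> nat) option + (nat \<times> nat) option, 'r) mpoly"
  let ?e = "\<lambda>v. mconst (gunit ?G v)"
  have I: "ideal (eqs ?G) (pol_ring (vars ?G))" unfolding GL_simps(1) by (rule GL_ideal)
  have X: "?X \<in> carrier_mat n n" by simp
  note A = GL_affine[of n, where 'r = 'r]
  note A2 = aprod_ideal[OF A A]
  have I2: "ideal (eqs (aprod ?G ?G)) (pol_ring (vars (aprod ?G ?G)))" using A2(1) by (simp add: aprod_def)
  have aff2: "is_affine_scheme (aprod ?G ?G)"
    using I2 A by (simp add: is_affine_scheme_def) (simp add: aprod_def)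
  have I3: "ideal (eqs (aprod ?G (aprod ?G ?G))) (pol_ring (vars (aprod ?G (aprod ?G ?G))))"
    using aprod_ideal(1)[OF A aff2] by (simp add: aprod_def)
  have mul: "amor (aprod ?G ?G) ?G (gmul ?G)"
  proof (rule GL_amor[OF _ I2])
    fix v assume "v \<in> ?V"
    then show "gmul ?G v \<in> carrier (pol_ring (vars (aprod ?G ?G)))"
      by (rule GLvars_cases) (auto simp: GL_simps aprod_def InlI InrI intro!: pol_closed pol_sum)
  next
    \<comment> \<open>The equations of the two factors. The pullback of the equation along the
      product is \<open>(u + 1) * (v + 1) - 1 = (u + 1) * v + u\<close>, and \<open>?c\<close> is
      \<open>u + 1\<close>.\<close>
    let ?u = "msubst ?l (GLeq n)" and ?v = "msubst ?r (GLeq n)"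
    let ?c = "mvar (Inl None) * det (coord_mat n ?l)"
    have u: "?u = ?c - 1" and v: "?v = mvar (Inr None) * det (coord_mat n ?r) - 1" by (simp_all add: msubst_GLeq)
    have uv: "?u \<in> eqs (aprod ?G ?G)" "?v \<in> eqs (aprod ?G ?G)" using A2(2,3)[OF GLeq_in] by simp_all
    have "?c \<in> carrier (pol_ring (vars (aprod ?G ?G)))"
      by (rule pol_closed(2)[OF _ det_pol[of _ n]]) (auto simp: aprod_def GL_simps InlI)
    from pol_ideal_closed(1)[OF I2 pol_ideal_closed(2)[OF I2 uv(2) this] uv(1)]
    have "?c * ?v + ?u \<in> eqs (aprod ?G ?G)" .
    moreover have "gmul ?G None * det (coord_mat n (gmul ?G)) - 1 = ?c * ?v + ?u"
      unfolding u v GL_gmul_coord by (simp add: GL_simps det_mult[of _ n] algebra_simps)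
    ultimately show "gmul ?G None * det (coord_mat n (gmul ?G)) - 1 \<in> eqs (aprod ?G ?G)" by simp
  qed
  have unit: "meval id (gunit ?G) g = 0" if g: "g \<in> eqs ?G" for g :: "((nat \<times> nat) option, 'r) mpoly"
  proof -
    obtain c where g: "g = c * GLeq n" using g unfolding GL_eqs_iff by blast
    note h = rhomD[OF rhom_meval[OF rhom_id(1), of "gunit ?G"]]
    have "meval id (gunit ?G) (GLeq n) = 0"
      by (simp add: GLeq_def h rhom_det[OF rhom_meval[OF rhom_id(1)]] GL_gunit)
    then show ?thesis by (simp add: g h)
  qed
  have inv: "amor ?G ?G (ginv ?G)"
  proof (rule GL_amor[OF _ I])
    fix v assume "v \<in> ?V"
    then show "ginv ?G v \<in> carrier (pol_ring (vars ?G))"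
    proof (rule GLvars_cases)
      assume "v = None"
      then show ?thesis unfolding GL_simps
        by (simp add: GL_ginv) (rule pol_mono[OF det_coord_pol], auto simp: GLvars_def)
    next
      fix i j assume ij: "i < n" "j < n" "v = Some (i, j)"
      have "?N * adj_mat ?X $$ (i, j) \<in> carrier (pol_ring ?V)"
        by (rule pol_closed(2)[OF _ adj_coord_pol[OF ij(1,2)]]) simp
      then show ?thesis unfolding GL_simps(1) by (simp add: GL_def Let_def ij(3))
    qed
  next
    \<comment> \<open>Only this product is computed. The determinant of the adjugate by itself would
      require cancelling \<open>det X\<close>.\<close>
    have "det (adj_mat ?X) * det ?X = det (adj_mat ?X * ?X)" by (simp add: det_mult[of _ n] adj_mat(1)[OF X])
    also have "\<dots> = det ?X ^ n" by (simp add: adj_mat(3)[OF X])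
    finally have d: "det (adj_mat ?X) * det ?X = det ?X ^ n" .
    have "ginv ?G None * det (coord_mat n (ginv ?G)) = ?N ^ n * (det (adj_mat ?X) * det ?X)"
      by (simp add: GL_ginv adj_mat(1)[OF X, THEN carrier_matD(2)] algebra_simps)
    then have "ginv ?G None * det (coord_mat n (ginv ?G)) - 1 = (?N * det ?X) ^ n - 1"
      by (simp add: d power_mult_distrib)
    then show "ginv ?G None * det (coord_mat n (ginv ?G)) - 1 \<in> eqs ?G" using power_minus_one_GL by simp
  qed
  note gma = GL_gmul_at[OF rhom_mconst]
  have assoc: "amor_eq (aprod ?G (aprod ?G ?G)) ?G (gmul_at ?G mconst a (gmul_at ?G mconst b c)) (gmul_at ?G mconst (gmul_at ?G mconst a b) c)"
    for a b c
    by (rule GL_amor_eqI[OF I3])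
      (simp_all add: gma pol_ideal_closed(3)[OF I3] mult.assoc assoc_mult_mat[of _ n n _ n _ n] del: index_mult_mat)
  have e: "?e None = 1" "coord_mat n ?e = 1\<^sub>m n"
  proof -
    show "?e None = 1" by (simp add: GL_gunit rhomD(1)[OF rhom_mconst])
    show "coord_mat n ?e = 1\<^sub>m n"
      unfolding map_coord_mat[of mconst n "gunit ?G", symmetric] GL_gunit(2)
      by (rule eq_matI) (auto simp: rhomD[OF rhom_mconst])
  qed
  have units: "amor_eq ?G ?G (gmul_at ?G mconst ?e mvar) mvar" "amor_eq ?G ?G (gmul_at ?G mconst mvar ?e) mvar"
    by (rule GL_amor_eqI[OF I]; simp add: gma e left_mult_one_mat[OF X] right_mult_one_mat[OF X] pol_ideal_closed(3)[OF I]
        del: index_mult_mat)+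
  have d: "GLeq n * c \<in> eqs ?G" if "c \<in> carrier (pol_ring (GLvars n))" for c
    unfolding GL_eqs_iff using that by (auto simp: mult.commute)
  have one: "1\<^sub>m n $$ (i, j) \<in> carrier (pol_ring ?V :: ((nat \<times> nat) option, 'r) mpoly ring)" if "i < n" "j < n" for i j using that by simp
  have ent: "(?N \<cdot>\<^sub>m (det ?X \<cdot>\<^sub>m 1\<^sub>m n)) $$ (i, j) - 1\<^sub>m n $$ (i, j) \<in> eqs ?G" if "i < n" "j < n" for i j
  proof -
    have "(?N \<cdot>\<^sub>m (det ?X \<cdot>\<^sub>m 1\<^sub>m n)) $$ (i, j) - 1\<^sub>m n $$ (i, j) = GLeq n * (1\<^sub>m n $$ (i, j))"
      using that by (simp add: GLeq_def algebra_simps)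
    then show ?thesis using d[OF one[OF that]] by simp
  qed
  have invs: "amor_eq ?G ?G (gmul_at ?G mconst (ginv ?G) mvar) ?e" "amor_eq ?G ?G (gmul_at ?G mconst mvar (ginv ?G)) ?e"
    by (rule GL_amor_eqI[OF I];
      use d[OF pol_1] ent in \<open>simp add: gma e GL_ginv GLeq_def mult.commute mult_smult_assoc_mat[OF adj_mat(1)[OF X] X]
        mult_smult_distrib[OF X adj_mat(1)[OF X]] adj_mat(2,3)[OF X] del: index_mult_mat index_smult_mat index_one_mat\<close>)+
  show ?thesis
    unfolding is_group_scheme_def Let_def by (intro conjI GL_affine mul inv assoc units invs ballI unit)
qed

lemma mpderiv_not_var: "f \<in> carrier (pol_ring V) \<Longrightarrow> v \<notin> V \<Longrightarrow> mpderiv v f = 0"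
  by (induction f rule: pol_induct) (auto simp: mpderiv_add mpderiv_mult mpderiv_mvar)

text \<open>One global equation suffices, with h = 1. Its derivative with respect to the variable
  \<open>None\<close> is \<open>det X\<close>, which is invertible modulo the equation: c equals
  \<open>None\<close> times \<open>c * det X\<close> minus \<open>c * GLeq n\<close>, with
  \<open>None\<close> standing for its variable, so c lies in P.\<close>

lemma GL_smooth: "smooth (GL n :: ((nat \<times> nat) option, 'r::comm_ring_1) group_scheme)"
  unfolding smooth_def Let_def
proof (intro allI impI)
  fix P :: "((nat \<times> nat) option, 'r) mpoly set"
  assume "primeideal P (pol_ring (vars (GL n))) \<and> eqs (GL n) \<subseteq> P"
  then have P: "primeideal P (pol_ring (GLvars n))" and eP: "eqs (GL n) \<subseteq> P" by (simp_all add: GL_simps)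
  have I: "ideal P (pol_ring (GLvars n))" by (rule primeideal.axioms(1)[OF P])
  have "1 \<notin> P"
    using ideal.one_imp_carrier[OF I] primeideal.I_notcarr[OF P] by auto
  have "c \<in> P" if c: "c \<in> carrier (pol_ring (GLvars n))" and v: "\<forall>v\<in>GLvars n. c * mpderiv v (GLeq n) \<in> P" for c
  proof -
    have d0: "mpderiv None (det (coord_mat n (mvar :: _ \<Rightarrow> ((nat \<times> nat) option, 'r) mpoly))) = 0" by (rule mpderiv_not_var[OF det_coord_pol]) auto
    have m1: "mpderiv v (1 :: ((nat \<times> nat) option, 'r) mpoly) = 0" for v
      using mpderiv_mconst[of v "1 :: 'r"] by (simp add: rhomD(1)[OF rhom_mconst])
    have "mpderiv None (GLeq n + 1 :: ((nat \<times> nat) option, 'r) mpoly) = det (coord_mat n mvar)"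
      by (simp add: GLeq_def mpderiv_mult mpderiv_mvar d0)
    then have "mpderiv None (GLeq n :: ((nat \<times> nat) option, 'r) mpoly) = det (coord_mat n mvar)" by (simp add: mpderiv_add m1)
    then have "c * det (coord_mat n mvar) \<in> P" using v[rule_format, of None] by simp
    then have 1: "mvar None * (c * det (coord_mat n mvar)) \<in> P" by (rule pol_ideal_closed(2)[OF I]) simp
    have 2: "c * GLeq n \<in> P" using c eP GL_eqs_iff by blast
    have "mvar None * (c * det (coord_mat n mvar)) - c * GLeq n = c" by (simp add: GLeq_def algebra_simps)
    then show "c \<in> P" using pol_ideal_closed(4)[OF I 1 2] by simp
  qed
  moreover have "\<exists>h\<in>carrier (pol_ring (GLvars n)) - P. \<forall>f\<in>eqs (GL n :: ((nat \<times> nat) option, 'r) group_scheme).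
      \<exists>N. h ^ N * f \<in> Idl\<^bsub>pol_ring (GLvars n)\<^esub> set [GLeq n :: ((nat \<times> nat) option, 'r) mpoly]"
    using \<open>1 \<notin> P\<close> by (intro bexI[of _ 1]) (auto simp: GL_simps)
  ultimately show "\<exists>gs. set gs \<subseteq> eqs (GL n) \<and>
      (\<exists>h\<in>carrier (pol_ring (vars (GL n))) - P. \<forall>f\<in>eqs (GL n). \<exists>N. h ^ N * f \<in> Idl\<^bsub>pol_ring (vars (GL n))\<^esub> set gs) \<and>
      (\<forall>c. (\<forall>i<length gs. c i \<in> carrier (pol_ring (vars (GL n)))) \<and>
        (\<forall>v\<in>vars (GL n). (\<Sum>i<length gs. c i * mpderiv v (gs ! i)) \<in> P) \<longrightarrow> (\<forall>i<length gs. c i \<in> P))"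
    unfolding GL_simps(1) by (intro exI[of _ "[GLeq n]"] conjI) (simp_all add: GLeq_in)
qed

lemma msubst_mvar: "msubst mvar f = f"
proof -
  have "f \<in> carrier (pol_ring UNIV)" by (simp add: pol_ring_def)
  then show ?thesis by (induction f rule: pol_induct) (simp_all add: meval_add meval_mult)
qed

lemma group_iso_refl:
  assumes G: "is_group_scheme G"
  shows "group_iso G G"
proof -
  have aff: "is_affine_scheme G" using G by (simp add: is_group_scheme_def)
  have I: "ideal (eqs G) (pol_ring (vars G))" using aff by (simp add: is_affine_scheme_def)
  note I2 = aprod_ideal(1)[OF aff aff]
  have cs: "case_sum (\<lambda>v. mvar (Inl v)) (\<lambda>v. mvar (Inr v)) = mvar" by (rule ext) (simp split: sum.split)
  have "group_hom G G mvar"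
    by (simp add: group_hom_def amor_def amor_eq_def msubst_mvar gmul_at_def cs pol_ideal_closed(3)[OF I2])
  then show ?thesis
    unfolding group_iso_def by (intro exI[of _ mvar]) (simp add: amor_eq_def msubst_mvar pol_ideal_closed(3)[OF I])
qed

lemma GL_smooth_linear: "n \<ge> 1 \<Longrightarrow> smooth_linear_group (GL n)"
  unfolding smooth_linear_group_def
  using GL_group_scheme[of n] GL_smooth[of n] group_iso_refl[OF GL_group_scheme[of n]]
  by (auto simp: closed_subgroup_def)

context pring
begin

section \<open>The bracket in terms of matrices\<close>

lemma GL_rep: "matrix_rep (GL n) n (coord_mat n)"
proof -
  have det1: "a None * det (coord_mat n a) = 1" if "zpt (GL n) a" for a
  proof -
    have "pev a (GLeq n) = 0" using that GLeq_in unfolding zpt_def by blast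
    then show ?thesis by (simp add: pev_GLeq)
  qed
  have gm: "gm (GL n) a b = gmul_at (GL n) id a b" for a b by (simp add: fun_eq_iff gm_def gmul_at_def pev_def)
  have c: "(\<forall>v\<in>vars (GL n). q ^ k dvd a v - b v) \<longleftrightarrow> mat_near n k (coord_mat n a) (coord_mat n b)"
    if "zpt (GL n) a" "zpt (GL n) b" for a b k
    using GL_cong[OF det1[OF that(1)] det1[OF that(2)], of k] unfolding GL_simps mat_near_coord_mat
    by (intro iffI) simp_all
  show ?thesis
    unfolding matrix_rep_def
  proof (intro conjI allI impI; (elim conjE)?)
    show "coord_mat n (gm (GL n) a b) = coord_mat n a * coord_mat n b" for a b
      unfolding gm by (rule GL_gmul_at(2)[OF rhom_id(1)])
  qed (simp only: coord_mat_carrier GL_gunit, simp only: coord_mat_carrier GL_gunit, rule c)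
qed

text \<open>As k is at least 1, the k-th derivatives of the entries 0 and 1 of the identity matrix
  vanish, so there is no shift in order k: the coordinate matrix is the logarithm twisted by
  \<open>\<phi>^k\<close>.\<close>

lemma gl_mat_lmat:
  assumes k: "k \<ge> 1" and a: "a \<in> Lie_pts p \<phi> k (GL n)"
  shows "gl_mat n k a = map_mat (\<phi> ^^ k) (lmat n (coord_mat n) k a)"
proof -
  let ?B = "coord_mat n (\<lambda>v. (\<psi> ^^ k) (a (v, k)))"
  have "coord_mat n (exq k a) = 1\<^sub>m n + q ^ k \<cdot>\<^sub>m ?B"
  proof (rule eq_matI)
    fix i j assume "i < dim_row (1\<^sub>m n + q ^ k \<cdot>\<^sub>m ?B)" "j < dim_col (1\<^sub>m n + q ^ k \<cdot>\<^sub>m ?B)"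
    then have ij: "i < n" "j < n" by simp_all
    have u: "gunit (GL n) (Some (i, j)) = (1\<^sub>m n :: 'r mat) $$ (i, j)" by (simp add: GL_def Let_def)
    obtain l where "k = Suc l" using k by (cases k) auto
    then have "(\<delta> ^^ k) 1 = (\<delta> ^^ l) (\<delta> 1)" by (simp only: funpow_Suc_right o_apply)
    then have "(\<delta> ^^ k) (gunit (GL n) (Some (i, j))) = 0" using ij by (simp add: u)
    then show "coord_mat n (exq k a) $$ (i, j) = (1\<^sub>m n + q ^ k \<cdot>\<^sub>m ?B) $$ (i, j)"
      using ij Lie_pts_exq[OF GL_group_scheme k a, of "Some (i, j)"] by (simp add: GL_simps u del: index_one_mat)
  qed simp_all
  then have "lmat n (coord_mat n) k a = ?B" unfolding lmat_def by (intro mat_log_eqI) simp_all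
  then show ?thesis by (simp add: gl_mat_def map_coord_mat)
qed

lemma mat_near_map_\<phi>:
  assumes "mat_near n m A B"
  shows "mat_near n m (map_mat (\<phi> ^^ k) A) (map_mat (\<phi> ^^ k) B)"
proof -
  have "(\<phi> ^^ k) x - (\<phi> ^^ k) y = (\<phi> ^^ k) (x - y)" for x y by (simp add: \<phi>_pow_hom)
  then show ?thesis using assms by (auto simp: mat_near_def q_power_dvd_\<phi>_pow)
qed

lemma map_\<phi>_gl_bracket:
  assumes "a \<in> carrier_mat n n" "b \<in> carrier_mat n n"
  shows "map_mat (\<phi> ^^ k) (gl_bracket a b) = gl_bracket (map_mat (\<phi> ^^ k) a) (map_mat (\<phi> ^^ k) b)"
proof -
  have "(\<phi> ^^ k) (sum f S) = (\<Sum>i\<in>S. (\<phi> ^^ k) (f i))" for f and S :: "nat set"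
    by (induction S rule: infinite_finite_induct) (simp_all add: \<phi>_pow_hom)
  then show ?thesis
    using assms unfolding gl_bracket_def
    by (intro eq_matI) (simp_all add: mat_mult_index[of _ n] \<phi>_pow_hom del: index_mult_mat(1))
qed

lemma \<phi>_pow_frob: "q dvd (\<phi> ^^ k) x - x ^ (p ^ k)"
proof (induction k)
  case (Suc k)
  have "q dvd \<phi> ((\<phi> ^^ k) x) - \<phi> (x ^ (p ^ k))" using Suc q_dvd_\<phi>[of "(\<phi> ^^ k) x - x ^ (p ^ k)"] by (simp add: \<phi>_diff)
  moreover have "q dvd \<phi> (x ^ (p ^ k)) - (x ^ (p ^ k)) ^ p" by (rule \<phi>_frob)
  ultimately have "q dvd (\<phi> ((\<phi> ^^ k) x) - \<phi> (x ^ (p ^ k))) + (\<phi> (x ^ (p ^ k)) - (x ^ (p ^ k)) ^ p)" by (rule dvd_add)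
  then show ?case by (simp add: power_mult[symmetric] mult.commute)
qed simp

text \<open>The logarithms of the arguments are untwisted by \<open>\<phi>^r\<close> and
  \<open>\<phi>^s\<close>, that of the bracket by \<open>\<phi>^(r+s)\<close>. Applying
  \<open>\<phi>^(r+s)\<close> leaves \<open>\<phi>^s\<close> on the first matrix and
  \<open>\<phi>^r\<close> on the second, and modulo p these raise the entries to the powers
  \<open>p^s\<close> and \<open>p^r\<close>.\<close>

lemma bracket_GL:
  assumes n: "n \<ge> 1" and r: "r \<ge> 1" and s: "s \<ge> 1" and a: "a \<in> Lie_pts p \<phi> r (GL n)" and b: "b \<in> Lie_pts p \<phi> s (GL n)"
  shows "mat_cong q (gl_mat n (r + s) (bracket p \<phi> r s (GL n) a b))
    (gl_bracket (map_mat (\<lambda>x. x ^ (p ^ s)) (gl_mat n r a)) (map_mat (\<lambda>x. x ^ (p ^ r)) (gl_mat n s b)))"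
proof -
  note S = GL_smooth_linear[OF n]
  let ?L = "lmat n (coord_mat n)" and ?B = "bracket p \<phi> r s (GL n) a b"
  have rs: "r + s \<ge> 1" using r by simp
  have "mat_near n 1 (?L (r + s) ?B) (gl_bracket (?L r a) (?L s b))" by (rule lmat_bracket(2)[OF S GL_rep r s a b])
  then have "mat_near n 1 (map_mat (\<phi> ^^ (r + s)) (?L (r + s) ?B)) (map_mat (\<phi> ^^ (r + s)) (gl_bracket (?L r a) (?L s b)))"
    by (rule mat_near_map_\<phi>)
  moreover have "map_mat (\<phi> ^^ (r + s)) (?L (r + s) ?B) = gl_mat n (r + s) ?B"
    by (rule gl_mat_lmat[OF rs bracket_pts(1)[OF S r s a b], symmetric])
  moreover have "map_mat (\<phi> ^^ (r + s)) (?L r a) = map_mat (\<phi> ^^ s) (gl_mat n r a)"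
    unfolding gl_mat_lmat[OF r a] add.commute[of r s] by (rule eq_matI) (simp_all add: funpow_add)
  moreover have "map_mat (\<phi> ^^ (r + s)) (?L s b) = map_mat (\<phi> ^^ r) (gl_mat n s b)"
    unfolding gl_mat_lmat[OF s b] by (rule eq_matI) (simp_all add: funpow_add)
  ultimately have 1: "mat_near n 1 (gl_mat n (r + s) ?B) (gl_bracket (map_mat (\<phi> ^^ s) (gl_mat n r a)) (map_mat (\<phi> ^^ r) (gl_mat n s b)))"
    by (simp add: map_\<phi>_gl_bracket[OF lmat_carrier lmat_carrier])
  have fr: "mat_near n 1 (map_mat (\<phi> ^^ k) A) (map_mat (\<lambda>x. x ^ (p ^ k)) A)" if "A \<in> carrier_mat n n" for k A
    using that \<phi>_pow_frob by (auto simp: mat_near_def)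
  have c: "gl_mat n k c \<in> carrier_mat n n" for k c by (simp add: gl_mat_def)
  have "mat_near n 1 (gl_mat n (r + s) ?B) (gl_bracket (map_mat (\<lambda>x. x ^ (p ^ s)) (gl_mat n r a)) (map_mat (\<lambda>x. x ^ (p ^ r)) (gl_mat n s b)))"
    by (rule mat_near_trans[OF 1 mat_near_gl_bracket[OF fr[OF c] fr[OF c]]])
  then show ?thesis unfolding mat_near_def mat_cong_def gl_bracket_def by auto
qed

end

theorem proposition3p25:
  fixes p :: nat and \<phi> :: "'r::idom \<Rightarrow> 'r"
    and G :: "('v, 'r) group_scheme" and r s :: nat
  assumes "base_ring p \<phi>" and "smooth_linear_group G" and "r \<ge> 1" and "s \<ge> 1"
  shows
   "(\<exists>!B. is_bracket p \<phi> r s G B) \<and>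
    (\<forall>(G' :: ('w, 'r) group_scheme) f. smooth_linear_group G' \<and> group_hom G G' f \<longrightarrow>
       (\<forall>\<alpha>\<in>Lie_pts p \<phi> r G. \<forall>\<beta>\<in>Lie_pts p \<phi> s G.
          bracket p \<phi> r s G' (Lie_map p \<phi> r G' f \<alpha>) (Lie_map p \<phi> s G' f \<beta>) =
          Lie_map p \<phi> (r + s) G' f (bracket p \<phi> r s G \<alpha> \<beta>))) \<and>
    (\<forall>m. \<forall>\<alpha>\<^sub>1\<in>Lie_pts p \<phi> r G. \<forall>\<alpha>\<^sub>2\<in>Lie_pts p \<phi> r G. \<forall>\<beta>\<^sub>1\<in>Lie_pts p \<phi> s G. \<forall>\<beta>\<^sub>2\<in>Lie_pts p \<phi> s G.
       pt_cong p m (Lie p \<phi> r G) \<alpha>\<^sub>1 \<alpha>\<^sub>2 \<and> pt_cong p m (Lie p \<phi> s G) \<beta>\<^sub>1 \<beta>\<^sub>2 \<longrightarrow>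
       pt_cong p m (Lie p \<phi> (r + s) G) (bracket p \<phi> r s G \<alpha>\<^sub>1 \<beta>\<^sub>1) (bracket p \<phi> r s G \<alpha>\<^sub>2 \<beta>\<^sub>2)) \<and>
    (\<forall>\<alpha>\<^sub>1\<in>Lie_pts p \<phi> r G. \<forall>\<alpha>\<^sub>2\<in>Lie_pts p \<phi> r G. \<forall>\<beta>\<in>Lie_pts p \<phi> s G.
       pt_cong p 1 (Lie p \<phi> (r + s) G)
         (bracket p \<phi> r s G (Lie_add p \<phi> r G \<alpha>\<^sub>1 \<alpha>\<^sub>2) \<beta>)
         (Lie_add p \<phi> (r + s) G (bracket p \<phi> r s G \<alpha>\<^sub>1 \<beta>) (bracket p \<phi> r s G \<alpha>\<^sub>2 \<beta>))) \<and>
    (\<forall>\<alpha>\<in>Lie_pts p \<phi> r G. \<forall>\<beta>\<in>Lie_pts p \<phi> s G.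
       pt_cong p 1 (Lie p \<phi> (r + s) G)
         (Lie_add p \<phi> (r + s) G (bracket p \<phi> r s G \<alpha> \<beta>) (bracket p \<phi> s r G \<beta> \<alpha>))
         (jet_unit p \<phi> (r + s) G)) \<and>
    (\<forall>t\<ge>1. \<forall>\<alpha>\<in>Lie_pts p \<phi> r G. \<forall>\<beta>\<in>Lie_pts p \<phi> s G. \<forall>\<gamma>\<in>Lie_pts p \<phi> t G.
       pt_cong p 1 (Lie p \<phi> (r + s + t) G)
         (Lie_add p \<phi> (r + s + t) G
           (Lie_add p \<phi> (r + s + t) G
             (bracket p \<phi> (r + s) t G (bracket p \<phi> r s G \<alpha> \<beta>) \<gamma>)
             (bracket p \<phi> (s + t) r G (bracket p \<phi> s t G \<beta> \<gamma>) \<alpha>))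
           (bracket p \<phi> (t + r) s G (bracket p \<phi> t r G \<gamma> \<alpha>) \<beta>))
         (jet_unit p \<phi> (r + s + t) G)) \<and>
    (\<forall>n\<ge>1. \<forall>\<alpha>\<in>Lie_pts p \<phi> r (GL n). \<forall>\<beta>\<in>Lie_pts p \<phi> s (GL n).
       mat_cong (of_nat p)
         (gl_mat n (r + s) (bracket p \<phi> r s (GL n) \<alpha> \<beta>))
         (gl_bracket (map_mat (\<lambda>x. x ^ (p ^ s)) (gl_mat n r \<alpha>))
                     (map_mat (\<lambda>x. x ^ (p ^ r)) (gl_mat n s \<beta>))))"
proof -
  interpret pring p \<phi> by (rule pring.intro[OF assms(1)])
  show ?thesis
    by (intro conjI allI ballI impI bracket_ex1[OF assms(2-4)] bracket_functorial[OF assms(2) _ _ assms(3,4)]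
        bracket_cong[OF assms(2-4)] bracket_add_left[OF assms(2-4)] bracket_antisym[OF assms(2-4)]
        bracket_jacobi[OF assms(2-4)] bracket_GL[OF _ assms(3,4)]; (elim conjE)?; assumption)
qed

end
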